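(* Let $N\ge1$, let $\mathcal T_1,\mathcal T_2,\mathcal T_3,\mathcal Y,U_i,U_o,Y$ be as in the context. Let $\gamma>\|Y\|_\infty$ be such that the associated transfer matrix $Z$ satisfies $\|Z\|_\infty<1$, and let $Y_o,V_{co},V_{ci},Z_{co},R,\hat R(V),\hat R_1(V),A_R,B_R,C_R(V)$ be as in the context. Put $$\alpha:=\inf\{\|\mathcal T_1-\mathcal T_2V\mathcal T_3-z^{-N}\mathcal T_2D\mathcal T_3\|_\infty : D\in\mathcal{RH}_\infty,\ V\in\mathcal Y\}.$$ Then the following are equivalent: (i) there exist $V\in\mathcal Y$, real symmetric matrices $P,Q\ge0$ and a scalar $\lambda\ge0$ such that $$\begin{bmatrix}A_R^\top QA_R-Q & C_R(V)^\top\\ C_R(V)&-\lambda I\end{bmatrix}\le0,\quad \begin{bmatrix}-P&PB_R&PA_R\\ B_R^\top P&-I&0\\ A_R^\top P&0&-P\end{bmatrix}\le0,\quad P-Q\ge0,\quad \lambda<1;$$ (ii) there exists $V\in\mathcal Y$ such that $\|\tilde\Gamma_{\hat R_1(V)}\|<1$; (iii) $\alpha<\gamma$. Moreover, any $V$ occurring in a solution of (i) satisfies $\|\tilde\Gamma_{\hat R_1(V)}\|<1$.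
   Context: Discrete time. $\mathcal{RL}_\infty$ is the set of real-rational transfer matrices (of whatever size is required) that are bounded on the unit circle, with norm $\|G\|_\infty=\sup_{|z|=1}\|G(z)\|$ (largest singular value). $\mathcal{RH}_\infty\subset\mathcal{RL}_\infty$ is the set of proper stable ones (all poles in $|z|<1$). $G^\sim(z):=G(z^{-1})^\top$. $\mathcal H_2$ is the Hardy space of square-summable series $\sum_{i\ge0}H_iz^{-i}$, $\mathcal H_2^\perp$ its orthogonal complement in $L_2$ of the unit circle (series $\sum_{k\ge1}H_kz^k$). For $F\in\mathcal{RH}_\infty$, $\tilde\Gamma_F:\mathcal H_2^\perp\to\mathcal H_2$ is the Hankel operator $g\mapsto \Pi_{\mathcal H_2}(Fg)$, with operator norm $\|\tilde\Gamma_F\|$. Matrix inequalities are in the semidefinite order. Plant data: $A$ is a real matrix with spectral radius $<1$, and with real matrices $B_1,B_2,C_1,C_2,D_{12},D_{21}$, $\mathcal T_1=C_1(zI-A)^{-1}B_1$, $\mathcal T_2=C_1(zI-A)^{-1}B_2+D_{12}$ (with $p_2$ columns), $\mathcal T_3=C_2(zI-A)^{-1}B_1+D_{21}$ (with $q_2$ rows), where $D_{12}^\top D_{12}>0$, $D_{21}D_{21}^\top>0$, $C_1^\top D_{12}=0$, $B_1D_{21}^\top=0$. Definitions: - $\mathcal T_2=U_iU_o$ with $U_i,U_o,U_o^{-1}\in\mathcal{RH}_\infty$, $U_i^\sim U_i=I$; $Y:=(I-U_iU_i^\sim)\mathcal T_1$. - For $\gamma>\|Y\|_\infty$: $Y_o,Y_o^{-1}\in\mathcal{RH}_\infty$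 with $Y_o^\sim Y_o=\gamma^2I-Y^\sim Y$. - $\mathcal T_3Y_o^{-1}=V_{co}V_{ci}$ with $V_{ci},V_{co},V_{co}^{-1}\in\mathcal{RH}_\infty$, $V_{ci}V_{ci}^\sim=I$. - $Z:=U_i^\sim\mathcal T_1Y_o^{-1}(I-V_{ci}^\sim V_{ci})$; if $\|Z\|_\infty<1$: $Z_{co},Z_{co}^{-1}\in\mathcal{RH}_\infty$ with $Z_{co}Z_{co}^\sim=I-ZZ^\sim$. - $R:=Z_{co}^{-1}U_i^\sim\mathcal T_1Y_o^{-1}V_{ci}^\sim$. - $\mathcal{Y}$ is the set of all $V=\sum_{i=0}^{N-1}z^{-i}V_i$ with $V_i\in\mathcal Y_i$, each $\mathcal{Y}_i\subset\mathbb{R}^{p_2\times q_2}$ a given linear subspace. - $\hat R(V):=z^NR-Z_{co}^{-1}U_o(z^NV)V_{co}$. - An anti-stable/stable decomposition of $F\in\mathcal{RL}_\infty$ is a pair $(F_1,F_2)$ with $F_1,F_2\in\mathcal{RH}_\infty$, $F_1$ strictly proper, $F=F_1^\sim+F_2$. Let $(R_1,R_2)$ be such a decomposition of $z^NR$, and $(\hat R_1(V),\hat R_2(V))$ one of $\hat R(V)$. - $G(V):=Z_{co}^{-1}U_oVV_{co}=\sum_{i\ge0}z^{-i}G_i(V)\in\mathcal{RH}_\infty$. - $(A_r,B_r,C_r,0)$ is a minimal (stable) real realization of $R_1$, i.e. $R_1=C_r(zI-A_r)^{-1}B_r$. $A_q$ is the $N\times N$ block down-shift matrix with blocks of size $p_2\times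 p_2$ (identity blocks on the first block sub-diagonal, zeros elsewhere), $B_q=[I,0,\dots,0]^\top$, $C_q(V)=[G_{N-1}(V)^\top,\dots,G_0(V)^\top]$. - $A_R=\begin{bmatrix}A_r&0\\ 0&A_q\end{bmatrix}$, $B_R=\begin{bmatrix}B_r\\ B_q\end{bmatrix}$, $C_R(V)=[\,C_r\ \ -C_q(V)\,]$. *)

theory Defs
  imports
    "Jordan_Normal_Form.Spectral_Radius"
    "Jordan_Normal_Form.Schur_Decomposition"
    "Jordan_Normal_Form.Gauss_Jordan_Elimination"
    "HOL-Computational_Algebra.Computational_Algebra"
    "HOL-Computational_Algebra.Field_as_Ring"
    "HOL-Analysis.Infinite_Sum"
begin

type_synonym ratfun = "real poly fract"
type_synonym tfm = "ratfun mat"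

definition rf_num :: "ratfun \<Rightarrow> real poly" where
  "rf_num f = fst (quot_of_fract f)"

definition rf_den :: "ratfun \<Rightarrow> real poly" where
  "rf_den f = snd (quot_of_fract f)"

definition rf_const :: "real \<Rightarrow> ratfun" where
  "rf_const c = to_fract [:c:]"

definition rf_z :: ratfun where
  "rf_z = to_fract [:0, 1:]"

text \<open>Numerator and denominator are coprime, so the zeros of the denominator are exactly the
  poles. At a pole the division below returns the junk value 0.\<close>

definition rf_eval :: "ratfun \<Rightarrow> complex \<Rightarrow> complex" where
  "rf_eval f z = poly (map_poly complex_of_real (rf_num f)) z
                   / poly (map_poly complex_of_real (rf_den f)) z"

definition rf_pole :: "ratfun \<Rightarrow> complex \<Rightarrow> bool" where
  "rf_pole f z \<longleftrightarrow> poly (map_poly complex_of_real (rf_den f)) z = 0"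

definition rf_proper :: "ratfun \<Rightarrow> bool" where
  "rf_proper f \<longleftrightarrow> degree (rf_num f) \<le> degree (rf_den f)"

definition rf_strictly_proper :: "ratfun \<Rightarrow> bool" where
  "rf_strictly_proper f \<longleftrightarrow> f = 0 \<or> degree (rf_num f) < degree (rf_den f)"

text \<open>The substitution $f(z) \mapsto f(z^{-1})$, carried out in the field of rational functions.\<close>

definition rf_recip :: "ratfun \<Rightarrow> ratfun" where
  "rf_recip f = poly (map_poly rf_const (rf_num f)) (inverse rf_z)
                  / poly (map_poly rf_const (rf_den f)) (inverse rf_z)"

text \<open>For proper \<open>f\<close>, the coefficient of $z^{-i}$ in the expansion of \<open>f\<close> at infinity: since
  $f(z^{-1})$ is regular at 0, this is its \<open>i\<close>-th Taylor coefficient.\<close>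

definition rf_coeff :: "ratfun \<Rightarrow> nat \<Rightarrow> real" where
  "rf_coeff f i =
     fps_nth (fps_of_poly (rf_num (rf_recip f)) / fps_of_poly (rf_den (rf_recip f))) i"

definition tf_const :: "real mat \<Rightarrow> tfm" where
  "tf_const M = map_mat rf_const M"

definition tf_eval :: "tfm \<Rightarrow> complex \<Rightarrow> complex mat" where
  "tf_eval G z = map_mat (\<lambda>f. rf_eval f z) G"

definition tf_coeff :: "tfm \<Rightarrow> nat \<Rightarrow> real mat" where
  "tf_coeff G i = map_mat (\<lambda>f. rf_coeff f i) G"

definition para_conj :: "tfm \<Rightarrow> tfm"  (\<open>_\<^sup>\<sim>\<close> [1000] 999) where
  "G\<^sup>\<sim> = transpose_mat (map_mat rf_recip G)"

definition mat_inv :: "'a::field mat \<Rightarrow> 'a mat" where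
  "mat_inv M = the (mat_inverse M)"

definition state_space :: "nat \<Rightarrow> real mat \<Rightarrow> real mat \<Rightarrow> real mat \<Rightarrow> real mat \<Rightarrow> tfm" where
  "state_space n A B C D =
     tf_const C * mat_inv (rf_z \<cdot>\<^sub>m 1\<^sub>m n - tf_const A) * tf_const B + tf_const D"

definition singular_values :: "complex mat \<Rightarrow> real set" where
  "singular_values M = {sqrt (Re k) | k. k \<in> spectrum (mat_adjoint M * M)}"

definition sv_norm :: "complex mat \<Rightarrow> real" where
  "sv_norm M = Max (singular_values M)"

definition tf_norm :: "tfm \<Rightarrow> real" where
  "tf_norm G = (SUP z\<in>{z. cmod z = 1}. sv_norm (tf_eval G z))"

text \<open>The junk value of \<open>rf_eval\<close> at a pole is harmless: an entry with a pole on the unit circle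
  is unbounded near that pole.\<close>

definition RLinf :: "nat \<Rightarrow> nat \<Rightarrow> tfm set" where
  "RLinf r c =
     {G \<in> carrier_mat r c. bdd_above ((\<lambda>z. sv_norm (tf_eval G z)) ` {z. cmod z = 1})}"

definition RHinf :: "nat \<Rightarrow> nat \<Rightarrow> tfm set" where
  "RHinf r c =
     {G \<in> carrier_mat r c. \<forall>i<r. \<forall>j<c.
        rf_proper (G $$ (i,j)) \<and> (\<forall>z. rf_pole (G $$ (i,j)) z \<longrightarrow> cmod z < 1)}"

definition RHinf_unit :: "nat \<Rightarrow> tfm \<Rightarrow> bool" where
  "RHinf_unit n U \<longleftrightarrow> U \<in> RHinf n n \<and> invertible_mat U \<and> mat_inv U \<in> RHinf n n"

definition strictly_proper :: "tfm \<Rightarrow> bool" where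
  "strictly_proper G \<longleftrightarrow> (\<forall>i<dim_row G. \<forall>j<dim_col G. rf_strictly_proper (G $$ (i,j)))"

definition antistable_stable_decomp :: "nat \<Rightarrow> nat \<Rightarrow> tfm \<Rightarrow> tfm \<Rightarrow> tfm \<Rightarrow> bool" where
  "antistable_stable_decomp r c F F1 F2 \<longleftrightarrow>
     F \<in> RLinf r c \<and> F1 \<in> RHinf c r \<and> F2 \<in> RHinf r c \<and> strictly_proper F1 \<and> F = F1\<^sup>\<sim> + F2"

text \<open>An element $\sum_{m\in\mathbb{Z}} g_m z^m$ of the vector-valued $L_2$ of the unit circle is
  represented by its square-summable family of coefficients \<open>g\<close> (the norm is the $L_2$-norm for
  normalized arc length, by Parseval).\<close>

type_synonym circle_series = "int \<Rightarrow> complex vec"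

definition vec_norm_sq :: "complex vec \<Rightarrow> real" where
  "vec_norm_sq v = (\<Sum>i<dim_vec v. (cmod (v $ i))\<^sup>2)"

definition L2_space :: "nat \<Rightarrow> circle_series set" where
  "L2_space n = {g. (\<forall>m. g m \<in> carrier_vec n) \<and> (\<lambda>m. vec_norm_sq (g m)) summable_on UNIV}"

definition L2_norm :: "circle_series \<Rightarrow> real" where
  "L2_norm g = sqrt (\<Sum>\<^sub>\<infinity>m. vec_norm_sq (g m))"

text \<open>As analyticity is meant outside the disc, $\mathcal{H}_2$ has the powers
  $z^{-i}$, $i\ge 0$, and its complement the powers $z^k$, $k\ge 1$.\<close>

definition H2_space :: "nat \<Rightarrow> circle_series set" where
  "H2_space n = {g \<in> L2_space n. \<forall>m>0. g m = 0\<^sub>v n}"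

definition H2_perp :: "nat \<Rightarrow> circle_series set" where
  "H2_perp n = {g \<in> L2_space n. \<forall>m\<le>0. g m = 0\<^sub>v n}"

definition H2_proj :: "circle_series \<Rightarrow> circle_series" where
  "H2_proj g = (\<lambda>m. if m \<le> 0 then g m else 0\<^sub>v (dim_vec (g m)))"

text \<open>Multiplication by a proper stable $F = \sum_j F_j z^{-j}$: the coefficient of $z^m$ in
  $Fg$ is $\sum_{j\ge 0} F_j g_{m+j}$.\<close>

definition tf_mult_series :: "tfm \<Rightarrow> circle_series \<Rightarrow> circle_series" where
  "tf_mult_series F g = (\<lambda>m. vec (dim_row F) (\<lambda>i.
     \<Sum>\<^sub>\<infinity>j::nat. (map_mat complex_of_real (tf_coeff F j) *\<^sub>v g (m + int j)) $ i))"

definition hankel_op :: "tfm \<Rightarrow> circle_series \<Rightarrow> circle_series" where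
  "hankel_op F g = H2_proj (tf_mult_series F g)"

definition hankel_norm :: "tfm \<Rightarrow> real" where
  "hankel_norm F =
     (SUP g\<in>{g \<in> H2_perp (dim_col F). L2_norm g \<le> 1}. L2_norm (hankel_op F g))"

text \<open>All eigenvalues lie in the open unit disc; unlike \<open>spectral_radius\<close>, which is unspecified
  for the empty matrix, this also covers state dimension 0.\<close>

definition schur_stable :: "real mat \<Rightarrow> bool" where
  "schur_stable A \<longleftrightarrow> (\<forall>k \<in> spectrum (map_mat complex_of_real A). cmod k < 1)"

definition sym_psd :: "real mat \<Rightarrow> bool" where
  "sym_psd M \<longleftrightarrow> square_mat M \<and> transpose_mat M = M \<and>
     (\<forall>x \<in> carrier_vec (dim_row M). 0 \<le> scalar_prod x (M *\<^sub>v x))"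

definition sym_pd :: "real mat \<Rightarrow> bool" where
  "sym_pd M \<longleftrightarrow> square_mat M \<and> transpose_mat M = M \<and>
     (\<forall>x \<in> carrier_vec (dim_row M). x \<noteq> 0\<^sub>v (dim_row M) \<longrightarrow> 0 < scalar_prod x (M *\<^sub>v x))"

definition sym_nsd :: "real mat \<Rightarrow> bool" where
  "sym_nsd M \<longleftrightarrow> sym_psd (- M)"

definition matrix_subspace :: "nat \<Rightarrow> nat \<Rightarrow> real mat set \<Rightarrow> bool" where
  "matrix_subspace r c S \<longleftrightarrow> S \<subseteq> carrier_mat r c \<and> 0\<^sub>m r c \<in> S \<and>
     (\<forall>X\<in>S. \<forall>Y\<in>S. X + Y \<in> S) \<and> (\<forall>a. \<forall>X\<in>S. a \<cdot>\<^sub>m X \<in> S)"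

text \<open>The transfer matrices $\sum_{i=0}^{N-1} z^{-i} V_i$ with \<open>V\<^sub>i \<in> Ys i\<close>\<close>

definition fir_set :: "nat \<Rightarrow> nat \<Rightarrow> nat \<Rightarrow> (nat \<Rightarrow> real mat set) \<Rightarrow> tfm set" where
  "fir_set r c N Ys =
     {mat r c (\<lambda>(a,b). \<Sum>i<N. inverse rf_z ^ i * rf_const (v i $$ (a,b))) | v.
        \<forall>i<N. v i \<in> Ys i}"

definition append_cols :: "'a::zero mat \<Rightarrow> 'a mat \<Rightarrow> 'a mat"  (infixr \<open>@\<^sub>c\<close> 65) where
  "X @\<^sub>c Y = four_block_mat X Y (0\<^sub>m 0 (dim_col X)) (0\<^sub>m 0 (dim_col Y))"

definition is_realization :: "nat \<Rightarrow> real mat \<Rightarrow> real mat \<Rightarrow> real mat \<Rightarrow> tfm \<Rightarrow> bool" where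
  "is_realization k A B C F \<longleftrightarrow>
     A \<in> carrier_mat k k \<and> B \<in> carrier_mat k (dim_col F) \<and> C \<in> carrier_mat (dim_row F) k \<and>
     F = state_space k A B C (0\<^sub>m (dim_row F) (dim_col F))"

definition minimal_realization :: "nat \<Rightarrow> real mat \<Rightarrow> real mat \<Rightarrow> real mat \<Rightarrow> tfm \<Rightarrow> bool" where
  "minimal_realization k A B C F \<longleftrightarrow> is_realization k A B C F \<and>
     (\<forall>k' A' B' C'. is_realization k' A' B' C' F \<longrightarrow> k \<le> k')"

definition shift_A :: "nat \<Rightarrow> nat \<Rightarrow> real mat" where
  "shift_A N p = mat (N * p) (N * p) (\<lambda>(i,j). if i = j + p then 1 else 0)"

definition shift_B :: "nat \<Rightarrow> nat \<Rightarrow> real mat" where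
  "shift_B N p = mat (N * p) p (\<lambda>(i,j). if i = j then 1 else 0)"

text \<open>$[G_{N-1}^T, \dots, G_0^T]$ for \<open>G\<close> of size \<open>p \<times> q\<close>: column \<open>j\<close> belongs to the block
  \<open>j div p\<close>, which is the transpose of $G_{N-1-(j\,\mathrm{div}\,p)}$.\<close>

definition shift_C :: "nat \<Rightarrow> nat \<Rightarrow> nat \<Rightarrow> tfm \<Rightarrow> real mat" where
  "shift_C N p q G =
     mat q (N * p) (\<lambda>(i,j). tf_coeff G (N - 1 - j div p) $$ (j mod p, i))"

definition lmi_observe :: "real mat \<Rightarrow> real mat \<Rightarrow> real mat \<Rightarrow> real \<Rightarrow> real mat" where
  "lmi_observe A C Q l =
     four_block_mat (transpose_mat A * Q * A - Q) (transpose_mat C)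
                    C                             (- (l \<cdot>\<^sub>m 1\<^sub>m (dim_row C)))"

definition lmi_control :: "real mat \<Rightarrow> real mat \<Rightarrow> real mat \<Rightarrow> real mat" where
  "lmi_control A B P =
     (      - P              @\<^sub>c       P * B                    @\<^sub>c    P * A) @\<^sub>r
     (transpose_mat B * P    @\<^sub>c  - 1\<^sub>m (dim_col B)            @\<^sub>c  0\<^sub>m (dim_col B) (dim_row A)) @\<^sub>r
     (transpose_mat A * P    @\<^sub>c  0\<^sub>m (dim_row A) (dim_col B)  @\<^sub>c   - P)"

definition lmi_solution ::
    "real mat \<Rightarrow> real mat \<Rightarrow> real mat \<Rightarrow> real mat \<Rightarrow> real mat \<Rightarrow> real \<Rightarrow> bool" where
  "lmi_solution A B C P Q l \<longleftrightarrow>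
     P \<in> carrier_mat (dim_row A) (dim_row A) \<and> Q \<in> carrier_mat (dim_row A) (dim_row A) \<and>
     sym_psd P \<and> sym_psd Q \<and> 0 \<le> l \<and>
     sym_nsd (lmi_observe A C Q l) \<and> sym_nsd (lmi_control A B P) \<and> sym_psd (P - Q) \<and> l < 1"

end

theory Submission
  imports Defs "HOL-Analysis.L2_Norm"
begin

text \<open>On the circle, with $X = V + z^{-N} D$, the model error $\mathcal{T}_1 - \mathcal{T}_2 X \mathcal{T}_3$
  splits orthogonally along the range of the inner factor $U_i$. Its norm is therefore below $\gamma$ if
  and only if the norm of what remains after $U_i$ and $Y_o$ are removed is below 1. Doing the same on the other side with
  $V_{ci}$ and $Z_{co}$ leaves $R - Z_{co}^{-1} U_o X V_{co}$, which up to the unimodular factor $z^N$ is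
  $\hat R(V) - Z_{co}^{-1} U_o D V_{co}$. Since $D$ ranges over all proper stable matrices, Nehari's
  theorem shows that the norm can be made less than 1 exactly when the Hankel operator of $\hat R_1(V)$ is a strict
  contraction. Nehari's theorem is proved by completing finite sections of the Hankel matrix with
  Parrott's theorem and averaging along diagonals.

  The impulse response of $\hat R_1(V)$ is that of $(A_R, B_R, C_R(V))$, because the block shift
  subtracts the coefficients $G_{N-1}, \dots, G_0$. Up to a perturbation, \<open>P\<close> and \<open>Q\<close> are the inverse
  controllability and the observability Gramian of this realization: the second inequality bounds
  from below the energy of an input reaching a state, the first bounds from above the energy of the output it
  releases, and $Q \le P$, $\lambda < 1$ compare the two.\<close>

subsection \<open>Contractive completions\<close>

text \<open>\<open>hankel_bounded\<close> is the hub: it bounds the finite sections of a real block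
  Hankel matrix, and the operator norm, the supremum on the circle and the matrix inequalities are
  each compared with it alone. As it involves finite sums only, no compactness argument or weak
  limit is needed. The price is that a Hankel bound \<open>c\<close> yields completions of norm
  \<open>d\<close> for every \<open>d > c\<close>, not for \<open>c\<close> itself. All claims are
  strict inequalities, so this slack is always available. It is spent three times: it makes
  \<open>I - B^T B\<close> invertible when a column is completed, it pays for the Fejer damping, and
  it absorbs the perturbation of the Gramian. A second obstacle is that \<open>D\<close> has to be
  rational, so a merely bounded completion would not do. The averaged completion is a polynomial in
  z; its adjoint is proper and stable, and \<open>D\<close> is obtained from it by dividing by
  units. Finally, \<open>rf_eval\<close> has a default value at poles, so identities between
  transfer matrices pass to the circle only for entries known to be free of poles there.\<close>

no_notation fps_nth (infixl \<open>$\<close> 75)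
unbundle no fps_syntax

text \<open>Because \<open>B^T B\<close> is at most \<open>c < 1\<close>, the matrix
  \<open>I - B^T B\<close> is invertible. The solution of \<open>y = B^T (B y + b)\<close> is the
  stationary point of the strictly concave function |B u + b|^2 - |u|^2 of u, which is why it
  settles the worst case when a column is completed.\<close>

lemma contraction_resolvent:
  fixes B :: "'a \<Rightarrow> nat \<Rightarrow> real" and b :: "'a \<Rightarrow> real"
  assumes S: "finite S" and c: "c < 1"
    and B: "\<And>u. (\<Sum>r\<in>S. (\<Sum>l<n. B r l * u l)\<^sup>2) \<le> c * (\<Sum>l<n. (u l)\<^sup>2)"
  obtains y where "\<And>l. l < n \<Longrightarrow> y l = (\<Sum>r\<in>S. B r l * ((\<Sum>k<n. B r k * y k) + b r))"
proof -
  define M where "M = mat n n (\<lambda>(l,k). (if l = k then 1 else 0) - (\<Sum>r\<in>S. B r l * B r k))"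
  define d where "d = vec n (\<lambda>l. \<Sum>r\<in>S. B r l * b r)"
  have MC: "M \<in> carrier_mat n n" by (simp add: M_def)
  have Mv: "(M *\<^sub>v v) $ l = v $ l - (\<Sum>r\<in>S. B r l * (\<Sum>k<n. B r k * v $ k))"
    if "l < n" "v \<in> carrier_vec n" for v l
  proof -
    have "(M *\<^sub>v v) $ l = (\<Sum>k<n. ((if l = k then 1 else 0) - (\<Sum>r\<in>S. B r l * B r k)) * v $ k)"
      using that by (simp add: M_def scalar_prod_def atLeast0LessThan)
    also have "\<dots> = (\<Sum>k<n. (if l = k then v $ k else 0)) - (\<Sum>k<n. \<Sum>r\<in>S. B r l * B r k * v $ k)"
      unfolding sum_subtractf[symmetric]
      by (intro sum.cong refl) (auto simp: left_diff_distrib sum_distrib_right)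
    also have "(\<Sum>k<n. (if l = k then v $ k else 0)) = v $ l"
      using that by simp
    also have "(\<Sum>k<n. \<Sum>r\<in>S. B r l * B r k * v $ k) = (\<Sum>r\<in>S. B r l * (\<Sum>k<n. B r k * v $ k))"
      by (subst sum.swap) (simp add: sum_distrib_left mult.assoc)
    finally show ?thesis .
  qed
  have "det M \<noteq> 0"
  proof
    assume "det M = 0"
    then obtain v where v: "v \<in> carrier_vec n" "v \<noteq> 0\<^sub>v n" "M *\<^sub>v v = 0\<^sub>v n"
      using det_0_iff_vec_prod_zero_field[OF MC] by auto
    have e: "v $ l = (\<Sum>r\<in>S. B r l * (\<Sum>k<n. B r k * v $ k))" if "l < n" for l
      using Mv[OF that v(1)] v(3) that by simp
    have "(\<Sum>l<n. (v $ l)\<^sup>2) = (\<Sum>l<n. v $ l * (\<Sum>r\<in>S. B r l * (\<Sum>k<n. B r k * v $ k)))"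
      by (intro sum.cong refl, subst e[symmetric]) (simp_all add: power2_eq_square)
    also have "\<dots> = (\<Sum>r\<in>S. (\<Sum>l<n. B r l * v $ l)\<^sup>2)"
      by (simp add: sum_distrib_left, subst sum.swap)
         (simp add: power2_eq_square sum_distrib_left sum_distrib_right algebra_simps)
    also have "\<dots> \<le> c * (\<Sum>l<n. (v $ l)\<^sup>2)" by (rule B)
    finally have "(1 - c) * (\<Sum>l<n. (v $ l)\<^sup>2) \<le> 0" by (simp add: algebra_simps)
    with c have "(\<Sum>l<n. (v $ l)\<^sup>2) \<le> 0" by (simp add: mult_le_0_iff)
    hence "(\<Sum>l<n. (v $ l)\<^sup>2) = 0" by (simp add: antisym sum_nonneg)
    hence "\<forall>l<n. v $ l = 0" by (subst (asm) sum_nonneg_eq_0_iff) auto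
    with v(1,2) show False by auto
  qed
  from det_non_zero_imp_unit[OF MC this] obtain W where W: "W \<in> carrier_mat n n" "M * W = 1\<^sub>m n"
    by (auto simp: Units_def ring_mat_def)
  define y where "y = W *\<^sub>v d"
  have d: "d \<in> carrier_vec n" by (simp add: d_def)
  have y: "y \<in> carrier_vec n" using W d by (simp add: y_def)
  have "M *\<^sub>v y = d" using W MC d by (simp add: y_def assoc_mult_mat_vec[symmetric])
  hence "y $ l = (\<Sum>r\<in>S. B r l * ((\<Sum>k<n. B r k * y $ k) + b r))" if "l < n" for l
    using Mv[OF that y] that by (simp add: d_def algebra_simps sum.distrib)
  thus ?thesis by (rule that)
qed

text \<open>Parrott's theorem for one missing block of a column, in the strictly contractive case, where
  the missing block is an explicit function of the data.\<close>

lemma contraction_complete_column: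
  fixes B A :: "'a \<Rightarrow> nat \<Rightarrow> real" and b :: "'a \<Rightarrow> real"
  assumes S: "finite S" "finite S'" and c: "c < 1"
    and B: "\<And>u. (\<Sum>r\<in>S. (\<Sum>l<n. B r l * u l)\<^sup>2) \<le> c * (\<Sum>l<n. (u l)\<^sup>2)"
    and Bb: "\<And>u x. (\<Sum>r\<in>S. ((\<Sum>l<n. B r l * u l) + b r * x)\<^sup>2) \<le> (\<Sum>l<n. (u l)\<^sup>2) + x\<^sup>2"
    and AB: "\<And>u. (\<Sum>r\<in>S'. (\<Sum>l<n. A r l * u l)\<^sup>2) + (\<Sum>r\<in>S. (\<Sum>l<n. B r l * u l)\<^sup>2)
                  \<le> (\<Sum>l<n. (u l)\<^sup>2)"
  obtains a where "\<And>u x. (\<Sum>r\<in>S'. ((\<Sum>l<n. A r l * u l) + a r * x)\<^sup>2)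
      + (\<Sum>r\<in>S. ((\<Sum>l<n. B r l * u l) + b r * x)\<^sup>2) \<le> (\<Sum>l<n. (u l)\<^sup>2) + x\<^sup>2"
proof -
  obtain y where y: "\<And>l. l < n \<Longrightarrow> y l = (\<Sum>r\<in>S. B r l * ((\<Sum>k<n. B r k * y k) + b r))"
    using contraction_resolvent[OF S(1) c B] by blast
  \<comment> \<open>This choice turns the new rows into A v for v = u - x y. By the equation for y,
    the defect of the known rows splits without a cross term into |v|^2 - |B v|^2 and x^2 times the
    defect at u = y, x = 1. The hypothesis \<open>AB\<close> at v covers the first part together
    with the new rows, \<open>Bb\<close> at y covers the second.\<close>
  define a where "a r = - (\<Sum>l<n. A r l * y l)" for r
  define By where "By r = (\<Sum>l<n. B r l * y l)" for r
  have yu: "(\<Sum>l<n. y l * u l) = (\<Sum>r\<in>S. (\<Sum>l<n. B r l * u l) * (By r + b r))" for u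
  proof -
    have "(\<Sum>l<n. y l * u l) = (\<Sum>l<n. (\<Sum>r\<in>S. B r l * (By r + b r)) * u l)"
      by (intro sum.cong refl, subst y) (simp_all add: By_def)
    also have "\<dots> = (\<Sum>r\<in>S. (\<Sum>l<n. B r l * u l) * (By r + b r))"
      by (simp add: sum_distrib_right, subst sum.swap) (simp add: algebra_simps)
    finally show ?thesis .
  qed
  have main: "(\<Sum>r\<in>S'. ((\<Sum>l<n. A r l * u l) + a r * x)\<^sup>2)
      + (\<Sum>r\<in>S. ((\<Sum>l<n. B r l * u l) + b r * x)\<^sup>2) \<le> (\<Sum>l<n. (u l)\<^sup>2) + x\<^sup>2" for u x
  proof -
    define v where "v l = u l - y l * x" for l
    define Bv where "Bv r = (\<Sum>l<n. B r l * v l)" for r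
    have Bu: "(\<Sum>l<n. B r l * u l) = Bv r + By r * x" for r
      by (simp add: Bv_def By_def v_def algebra_simps sum_subtractf sum_distrib_left)
    have Au: "(\<Sum>l<n. A r l * u l) + a r * x = (\<Sum>l<n. A r l * v l)" for r
      by (simp add: a_def v_def algebra_simps sum_subtractf sum_distrib_left)
    have uu: "(\<Sum>l<n. (u l)\<^sup>2) = (\<Sum>l<n. (v l)\<^sup>2) + 2 * x * (\<Sum>l<n. y l * v l) + x\<^sup>2 * (\<Sum>l<n. y l * y l)"
      by (simp add: v_def power2_eq_square algebra_simps sum_subtractf sum.distrib sum_distrib_left)
    have vy: "(\<Sum>l<n. y l * v l) = (\<Sum>r\<in>S. Bv r * (By r + b r))"
      unfolding yu Bv_def ..
    have yy: "(\<Sum>l<n. y l * y l) = (\<Sum>r\<in>S. By r * (By r + b r))"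
      unfolding yu By_def ..
    have b1: "(\<Sum>r\<in>S. (By r + b r)\<^sup>2) \<le> (\<Sum>r\<in>S. By r * (By r + b r)) + 1"
      using Bb[of y 1] by (simp add: By_def[symmetric] power2_eq_square[of "y _"] yy)
    have ab: "(\<Sum>r\<in>S'. (\<Sum>l<n. A r l * v l)\<^sup>2) + (\<Sum>r\<in>S. (Bv r)\<^sup>2) \<le> (\<Sum>l<n. (v l)\<^sup>2)"
      using AB[of v] by (simp add: Bv_def)
    have "(\<Sum>r\<in>S. ((\<Sum>l<n. B r l * u l) + b r * x)\<^sup>2) = (\<Sum>r\<in>S. (Bv r)\<^sup>2)
       + 2 * x * (\<Sum>r\<in>S. Bv r * (By r + b r)) + x\<^sup>2 * (\<Sum>r\<in>S. (By r + b r)\<^sup>2)"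
      unfolding Bu by (simp add: power2_eq_square algebra_simps sum.distrib sum_distrib_left)
    moreover have "x\<^sup>2 * (\<Sum>r\<in>S. (By r + b r)\<^sup>2) \<le> x\<^sup>2 * ((\<Sum>r\<in>S. By r * (By r + b r)) + 1)"
      using b1 by (intro mult_left_mono) auto
    ultimately show ?thesis
      unfolding Au uu vy yy using ab by (simp add: algebra_simps)
  qed
  show ?thesis by (rule that[of a, OF main])
qed

text \<open>Columns are filled in from left to right. The rows in \<open>S n\<close> are prescribed
  in all earlier columns as well, because the sets decrease, so the rows \<open>W - S n\<close> of
  column \<open>n\<close> form a single missing block. Strictness is asked only of the fully
  prescribed part, and the hypothesis on \<open>f\<close> supplies it afresh for each column; hence
  the constant does not deteriorate, although the completed part is merely a contraction.\<close>

lemma contraction_complete_staircase: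
  fixes f :: "'a \<Rightarrow> nat \<Rightarrow> real" and S :: "nat \<Rightarrow> 'a set"
  assumes W: "finite W" and c: "0 \<le> c" "c < 1"
    and S: "\<And>j. S j \<subseteq> W" "\<And>i j. i \<le> j \<Longrightarrow> S j \<subseteq> S i"
    and f: "\<And>j u. j < n \<Longrightarrow> (\<Sum>r\<in>S j. (\<Sum>l\<le>j. f r l * u l)\<^sup>2) \<le> c * (\<Sum>l\<le>j. (u l)\<^sup>2)"
  shows "\<exists>T. (\<forall>j<n. \<forall>r\<in>S j. T r j = f r j) \<and>
     (\<forall>u. (\<Sum>r\<in>W. (\<Sum>l<n. T r l * u l)\<^sup>2) \<le> (\<Sum>l<n. (u l)\<^sup>2))"
  using f
proof (induction n)
  case 0
  show ?case by simp
next
  case (Suc n)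
  have "\<exists>T. (\<forall>j<n. \<forall>r\<in>S j. T r j = f r j) \<and>
     (\<forall>u. (\<Sum>r\<in>W. (\<Sum>l<n. T r l * u l)\<^sup>2) \<le> (\<Sum>l<n. (u l)\<^sup>2))"
    by (rule Suc.IH) (rule Suc.prems, simp)
  then obtain T where T: "\<And>j r. j < n \<Longrightarrow> r \<in> S j \<Longrightarrow> T r j = f r j"
    and TC: "\<And>u. (\<Sum>r\<in>W. (\<Sum>l<n. T r l * u l)\<^sup>2) \<le> (\<Sum>l<n. (u l)\<^sup>2)"
    by auto
  have Tf: "(\<Sum>l<n. T r l * u l) = (\<Sum>l<n. f r l * u l)" if "r \<in> S n" for r u
    using T S(2)[of _ n] that by (intro sum.cong) (auto simp: subset_iff)
  have fin: "finite (S n)" "finite (W - S n)" using W S(1) by (auto intro: finite_subset)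
  have W_split: "(\<Sum>r\<in>W. g r) = (\<Sum>r\<in>W - S n. g r) + (\<Sum>r\<in>S n. g r)" for g :: "'a \<Rightarrow> real"
    using W S(1) by (simp add: sum.subset_diff)
  have fn: "(\<Sum>r\<in>S n. ((\<Sum>l<n. f r l * u l) + f r n * x)\<^sup>2) \<le> c * ((\<Sum>l<n. (u l)\<^sup>2) + x\<^sup>2)" for u x
  proof -
    have "(\<Sum>r\<in>S n. (\<Sum>l\<le>n. f r l * (u(n := x)) l)\<^sup>2) \<le> c * (\<Sum>l\<le>n. ((u(n := x)) l)\<^sup>2)"
      by (rule Suc.prems) simp
    thus ?thesis by (simp add: lessThan_Suc_atMost[symmetric] algebra_simps)
  qed
  obtain a where a: "\<And>u x. (\<Sum>r\<in>W - S n. ((\<Sum>l<n. T r l * u l) + a r * x)\<^sup>2)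
      + (\<Sum>r\<in>S n. ((\<Sum>l<n. f r l * u l) + f r n * x)\<^sup>2) \<le> (\<Sum>l<n. (u l)\<^sup>2) + x\<^sup>2"
  proof (rule contraction_complete_column[OF fin c(2), of f n "\<lambda>r. f r n" T])
    show "(\<Sum>r\<in>S n. (\<Sum>l<n. f r l * u l)\<^sup>2) \<le> c * (\<Sum>l<n. (u l)\<^sup>2)" for u
      using fn[of u 0] by simp
    show "(\<Sum>r\<in>S n. ((\<Sum>l<n. f r l * u l) + f r n * x)\<^sup>2) \<le> (\<Sum>l<n. (u l)\<^sup>2) + x\<^sup>2" for u x
      by (rule order_trans[OF fn]) (use c in \<open>auto intro!: mult_left_le_one_le add_nonneg_nonneg sum_nonneg\<close>)
    show "(\<Sum>r\<in>W - S n. (\<Sum>l<n. T r l * u l)\<^sup>2) + (\<Sum>r\<in>S n. (\<Sum>l<n. f r l * u l)\<^sup>2)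
         \<le> (\<Sum>l<n. (u l)\<^sup>2)" for u
      using TC[of u] Tf by (simp add: W_split)
  qed blast
  define T' where "T' r l = (if l < n then T r l else if r \<in> S n then f r n else a r)" for r l
  have "\<forall>j<Suc n. \<forall>r\<in>S j. T' r j = f r j"
    using T by (auto simp: T'_def less_Suc_eq)
  moreover have "(\<Sum>r\<in>W. (\<Sum>l<Suc n. T' r l * u l)\<^sup>2) \<le> (\<Sum>l<Suc n. (u l)\<^sup>2)" for u
    using a[of u "u n"] unfolding W_split
    by (simp add: T'_def Tf)
  ultimately show ?case by blast
qed

subsection \<open>Hankel matrices and bounds on the circle\<close>

text \<open>Matrices are index functions here, read only at \<open>i < q\<close> and
  \<open>j < p\<close>, so that coefficient families can be bounded without forming a
  matrix.\<close>

definition op_bound :: "nat \<Rightarrow> nat \<Rightarrow> (nat \<Rightarrow> nat \<Rightarrow> complex) \<Rightarrow> real \<Rightarrow> bool" where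
  "op_bound q p E c \<longleftrightarrow> (\<forall>v. L2_set (\<lambda>i. cmod (\<Sum>j<p. E i j * v j)) {..<q}
                             \<le> c * L2_set (\<lambda>j. cmod (v j)) {..<p})"

lemma op_boundD:
  "op_bound q p E c \<Longrightarrow> L2_set (\<lambda>i. cmod (\<Sum>j<p. E i j * v j)) {..<q} \<le> c * L2_set (\<lambda>j. cmod (v j)) {..<p}"
  by (simp add: op_bound_def)

lemma op_bound_mono: "op_bound q p E a \<Longrightarrow> a \<le> b \<Longrightarrow> op_bound q p E b"
  unfolding op_bound_def by (meson order_trans mult_right_mono L2_set_nonneg)

lemma op_bound_cong:
  assumes "op_bound q p E c" "\<And>i j. i < q \<Longrightarrow> j < p \<Longrightarrow> F i j = E i j"
  shows "op_bound q p F c"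
  unfolding op_bound_def
proof
  fix v :: "nat \<Rightarrow> complex"
  have "L2_set (\<lambda>i. cmod (\<Sum>j<p. F i j * v j)) {..<q} = L2_set (\<lambda>i. cmod (\<Sum>j<p. E i j * v j)) {..<q}"
    using assms(2) by (intro L2_set_cong) (auto intro!: arg_cong[where f=cmod] sum.cong)
  thus "L2_set (\<lambda>i. cmod (\<Sum>j<p. F i j * v j)) {..<q} \<le> c * L2_set (\<lambda>j. cmod (v j)) {..<p}"
    using op_boundD[OF assms(1)] by simp
qed

lemma op_bound_add:
  assumes "op_bound q p E a" "op_bound q p F b"
  shows "op_bound q p (\<lambda>i j. E i j + F i j) (a + b)"
  unfolding op_bound_def
proof
  fix v :: "nat \<Rightarrow> complex"
  let ?v = "L2_set (\<lambda>j. cmod (v j)) {..<p}"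
  have "L2_set (\<lambda>i. cmod (\<Sum>j<p. (E i j + F i j) * v j)) {..<q}
     \<le> L2_set (\<lambda>i. cmod (\<Sum>j<p. E i j * v j) + cmod (\<Sum>j<p. F i j * v j)) {..<q}"
    by (intro L2_set_mono) (auto simp: distrib_right sum.distrib norm_triangle_ineq)
  also have "\<dots> \<le> a * ?v + b * ?v"
    by (intro order_trans[OF L2_set_triangle_ineq] add_mono op_boundD assms)
  finally show "L2_set (\<lambda>i. cmod (\<Sum>j<p. (E i j + F i j) * v j)) {..<q} \<le> (a + b) * ?v"
    by (simp add: distrib_right)
qed

text \<open>The constant is crude, but it is applied only to errors that can be made arbitrarily
  small, or where any finite bound will do.\<close>

lemma op_bound_entries:
  assumes "\<And>i j. i < q \<Longrightarrow> j < p \<Longrightarrow> cmod (E i j) \<le> e"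
  shows "op_bound q p E (real q * real p * e)"
  unfolding op_bound_def
proof
  fix v :: "nat \<Rightarrow> complex"
  let ?v = "L2_set (\<lambda>j. cmod (v j)) {..<p}"
  have "L2_set (\<lambda>i. cmod (\<Sum>j<p. E i j * v j)) {..<q} \<le> (\<Sum>i<q. cmod (\<Sum>j<p. E i j * v j))"
    by (rule L2_set_le_sum) auto
  also have "\<dots> \<le> (\<Sum>i<q. \<Sum>j<p. e * ?v)"
  proof (intro sum_mono order_trans[OF norm_sum])
    fix i j assume ij: "i \<in> {..<q}" "j \<in> {..<p}"
    have "cmod (E i j) \<le> e" using assms ij by simp
    moreover have "cmod (v j) \<le> ?v" using ij by (intro member_le_L2_set) auto
    ultimately show "cmod (E i j * v j) \<le> e * ?v"
      unfolding norm_mult by (intro mult_mono) (auto intro: order_trans[OF norm_ge_zero])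
  qed
  also have "\<dots> = real q * real p * e * ?v" by simp
  finally show "L2_set (\<lambda>i. cmod (\<Sum>j<p. E i j * v j)) {..<q} \<le> real q * real p * e * ?v" .
qed

text \<open>The norm of a block Hankel matrix, stated by finite sections and real inputs. The index
  \<open>s + t + 1\<close> pairs an input at z^(t+1) with an output at z^(-s), so the first block is
  \<open>f 1\<close>.\<close>

definition hankel_bounded :: "nat \<Rightarrow> nat \<Rightarrow> (nat \<Rightarrow> nat \<Rightarrow> nat \<Rightarrow> real) \<Rightarrow> real \<Rightarrow> bool" where
  "hankel_bounded q p f c \<longleftrightarrow> (\<forall>I K g.
     (\<Sum>s<I. \<Sum>i<q. (\<Sum>t<K. \<Sum>j<p. f (s + t + 1) i j * g t j)\<^sup>2) \<le> c\<^sup>2 * (\<Sum>t<K. \<Sum>j<p. (g t j)\<^sup>2))"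

text \<open>Both exponents lie below \<open>n\<close>, so their difference is a multiple of
  \<open>n\<close> only if it is zero; otherwise the sum is geometric, with an n-th root of unity
  different from 1 as its ratio.\<close>

lemma sum_roots_of_unity:
  fixes a b n :: nat
  defines "w \<equiv> (\<lambda>r::nat. cis (2 * pi * real r / real n))"
  assumes n: "a < n" "b < n"
  shows "(\<Sum>r<n. w r ^ a * inverse (w r) ^ b) = (if a = b then of_nat n else 0)"
proof -
  define y where "y = cis (2 * pi * (real a - real b) / real n)"
  have wy: "w r ^ a * inverse (w r) ^ b = y ^ r" for r
    unfolding w_def y_def cis_inverse DeMoivre cis_mult
    by (rule arg_cong[where f=cis]) (simp add: diff_divide_distrib algebra_simps)
  show ?thesis
  proof (cases "a = b")
    case True
    thus ?thesis unfolding wy by (simp add: y_def)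
  next
    case False
    have yn: "y ^ n = 1"
    proof -
      have "y ^ n = cis (2 * pi * of_int (int a - int b))"
        using n by (simp add: y_def DeMoivre)
      also have "\<dots> = 1" by (intro cis_multiple_2pi) simp
      finally show ?thesis .
    qed
    have y1: "y \<noteq> 1"
    proof
      assume "y = 1"
      hence "cos (2 * pi * (real a - real b) / real n) = 1"
        by (simp add: y_def complex_eq_iff)
      then obtain k :: int where k: "2 * pi * (real a - real b) / real n = of_int k * 2 * pi"
        using cos_one_2pi_int by auto
      hence "2 * pi * (real a - real b) = 2 * pi * (of_int k * real n)"
        using n by (simp add: field_simps)
      hence "real a - real b = of_int k * real n" by simp
      hence "int a - int b = k * int n"
        by (metis of_int_diff of_int_eq_iff of_int_mult of_int_of_nat_eq)
      moreover have "\<bar>int a - int b\<bar> < int n" using n by simp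
      ultimately have "\<bar>k\<bar> * int n < 1 * int n" by (simp add: abs_mult)
      hence "k = 0" using n by simp
      with \<open>int a - int b = k * int n\<close> False show False by simp
    qed
    have "(\<Sum>r<n. y ^ r) = 0" using y1 yn by (simp add: geometric_sum)
    thus ?thesis unfolding wy using False by simp
  qed
qed

text \<open>The offset \<open>a\<close> is there because inputs carry the powers z^(t+1) and outputs
  the powers z^s.\<close>

lemma parseval_roots_of_unity:
  fixes g :: "nat \<Rightarrow> real" and a n :: nat
  defines "w \<equiv> (\<lambda>r::nat. cis (2 * pi * real r / real n))"
  assumes n: "a + K \<le> n"
  shows "(\<Sum>r<n. (cmod (\<Sum>t<K. of_real (g t) * w r ^ (t + a)))\<^sup>2) = real n * (\<Sum>t<K. (g t)\<^sup>2)"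
proof -
  have cw: "cnj (w r) = inverse (w r)" for r by (simp add: w_def cis_cnj)
  have "of_real (\<Sum>r<n. (cmod (\<Sum>t<K. of_real (g t) * w r ^ (t + a)))\<^sup>2)
     = (\<Sum>r<n. (\<Sum>t<K. of_real (g t) * w r ^ (t + a)) * (\<Sum>u<K. of_real (g u) * inverse (w r) ^ (u + a)))"
    by (simp only: of_real_sum complex_norm_square) (simp add: cw)
  also have "\<dots> = (\<Sum>r<n. \<Sum>t<K. \<Sum>u<K. of_real (g t) * of_real (g u) * (w r ^ (t + a) * inverse (w r) ^ (u + a)))"
    by (simp only: sum_product) (simp add: mult_ac)
  also have "\<dots> = (\<Sum>t<K. \<Sum>u<K. of_real (g t) * of_real (g u) * (\<Sum>r<n. w r ^ (t + a) * inverse (w r) ^ (u + a)))"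
    unfolding sum_distrib_left by (subst sum.swap) (intro sum.cong refl sum.swap)
  also have "\<dots> = (\<Sum>t<K. \<Sum>u<K. of_real (g t) * of_real (g u) * (if t = u then of_nat n else 0))"
    using n unfolding w_def by (intro sum.cong refl, subst sum_roots_of_unity) auto
  also have "\<dots> = of_real (real n * (\<Sum>t<K. (g t)\<^sup>2))"
    by (simp add: if_distrib sum_distrib_left power2_eq_square mult_ac cong: if_cong)
  finally show ?thesis by (simp only: of_real_eq_iff)
qed

section \<open>Uniform truncation of absolutely convergent series\<close>

lemma summable_tail_small:
  fixes a :: "nat \<Rightarrow> 'a::banach"
  assumes "summable a" "0 < e"
  shows "\<forall>\<^sub>F L in sequentially. norm (suminf a - (\<Sum>k<L. a k)) < e"
  using tendstoD[OF summable_LIMSEQ[OF assms(1)] assms(2)]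
  by (simp add: dist_norm norm_minus_commute)

text \<open>On the circle every tail is dominated by the tail of the series of absolute values,
  which does not depend on z.\<close>

lemma abs_summable_tail_small:
  fixes a :: "nat \<Rightarrow> real"
  assumes "summable (\<lambda>k. \<bar>a k\<bar>)" "0 < e"
  shows "\<forall>\<^sub>F L in sequentially. \<forall>z. cmod z = 1 \<longrightarrow>
           cmod ((\<Sum>k. of_real (a k) * z ^ k) - (\<Sum>k<L. of_real (a k) * z ^ k)) < e"
proof -
  have "\<forall>\<^sub>F L in sequentially. norm ((\<Sum>k. \<bar>a k\<bar>) - (\<Sum>k<L. \<bar>a k\<bar>)) < e"
    by (rule summable_tail_small[OF assms])
  thus ?thesis
  proof (eventually_elim, intro allI impI)
    fix L and z :: complex
    assume L: "norm ((\<Sum>k. \<bar>a k\<bar>) - (\<Sum>k<L. \<bar>a k\<bar>)) < e" and z: "cmod z = 1"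
    have n: "norm (of_real (a k) * z ^ k) = \<bar>a k\<bar>" for k
      using z by (simp add: norm_mult norm_power)
    have s: "summable (\<lambda>k. norm (of_real (a k) * z ^ k))" unfolding n by (rule assms)
    have "(\<Sum>k. of_real (a k) * z ^ k) - (\<Sum>k<L. of_real (a k) * z ^ k)
        = (\<Sum>k. of_real (a (k + L)) * z ^ (k + L))"
      using suminf_split_initial_segment[OF summable_norm_cancel[OF s], of L] by simp
    also have "norm \<dots> \<le> (\<Sum>k. norm (of_real (a (k + L)) * z ^ (k + L)))"
      using s by (intro summable_norm) (rule summable_ignore_initial_segment)
    also have "\<dots> = (\<Sum>k. \<bar>a k\<bar>) - (\<Sum>k<L. \<bar>a k\<bar>)"
      unfolding n by (rule suminf_minus_initial_segment[OF assms(1)])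
    finally show "cmod ((\<Sum>k. of_real (a k) * z ^ k) - (\<Sum>k<L. of_real (a k) * z ^ k)) < e"
      using L by simp
  qed
qed

lemma L2_set_Times:
  assumes "finite A"
  shows "L2_set (\<lambda>r. L2_set (h r) B) A = sqrt (\<Sum>r\<in>A. \<Sum>i\<in>B. (h r i)\<^sup>2)"
  by (simp add: L2_set_def sum_nonneg)

lemma finite_pairs_eventually:
  assumes "\<And>i j. i < (q::nat) \<Longrightarrow> j < (p::nat) \<Longrightarrow> \<forall>\<^sub>F L in F. P L i j"
  shows "\<forall>\<^sub>F L in F. \<forall>i<q. \<forall>j<p. P L i j"
proof -
  have "\<forall>\<^sub>F L in F. \<forall>x\<in>{..<q} \<times> {..<p}. P L (fst x) (snd x)"
    by (rule eventually_ball_finite) (auto intro: assms)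
  thus ?thesis by (rule eventually_mono) auto
qed

lemma sum_product3:
  fixes a b c :: "nat \<Rightarrow> 'a::comm_semiring_0"
  shows "sum a A * (sum b B * sum c C) = (\<Sum>s\<in>A. \<Sum>t\<in>C. \<Sum>m\<in>B. a s * (b m * c t))"
proof -
  have "sum a A * (sum b B * sum c C) = sum a A * (sum c C * sum b B)" by (simp only: mult_ac)
  also have "\<dots> = (\<Sum>s\<in>A. \<Sum>t\<in>C. \<Sum>m\<in>B. a s * (c t * b m))"
    unfolding sum_product[of c C b B] sum_distrib_right[of a A] by (simp only: sum_distrib_left)
  finally show ?thesis by (simp only: mult_ac)
qed

text \<open>Averages over sufficiently many roots of unity replace integrals over the circle, so that no
  integration theory is needed.\<close>

lemma fir_hankel_le_sup:
  fixes f k :: "nat \<Rightarrow> nat \<Rightarrow> nat \<Rightarrow> real" and g :: "nat \<Rightarrow> nat \<Rightarrow> real"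
  assumes c: "0 \<le> c" and L: "I + K \<le> L"
    and E: "\<And>z. cmod z = 1 \<Longrightarrow> op_bound q p (\<lambda>i j. (\<Sum>m<L. of_real (f m i j) * inverse z ^ m)
                                                 - (\<Sum>m<L. of_real (k m i j) * z ^ m)) c"
  shows "(\<Sum>s<I. \<Sum>i<q. (\<Sum>t<K. \<Sum>j<p. f (s + t + 1) i j * g t j)\<^sup>2) \<le> c\<^sup>2 * (\<Sum>t<K. \<Sum>j<p. (g t j)\<^sup>2)"
proof -
  define h where "h s i = (\<Sum>t<K. \<Sum>j<p. f (s + t + 1) i j * g t j)" for s i
  \<comment> \<open>Every exponent that occurs below is smaller than \<open>n\<close>, so the
    averages over the n-th roots of unity are exactly the constant coefficients.\<close>
  define n where "n = I + K + L + 1"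
  define w where "w = (\<lambda>r::nat. cis (2 * pi * real r / real n))"
  have w1: "cmod (w r) = 1" for r by (simp add: w_def)
  define EE where "EE z i j = (\<Sum>m<L. of_real (f m i j) * inverse z ^ m)
                                   - (\<Sum>m<L. of_real (k m i j) * z ^ m)" for z :: complex and i j
  define gg where "gg z j = (\<Sum>t<K. of_real (g t j) * z ^ (t + 1))" for z :: complex and j
  \<comment> \<open>The output carries z^s instead of z^(-s): as \<open>h\<close> is real, this is
    the conjugate of the output series on the circle, and the inner product becomes a plain
    product.\<close>
  define hh where "hh z i = (\<Sum>s<I. of_real (h s i) * z ^ (s + 0))" for z :: complex and i
  define X where "X = (\<Sum>s<I. \<Sum>i<q. (h s i)\<^sup>2)"
  define G where "G = (\<Sum>t<K. \<Sum>j<p. (g t j)\<^sup>2)"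
  have X0: "0 \<le> X" and G0: "0 \<le> G" by (auto simp: X_def G_def intro!: sum_nonneg)
  have PG: "(\<Sum>r<n. \<Sum>j<p. (cmod (gg (w r) j))\<^sup>2) = real n * G"
    unfolding gg_def w_def
    by (subst sum.swap, subst parseval_roots_of_unity)
       (auto simp: n_def G_def sum_distrib_left intro: sum.swap)
  have PX: "(\<Sum>r<n. \<Sum>i<q. (cmod (hh (w r) i))\<^sup>2) = real n * X"
    unfolding hh_def w_def
    by (subst sum.swap, subst parseval_roots_of_unity)
       (auto simp: n_def X_def sum_distrib_left intro: sum.swap)
  \<comment> \<open>Averaging keeps the terms of exponent zero. Those with \<open>f\<close> have
    exponent s + t + 1 - m and leave m = s + t + 1, which lies below \<open>L\<close>; those with
    \<open>k\<close> have exponent at least 1 and disappear.\<close>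
  have pair: "(\<Sum>r<n. hh (w r) i * (EE (w r) i j * gg (w r) j))
     = of_nat n * (\<Sum>s<I. \<Sum>t<K. of_real (h s i * (f (s + t + 1) i j * g t j)))" for i j
  proof -
    have "hh z i * (EE z i j * gg z j)
      = (\<Sum>s<I. \<Sum>t<K. \<Sum>m<L. of_real (h s i * f m i j * g t j) * (z ^ (s + t + 1) * inverse z ^ m))
      - (\<Sum>s<I. \<Sum>t<K. \<Sum>m<L. of_real (h s i * k m i j * g t j) * (z ^ (s + t + 1 + m) * inverse z ^ 0))" for z
      unfolding hh_def EE_def gg_def right_diff_distrib left_diff_distrib sum_product3
      by (simp add: power_add mult_ac)
    hence "(\<Sum>r<n. hh (w r) i * (EE (w r) i j * gg (w r) j))
      = (\<Sum>r<n. \<Sum>s<I. \<Sum>t<K. \<Sum>m<L. of_real (h s i * f m i j * g t j) * (w r ^ (s + t + 1) * inverse (w r) ^ m))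
      - (\<Sum>r<n. \<Sum>s<I. \<Sum>t<K. \<Sum>m<L. of_real (h s i * k m i j * g t j) * (w r ^ (s + t + 1 + m) * inverse (w r) ^ 0))"
      by (simp only: sum_subtractf)
    also have "\<dots> = (\<Sum>s<I. \<Sum>t<K. \<Sum>m<L. of_real (h s i * f m i j * g t j) * (\<Sum>r<n. w r ^ (s + t + 1) * inverse (w r) ^ m))
      - (\<Sum>s<I. \<Sum>t<K. \<Sum>m<L. of_real (h s i * k m i j * g t j) * (\<Sum>r<n. w r ^ (s + t + 1 + m) * inverse (w r) ^ 0))"
      unfolding sum_distrib_left
      by (simp only: sum.swap[of _ _ "{..<n}"])
    also have "(\<Sum>s<I. \<Sum>t<K. \<Sum>m<L. of_real (h s i * k m i j * g t j) * (\<Sum>r<n. w r ^ (s + t + 1 + m) * inverse (w r) ^ 0)) = 0"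
      unfolding w_def by (intro sum.neutral ballI, subst sum_roots_of_unity) (auto simp: n_def)
    also have "(\<Sum>s<I. \<Sum>t<K. \<Sum>m<L. of_real (h s i * f m i j * g t j) * (\<Sum>r<n. w r ^ (s + t + 1) * inverse (w r) ^ m))
      = (\<Sum>s<I. \<Sum>t<K. \<Sum>m<L. if m = s + t + 1 then of_nat n * of_real (h s i * (f m i j * g t j)) else 0)"
      unfolding w_def by (intro sum.cong refl, subst sum_roots_of_unity) (auto simp: n_def)
    also have "\<dots> = (\<Sum>s<I. \<Sum>t<K. of_nat n * of_real (h s i * (f (s + t + 1) i j * g t j)))"
      using L by (intro sum.cong refl, subst sum.delta) auto
    finally show ?thesis by (simp add: sum_distrib_left)
  qed
  have "(\<Sum>r<n. \<Sum>i<q. hh (w r) i * (\<Sum>j<p. EE (w r) i j * gg (w r) j))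
     = (\<Sum>i<q. \<Sum>j<p. (\<Sum>r<n. hh (w r) i * (EE (w r) i j * gg (w r) j)))"
    by (simp only: sum_distrib_left sum.swap[of _ _ "{..<n}"])
  also have "\<dots> = of_nat n * of_real (\<Sum>i<q. \<Sum>j<p. \<Sum>s<I. \<Sum>t<K. (h s i * (f (s + t + 1) i j * g t j)))"
    unfolding pair by (simp add: sum_distrib_left)
  also have "(\<Sum>i<q. \<Sum>j<p. \<Sum>s<I. \<Sum>t<K. (h s i * (f (s + t + 1) i j * g t j)))
     = (\<Sum>s<I. \<Sum>i<q. h s i * (\<Sum>t<K. \<Sum>j<p. f (s + t + 1) i j * g t j))"
    by (simp only: sum_distrib_left sum.swap[of _ _ "{..<p}"] sum.swap[of _ "{..<q}" "{..<I}"])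
  also have "\<dots> = X" by (simp add: X_def h_def power2_eq_square)
  \<comment> \<open>Since \<open>h\<close> is the Hankel image of \<open>g\<close> itself, pairing
    it with the symbol applied to \<open>g\<close> reproduces its squared norm \<open>X\<close>.
    Cauchy-Schwarz at each root and then over the roots bounds \<open>X\<close> by c sqrt X sqrt
    G.\<close>
  finally have "of_real (real n * X) = (\<Sum>r<n. \<Sum>i<q. hh (w r) i * (\<Sum>j<p. EE (w r) i j * gg (w r) j))"
    by simp
  hence "real n * X = cmod (\<Sum>r<n. \<Sum>i<q. hh (w r) i * (\<Sum>j<p. EE (w r) i j * gg (w r) j))"
    using X0 by (metis norm_of_real abs_of_nonneg mult_nonneg_nonneg of_nat_0_le_iff)
  also have "\<dots> \<le> (\<Sum>r<n. \<Sum>i<q. \<bar>cmod (hh (w r) i)\<bar> * \<bar>cmod (\<Sum>j<p. EE (w r) i j * gg (w r) j)\<bar>)"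
    by (intro order_trans[OF norm_sum] sum_mono) (simp add: norm_mult)
  also have "\<dots> \<le> (\<Sum>r<n. L2_set (\<lambda>i. cmod (hh (w r) i)) {..<q} * (c * L2_set (\<lambda>j. cmod (gg (w r) j)) {..<p}))"
  proof (intro sum_mono order_trans[OF L2_set_mult_ineq] mult_left_mono)
    fix r
    show "L2_set (\<lambda>i. cmod (\<Sum>j<p. EE (w r) i j * gg (w r) j)) {..<q} \<le> c * L2_set (\<lambda>j. cmod (gg (w r) j)) {..<p}"
      unfolding EE_def by (rule op_boundD[OF E[OF w1]])
  qed simp
  also have "\<dots> = c * (\<Sum>r<n. \<bar>L2_set (\<lambda>i. cmod (hh (w r) i)) {..<q}\<bar> * \<bar>L2_set (\<lambda>j. cmod (gg (w r) j)) {..<p}\<bar>)"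
    by (simp add: sum_distrib_left mult_ac)
  also have "\<dots> \<le> c * (sqrt (real n * X) * sqrt (real n * G))"
    using c by (intro mult_left_mono order_trans[OF L2_set_mult_ineq]) (simp_all add: L2_set_Times PX PG)
  also have "\<dots> = real n * (c * (sqrt X * sqrt G))"
    by (simp add: real_sqrt_mult)
  finally have "X \<le> c * (sqrt X * sqrt G)" by (simp add: n_def)
  have "X \<le> c\<^sup>2 * G"
  proof (cases "X = 0")
    case True thus ?thesis using G0 by simp
  next
    case False
    hence "sqrt X > 0" using X0 by simp
    moreover have "sqrt X * sqrt X \<le> sqrt X * (c * sqrt G)"
      using \<open>X \<le> c * (sqrt X * sqrt G)\<close> X0 by (simp add: mult_ac)
    ultimately have "sqrt X \<le> c * sqrt G" by (simp only: mult_le_cancel_left_pos)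
    hence "(sqrt X)\<^sup>2 \<le> (c * sqrt G)\<^sup>2" using X0 by (intro power_mono) auto
    thus ?thesis using X0 G0 by (simp add: power_mult_distrib)
  qed
  thus ?thesis by (simp add: X_def G_def h_def)
qed

text \<open>The easy half of Nehari's theorem: a series in nonnegative powers of z does not change
  the Hankel matrix, so every completion by such a series bounds it. Truncating both series perturbs
  the symbol by a multiple of \<open>e\<close>, uniformly on the circle, and \<open>e\<close> then
  tends to 0.\<close>

lemma hankel_le_sup:
  fixes f k :: "nat \<Rightarrow> nat \<Rightarrow> nat \<Rightarrow> real"
  assumes c: "0 \<le> c"
    and f: "\<And>i j. i < q \<Longrightarrow> j < p \<Longrightarrow> summable (\<lambda>m. \<bar>f m i j\<bar>)"
    and k: "\<And>i j. i < q \<Longrightarrow> j < p \<Longrightarrow> summable (\<lambda>m. \<bar>k m i j\<bar>)"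
    and E: "\<And>z. cmod z = 1 \<Longrightarrow> op_bound q p (\<lambda>i j. (\<Sum>m. of_real (f m i j) * inverse z ^ m)
                                                 - (\<Sum>m. of_real (k m i j) * z ^ m)) c"
  shows "hankel_bounded q p f c"
  unfolding hankel_bounded_def
proof (intro allI)
  fix I K and g :: "nat \<Rightarrow> nat \<Rightarrow> real"
  define X where "X = (\<Sum>s<I. \<Sum>i<q. (\<Sum>t<K. \<Sum>j<p. f (s + t + 1) i j * g t j)\<^sup>2)"
  define G where "G = (\<Sum>t<K. \<Sum>j<p. (g t j)\<^sup>2)"
  have approx: "X \<le> (c + real q * real p * (2 * e))\<^sup>2 * G" if e: "0 < e" for e
  proof -
    have "\<forall>\<^sub>F L in sequentially. \<forall>i<q. \<forall>j<p. \<forall>z. cmod z = 1 \<longrightarrow>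
           cmod ((\<Sum>m. of_real (f m i j) * z ^ m) - (\<Sum>m<L. of_real (f m i j) * z ^ m)) < e"
      by (intro finite_pairs_eventually abs_summable_tail_small f e)
    moreover have "\<forall>\<^sub>F L in sequentially. \<forall>i<q. \<forall>j<p. \<forall>z. cmod z = 1 \<longrightarrow>
           cmod ((\<Sum>m. of_real (k m i j) * z ^ m) - (\<Sum>m<L. of_real (k m i j) * z ^ m)) < e"
      by (intro finite_pairs_eventually abs_summable_tail_small k e)
    moreover have "\<forall>\<^sub>F L in sequentially. I + K \<le> L" by (rule eventually_ge_at_top)
    ultimately have ev: "\<forall>\<^sub>F L in sequentially. (\<forall>i<q. \<forall>j<p. \<forall>z. cmod z = 1 \<longrightarrow>
           cmod ((\<Sum>m. of_real (f m i j) * z ^ m) - (\<Sum>m<L. of_real (f m i j) * z ^ m)) < e) \<and>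
        (\<forall>i<q. \<forall>j<p. \<forall>z. cmod z = 1 \<longrightarrow>
           cmod ((\<Sum>m. of_real (k m i j) * z ^ m) - (\<Sum>m<L. of_real (k m i j) * z ^ m)) < e) \<and> I + K \<le> L"
      by (intro eventually_conj)
    obtain L where Lf: "\<And>i j z. i < q \<Longrightarrow> j < p \<Longrightarrow> cmod z = 1 \<Longrightarrow>
           cmod ((\<Sum>m. of_real (f m i j) * z ^ m) - (\<Sum>m<L. of_real (f m i j) * z ^ m)) < e"
      and Lk: "\<And>i j z. i < q \<Longrightarrow> j < p \<Longrightarrow> cmod z = 1 \<Longrightarrow>
           cmod ((\<Sum>m. of_real (k m i j) * z ^ m) - (\<Sum>m<L. of_real (k m i j) * z ^ m)) < e"
      and L: "I + K \<le> L"
      using eventually_happens'[OF sequentially_bot ev] by blast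
    show ?thesis unfolding X_def G_def
    proof (rule fir_hankel_le_sup[OF _ L, of _ q p f k])
      fix z :: complex assume z: "cmod z = 1"
      define F1 F2 K1 K2 where "F1 i j = (\<Sum>m. of_real (f m i j) * inverse z ^ m)"
        and "F2 i j = (\<Sum>m<L. of_real (f m i j) * inverse z ^ m)"
        and "K1 i j = (\<Sum>m. of_real (k m i j) * z ^ m)"
        and "K2 i j = (\<Sum>m<L. of_real (k m i j) * z ^ m)" for i j
      have "op_bound q p (\<lambda>i j. (F2 i j - F1 i j) + (K1 i j - K2 i j)) (real q * real p * (2 * e))"
      proof (rule op_bound_entries)
        fix i j assume ij: "i < q" "j < p"
        have "cmod (F1 i j - F2 i j) < e" unfolding F1_def F2_def
          using Lf[OF ij, of "inverse z"] z by (simp add: norm_inverse)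
        moreover have "cmod (K1 i j - K2 i j) < e" unfolding K1_def K2_def
          using Lk[OF ij z] .
        ultimately show "cmod ((F2 i j - F1 i j) + (K1 i j - K2 i j)) \<le> 2 * e"
          by (smt (verit) norm_triangle_ineq norm_minus_commute)
      qed
      from op_bound_add[OF E[OF z] this]
      have "op_bound q p (\<lambda>i j. F2 i j - K2 i j) (c + real q * real p * (2 * e))"
        by (rule op_bound_cong) (simp add: F1_def K1_def)
      thus "op_bound q p (\<lambda>i j. (\<Sum>m<L. of_real (f m i j) * inverse z ^ m)
         - (\<Sum>m<L. of_real (k m i j) * z ^ m)) (c + real q * real p * (2 * e))"
        by (simp add: F2_def K2_def)
    qed (use c e in auto)
  qed
  have "((\<lambda>e. (c + real q * real p * (2 * e))\<^sup>2 * G) \<longlongrightarrow> (c + real q * real p * (2 * 0))\<^sup>2 * G) (at_right 0)"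
    by (intro tendsto_intros)
  hence "X \<le> (c + real q * real p * (2 * 0))\<^sup>2 * G"
    by (rule tendsto_lowerbound) (auto intro!: eventually_at_rightI[of 0 1] approx)
  thus "X \<le> c\<^sup>2 * G" by simp
qed

subsection \<open>Nehari's theorem\<close>

lemma sum_div_mod:
  fixes g :: "nat \<Rightarrow> nat \<Rightarrow> 'a::comm_monoid_add"
  shows "(\<Sum>l<M * p. g (l div p) (l mod p)) = (\<Sum>j<M. \<Sum>b<p. g j b)"
proof (induction M)
  case (Suc M)
  have "(\<Sum>l<Suc M * p. g (l div p) (l mod p))
     = (\<Sum>l<M * p. g (l div p) (l mod p)) + (\<Sum>l\<in>{M * p..<M * p + p}. g (l div p) (l mod p))"
    by (subst sum.union_disjoint[symmetric]) (auto intro: sum.cong)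
  also have "(\<Sum>l\<in>{M * p..<M * p + p}. g (l div p) (l mod p)) = (\<Sum>b<p. g ((b + M * p) div p) ((b + M * p) mod p))"
    using sum.shift_bounds_nat_ivl[of "\<lambda>l. g (l div p) (l mod p)" 0 "M * p" p]
    by (simp add: atLeast0LessThan add.commute)
  also have "\<dots> = (\<Sum>b<p. g M b)"
    by (intro sum.cong refl) auto
  finally show ?case using Suc by simp
qed simp

text \<open>The prescribed entries form the strict lower triangle of a block Toeplitz matrix. The
  rows below block \<open>j\<close> and the columns up to block \<open>j\<close> form a full
  rectangle, which becomes a section of the Hankel matrix once the order of the columns is reversed.
  Divided by \<open>d\<close>, these rectangles have norm at most c / d < 1. The completion itself
  need not be Toeplitz.\<close>

lemma toeplitz_completion:
  fixes f :: "nat \<Rightarrow> nat \<Rightarrow> nat \<Rightarrow> real"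
  assumes f: "hankel_bounded q p f c" and c: "0 \<le> c" "c < d"
  obtains T :: "nat \<Rightarrow> nat \<Rightarrow> nat \<Rightarrow> nat \<Rightarrow> real" where
    "\<And>i a j b. j < i \<Longrightarrow> i < M \<Longrightarrow> a < q \<Longrightarrow> b < p \<Longrightarrow> T i a j b = f (i - j) a b"
    "\<And>u. (\<Sum>i<M. \<Sum>a<q. (\<Sum>j<M. \<Sum>b<p. T i a j b * u j b)\<^sup>2) \<le> d\<^sup>2 * (\<Sum>j<M. \<Sum>b<p. (u j b)\<^sup>2)"
proof -
  have d: "0 < d" using c by simp
  \<comment> \<open>Columns are scalar, numbered l = j p + b; prescribed are all rows strictly below
    the block \<open>l div p\<close>.\<close>
  define S where "S l = {l div p<..<M} \<times> {..<q}" for l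
  define F where "F r l = f (fst r - l div p) (snd r) (l mod p) / d" for r :: "nat \<times> nat" and l
  have key: "(\<Sum>r\<in>S l. (\<Sum>k\<le>l. F r k * u k)\<^sup>2) \<le> (c / d)\<^sup>2 * (\<Sum>k\<le>l. (u k)\<^sup>2)"
    if l: "l < M * p" for l u
  proof -
    define j0 where "j0 = l div p"
    have p: "0 < p" using l by (cases p) auto
    have lb: "l < Suc j0 * p" unfolding j0_def using p
      by (metis div_mult_mod_eq mod_less_divisor mult.commute mult_Suc_right nat_add_left_cancel_less add.commute)
    \<comment> \<open>A scalar column may end inside the block \<open>j0\<close>; zeros extend the
      input to the end of this block. Then \<open>g\<close> lists the blocks in reverse order, from
      \<open>j0\<close> down to 0.\<close>
    define u' where "u' k = (if k \<le> l then u k else 0)" for k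
    define g where "g t b = u' ((j0 - t) * p + b)" for t b
    have ext: "(\<Sum>k\<le>l. G k * u k) = (\<Sum>k<Suc j0 * p. G k * u' k)" for G
      using lb by (intro sum.mono_neutral_cong_left) (auto simp: u'_def)
    have ext2: "(\<Sum>k\<le>l. (u k)\<^sup>2) = (\<Sum>k<Suc j0 * p. (u' k)\<^sup>2)"
      using lb by (intro sum.mono_neutral_cong_left) (auto simp: u'_def)
    have norm_g: "(\<Sum>k\<le>l. (u k)\<^sup>2) = (\<Sum>t<Suc j0. \<Sum>b<p. (g t b)\<^sup>2)"
    proof -
      have "(\<Sum>k<Suc j0 * p. (u' k)\<^sup>2) = (\<Sum>k<Suc j0 * p. (u' (k div p * p + k mod p))\<^sup>2)" by simp
      also have "\<dots> = (\<Sum>j<Suc j0. \<Sum>b<p. (u' (j * p + b))\<^sup>2)" by (rule sum_div_mod)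
      also have "\<dots> = (\<Sum>t<Suc j0. \<Sum>b<p. (g t b)\<^sup>2)"
        by (subst sum.nat_diff_reindex[symmetric]) (simp add: g_def)
      finally show ?thesis unfolding ext2 .
    qed
    have row: "(\<Sum>k\<le>l. F (Suc (j0 + s), a) k * u k) = (\<Sum>t<Suc j0. \<Sum>b<p. f (s + t + 1) a b * g t b) / d" for s a
    proof -
      have "(\<Sum>k\<le>l. F (Suc (j0 + s), a) k * u k)
         = (\<Sum>k<Suc j0 * p. f (Suc (j0 + s) - k div p) a (k mod p) / d * u' (k div p * p + k mod p))"
        unfolding ext F_def by simp
      also have "\<dots> = (\<Sum>j<Suc j0. \<Sum>b<p. f (Suc (j0 + s) - j) a b / d * u' (j * p + b))" by (rule sum_div_mod)
      also have "\<dots> = (\<Sum>t<Suc j0. \<Sum>b<p. f (s + t + 1) a b / d * g t b)"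
        by (subst sum.nat_diff_reindex[symmetric]) (auto simp: g_def Suc_diff_le intro!: sum.cong)
      finally show ?thesis by (simp add: sum_divide_distrib del: sum.lessThan_Suc)
    qed
    have "(\<Sum>r\<in>S l. (\<Sum>k\<le>l. F r k * u k)\<^sup>2)
       = (\<Sum>i\<in>{j0<..<M}. \<Sum>a<q. (\<Sum>k\<le>l. F (i, a) k * u k)\<^sup>2)"
      by (simp add: S_def j0_def sum.cartesian_product case_prod_unfold)
    also have "\<dots> = (\<Sum>s<M - Suc j0. \<Sum>a<q. (\<Sum>k\<le>l. F (Suc (j0 + s), a) k * u k)\<^sup>2)"
      by (rule sum.reindex_bij_witness[of _ "\<lambda>s. Suc (j0 + s)" "\<lambda>i. i - Suc j0"]) auto
    also have "\<dots> = (\<Sum>s<M - Suc j0. \<Sum>a<q. (\<Sum>t<Suc j0. \<Sum>b<p. f (s + t + 1) a b * g t b)\<^sup>2) / d\<^sup>2"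
      unfolding row by (simp add: power_divide sum_divide_distrib)
    also have "\<dots> \<le> c\<^sup>2 * (\<Sum>t<Suc j0. \<Sum>b<p. (g t b)\<^sup>2) / d\<^sup>2"
      using f unfolding hankel_bounded_def by (intro divide_right_mono) (blast, simp)
    finally show ?thesis unfolding norm_g by (simp add: power_divide)
  qed
  have "(c / d)\<^sup>2 < 1" using c d by (simp add: power_less_one_iff)
  have "\<exists>T. (\<forall>j<M * p. \<forall>r\<in>S j. T r j = F r j) \<and>
     (\<forall>u. (\<Sum>r\<in>{..<M} \<times> {..<q}. (\<Sum>l<M * p. T r l * u l)\<^sup>2) \<le> (\<Sum>l<M * p. (u l)\<^sup>2))"
  proof (rule contraction_complete_staircase[of _ "(c / d)\<^sup>2"])
    show "S l \<subseteq> {..<M} \<times> {..<q}" for l by (auto simp: S_def)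
    show "S l \<subseteq> S k" if "k \<le> l" for k l
    proof -
      have "k div p \<le> l div p" using that by (rule div_le_mono)
      thus ?thesis by (auto simp: S_def)
    qed
  qed (use \<open>(c / d)\<^sup>2 < 1\<close> key in auto)
  then obtain T where T: "\<And>j r. j < M * p \<Longrightarrow> r \<in> S j \<Longrightarrow> T r j = F r j"
    and TC: "\<And>u. (\<Sum>r\<in>{..<M} \<times> {..<q}. (\<Sum>l<M * p. T r l * u l)\<^sup>2) \<le> (\<Sum>l<M * p. (u l)\<^sup>2)"
    by blast
  show ?thesis
  proof (rule that[of "\<lambda>i a j b. d * T (i, a) (j * p + b)"])
    fix i a j b assume *: "j < i" "i < M" "a < q" "b < p"
    have "j * p + b < Suc j * p" using * by simp
    also have "\<dots> \<le> M * p" using * by (intro mult_right_mono) auto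
    finally have "T (i, a) (j * p + b) = F (i, a) (j * p + b)"
      using * by (intro T) (auto simp: S_def)
    thus "d * T (i, a) (j * p + b) = f (i - j) a b" using * d by (simp add: F_def)
  next
    fix u :: "nat \<Rightarrow> nat \<Rightarrow> real"
    define u' where "u' l = u (l div p) (l mod p)" for l
    have row: "(\<Sum>j<M. \<Sum>b<p. d * T (i, a) (j * p + b) * u j b) = d * (\<Sum>l<M * p. T (i, a) l * u' l)" for i a
    proof -
      have "(\<Sum>l<M * p. T (i, a) l * u' l) = (\<Sum>l<M * p. T (i, a) (l div p * p + l mod p) * u (l div p) (l mod p))"
        by (simp add: u'_def)
      also have "\<dots> = (\<Sum>j<M. \<Sum>b<p. T (i, a) (j * p + b) * u j b)" by (rule sum_div_mod)
      finally show ?thesis by (simp add: sum_distrib_left mult.assoc)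
    qed
    have "(\<Sum>i<M. \<Sum>a<q. (\<Sum>j<M. \<Sum>b<p. d * T (i, a) (j * p + b) * u j b)\<^sup>2)
       = d\<^sup>2 * (\<Sum>r\<in>{..<M} \<times> {..<q}. (\<Sum>l<M * p. T r l * u' l)\<^sup>2)"
      unfolding row power_mult_distrib sum_distrib_left[symmetric]
      by (simp add: sum.cartesian_product case_prod_unfold)
    also have "\<dots> \<le> d\<^sup>2 * (\<Sum>l<M * p. (u' l)\<^sup>2)" by (intro mult_left_mono TC) simp
    also have "(\<Sum>l<M * p. (u' l)\<^sup>2) = (\<Sum>j<M. \<Sum>b<p. (u j b)\<^sup>2)"
      unfolding u'_def by (rule sum_div_mod)
    finally show "(\<Sum>i<M. \<Sum>a<q. (\<Sum>j<M. \<Sum>b<p. d * T (i, a) (j * p + b) * u j b)\<^sup>2)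
       \<le> d\<^sup>2 * (\<Sum>j<M. \<Sum>b<p. (u j b)\<^sup>2)" .
  qed
qed

text \<open>Real and imaginary parts are mapped separately, and their squares add up.\<close>

lemma real_contraction_complex:
  fixes T :: "'r \<Rightarrow> 's \<Rightarrow> real" and u :: "'s \<Rightarrow> complex"
  assumes "\<And>u. (\<Sum>r\<in>R. (\<Sum>s\<in>S. T r s * u s)\<^sup>2) \<le> c * (\<Sum>s\<in>S. (u s)\<^sup>2)"
  shows "(\<Sum>r\<in>R. (cmod (\<Sum>s\<in>S. of_real (T r s) * u s))\<^sup>2) \<le> c * (\<Sum>s\<in>S. (cmod (u s))\<^sup>2)"
  using add_mono[OF assms[of "\<lambda>s. Re (u s)"] assms[of "\<lambda>s. Im (u s)"]]
  by (simp add: cmod_power2 sum.distrib distrib_left)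

lemma cmod_sum_squared_le:
  fixes a :: "nat \<Rightarrow> complex"
  shows "(cmod (\<Sum>i<M. a i))\<^sup>2 \<le> real M * (\<Sum>i<M. (cmod (a i))\<^sup>2)"
proof -
  have "cmod (\<Sum>i<M. a i) \<le> (\<Sum>i<M. \<bar>1\<bar> * \<bar>cmod (a i)\<bar>)"
    using norm_sum[of a] by simp
  also have "\<dots> \<le> L2_set (\<lambda>_. 1) {..<M} * L2_set (\<lambda>i. cmod (a i)) {..<M}" by (rule L2_set_mult_ineq)
  finally have "(cmod (\<Sum>i<M. a i))\<^sup>2 \<le> (L2_set (\<lambda>_. 1) {..<M} * L2_set (\<lambda>i. cmod (a i)) {..<M})\<^sup>2"
    by (intro power_mono) auto
  thus ?thesis by (simp add: power_mult_distrib L2_set_def sum_nonneg)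
qed

lemma sum_square_diagonals:
  fixes h :: "nat \<Rightarrow> nat \<Rightarrow> 'a::comm_monoid_add"
  shows "(\<Sum>i<M. \<Sum>j<M. h i j) = (\<Sum>k<M. \<Sum>i<M - k. h i (i + k)) + (\<Sum>k\<in>{1..<M}. \<Sum>j<M - k. h (j + k) j)"
proof -
  have "(\<Sum>i<M. \<Sum>j<M. h i j) = (\<Sum>i<M. \<Sum>j\<in>{i..<M}. h i j) + (\<Sum>i<M. \<Sum>j<i. h i j)"
    unfolding sum.distrib[symmetric]
  proof (intro sum.cong refl)
    fix i assume "i \<in> {..<M}"
    hence "{..<M} = {i..<M} \<union> {..<i}" by auto
    moreover have "sum (h i) ({i..<M} \<union> {..<i}) = (\<Sum>j\<in>{i..<M}. h i j) + (\<Sum>j<i. h i j)"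
      by (rule sum.union_disjoint) auto
    ultimately show "(\<Sum>j<M. h i j) = (\<Sum>j\<in>{i..<M}. h i j) + (\<Sum>j<i. h i j)" by simp
  qed
  also have "(\<Sum>i<M. \<Sum>j\<in>{i..<M}. h i j) = (\<Sum>k<M. \<Sum>i<M - k. h i (i + k))"
    unfolding sum.Sigma[OF finite_lessThan ballI[OF finite_atLeastLessThan]]
      sum.Sigma[OF finite_lessThan ballI[OF finite_lessThan]]
    by (rule sum.reindex_bij_witness[of _ "\<lambda>(k, i). (i, i + k)" "\<lambda>(i, j). (j - i, i)"]) auto
  also have "(\<Sum>i<M. \<Sum>j<i. h i j) = (\<Sum>k\<in>{1..<M}. \<Sum>j<M - k. h (j + k) j)"
    unfolding sum.Sigma[OF finite_lessThan ballI[OF finite_lessThan]]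
      sum.Sigma[OF finite_atLeastLessThan ballI[OF finite_lessThan]]
    by (rule sum.reindex_bij_witness[of _ "\<lambda>(k, j). (j + k, j)" "\<lambda>(i, j). (i - j, j)"]) auto
  finally show ?thesis .
qed

text \<open>Averaging a completion along its diagonals gives a trigonometric polynomial of no larger
  norm, whatever the completed entries are; only the given coefficients get damped.\<close>

lemma fejer_completion:
  fixes f :: "nat \<Rightarrow> nat \<Rightarrow> nat \<Rightarrow> real"
  assumes f: "hankel_bounded q p f c" and c: "0 \<le> c" "c < d" and M: "0 < M"
  obtains k :: "nat \<Rightarrow> nat \<Rightarrow> nat \<Rightarrow> real" where
    "\<And>z. cmod z = 1 \<Longrightarrow> op_bound q p (\<lambda>i j.
        (\<Sum>m\<in>{1..<M}. of_real ((1 - real m / real M) * f m i j) * inverse z ^ m)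
          - (\<Sum>m<M. of_real (k m i j) * z ^ m)) d"
proof -
  obtain T :: "nat \<Rightarrow> nat \<Rightarrow> nat \<Rightarrow> nat \<Rightarrow> real" where
    T: "\<And>i a j b. j < i \<Longrightarrow> i < M \<Longrightarrow> a < q \<Longrightarrow> b < p \<Longrightarrow> T i a j b = f (i - j) a b" and
    TC: "\<And>u. (\<Sum>i<M. \<Sum>a<q. (\<Sum>j<M. \<Sum>b<p. T i a j b * u j b)\<^sup>2) \<le> d\<^sup>2 * (\<Sum>j<M. \<Sum>b<p. (u j b)\<^sup>2)"
    by (rule toeplitz_completion[OF f c, of M]) blast
  have TC': "(\<Sum>i<M. \<Sum>a<q. (cmod (\<Sum>j<M. \<Sum>b<p. of_real (T i a j b) * u j b))\<^sup>2)
       \<le> d\<^sup>2 * (\<Sum>j<M. \<Sum>b<p. (cmod (u j b))\<^sup>2)" for u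
  proof -
    have "(\<Sum>r\<in>{..<M} \<times> {..<q}. (\<Sum>s\<in>{..<M} \<times> {..<p}. T (fst r) (snd r) (fst s) (snd s) * x s)\<^sup>2)
        \<le> d\<^sup>2 * (\<Sum>s\<in>{..<M} \<times> {..<p}. (x s)\<^sup>2)" for x
      using TC[of "\<lambda>j b. x (j, b)"] by (simp add: sum.cartesian_product case_prod_unfold)
    from real_contraction_complex[OF this, of "\<lambda>s. u (fst s) (snd s)"]
    show ?thesis by (simp add: sum.cartesian_product case_prod_unfold)
  qed
  \<comment> \<open>The diagonal at distance \<open>m\<close> has M - m entries but is divided by
    \<open>M\<close>. The sign is there because the second sum is subtracted in the claim.\<close>
  define k where "k m a b = - (\<Sum>i<M - m. T i a (i + m) b) / real M" for m a b
  have "op_bound q p (\<lambda>i j.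
        (\<Sum>m\<in>{1..<M}. of_real ((1 - real m / real M) * f m i j) * inverse z ^ m)
          - (\<Sum>m<M. of_real (k m i j) * z ^ m)) d" if z: "cmod z = 1" for z
    unfolding op_bound_def
  proof
    fix v :: "nat \<Rightarrow> complex"
    have z0: "z \<noteq> 0" using z by auto
    \<comment> \<open>The block (i, j) of the completion is carried by z^(j-i). Applied to v, this
      is the mean of the vectors z^(-i) w_i, where w is the completion applied to the vector with
      blocks z^j v. That vector has squared norm M |v|^2, while taking the mean of M vectors gains a
      factor 1 / M, so the two factors cancel.\<close>
    define Phi where "Phi a b = (\<Sum>i<M. \<Sum>j<M. of_real (T i a j b) * (inverse z ^ i * z ^ j)) / of_nat M" for a b
    define w where "w i a = (\<Sum>j<M. \<Sum>b<p. of_real (T i a j b) * (z ^ j * v b))" for i a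
    have Phi_eq: "(\<Sum>m\<in>{1..<M}. of_real ((1 - real m / real M) * f m a b) * inverse z ^ m)
          - (\<Sum>m<M. of_real (k m a b) * z ^ m) = Phi a b" if ab: "a < q" "b < p" for a b
    proof -
      have "Phi a b = ((\<Sum>m<M. \<Sum>i<M - m. of_real (T i a (i + m) b) * (inverse z ^ i * z ^ (i + m)))
         + (\<Sum>m\<in>{1..<M}. \<Sum>j<M - m. of_real (T (j + m) a j b) * (inverse z ^ (j + m) * z ^ j))) / of_nat M"
        unfolding Phi_def by (subst sum_square_diagonals) (rule refl)
      also have "(\<Sum>m<M. \<Sum>i<M - m. of_real (T i a (i + m) b) * (inverse z ^ i * z ^ (i + m)))
         = - of_nat M * (\<Sum>m<M. of_real (k m a b) * z ^ m)"
        unfolding sum_distrib_left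
      proof (intro sum.cong refl)
        fix m
        have "(\<Sum>i<M - m. of_real (T i a (i + m) b) * (inverse z ^ i * z ^ (i + m)))
           = (\<Sum>i<M - m. of_real (T i a (i + m) b) * z ^ m)"
          using z0 by (intro sum.cong refl) (simp add: power_add power_inverse)
        also have "\<dots> = - of_nat M * (of_real (k m a b) * z ^ m)"
          using M by (simp add: k_def sum_distrib_right)
        finally show "(\<Sum>i<M - m. of_real (T i a (i + m) b) * (inverse z ^ i * z ^ (i + m)))
           = - of_nat M * (of_real (k m a b) * z ^ m)" .
      qed
      also have "(\<Sum>m\<in>{1..<M}. \<Sum>j<M - m. of_real (T (j + m) a j b) * (inverse z ^ (j + m) * z ^ j))
         = of_nat M * (\<Sum>m\<in>{1..<M}. of_real ((1 - real m / real M) * f m a b) * inverse z ^ m)"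
        unfolding sum_distrib_left
      proof (intro sum.cong refl)
        fix m assume m: "m \<in> {1..<M}"
        have "(\<Sum>j<M - m. of_real (T (j + m) a j b) * (inverse z ^ (j + m) * z ^ j))
           = (\<Sum>j<M - m. of_real (f m a b) * inverse z ^ m)"
          using m ab z0 by (intro sum.cong refl) (auto simp: T power_add power_inverse field_simps)
        also have "\<dots> = of_nat M * (of_real ((1 - real m / real M) * f m a b) * inverse z ^ m)"
        proof -
          \<comment> \<open>A lower diagonal consists of M - m equal entries, which is the origin of
            the weight 1 - m / M.\<close>
          have "of_nat M * of_real (1 - real m / real M) = (of_nat (M - m) :: complex)"
            using m M by (simp add: of_nat_diff right_diff_distrib)
          thus ?thesis by (simp add: mult.assoc[symmetric])
        qed
        finally show "(\<Sum>j<M - m. of_real (T (j + m) a j b) * (inverse z ^ (j + m) * z ^ j))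
           = of_nat M * (of_real ((1 - real m / real M) * f m a b) * inverse z ^ m)" .
      qed
      finally show ?thesis using M by (simp add: field_simps)
    qed
    have sum_w: "(\<Sum>b<p. Phi a b * v b) = (\<Sum>i<M. inverse z ^ i * w i a) / of_nat M" for a
    proof -
      have "(\<Sum>b<p. Phi a b * v b)
        = (\<Sum>b<p. \<Sum>i<M. \<Sum>j<M. inverse z ^ i * (of_real (T i a j b) * (z ^ j * v b))) / of_nat M"
        unfolding Phi_def by (simp add: sum_divide_distrib sum_distrib_right sum_distrib_left mult_ac)
      also have "(\<Sum>b<p. \<Sum>i<M. \<Sum>j<M. inverse z ^ i * (of_real (T i a j b) * (z ^ j * v b)))
        = (\<Sum>i<M. \<Sum>j<M. \<Sum>b<p. inverse z ^ i * (of_real (T i a j b) * (z ^ j * v b)))"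
        by (simp only: sum.swap[of _ _ "{..<p}"])
      finally show ?thesis by (simp add: w_def sum_distrib_left)
    qed
    have vz: "(\<Sum>j<M. \<Sum>b<p. (cmod (z ^ j * v b))\<^sup>2) = real M * (\<Sum>b<p. (cmod (v b))\<^sup>2)"
      using z by (simp add: norm_mult norm_power)
    have "(\<Sum>a<q. (cmod (\<Sum>b<p. Phi a b * v b))\<^sup>2)
       \<le> (\<Sum>a<q. (\<Sum>i<M. (cmod (w i a))\<^sup>2) / real M)"
    proof (rule sum_mono)
      fix a
      have "(cmod (\<Sum>i<M. inverse z ^ i * w i a))\<^sup>2 \<le> real M * (\<Sum>i<M. (cmod (w i a))\<^sup>2)"
        using cmod_sum_squared_le[of "\<lambda>i. inverse z ^ i * w i a" M] z
        by (simp add: norm_mult norm_power norm_inverse)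
      hence "(cmod (\<Sum>i<M. inverse z ^ i * w i a))\<^sup>2 / (real M)\<^sup>2
         \<le> real M * (\<Sum>i<M. (cmod (w i a))\<^sup>2) / (real M)\<^sup>2"
        by (rule divide_right_mono) simp
      thus "(cmod (\<Sum>b<p. Phi a b * v b))\<^sup>2 \<le> (\<Sum>i<M. (cmod (w i a))\<^sup>2) / real M"
        unfolding sum_w using M by (simp add: norm_divide power_divide power2_eq_square)
    qed
    also have "\<dots> = (\<Sum>i<M. \<Sum>a<q. (cmod (w i a))\<^sup>2) / real M"
      unfolding sum_divide_distrib by (rule sum.swap)
    also have "\<dots> \<le> d\<^sup>2 * (\<Sum>j<M. \<Sum>b<p. (cmod (z ^ j * v b))\<^sup>2) / real M"
      unfolding w_def by (intro divide_right_mono TC') simp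
    also have "\<dots> = d\<^sup>2 * (\<Sum>b<p. (cmod (v b))\<^sup>2)" unfolding vz using M by simp
    finally have "sqrt (\<Sum>a<q. (cmod (\<Sum>b<p. Phi a b * v b))\<^sup>2) \<le> sqrt (d\<^sup>2 * (\<Sum>b<p. (cmod (v b))\<^sup>2))"
      by simp
    hence "L2_set (\<lambda>a. cmod (\<Sum>b<p. Phi a b * v b)) {..<q} \<le> d * L2_set (\<lambda>b. cmod (v b)) {..<p}"
      using c by (simp add: L2_set_def real_sqrt_mult)
    moreover have "L2_set (\<lambda>i. cmod (\<Sum>j<p. ((\<Sum>m\<in>{1..<M}. of_real ((1 - real m / real M) * f m i j) * inverse z ^ m)
          - (\<Sum>m<M. of_real (k m i j) * z ^ m)) * v j)) {..<q} = L2_set (\<lambda>a. cmod (\<Sum>b<p. Phi a b * v b)) {..<q}"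
      using Phi_eq by (intro L2_set_cong refl arg_cong[where f=cmod] sum.cong) auto
    ultimately show "L2_set (\<lambda>i. cmod (\<Sum>j<p. ((\<Sum>m\<in>{1..<M}. of_real ((1 - real m / real M) * f m i j) * inverse z ^ m)
          - (\<Sum>m<M. of_real (k m i j) * z ^ m)) * v j)) {..<q} \<le> d * L2_set (\<lambda>b. cmod (v b)) {..<p}"
      by simp
  qed
  thus ?thesis by (rule that)
qed

text \<open>For absolutely summable coefficients damping is harmless: below a fixed \<open>L\<close>
  it changes the sum by at most s / M, and beyond \<open>L\<close> by at most the tail.\<close>

lemma fejer_damping_small:
  fixes a :: "nat \<Rightarrow> real"
  assumes a: "summable (\<lambda>m. \<bar>a m\<bar>)" "a 0 = 0" and e: "0 < e"
  shows "\<forall>\<^sub>F M in sequentially. \<forall>z. cmod z = 1 \<longrightarrow>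
    cmod ((\<Sum>m. of_real (a m) * z ^ m) - (\<Sum>m\<in>{1..<M}. of_real ((1 - real m / real M) * a m) * z ^ m)) < e"
proof -
  \<comment> \<open>One quarter is for the damped head, two are for the coefficients between
    \<open>L\<close> and \<open>M\<close> as a difference of two tails, and one is for the tail
    beyond \<open>M\<close>.\<close>
  have e4: "0 < e / 4" using e by simp
  obtain L where L: "\<And>M. M \<ge> L \<Longrightarrow> norm ((\<Sum>k. \<bar>a k\<bar>) - (\<Sum>k<M. \<bar>a k\<bar>)) < e / 4"
    using summable_tail_small[OF a(1) e4] unfolding eventually_sequentially by auto
  define s where "s = (\<Sum>m<L. real m * \<bar>a m\<bar>)"
  have s0: "0 \<le> s" by (auto simp: s_def intro!: sum_nonneg)
  have ev1: "\<forall>\<^sub>F M in sequentially. s / real M < e / 4"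
    using order_tendstoD(2)[OF lim_const_over_n e4] .
  have ev2: "\<forall>\<^sub>F M in sequentially. \<forall>z. cmod z = 1 \<longrightarrow>
           cmod ((\<Sum>k. of_real (a k) * z ^ k) - (\<Sum>k<M. of_real (a k) * z ^ k)) < e / 4"
    by (rule abs_summable_tail_small[OF a(1) e4])
  have ev3: "\<forall>\<^sub>F M in sequentially. L < M" by (rule eventually_gt_at_top)
  show ?thesis
    using ev1 ev2 ev3
  proof (eventually_elim, intro allI impI)
    fix M and z :: complex
    assume M1: "s / real M < e / 4" and M2: "\<forall>z. cmod z = 1 \<longrightarrow>
           cmod ((\<Sum>k. of_real (a k) * z ^ k) - (\<Sum>k<M. of_real (a k) * z ^ k)) < e / 4"
      and M3: "L < M" and z: "cmod z = 1"
    have M: "0 < M" using M3 by simp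
    have "(\<Sum>m<M. of_real (a m) * z ^ m) - (\<Sum>m\<in>{1..<M}. of_real ((1 - real m / real M) * a m) * z ^ m)
        = (\<Sum>m<M. of_real (real m / real M * a m) * z ^ m)"
    proof -
      have "(\<Sum>m\<in>{1..<M}. of_real ((1 - real m / real M) * a m) * z ^ m)
         = (\<Sum>m<M. of_real ((1 - real m / real M) * a m) * z ^ m)"
        using a(2) M by (intro sum.mono_neutral_left) (auto simp: not_less_eq_eq)
      thus ?thesis by (simp add: sum_subtractf[symmetric] algebra_simps)
    qed
    also have "cmod \<dots> \<le> (\<Sum>m<M. real m / real M * \<bar>a m\<bar>)"
      using z by (intro order_trans[OF norm_sum] sum_mono) (simp add: norm_mult norm_power norm_divide)
    also have "\<dots> = (\<Sum>m<L. real m / real M * \<bar>a m\<bar>) + (\<Sum>m\<in>{L..<M}. real m / real M * \<bar>a m\<bar>)"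
    proof -
      have "{..<M} = {..<L} \<union> {L..<M}" using M3 by auto
      thus ?thesis by (simp add: sum.union_disjoint ivl_disj_int)
    qed
    also have "\<dots> \<le> s / real M + (\<Sum>m\<in>{L..<M}. \<bar>a m\<bar>)"
    proof (intro add_mono sum_mono)
      show "(\<Sum>m<L. real m / real M * \<bar>a m\<bar>) \<le> s / real M"
        by (simp add: s_def sum_divide_distrib)
      show "real m / real M * \<bar>a m\<bar> \<le> \<bar>a m\<bar>" if "m \<in> {L..<M}" for m
        using that by (intro mult_left_le_one_le) auto
    qed
    also have "(\<Sum>m\<in>{L..<M}. \<bar>a m\<bar>) = (\<Sum>m<M. \<bar>a m\<bar>) - (\<Sum>m<L. \<bar>a m\<bar>)"
      using sum_diff_nat_ivl[of 0 L M "\<lambda>m. \<bar>a m\<bar>"] M3 by (simp add: atLeast0LessThan)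
    also have "s / real M + ((\<Sum>m<M. \<bar>a m\<bar>) - (\<Sum>m<L. \<bar>a m\<bar>)) < e / 4 + (e / 4 + e / 4)"
      using M1 L[of M] L[of L] M3 unfolding real_norm_def by linarith
    finally show "cmod ((\<Sum>m. of_real (a m) * z ^ m)
        - (\<Sum>m\<in>{1..<M}. of_real ((1 - real m / real M) * a m) * z ^ m)) < e"
      using M2[rule_format, OF z] norm_triangle_ineq[of "(\<Sum>m. of_real (a m) * z ^ m) - (\<Sum>m<M. of_real (a m) * z ^ m)"
        "(\<Sum>m<M. of_real (a m) * z ^ m) - (\<Sum>m\<in>{1..<M}. of_real ((1 - real m / real M) * a m) * z ^ m)"]
      by simp
  qed
qed

text \<open>This is the strict form, with an arbitrary \<open>d\<close> above the Hankel bound. In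
  return the completion has finitely many terms, so that a rational matrix can realize it.\<close>

theorem nehari:
  fixes f :: "nat \<Rightarrow> nat \<Rightarrow> nat \<Rightarrow> real"
  assumes f: "hankel_bounded q p f c" and c: "0 \<le> c" "c < d"
    and fs: "\<And>i j. i < q \<Longrightarrow> j < p \<Longrightarrow> summable (\<lambda>m. \<bar>f m i j\<bar>)"
    and f0: "\<And>i j. i < q \<Longrightarrow> j < p \<Longrightarrow> f 0 i j = 0"
  obtains M and k :: "nat \<Rightarrow> nat \<Rightarrow> nat \<Rightarrow> real" where
    "\<And>z. cmod z = 1 \<Longrightarrow> op_bound q p (\<lambda>i j. (\<Sum>m. of_real (f m i j) * inverse z ^ m)
          - (\<Sum>m<M. of_real (k m i j) * z ^ m)) d"
proof -
  \<comment> \<open>Half of the gap between \<open>c\<close> and \<open>d\<close> is left for the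
    damping error, spread over the q p entries; the other half lets the averaged completion have
    norm (c + d) / 2. Adding 1 keeps the denominator positive for empty dimensions.\<close>
  define e where "e = (d - c) / 2 / (real q * real p + 1)"
  have e: "0 < e" using c by (simp add: e_def add_nonneg_pos)
  have "real q * real p * e \<le> (real q * real p + 1) * e" using e by (simp add: algebra_simps)
  also have "\<dots> = (d - c) / 2"
  proof -
    have "real q * real p + 1 \<noteq> 0" using add_nonneg_pos[of "real q * real p" 1] by simp
    moreover have "x * (y / x) = y" if "x \<noteq> 0" for x y :: real using that by simp
    ultimately show ?thesis unfolding e_def by blast
  qed
  finally have e2: "real q * real p * e \<le> (d - c) / 2" .
  have "\<forall>\<^sub>F M in sequentially. (\<forall>i<q. \<forall>j<p. \<forall>z. cmod z = 1 \<longrightarrow>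
    cmod ((\<Sum>m. of_real (f m i j) * z ^ m) - (\<Sum>m\<in>{1..<M}. of_real ((1 - real m / real M) * f m i j) * z ^ m)) < e) \<and> 0 < M"
    by (intro eventually_conj finite_pairs_eventually fejer_damping_small fs f0 e eventually_gt_at_top)
  then obtain M where Me: "\<And>i j z. i < q \<Longrightarrow> j < p \<Longrightarrow> cmod z = 1 \<Longrightarrow>
    cmod ((\<Sum>m. of_real (f m i j) * z ^ m) - (\<Sum>m\<in>{1..<M}. of_real ((1 - real m / real M) * f m i j) * z ^ m)) < e"
    and M: "0 < M"
    using eventually_happens'[OF sequentially_bot] by blast
  obtain k :: "nat \<Rightarrow> nat \<Rightarrow> nat \<Rightarrow> real" where
    k: "\<And>z. cmod z = 1 \<Longrightarrow> op_bound q p (\<lambda>i j.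
        (\<Sum>m\<in>{1..<M}. of_real ((1 - real m / real M) * f m i j) * inverse z ^ m)
          - (\<Sum>m<M. of_real (k m i j) * z ^ m)) ((c + d) / 2)"
    using fejer_completion[OF f c(1) _ M, of "(c + d) / 2"] c by auto
  show ?thesis
  proof (rule that[of k M])
    fix z :: complex assume z: "cmod z = 1"
    have "op_bound q p (\<lambda>i j. (\<Sum>m. of_real (f m i j) * inverse z ^ m)
       - (\<Sum>m\<in>{1..<M}. of_real ((1 - real m / real M) * f m i j) * inverse z ^ m)) (real q * real p * e)"
      using z by (intro op_bound_entries less_imp_le Me) (auto simp: norm_inverse)
    from op_bound_add[OF this k[OF z]]
    have "op_bound q p (\<lambda>i j. (\<Sum>m. of_real (f m i j) * inverse z ^ m)
          - (\<Sum>m<M. of_real (k m i j) * z ^ m)) (real q * real p * e + (c + d) / 2)"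
      by (rule op_bound_cong) simp
    thus "op_bound q p (\<lambda>i j. (\<Sum>m. of_real (f m i j) * inverse z ^ m)
          - (\<Sum>m<M. of_real (k m i j) * z ^ m)) d"
      by (rule op_bound_mono) (use e2 in \<open>simp add: field_simps\<close>)
  qed
qed

subsection \<open>Complex matrices and all-pass reduction\<close>

definition cnorm :: "complex vec \<Rightarrow> real" where
  "cnorm v = L2_set (\<lambda>i. cmod (v $ i)) {..<dim_vec v}"

definition mat_bound :: "complex mat \<Rightarrow> real \<Rightarrow> bool" where
  "mat_bound M c \<longleftrightarrow> (\<forall>v\<in>carrier_vec (dim_col M). cnorm (M *\<^sub>v v) \<le> c * cnorm v)"

lemma cnorm_nonneg [simp]: "0 \<le> cnorm v"
  by (simp add: cnorm_def)

lemma mat_bound_iff_op_bound: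
  assumes "M \<in> carrier_mat q p"
  shows "mat_bound M c \<longleftrightarrow> op_bound q p (\<lambda>i j. M $$ (i, j)) c"
proof
  assume M: "mat_bound M c"
  show "op_bound q p (\<lambda>i j. M $$ (i, j)) c" unfolding op_bound_def
  proof
    fix v :: "nat \<Rightarrow> complex"
    have "cnorm (M *\<^sub>v vec p v) \<le> c * cnorm (vec p v)" using M assms by (auto simp: mat_bound_def)
    thus "L2_set (\<lambda>i. cmod (\<Sum>j<p. M $$ (i, j) * v j)) {..<q} \<le> c * L2_set (\<lambda>j. cmod (v j)) {..<p}"
      using assms by (auto simp: cnorm_def scalar_prod_def atLeast0LessThan cong: L2_set_cong_simp)
  qed
next
  assume M: "op_bound q p (\<lambda>i j. M $$ (i, j)) c"
  show "mat_bound M c" unfolding mat_bound_def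
  proof
    fix v :: "complex vec" assume "v \<in> carrier_vec (dim_col M)"
    thus "cnorm (M *\<^sub>v v) \<le> c * cnorm v"
      using op_boundD[OF M, of "\<lambda>j. v $ j"] assms
      by (auto simp: cnorm_def scalar_prod_def atLeast0LessThan cong: L2_set_cong_simp)
  qed
qed

section \<open>Adjoints and the Hermitian inner product\<close>

lemma mat_adjoint_carrier [simp]: "M \<in> carrier_mat q p \<Longrightarrow> mat_adjoint M \<in> carrier_mat p q"
  by (auto simp: mat_adjoint_def)

lemma mat_adjoint_dim [simp]: "dim_row (mat_adjoint M) = dim_col M" "dim_col (mat_adjoint M) = dim_row M"
  by (auto simp: mat_adjoint_def)

lemma mat_adjoint_index [simp]:
  fixes M :: "complex mat"
  shows "i < dim_col M \<Longrightarrow> j < dim_row M \<Longrightarrow> mat_adjoint M $$ (i, j) = cnj (M $$ (j, i))"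
  by (simp add: mat_adjoint_def mat_of_rows_def)

lemma mat_adjoint_adjoint [simp]: "mat_adjoint (mat_adjoint M) = (M :: complex mat)"
  by (rule eq_matI) auto

lemma mat_adjoint_mult:
  fixes M :: "complex mat"
  assumes "M \<in> carrier_mat q p" "K \<in> carrier_mat p r"
  shows "mat_adjoint (M * K) = mat_adjoint K * mat_adjoint M"
proof (rule eq_matI)
  fix i j assume "i < dim_row (mat_adjoint K * mat_adjoint M)" "j < dim_col (mat_adjoint K * mat_adjoint M)"
  thus "mat_adjoint (M * K) $$ (i, j) = (mat_adjoint K * mat_adjoint M) $$ (i, j)"
    using assms by (auto simp: scalar_prod_def mult.commute intro!: sum.cong)
qed (use assms in auto)

lemma mat_adjoint_one [simp]: "mat_adjoint (1\<^sub>m n) = (1\<^sub>m n :: complex mat)"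
  by (rule eq_matI) auto

lemma mat_adjoint_minus:
  fixes M :: "complex mat"
  assumes "M \<in> carrier_mat q p" "K \<in> carrier_mat q p"
  shows "mat_adjoint (M - K) = mat_adjoint M - mat_adjoint K"
  using assms by (intro eq_matI) auto

lemma cscalar_prod_cnorm: "v \<bullet>c v = of_real ((cnorm v)\<^sup>2)"
proof -
  have "(cnorm v)\<^sup>2 = (\<Sum>i<dim_vec v. (cmod (v $ i))\<^sup>2)"
    unfolding cnorm_def L2_set_def by (intro real_sqrt_pow2 sum_nonneg) auto
  thus ?thesis
    by (simp only: of_real_sum complex_norm_square scalar_prod_def) (simp add: atLeast0LessThan)
qed

lemma cscalar_prod_le:
  assumes "v \<in> carrier_vec n" "w \<in> carrier_vec n"
  shows "cmod (v \<bullet>c w) \<le> cnorm v * cnorm w"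
proof -
  have "cmod (v \<bullet>c w) \<le> (\<Sum>i<n. \<bar>cmod (v $ i)\<bar> * \<bar>cmod (w $ i)\<bar>)"
    using assms by (auto simp: scalar_prod_def atLeast0LessThan norm_mult intro!: order_trans[OF norm_sum])
  also have "\<dots> \<le> cnorm v * cnorm w"
    using assms L2_set_mult_ineq[of "\<lambda>i. cmod (v $ i)" "\<lambda>i. cmod (w $ i)" "{..<n}"]
    by (simp add: cnorm_def)
  finally show ?thesis .
qed

lemma cscalar_prod_adjoint:
  fixes M :: "complex mat" and v w :: "complex vec"
  assumes "M \<in> carrier_mat q p" "v \<in> carrier_vec p" "w \<in> carrier_vec q"
  shows "(M *\<^sub>v v) \<bullet>c w = v \<bullet>c (mat_adjoint M *\<^sub>v w)"
proof -
  have "(M *\<^sub>v v) \<bullet>c w = (\<Sum>i<q. \<Sum>j<p. M $$ (i, j) * v $ j * cnj (w $ i))"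
    using assms by (auto simp: scalar_prod_def atLeast0LessThan sum_distrib_right intro!: sum.cong)
  also have "\<dots> = (\<Sum>j<p. \<Sum>i<q. M $$ (i, j) * v $ j * cnj (w $ i))" by (rule sum.swap)
  also have "\<dots> = v \<bullet>c (mat_adjoint M *\<^sub>v w)"
    using assms by (auto simp: scalar_prod_def atLeast0LessThan sum_distrib_left mult_ac intro!: sum.cong)
  finally show ?thesis .
qed

lemma cnorm_mult_square:
  assumes "M \<in> carrier_mat q p" "v \<in> carrier_vec p"
  shows "of_real ((cnorm (M *\<^sub>v v))\<^sup>2) = v \<bullet>c ((mat_adjoint M * M) *\<^sub>v v)"
proof -
  have "of_real ((cnorm (M *\<^sub>v v))\<^sup>2) = (M *\<^sub>v v) \<bullet>c (M *\<^sub>v v)" by (simp only: cscalar_prod_cnorm)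
  also have "\<dots> = v \<bullet>c (mat_adjoint M *\<^sub>v (M *\<^sub>v v))"
    using assms by (intro cscalar_prod_adjoint) auto
  finally show ?thesis using assms by (simp add: assoc_mult_mat_vec[OF mat_adjoint_carrier])
qed

lemma cnorm_mult_smult_square:
  assumes M: "M \<in> carrier_mat q p" and v: "v \<in> carrier_vec p"
  shows "(cnorm (M *\<^sub>v v))\<^sup>2 \<le> cnorm v * cnorm ((mat_adjoint M * M) *\<^sub>v v)"
proof -
  have "(cnorm (M *\<^sub>v v))\<^sup>2 = cmod (of_real ((cnorm (M *\<^sub>v v))\<^sup>2))" by (simp only: norm_of_real) simp
  also have "\<dots> \<le> cnorm v * cnorm ((mat_adjoint M * M) *\<^sub>v v)"
    unfolding cnorm_mult_square[OF M v] using M v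
    by (intro cscalar_prod_le[of _ p]) (meson mat_adjoint_carrier mult_carrier_mat mult_mat_vec_carrier)+
  finally show ?thesis .
qed

text \<open>If u is the adjoint applied to w, then |u|^2 is the inner product of w with M u, hence
  at most c |w| |u|, and |u| cancels.\<close>

lemma mat_bound_adjoint:
  assumes "mat_bound M c" "0 \<le> c"
  shows "mat_bound (mat_adjoint M) c"
  unfolding mat_bound_def
proof
  fix w :: "complex vec" assume w: "w \<in> carrier_vec (dim_col (mat_adjoint M))"
  define u where "u = mat_adjoint M *\<^sub>v w"
  have adj: "mat_adjoint M \<in> carrier_mat (dim_col M) (dim_row M)" by (intro mat_adjoint_carrier carrier_matI refl)
  have w': "w \<in> carrier_vec (dim_row M)" using w by (simp only: mat_adjoint_dim)
  have u: "u \<in> carrier_vec (dim_col M)" unfolding u_def by (rule mult_mat_vec_carrier[OF adj w'])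
  have Mu: "M *\<^sub>v u \<in> carrier_vec (dim_row M)" by (intro mult_mat_vec_carrier[OF _ u] carrier_matI refl)
  have "(cnorm u)\<^sup>2 \<le> cnorm w * cnorm (M *\<^sub>v u)"
  proof -
    have "of_real ((cnorm u)\<^sup>2) = (mat_adjoint M *\<^sub>v w) \<bullet>c u" by (simp only: cscalar_prod_cnorm u_def)
    also have "\<dots> = w \<bullet>c (M *\<^sub>v u)"
      using cscalar_prod_adjoint[OF adj w' u] by (simp only: mat_adjoint_adjoint)
    finally have "(cnorm u)\<^sup>2 = cmod (w \<bullet>c (M *\<^sub>v u))"
      by (metis abs_of_nonneg norm_of_real zero_le_power2)
    also have "\<dots> \<le> cnorm w * cnorm (M *\<^sub>v u)"
      by (rule cscalar_prod_le[OF w' Mu])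
    finally show ?thesis .
  qed
  also have "\<dots> \<le> cnorm w * (c * cnorm u)"
    using assms(1) u by (intro mult_left_mono) (auto simp: mat_bound_def)
  finally have "cnorm u * cnorm u \<le> (c * cnorm w) * cnorm u" by (simp add: power2_eq_square mult_ac)
  thus "cnorm (mat_adjoint M *\<^sub>v w) \<le> c * cnorm w"
    unfolding u_def[symmetric] using assms(2)
    by (cases "cnorm u = 0") (auto simp: mult_le_cancel_right less_le)
qed

section \<open>Operator norm and singular values\<close>

lemma mat_pow_add:
  fixes A :: "'a::comm_semiring_1 mat"
  assumes "A \<in> carrier_mat n n"
  shows "A ^\<^sub>m (k + l) = A ^\<^sub>m k * A ^\<^sub>m l"
proof (induction l)
  case 0
  show ?case using assms by (simp add: right_mult_one_mat[of _ n n])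
next
  case (Suc l)
  show ?case using assms Suc by (simp add: assoc_mult_mat[of _ n n _ n _ n])
qed

lemma cnorm_zero_iff: "v \<in> carrier_vec n \<Longrightarrow> cnorm v = 0 \<longleftrightarrow> v = 0\<^sub>v n"
  by (auto simp: cnorm_def L2_set_eq_0_iff)

lemma cnorm_smult: "cnorm (a \<cdot>\<^sub>v v) = cmod a * cnorm v"
  by (simp add: cnorm_def norm_mult L2_set_right_distrib cong: L2_set_cong_simp)

text \<open>For a Hermitian \<open>H\<close> the numbers \<open>cnorm (H ^ 2 ^ k v)\<close> grow at least like the powers of
  \<open>cnorm (H v) / cnorm v\<close>, so a bound on the powers forces this quotient to be at most 1.\<close>

lemma hermitian_power_bounded:
  fixes H :: "complex mat"
  assumes H: "H \<in> carrier_mat p p" "mat_adjoint H = H"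
    and b: "\<And>k. norm_bound (H ^\<^sub>m k) b" and v: "v \<in> carrier_vec p"
  shows "cnorm (H *\<^sub>v v) \<le> cnorm v"
proof (rule ccontr)
  assume "\<not> cnorm (H *\<^sub>v v) \<le> cnorm v"
  hence gt: "cnorm v < cnorm (H *\<^sub>v v)" by simp
  have pos: "0 < cnorm v"
  proof (rule ccontr)
    assume "\<not> 0 < cnorm v"
    hence "cnorm v = 0" by (simp add: less_le)
    hence "v = 0\<^sub>v p" using cnorm_zero_iff[OF v] by simp
    moreover have "H *\<^sub>v 0\<^sub>v p = 0\<^sub>v p" using H(1) by (intro eq_vecI) auto
    ultimately show False using gt by simp
  qed
  have Hk: "H ^\<^sub>m k \<in> carrier_mat p p" for k using H by simp
  have adj: "mat_adjoint (H ^\<^sub>m k) = H ^\<^sub>m k" for k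
  proof (induction k)
    case 0 show ?case using H by simp
  next
    case (Suc k)
    have "mat_adjoint (H ^\<^sub>m Suc k) = H * H ^\<^sub>m k" using H Hk Suc by (simp add: mat_adjoint_mult[of _ p p _ p])
    also have "\<dots> = H ^\<^sub>m Suc k" using mat_pow_add[OF H(1), of 1 k] H by simp
    finally show ?case .
  qed
  define a where "a k = cnorm ((H ^\<^sub>m (2 ^ k)) *\<^sub>v v)" for k
  \<comment> \<open>The powers of \<open>H\<close> are Hermitian, so Cauchy-Schwarz bounds |H^m v|^2
    by |v| |H^(2m) v|; this is the doubling step of the growth.\<close>
  have step: "(a k)\<^sup>2 \<le> cnorm v * a (Suc k)" for k
    using cnorm_mult_smult_square[OF Hk v, of "2 ^ k"]
    unfolding adj mat_pow_add[OF H(1), symmetric] a_def by (simp add: mult_2)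
  define t where "t = cnorm (H *\<^sub>v v) / cnorm v"
  have t1: "1 < t" using gt pos by (simp add: t_def)
  have grow: "cnorm v * t ^ (2 ^ k) \<le> a k" for k
  proof (induction k)
    case 0
    show ?case using pos H by (simp add: a_def t_def)
  next
    case (Suc k)
    have "(cnorm v * t ^ (2 ^ k))\<^sup>2 \<le> (a k)\<^sup>2" using Suc pos t1 by (intro power_mono) auto
    also have "\<dots> \<le> cnorm v * a (Suc k)" by (rule step)
    finally have "cnorm v * (cnorm v * t ^ (2 ^ Suc k)) \<le> cnorm v * a (Suc k)"
      by (simp only: power2_eq_square power_Suc mult_2 power_add mult_ac)
    thus ?case using mult_le_cancel_left_pos[OF pos] by blast
  qed
  have ak: "a k \<le> real p * real p * b * cnorm v" for k
  proof -
    have "op_bound p p (\<lambda>i j. (H ^\<^sub>m (2 ^ k)) $$ (i, j)) (real p * real p * b)"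
      using b[of "2 ^ k"] H(1) by (intro op_bound_entries) (auto simp: norm_bound_def)
    hence "mat_bound (H ^\<^sub>m (2 ^ k)) (real p * real p * b)"
      using mat_bound_iff_op_bound[OF Hk] by blast
    thus ?thesis using v Hk[of "2 ^ k"] unfolding a_def mat_bound_def
      by (metis carrier_matD(2))
  qed
  hence bnd: "t ^ (2 ^ k) \<le> real p * real p * b" for k
  proof -
    have "cnorm v * t ^ (2 ^ k) \<le> cnorm v * (real p * real p * b)"
      using order_trans[OF grow ak] by (simp only: mult.commute)
    thus ?thesis using mult_le_cancel_left_pos[OF pos] by blast
  qed
  obtain m where m: "real p * real p * b < t ^ m" using real_arch_pow[OF t1] by blast
  have "t ^ m \<le> t ^ (2 ^ m)" using t1 by (intro power_increasing) (auto intro: less_imp_le)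
  with m bnd[of m] show False by simp
qed

text \<open>Pairing an eigenvector v with its image gives |M v|^2 = k |v|^2 up to conjugation of k,
  which shows at the same time that the eigenvalue is real.\<close>

lemma singular_value_eigen:
  fixes M :: "complex mat"
  assumes M: "M \<in> carrier_mat q p" and k: "k \<in> spectrum (mat_adjoint M * M)"
  obtains v where "v \<in> carrier_vec p" "0 < cnorm v" "(cnorm (M *\<^sub>v v))\<^sup>2 = Re k * (cnorm v)\<^sup>2" "k = of_real (Re k)"
proof -
  obtain v where v: "v \<in> carrier_vec p" "v \<noteq> 0\<^sub>v p" "(mat_adjoint M * M) *\<^sub>v v = k \<cdot>\<^sub>v v"
    using k M by (auto simp: spectrum_def eigenvalue_def eigenvector_def)
  have pos: "0 < cnorm v" using cnorm_zero_iff[OF v(1)] v(2) by (simp add: less_le)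
  have "of_real ((cnorm (M *\<^sub>v v))\<^sup>2) = cnj k * of_real ((cnorm v)\<^sup>2)"
    unfolding cnorm_mult_square[OF M v(1)] v(3)
    by (simp add: conjugate_smult_vec cscalar_prod_cnorm)
  hence "complex_of_real ((cnorm (M *\<^sub>v v))\<^sup>2 / (cnorm v)\<^sup>2) = cnj k"
    using pos by (simp add: field_simps)
  hence e: "k = of_real ((cnorm (M *\<^sub>v v))\<^sup>2 / (cnorm v)\<^sup>2)"
    by (metis complex_cnj_cnj complex_cnj_complex_of_real)
  hence "Re k = (cnorm (M *\<^sub>v v))\<^sup>2 / (cnorm v)\<^sup>2" by simp
  thus ?thesis using that[OF v(1) pos] e pos by simp
qed

text \<open>The largest singular value is the operator norm. No orthonormal eigenbasis is used: for
  every m above its square, the product of the adjoint and \<open>M\<close>, divided by m, is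
  Hermitian of spectral radius below 1. Its powers are bounded, so it does not increase norms; then
  m decreases to the square. A positive number of columns ensures that the maximum is over a
  nonempty set.\<close>

lemma sv_norm_mat_bound:
  assumes M: "M \<in> carrier_mat q p" and p: "0 < p"
  shows "0 \<le> sv_norm M" "mat_bound M (sv_norm M)" "mat_bound M c \<Longrightarrow> 0 \<le> c \<Longrightarrow> sv_norm M \<le> c"
proof -
  let ?H = "mat_adjoint M * M"
  have H: "?H \<in> carrier_mat p p" using M by (meson mat_adjoint_carrier mult_carrier_mat)
  have eq: "singular_values M = (\<lambda>k. sqrt (Re k)) ` spectrum ?H" by (auto simp: singular_values_def)
  have fin: "finite (singular_values M)" unfolding eq using card_finite_spectrum[OF H] by simp
  have ne: "singular_values M \<noteq> {}" unfolding eq using spectrum_non_empty[OF H p] by simp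
  have Re0: "0 \<le> Re k" if k: "k \<in> spectrum ?H" for k
  proof -
    obtain v where "0 < cnorm v" "(cnorm (M *\<^sub>v v))\<^sup>2 = Re k * (cnorm v)\<^sup>2"
      using singular_value_eigen[OF M k] by metis
    thus ?thesis by (metis zero_le_power2 zero_le_mult_iff zero_less_power not_less)
  qed
  show nn: "0 \<le> sv_norm M"
  proof -
    have "sv_norm M \<in> singular_values M" unfolding sv_norm_def by (rule Max_in[OF fin ne])
    thus ?thesis unfolding eq using Re0 by auto
  qed
  show "sv_norm M \<le> c" if c: "mat_bound M c" "0 \<le> c"
    unfolding sv_norm_def
  proof (rule Max.boundedI[OF fin ne])
    fix s assume "s \<in> singular_values M"
    then obtain k where k: "k \<in> spectrum ?H" "s = sqrt (Re k)" unfolding eq by auto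
    obtain v where v: "v \<in> carrier_vec p" "0 < cnorm v" "(cnorm (M *\<^sub>v v))\<^sup>2 = Re k * (cnorm v)\<^sup>2"
      using singular_value_eigen[OF M k(1)] by metis
    have "cnorm (M *\<^sub>v v) \<le> c * cnorm v" using c v M by (auto simp: mat_bound_def)
    hence "(cnorm (M *\<^sub>v v))\<^sup>2 \<le> (c * cnorm v)\<^sup>2" by (intro power_mono) auto
    hence "Re k * (cnorm v)\<^sup>2 \<le> c\<^sup>2 * (cnorm v)\<^sup>2" by (simp add: v(3) power_mult_distrib)
    hence "Re k \<le> c\<^sup>2" using v(2) by simp
    thus "s \<le> c" unfolding k(2) using c(2) by (metis real_sqrt_le_mono real_sqrt_abs abs_of_nonneg)
  qed
  show "mat_bound M (sv_norm M)"
    unfolding mat_bound_def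
  proof
    fix v :: "complex vec" assume "v \<in> carrier_vec (dim_col M)"
    hence v: "v \<in> carrier_vec p" using M by simp
    have spec: "cmod k \<le> (sv_norm M)\<^sup>2" if k: "k \<in> spectrum ?H" for k
    proof -
      have "sqrt (Re k) \<le> sv_norm M" unfolding sv_norm_def using fin k by (intro Max_ge) (auto simp: eq)
      hence "(sqrt (Re k))\<^sup>2 \<le> (sv_norm M)\<^sup>2" using Re0[OF k] by (intro power_mono) auto
      moreover have "cmod k = Re k"
        using singular_value_eigen[OF M k] Re0[OF k] by (metis abs_of_nonneg norm_of_real)
      ultimately show ?thesis using Re0[OF k] by simp
    qed
    have Hv: "cnorm (?H *\<^sub>v v) \<le> m * cnorm v" if m: "(sv_norm M)\<^sup>2 < m" for m
    proof -
      have m0: "0 < m" using m by (smt (verit) zero_le_power2)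
      define K where "K = of_real (1 / m) \<cdot>\<^sub>m ?H"
      have K: "K \<in> carrier_mat p p" using H by (simp add: K_def)
      have adjH: "mat_adjoint ?H = ?H" using M by (subst mat_adjoint_mult[of _ p q _ p]) auto
      have adjK: "mat_adjoint K = K"
      proof (rule eq_matI)
        fix i j assume "i < dim_row K" "j < dim_col K"
        hence ij: "i < p" "j < p" using K by auto
        hence "cnj (?H $$ (j, i)) = ?H $$ (i, j)"
          using adjH H by (metis mat_adjoint_index carrier_matD)
        moreover have "K $$ (a, b) = of_real (1 / m) * ?H $$ (a, b)" if "a < p" "b < p" for a b
          unfolding K_def using H that by (intro index_smult_mat) auto
        moreover have "mat_adjoint K $$ (i, j) = cnj (K $$ (j, i))"
          using K ij by (intro mat_adjoint_index) auto
        ultimately show "mat_adjoint K $$ (i, j) = K $$ (i, j)"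
          by (simp only: ij complex_cnj_mult complex_cnj_complex_of_real)
      qed (use K in auto)
      have sr: "spectral_radius K < 1"
      proof -
        obtain k where k: "k \<in> spectrum K" "spectral_radius K = cmod k"
          using spectral_radius_mem_max(1)[OF K p] by auto
        then obtain u where u: "u \<in> carrier_vec p" "u \<noteq> 0\<^sub>v p" "K *\<^sub>v u = k \<cdot>\<^sub>v u"
          using K by (auto simp: spectrum_def eigenvalue_def eigenvector_def)
        have "?H *\<^sub>v u = of_real m \<cdot>\<^sub>v (K *\<^sub>v u)"
          using u(1) H m0 by (intro eq_vecI) (auto simp: K_def)
        hence "?H *\<^sub>v u = (of_real m * k) \<cdot>\<^sub>v u" unfolding u(3) by (simp add: smult_smult_assoc)
        hence "of_real m * k \<in> spectrum ?H"
          using u(1,2) H M by (auto simp: spectrum_def eigenvalue_def eigenvector_def)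
        from spec[OF this] have "m * cmod k \<le> (sv_norm M)\<^sup>2" using m0 by (simp add: norm_mult)
        hence "m * cmod k < m * 1" using m by linarith
        thus ?thesis using mult_less_cancel_left_pos[OF m0] by (simp only: k(2))
      qed
      obtain b where b: "\<And>k. norm_bound (K ^\<^sub>m k) b"
        using spectral_radius_jnf_norm_bound_less_1_upper_triangular[OF K sr] by blast
      have "cnorm (K *\<^sub>v v) \<le> cnorm v" by (rule hermitian_power_bounded[OF K adjK b v])
      moreover have "?H *\<^sub>v v = of_real m \<cdot>\<^sub>v (K *\<^sub>v v)"
        using v H m0 by (intro eq_vecI) (auto simp: K_def)
      ultimately show ?thesis using m0 by (simp add: cnorm_smult)
    qed
    have "cnorm (?H *\<^sub>v v) \<le> (sv_norm M)\<^sup>2 * cnorm v"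
    proof (rule tendsto_lowerbound)
      show "((\<lambda>m. m * cnorm v) \<longlongrightarrow> (sv_norm M)\<^sup>2 * cnorm v) (at_right ((sv_norm M)\<^sup>2))"
        by (intro tendsto_intros)
      show "\<forall>\<^sub>F m in at_right ((sv_norm M)\<^sup>2). cnorm (?H *\<^sub>v v) \<le> m * cnorm v"
        by (rule eventually_at_rightI[of _ "(sv_norm M)\<^sup>2 + 1"]) (auto intro: Hv)
    qed simp
    hence "cnorm v * cnorm (?H *\<^sub>v v) \<le> cnorm v * ((sv_norm M)\<^sup>2 * cnorm v)"
      by (intro mult_left_mono) auto
    with cnorm_mult_smult_square[OF M v]
    have "(cnorm (M *\<^sub>v v))\<^sup>2 \<le> (sv_norm M * cnorm v)\<^sup>2" by (simp add: power2_eq_square mult_ac)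
    thus "cnorm (M *\<^sub>v v) \<le> sv_norm M * cnorm v" by (rule power2_le_imp_le) (simp add: nn)
  qed
qed

text \<open>Both reductions of the model error have this form: the first with \<open>U = U\<^sub>i\<close>, the second, after
  passing to adjoints, with \<open>U\<^sup>* = V\<^sub>c\<^sub>i\<close>. The bounds come from $|Mv|^2 = |U^*Mv|^2 + |Yv|^2$ and
  $|Y_o v|^2 = g^2 |v|^2 - |Yv|^2$.\<close>

lemma allpass_reduction:
  fixes U M Y Yo E :: "complex mat"
  assumes U: "U \<in> carrier_mat p q" "mat_adjoint U * U = 1\<^sub>m q"
    and M: "M \<in> carrier_mat p m"
    and Y: "Y = (1\<^sub>m p - U * mat_adjoint U) * M"
    and Yo: "Yo \<in> carrier_mat m m" "mat_adjoint Yo * Yo = of_real (g\<^sup>2) \<cdot>\<^sub>m 1\<^sub>m m - mat_adjoint Y * Y"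
    and Yi: "Yi \<in> carrier_mat m m" "Yo * Yi = 1\<^sub>m m"
    and E: "E \<in> carrier_mat q m" "E * Yo = mat_adjoint U * M"
    and g: "0 < g"
  shows "mat_bound M c \<Longrightarrow> 0 \<le> c \<Longrightarrow> c < g \<Longrightarrow> mat_bound E (c / g)"
    "mat_bound E d \<Longrightarrow> 0 \<le> d \<Longrightarrow> d < 1 \<Longrightarrow> mat_bound Y y \<Longrightarrow> 0 \<le> y \<Longrightarrow> y < g \<Longrightarrow>
       mat_bound M (sqrt (d\<^sup>2 * g\<^sup>2 + (1 - d\<^sup>2) * y\<^sup>2))"
proof -
  let ?U = "mat_adjoint U"
  have Uc: "?U \<in> carrier_mat q p" using U by simp
  have Yc: "Y \<in> carrier_mat p m" unfolding Y using U M by (auto intro!: mult_carrier_mat)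
  have q1: "(cnorm (Yo *\<^sub>v v))\<^sup>2 = g\<^sup>2 * (cnorm v)\<^sup>2 - (cnorm (Y *\<^sub>v v))\<^sup>2" if v: "v \<in> carrier_vec m" for v
  proof -
    have YYc: "mat_adjoint Y * Y \<in> carrier_mat m m" using Yc by (meson mat_adjoint_carrier mult_carrier_mat)
    have "(of_real (g\<^sup>2) \<cdot>\<^sub>m 1\<^sub>m m - mat_adjoint Y * Y) *\<^sub>v v = of_real (g\<^sup>2) \<cdot>\<^sub>v v - (mat_adjoint Y * Y) *\<^sub>v v"
    proof -
      have "(of_real (g\<^sup>2) \<cdot>\<^sub>m 1\<^sub>m m) *\<^sub>v v = of_real (g\<^sup>2) \<cdot>\<^sub>v v" using v by (intro eq_vecI) auto
      thus ?thesis using v YYc by (subst minus_mult_distrib_mat_vec[of _ m m]) auto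
    qed
    hence "complex_of_real ((cnorm (Yo *\<^sub>v v))\<^sup>2) = v \<bullet>c (of_real (g\<^sup>2) \<cdot>\<^sub>v v - (mat_adjoint Y * Y) *\<^sub>v v)"
      unfolding cnorm_mult_square[OF Yo(1) v] Yo(2) by simp
    also have "\<dots> = of_real (g\<^sup>2) * (v \<bullet>c v) - v \<bullet>c ((mat_adjoint Y * Y) *\<^sub>v v)"
    proof -
      have "conjugate (of_real (g\<^sup>2) \<cdot>\<^sub>v v - (mat_adjoint Y * Y) *\<^sub>v v)
          = of_real (g\<^sup>2) \<cdot>\<^sub>v conjugate v - conjugate ((mat_adjoint Y * Y) *\<^sub>v v)"
        using v YYc by (intro eq_vecI) auto
      thus ?thesis using v YYc by (simp add: scalar_prod_minus_distrib[of _ m])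
    qed
    also have "\<dots> = of_real (g\<^sup>2 * (cnorm v)\<^sup>2 - (cnorm (Y *\<^sub>v v))\<^sup>2)"
      unfolding cnorm_mult_square[OF Yc v, symmetric] cscalar_prod_cnorm by simp
    finally show ?thesis by (simp only: of_real_eq_iff)
  qed
  have q2: "(cnorm (M *\<^sub>v v))\<^sup>2 = (cnorm (E *\<^sub>v (Yo *\<^sub>v v)))\<^sup>2 + (cnorm (Y *\<^sub>v v))\<^sup>2" if v: "v \<in> carrier_vec m" for v
  proof -
    define x where "x = M *\<^sub>v v"
    define s where "s = ?U *\<^sub>v x"
    have x: "x \<in> carrier_vec p" and s: "s \<in> carrier_vec q" and Us: "U *\<^sub>v s \<in> carrier_vec p"
      unfolding x_def s_def using M U(1) Uc v by (meson mult_mat_vec_carrier)+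
    have Es: "E *\<^sub>v (Yo *\<^sub>v v) = s"
    proof -
      have "E *\<^sub>v (Yo *\<^sub>v v) = (E * Yo) *\<^sub>v v" using E(1) Yo(1) v by (simp add: assoc_mult_mat_vec)
      thus ?thesis unfolding E(2) s_def x_def using Uc M v by (simp add: assoc_mult_mat_vec)
    qed
    have Yx: "Y *\<^sub>v v = x - U *\<^sub>v s"
    proof -
      have "Y *\<^sub>v v = (1\<^sub>m p - U * ?U) *\<^sub>v x"
        unfolding Y x_def using U M v by (intro assoc_mult_mat_vec[of _ p p _ m]) auto
      also have "\<dots> = x - (U * ?U) *\<^sub>v x"
        using U x by (subst minus_mult_distrib_mat_vec[of _ p p]) auto
      also have "(U * ?U) *\<^sub>v x = U *\<^sub>v s" unfolding s_def using U Uc x by (intro assoc_mult_mat_vec) auto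
      finally show ?thesis .
    qed
    have UUs: "?U *\<^sub>v (U *\<^sub>v s) = s"
      using U Uc s by (subst assoc_mult_mat_vec[symmetric, of _ q p _ q]) auto
    have ss: "(U *\<^sub>v s) \<bullet>c (U *\<^sub>v s) = s \<bullet>c s"
      using cscalar_prod_adjoint[OF U(1) s Us] by (simp add: UUs)
    have xs: "(U *\<^sub>v s) \<bullet>c x = s \<bullet>c s"
      using cscalar_prod_adjoint[OF U(1) s x] by (simp add: s_def)
    have sx: "x \<bullet>c (U *\<^sub>v s) = s \<bullet>c s"
      using cscalar_prod_adjoint[OF Uc x s] by (simp add: s_def)
    have "(x - U *\<^sub>v s) \<bullet>c (x - U *\<^sub>v s) = x \<bullet>c x - s \<bullet>c s"
    proof -
      have "conjugate (x - U *\<^sub>v s) = conjugate x - conjugate (U *\<^sub>v s)"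
        using x Us U(1) by (intro eq_vecI) auto
      hence "(x - U *\<^sub>v s) \<bullet>c (x - U *\<^sub>v s) = (x - U *\<^sub>v s) \<bullet>c x - (x - U *\<^sub>v s) \<bullet>c (U *\<^sub>v s)"
        using x Us by (simp add: scalar_prod_minus_distrib[of _ p])
      also have "\<dots> = (x \<bullet>c x - (U *\<^sub>v s) \<bullet>c x) - (x \<bullet>c (U *\<^sub>v s) - (U *\<^sub>v s) \<bullet>c (U *\<^sub>v s))"
        using x Us by (simp add: minus_scalar_prod_distrib[of _ p])
      finally show ?thesis by (simp add: ss xs sx)
    qed
    hence "complex_of_real ((cnorm (Y *\<^sub>v v))\<^sup>2) = of_real ((cnorm x)\<^sup>2 - (cnorm s)\<^sup>2)"
      unfolding Yx cscalar_prod_cnorm by simp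
    hence "(cnorm (Y *\<^sub>v v))\<^sup>2 = (cnorm x)\<^sup>2 - (cnorm s)\<^sup>2" by (simp only: of_real_eq_iff)
    thus ?thesis unfolding Es x_def by simp
  qed
  show "mat_bound E (c / g)" if c: "mat_bound M c" "0 \<le> c" "c < g"
    unfolding mat_bound_def
  proof
    fix w :: "complex vec" assume "w \<in> carrier_vec (dim_col E)"
    hence w: "w \<in> carrier_vec m" using E by simp
    define v where "v = Yi *\<^sub>v w"
    have v: "v \<in> carrier_vec m" using Yi w by (simp add: v_def)
    have vw: "Yo *\<^sub>v v = w"
      unfolding v_def using Yo(1) Yi w by (subst assoc_mult_mat_vec[symmetric, of _ m m _ m]) auto
    have "cnorm (M *\<^sub>v v) \<le> c * cnorm v" using c v M by (auto simp: mat_bound_def)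
    hence "(cnorm (M *\<^sub>v v))\<^sup>2 \<le> (c * cnorm v)\<^sup>2" by (intro power_mono) auto
    \<comment> \<open>Multiplied by g^2 and with w = Yo v, this says that g^2 |E w|^2 is at most c^2
      |w|^2 - (g^2 - c^2) |Y v|^2, where the last term has the favourable sign because c <
      g.\<close>
    hence b: "(cnorm (E *\<^sub>v w))\<^sup>2 + (cnorm (Y *\<^sub>v v))\<^sup>2 \<le> c\<^sup>2 * (cnorm v)\<^sup>2"
      using q2[OF v] by (simp add: vw power_mult_distrib)
    have w2: "(cnorm w)\<^sup>2 = g\<^sup>2 * (cnorm v)\<^sup>2 - (cnorm (Y *\<^sub>v v))\<^sup>2" using q1[OF v] by (simp add: vw)
    have "(g\<^sup>2 - c\<^sup>2) * (cnorm (Y *\<^sub>v v))\<^sup>2 \<ge> 0"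
      using c by (intro mult_nonneg_nonneg) (auto intro: power_mono less_imp_le)
    hence "g\<^sup>2 * (cnorm (E *\<^sub>v w))\<^sup>2 \<le> c\<^sup>2 * (cnorm w)\<^sup>2"
      using mult_left_mono[OF b zero_le_power2[of g]] unfolding w2 by (simp add: algebra_simps)
    hence "(g * cnorm (E *\<^sub>v w))\<^sup>2 \<le> (c * cnorm w)\<^sup>2" by (simp add: power_mult_distrib)
    hence "g * cnorm (E *\<^sub>v w) \<le> c * cnorm w" by (rule power2_le_imp_le) (use c in auto)
    thus "cnorm (E *\<^sub>v w) \<le> c / g * cnorm w" using g by (simp add: field_simps)
  qed
  show "mat_bound M (sqrt (d\<^sup>2 * g\<^sup>2 + (1 - d\<^sup>2) * y\<^sup>2))"
    if d: "mat_bound E d" "0 \<le> d" "d < 1" and y: "mat_bound Y y" "0 \<le> y" "y < g"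
    unfolding mat_bound_def
  proof
    fix v :: "complex vec" assume "v \<in> carrier_vec (dim_col M)"
    hence v: "v \<in> carrier_vec m" using M by simp
    \<comment> \<open>Inserting the bound on \<open>E\<close> leaves d^2 g^2 |v|^2 + (1 - d^2) |Y
      v|^2; the second weight has to be nonnegative before the bound on \<open>Y\<close> can be
      inserted.\<close>
    have d2: "d\<^sup>2 \<le> 1" using d by (simp add: power_le_one)
    have "cnorm (E *\<^sub>v (Yo *\<^sub>v v)) \<le> d * cnorm (Yo *\<^sub>v v)"
      using d v E Yo by (auto simp: mat_bound_def)
    hence "(cnorm (E *\<^sub>v (Yo *\<^sub>v v)))\<^sup>2 \<le> (d * cnorm (Yo *\<^sub>v v))\<^sup>2" by (intro power_mono) auto
    hence e: "(cnorm (E *\<^sub>v (Yo *\<^sub>v v)))\<^sup>2 \<le> d\<^sup>2 * (g\<^sup>2 * (cnorm v)\<^sup>2 - (cnorm (Y *\<^sub>v v))\<^sup>2)"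
      by (simp add: power_mult_distrib q1[OF v])
    have "cnorm (Y *\<^sub>v v) \<le> y * cnorm v" using y v Yc by (auto simp: mat_bound_def)
    hence "(cnorm (Y *\<^sub>v v))\<^sup>2 \<le> (y * cnorm v)\<^sup>2" by (intro power_mono) auto
    hence "(1 - d\<^sup>2) * (cnorm (Y *\<^sub>v v))\<^sup>2 \<le> (1 - d\<^sup>2) * (y * cnorm v)\<^sup>2"
      using d2 by (intro mult_left_mono) auto
    hence "(cnorm (M *\<^sub>v v))\<^sup>2 \<le> (d\<^sup>2 * g\<^sup>2 + (1 - d\<^sup>2) * y\<^sup>2) * (cnorm v)\<^sup>2"
      unfolding q2[OF v] using e by (simp add: algebra_simps power_mult_distrib)
    also have "\<dots> = (sqrt (d\<^sup>2 * g\<^sup>2 + (1 - d\<^sup>2) * y\<^sup>2) * cnorm v)\<^sup>2"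
      using d2 by (simp add: power_mult_distrib)
    finally show "cnorm (M *\<^sub>v v) \<le> sqrt (d\<^sup>2 * g\<^sup>2 + (1 - d\<^sup>2) * y\<^sup>2) * cnorm v"
      by (rule power2_le_imp_le) (use d2 in simp)
  qed
qed

subsection \<open>Rational functions\<close>

interpretation cpoly: map_poly_inj_idom_hom complex_of_real ..

abbreviation cpoly :: "real poly \<Rightarrow> complex poly" where
  "cpoly \<equiv> map_poly complex_of_real"

lemma rf_num_den: "f = to_fract (rf_num f) / to_fract (rf_den f)"
  by (metis Fract_conv_to_fract Fract_quot_of_fract rf_num_def rf_den_def)

lemma rf_den_nonzero [simp]: "rf_den f \<noteq> 0"
  by (simp add: rf_den_def)

lemma rf_cross_mult:
  assumes "f = to_fract a / to_fract b" "b \<noteq> 0"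
  shows "rf_num f * b = a * rf_den f"
proof -
  have "to_fract (rf_num f) / to_fract (rf_den f) = to_fract a / to_fract b"
    using assms(1) rf_num_den[of f] by simp
  hence "to_fract (rf_num f) * to_fract b = to_fract a * to_fract (rf_den f)"
    using assms(2) by (simp add: frac_eq_eq)
  thus ?thesis by (simp only: to_fract_mult[symmetric] to_fract_eq_iff)
qed

lemma rf_den_dvd:
  assumes "f = to_fract a / to_fract b" "b \<noteq> 0"
  shows "rf_den f dvd b"
proof -
  have "rf_den f dvd rf_num f * b" using rf_cross_mult[OF assms] by simp
  moreover have "coprime (rf_den f) (rf_num f)"
    using coprime_quot_of_fract[of f] by (simp add: rf_num_def rf_den_def coprime_commute)
  ultimately show ?thesis by (simp add: coprime_dvd_mult_right_iff)
qed

text \<open>\<open>rf_eval\<close> has a default value at poles and is not additive there. This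
  relation also asserts that there is no pole, which makes it compatible with the ring
  operations.\<close>

definition rf_value :: "ratfun \<Rightarrow> complex \<Rightarrow> complex \<Rightarrow> bool" where
  "rf_value f z w \<longleftrightarrow> \<not> rf_pole f z \<and> rf_eval f z = w"

text \<open>The quotient need not be reduced: the reduced denominator divides \<open>b\<close>, so
  it does not vanish at \<open>z\<close> either.\<close>

lemma rf_valueI:
  assumes f: "f = to_fract a / to_fract b" and b: "poly (cpoly b) z \<noteq> 0"
  shows "rf_value f z (poly (cpoly a) z / poly (cpoly b) z)"
proof -
  have b0: "b \<noteq> 0" using b by auto
  obtain k where k: "b = rf_den f * k" using rf_den_dvd[OF f b0] by (auto simp: dvd_def)
  have d: "poly (cpoly (rf_den f)) z \<noteq> 0" using b unfolding k by (auto simp: cpoly.hom_mult)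
  have "poly (cpoly (rf_num f * b)) z = poly (cpoly (a * rf_den f)) z"
    by (simp only: rf_cross_mult[OF f b0])
  hence "rf_eval f z = poly (cpoly a) z / poly (cpoly b) z"
    using b d by (simp add: rf_eval_def cpoly.hom_mult frac_eq_eq)
  thus ?thesis using d by (simp add: rf_value_def rf_pole_def)
qed

lemma rf_valueE:
  assumes "rf_value f z w"
  obtains a b where "f = to_fract a / to_fract b" "poly (cpoly b) z \<noteq> 0" "w = poly (cpoly a) z / poly (cpoly b) z"
  using that[OF rf_num_den[of f]] assms by (auto simp: rf_value_def rf_pole_def rf_eval_def)

lemma rf_value_add:
  assumes "rf_value f z v" "rf_value g z w"
  shows "rf_value (f + g) z (v + w)"
proof -
  obtain a b where f: "f = to_fract a / to_fract b" "poly (cpoly b) z \<noteq> 0" "v = poly (cpoly a) z / poly (cpoly b) z"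
    using assms(1) by (rule rf_valueE)
  obtain c d where g: "g = to_fract c / to_fract d" "poly (cpoly d) z \<noteq> 0" "w = poly (cpoly c) z / poly (cpoly d) z"
    using assms(2) by (rule rf_valueE)
  have "b \<noteq> 0" "d \<noteq> 0" using f(2) g(2) by auto
  hence "f + g = to_fract (a * d + c * b) / to_fract (b * d)"
    unfolding f(1) g(1) by (simp add: add_frac_eq)
  from rf_valueI[OF this, of z] show ?thesis
    using f(2,3) g(2,3) by (simp add: cpoly.hom_mult cpoly.hom_add add_frac_eq)
qed

lemma rf_value_mult:
  assumes "rf_value f z v" "rf_value g z w"
  shows "rf_value (f * g) z (v * w)"
proof -
  obtain a b where f: "f = to_fract a / to_fract b" "poly (cpoly b) z \<noteq> 0" "v = poly (cpoly a) z / poly (cpoly b) z"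
    using assms(1) by (rule rf_valueE)
  obtain c d where g: "g = to_fract c / to_fract d" "poly (cpoly d) z \<noteq> 0" "w = poly (cpoly c) z / poly (cpoly d) z"
    using assms(2) by (rule rf_valueE)
  have "f * g = to_fract (a * c) / to_fract (b * d)"
    unfolding f(1) g(1) by simp
  from rf_valueI[OF this, of z] show ?thesis
    using f(2,3) g(2,3) by (simp add: cpoly.hom_mult)
qed

lemma rf_value_const [simp]: "rf_value (rf_const c) z (of_real c)"
proof -
  have "poly (cpoly (monom c 0)) z = of_real c"
    by (simp only: map_poly_monom[of complex_of_real, OF of_real_0] poly_monom) simp
  thus ?thesis using rf_valueI[of "rf_const c" "[:c:]" 1 z] by (simp add: rf_const_def monom_0)
qed

lemma rf_const_0 [simp]: "rf_const 0 = 0" and rf_const_1 [simp]: "rf_const 1 = 1"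
  by (simp_all add: rf_const_def flip: one_pCons)

lemma rf_const_eq_0_iff [simp]: "rf_const c = 0 \<longleftrightarrow> c = 0"
  by (simp add: rf_const_def)

lemma rf_z_nonzero [simp]: "rf_z \<noteq> 0"
  by (simp add: rf_z_def)

lemma rf_value_0 [simp]: "rf_value 0 z 0" and rf_value_1 [simp]: "rf_value 1 z 1"
  using rf_value_const[of 0 z] rf_value_const[of 1 z] by simp_all

lemma rf_value_z [simp]: "rf_value rf_z z z"
  using rf_valueI[of "rf_z" "[:0, 1:]" 1 z] by (simp add: rf_z_def)

lemma rf_value_inverse_z: "z \<noteq> 0 \<Longrightarrow> rf_value (inverse rf_z) z (inverse z)"
  using rf_valueI[of "inverse rf_z" 1 "[:0, 1:]" z] by (simp add: rf_z_def field_simps)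

lemma rf_value_minus: "rf_value f z v \<Longrightarrow> rf_value (- f) z (- v)"
  using rf_value_mult[OF rf_value_const[of "-1" z], of f v]
  by (simp add: rf_const_def) (metis mult_minus1 one_pCons to_fract_1 to_fract_uminus minus_pCons minus_zero rf_const_def)

lemma rf_value_diff: "rf_value f z v \<Longrightarrow> rf_value g z w \<Longrightarrow> rf_value (f - g) z (v - w)"
  using rf_value_add[OF _ rf_value_minus, of f z v g w] by simp

lemma rf_value_sum:
  "(\<And>i. i \<in> I \<Longrightarrow> rf_value (f i) z (v i)) \<Longrightarrow> rf_value (\<Sum>i\<in>I. f i) z (\<Sum>i\<in>I. v i)"
  by (induction I rule: infinite_finite_induct) (auto intro: rf_value_add)

lemma rf_value_power: "rf_value f z v \<Longrightarrow> rf_value (f ^ n) z (v ^ n)"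
  by (induction n) (auto intro: rf_value_mult)

text \<open>This is z^n p(1/z) for a chosen n, which should be at least the degree. Numerator and
  denominator are reversed with the same n, so that the powers of z cancel in the quotient.\<close>

definition poly_rev :: "nat \<Rightarrow> 'a::comm_monoid_add poly \<Rightarrow> 'a poly" where
  "poly_rev n p = (\<Sum>i\<le>n. monom (coeff p i) (n - i))"

lemma coeff_poly_rev: "coeff (poly_rev n p) i = (if i \<le> n then coeff p (n - i) else 0)"
proof (cases "i \<le> n")
  case True
  have "coeff (poly_rev n p) i = (\<Sum>j\<le>n. if j = n - i then coeff p j else 0)"
    unfolding poly_rev_def coeff_sum coeff_monom using True by (intro sum.cong) auto
  thus ?thesis using True by simp
qed (auto simp: poly_rev_def coeff_sum intro!: sum.neutral)

lemma poly_le_sum: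
  fixes p :: "'a::comm_semiring_1 poly"
  assumes "degree p \<le> n"
  shows "poly p x = (\<Sum>i\<le>n. coeff p i * x ^ i)"
  unfolding poly_altdef using assms by (intro sum.mono_neutral_left) (auto simp: coeff_eq_0)

lemma poly_cpoly_rev:
  assumes "degree p \<le> n" "z \<noteq> 0"
  shows "poly (cpoly (poly_rev n p)) z = z ^ n * poly (cpoly p) (inverse z)"
proof -
  have "poly (cpoly (poly_rev n p)) z = (\<Sum>i\<le>n. of_real (coeff p i) * z ^ (n - i))"
    by (simp add: poly_rev_def cpoly.hom_sum poly_sum poly_monom map_poly_monom)
  also have "\<dots> = (\<Sum>i\<le>n. z ^ n * (of_real (coeff p i) * inverse z ^ i))"
    using assms(2) by (intro sum.cong refl) (simp add: power_diff power_inverse field_simps)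
  also have "\<dots> = z ^ n * poly (cpoly p) (inverse z)"
    using assms(1) by (simp add: poly_le_sum[of "cpoly p" n] sum_distrib_left)
  finally show ?thesis .
qed

lemma to_fract_power: "to_fract (p ^ n) = to_fract p ^ n"
  by (induction n) simp_all

lemma to_fract_monom: "to_fract (monom c k) = rf_const c * rf_z ^ k"
proof -
  have "monom c k = [:c:] * [:0, 1:] ^ k" by (simp add: monom_altdef)
  thus ?thesis by (simp only: to_fract_mult to_fract_power rf_const_def rf_z_def)
qed

lemma to_fract_poly_rev:
  assumes "degree p \<le> n"
  shows "to_fract (poly_rev n p) = rf_z ^ n * poly (map_poly rf_const p) (inverse rf_z)"
proof -
  have "to_fract (poly_rev n p) = (\<Sum>i\<le>n. rf_const (coeff p i) * rf_z ^ (n - i))"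
    by (simp add: poly_rev_def to_fract_monom)
  also have "\<dots> = (\<Sum>i\<le>n. rf_z ^ n * (rf_const (coeff p i) * inverse rf_z ^ i))"
    by (intro sum.cong refl) (simp add: power_diff power_inverse field_simps)
  also have "\<dots> = rf_z ^ n * poly (map_poly rf_const p) (inverse rf_z)"
  proof -
    have "degree (map_poly rf_const p) = degree p" by (rule degree_map_poly) simp
    thus ?thesis using assms
      by (simp add: poly_le_sum[of "map_poly rf_const p" n] sum_distrib_left coeff_map_poly)
  qed
  finally show ?thesis .
qed

lemma rf_recip_quot:
  assumes "degree (rf_num f) \<le> n" "degree (rf_den f) \<le> n"
  shows "rf_recip f = to_fract (poly_rev n (rf_num f)) / to_fract (poly_rev n (rf_den f))"
  unfolding to_fract_poly_rev[OF assms(1)] to_fract_poly_rev[OF assms(2)] rf_recip_def by simp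

lemma rf_value_recip:
  assumes "rf_value f (inverse z) v" "z \<noteq> 0"
  shows "rf_value (rf_recip f) z v"
proof -
  define n where "n = max (degree (rf_num f)) (degree (rf_den f))"
  have n: "degree (rf_num f) \<le> n" "degree (rf_den f) \<le> n" by (simp_all add: n_def)
  have "poly (cpoly (poly_rev n (rf_den f))) z \<noteq> 0"
    using assms by (simp add: poly_cpoly_rev[OF n(2)] rf_value_def rf_pole_def)
  from rf_valueI[OF rf_recip_quot[OF n] this]
  show ?thesis using assms by (simp add: poly_cpoly_rev[OF n(1)] poly_cpoly_rev[OF n(2)] rf_value_def rf_eval_def)
qed

lemma cpoly_cnj: "poly (cpoly p) (cnj z) = cnj (poly (cpoly p) z)"
  by (simp add: poly_altdef)

lemma rf_value_cnj: "rf_value f z v \<Longrightarrow> rf_value f (cnj z) (cnj v)"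
  by (auto simp: rf_value_def rf_pole_def rf_eval_def cpoly_cnj)

text \<open>On the circle 1/z is the conjugate of z, and the coefficients are real. This is why
  \<open>para_conj\<close> takes the adjoint matrix as its value there.\<close>

lemma rf_value_recip_circle:
  assumes "rf_value f z v" "cmod z = 1"
  shows "rf_value (rf_recip f) z (cnj v)"
proof (rule rf_value_recip)
  have "inverse z = cnj z"
    using assms(2) complex_norm_square[of z] by (intro inverse_unique) simp
  thus "rf_value f (inverse z) (cnj v)" using rf_value_cnj[OF assms(1)] by simp
qed (use assms in auto)

definition rf_stable :: "ratfun \<Rightarrow> bool" where
  "rf_stable f \<longleftrightarrow> rf_proper f \<and> (\<forall>z. rf_pole f z \<longrightarrow> cmod z < 1)"

text \<open>Reducing a quotient lowers both degrees equally and only removes poles, so any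
  representation may be used.\<close>

lemma rf_stableI:
  assumes f: "f = to_fract a / to_fract b" and b: "b \<noteq> 0" "degree a \<le> degree b"
    and r: "\<And>z. poly (cpoly b) z = 0 \<Longrightarrow> cmod z < 1"
  shows "rf_stable f"
proof -
  have "degree (rf_num f) \<le> degree (rf_den f)"
  proof (cases "a = 0")
    case True
    hence "rf_num f = 0" using rf_cross_mult[OF f b(1)] b(1) by simp
    thus ?thesis by simp
  next
    case False
    hence "rf_num f \<noteq> 0" using rf_cross_mult[OF f b(1)] by auto
    hence "degree (rf_num f) + degree b = degree a + degree (rf_den f)"
      using False b(1) rf_cross_mult[OF f b(1)] by (metis degree_mult_eq rf_den_nonzero)
    thus ?thesis using b(2) by simp
  qed
  moreover have "cmod z < 1" if "rf_pole f z" for z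
    using rf_valueI[OF f, of z] r that by (auto simp: rf_value_def)
  ultimately show ?thesis by (simp add: rf_stable_def rf_proper_def)
qed

lemma rf_stableE:
  assumes "rf_stable f"
  obtains a b where "f = to_fract a / to_fract b" "b \<noteq> 0" "degree a \<le> degree b"
    "\<And>z. poly (cpoly b) z = 0 \<Longrightarrow> cmod z < 1"
  using that[OF rf_num_den[of f]] assms by (auto simp: rf_stable_def rf_proper_def rf_pole_def)

lemma rf_stable_add:
  assumes "rf_stable f" "rf_stable g"
  shows "rf_stable (f + g)"
proof -
  obtain a b where f: "f = to_fract a / to_fract b" "b \<noteq> 0" "degree a \<le> degree b"
    "\<And>z. poly (cpoly b) z = 0 \<Longrightarrow> cmod z < 1" using rf_stableE[OF assms(1)] by metis
  obtain c d where g: "g = to_fract c / to_fract d" "d \<noteq> 0" "degree c \<le> degree d"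
    "\<And>z. poly (cpoly d) z = 0 \<Longrightarrow> cmod z < 1" using rf_stableE[OF assms(2)] by metis
  have "degree (a * d + c * b) \<le> degree (b * d)"
  proof (rule degree_add_le)
    show "degree (a * d) \<le> degree (b * d)" "degree (c * b) \<le> degree (b * d)"
      using f(2,3) g(2,3) degree_mult_le[of a d] degree_mult_le[of c b] by (auto simp: degree_mult_eq)
  qed
  thus ?thesis
    using f g by (intro rf_stableI[of _ "a * d + c * b" "b * d"]) (auto simp: add_frac_eq cpoly.hom_mult)
qed

lemma rf_stable_mult:
  assumes "rf_stable f" "rf_stable g"
  shows "rf_stable (f * g)"
proof -
  obtain a b where f: "f = to_fract a / to_fract b" "b \<noteq> 0" "degree a \<le> degree b"
    "\<And>z. poly (cpoly b) z = 0 \<Longrightarrow> cmod z < 1" using rf_stableE[OF assms(1)] by metis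
  obtain c d where g: "g = to_fract c / to_fract d" "d \<noteq> 0" "degree c \<le> degree d"
    "\<And>z. poly (cpoly d) z = 0 \<Longrightarrow> cmod z < 1" using rf_stableE[OF assms(2)] by metis
  have "degree (a * c) \<le> degree (b * d)"
    using f(2,3) g(2,3) degree_mult_le[of a c] by (auto simp: degree_mult_eq)
  thus ?thesis
    using f g by (intro rf_stableI[of _ "a * c" "b * d"]) (auto simp: cpoly.hom_mult)
qed

lemma rf_stable_const [simp]: "rf_stable (rf_const c)"
  by (rule rf_stableI[of _ "[:c:]" 1]) (auto simp: rf_const_def)

lemma rf_stable_0 [simp]: "rf_stable 0" and rf_stable_1 [simp]: "rf_stable 1"
  using rf_stable_const[of 0] rf_stable_const[of 1] by simp_all

lemma rf_stable_inverse_z [simp]: "rf_stable (inverse rf_z)"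
  by (rule rf_stableI[of _ 1 "[:0, 1:]"]) (auto simp: rf_z_def field_simps)

lemma rf_stable_sum: "(\<And>i. i \<in> I \<Longrightarrow> rf_stable (f i)) \<Longrightarrow> rf_stable (\<Sum>i\<in>I. f i)"
  by (induction I rule: infinite_finite_induct) (auto intro: rf_stable_add)

lemma rf_stable_power: "rf_stable f \<Longrightarrow> rf_stable (f ^ n)"
  by (induction n) (auto intro: rf_stable_mult)

lemma rf_stable_value: "rf_stable f \<Longrightarrow> 1 \<le> cmod z \<Longrightarrow> rf_value f z (rf_eval f z)"
  by (auto simp: rf_stable_def rf_value_def)

text \<open>Induction on the degree removes one root r of the denominator. With b = a (X - r) one
  has |r| |a_k| <= |b_k| + |a_(k-1)|, and summation bounds (|r| - 1) times the sum of |a_k| by the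
  sum of |b_k|. Partial fractions and multiplicities are thereby avoided.\<close>

lemma fps_div_poly_summable:
  fixes a :: "complex fps"
  assumes "a * fps_of_poly Q = fps_of_poly P" "Q \<noteq> 0"
    and "\<And>w. poly Q w = 0 \<Longrightarrow> 1 < cmod w"
  shows "summable (\<lambda>k. cmod (fps_nth a k))"
  using assms
proof (induction "degree Q" arbitrary: a Q)
  case 0
  then obtain c where c: "Q = [:c:]" "c \<noteq> 0" using degree_eq_zeroE by (metis pCons_eq_0_iff)
  have "fps_nth a k = coeff P k / c" for k
  proof -
    have "fps_nth (a * fps_of_poly Q) k = coeff P k" by (simp add: 0)
    thus ?thesis using c by (simp add: fps_of_poly_const field_simps)
  qed
  thus ?case by (intro summable_finite[of "{..degree P}"]) (auto simp: coeff_eq_0)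
next
  case (Suc n)
  have "\<not> constant (poly Q)" using Suc.hyps(2) by (simp add: constant_degree)
  then obtain r where r: "poly Q r = 0" using fundamental_theorem_of_algebra by blast
  then obtain Q' where Q': "Q = [:- r, 1:] * Q'" using poly_eq_0_iff_dvd by blast
  have r1: "1 < cmod r" using Suc.prems(3) r by blast
  have Q0: "Q' \<noteq> 0" using Suc.prems(2) Q' by auto
  have n: "n = degree Q'"
  proof -
    have "degree Q = degree [:- r, 1:] + degree Q'" unfolding Q' using Q0 by (intro degree_mult_eq) auto
    thus ?thesis using Suc.hyps(2) by simp
  qed
  define b where "b = a * fps_of_poly [:- r, 1:]"
  have b: "summable (\<lambda>k. cmod (fps_nth b k))"
  proof (rule Suc.hyps(1)[OF n _ Q0])
    show "b * fps_of_poly Q' = fps_of_poly P"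
      using Suc.prems(1) unfolding b_def Q' by (simp only: fps_of_poly_mult mult.assoc)
    show "1 < cmod w" if "poly Q' w = 0" for w using Suc.prems(3)[of w] that by (simp add: Q')
  qed
  have bk: "fps_nth b (Suc k) = fps_nth a k - r * fps_nth a (Suc k)"
    and b0: "fps_nth b 0 = - r * fps_nth a 0" for k
    unfolding b_def by (simp_all add: fps_of_poly_linear algebra_simps)
  define S where "S = (\<Sum>k. cmod (fps_nth b k))"
  have part: "(\<Sum>k<K. cmod (fps_nth a k)) \<le> S / (cmod r - 1)" for K
  proof -
    have step: "cmod r * cmod (fps_nth a k) \<le> cmod (fps_nth b k) + (if k = 0 then 0 else cmod (fps_nth a (k - 1)))" for k
    proof (cases k)
      case 0
      thus ?thesis by (simp add: b0 norm_mult)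
    next
      case (Suc m)
      have "r * fps_nth a (Suc m) = fps_nth a m - fps_nth b (Suc m)" by (simp add: bk)
      hence "cmod r * cmod (fps_nth a (Suc m)) \<le> cmod (fps_nth a m) + cmod (fps_nth b (Suc m))"
        by (metis norm_mult norm_triangle_ineq4)
      thus ?thesis using Suc by simp
    qed
    have shift: "(\<Sum>k<K. if k = 0 then 0 else cmod (fps_nth a (k - 1))) \<le> (\<Sum>k<K. cmod (fps_nth a k))"
    proof (cases K)
      case (Suc m)
      show ?thesis unfolding Suc sum.lessThan_Suc_shift[of "\<lambda>k. if k = 0 then 0 else cmod (fps_nth a (k - 1))"]
        by simp
    qed simp
    have "cmod r * (\<Sum>k<K. cmod (fps_nth a k)) \<le> (\<Sum>k<K. cmod (fps_nth b k)) + (\<Sum>k<K. cmod (fps_nth a k))"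
      unfolding sum_distrib_left
      by (rule order_trans[OF sum_mono[OF step]]) (simp only: sum.distrib add_left_mono shift)
    moreover have "(\<Sum>k<K. cmod (fps_nth b k)) \<le> S"
      unfolding S_def using b by (intro sum_le_suminf) auto
    ultimately have "(cmod r - 1) * (\<Sum>k<K. cmod (fps_nth a k)) \<le> S" by (simp add: algebra_simps)
    thus ?thesis using r1 by (simp add: field_simps)
  qed
  show ?case
    by (rule bounded_imp_summable[where B = "S / (cmod r - 1)"]) (simp_all only: norm_ge_zero part flip: lessThan_Suc_atMost)
qed

text \<open>\<open>rf_coeff\<close> is defined through the reduced form of f(1/z). The reversed
  polynomials represent the same quotient up to a common factor, which cancels. The constant
  coefficient of the reversed denominator is the leading coefficient of \<open>rf_den f\<close>,
  hence not zero.\<close>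

lemma rf_coeff_rev:
  assumes f: "rf_proper f"
  defines "n \<equiv> degree (rf_den f)"
  shows "Abs_fps (rf_coeff f) * fps_of_poly (poly_rev n (rf_den f)) = fps_of_poly (poly_rev n (rf_num f))"
    and "coeff (poly_rev n (rf_den f)) 0 \<noteq> 0"
proof -
  let ?P = "poly_rev n (rf_num f)" and ?Q = "poly_rev n (rf_den f)"
  let ?p = "rf_num (rf_recip f)" and ?q = "rf_den (rf_recip f)"
  have q0: "coeff ?Q 0 \<noteq> 0" by (simp add: coeff_poly_rev n_def)
  show "coeff ?Q 0 \<noteq> 0" by (rule q0)
  have Q0: "?Q \<noteq> 0" using q0 by auto
  have rec: "rf_recip f = to_fract ?P / to_fract ?Q"
    using f by (intro rf_recip_quot) (auto simp: n_def rf_proper_def)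
  obtain k where k: "?Q = ?q * k" using rf_den_dvd[OF rec Q0] by (auto simp: dvd_def)
  have "coeff ?q 0 \<noteq> 0" using q0 unfolding k by (auto simp: mult_poly_0 coeff_mult)
  hence sub: "subdegree (fps_of_poly ?q) = 0" "fps_of_poly ?q \<noteq> 0"
    by (auto simp: subdegree_eq_0_iff)
  have "Abs_fps (rf_coeff f) = fps_of_poly ?p / fps_of_poly ?q"
    by (simp add: fps_eq_iff rf_coeff_def)
  hence "Abs_fps (rf_coeff f) * fps_of_poly ?q = fps_of_poly ?p"
    using sub by (simp add: fps_times_divide_eq)
  hence "Abs_fps (rf_coeff f) * fps_of_poly ?Q * fps_of_poly ?q = fps_of_poly (?p * ?Q)"
    by (metis (no_types) fps_of_poly_mult mult.assoc mult.commute)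
  also have "\<dots> = fps_of_poly ?P * fps_of_poly ?q"
    by (simp add: rf_cross_mult[OF rec Q0] fps_of_poly_mult)
  finally show "Abs_fps (rf_coeff f) * fps_of_poly ?Q = fps_of_poly ?P"
    using sub(2) by simp
qed

lemma poly_sums: "(\<lambda>k. coeff P k * w ^ k) sums poly P (w :: complex)"
  unfolding poly_altdef by (rule sums_finite) (auto simp: coeff_eq_0)

text \<open>The roots of the reversed denominator are the inverses of the nonzero poles, so they lie
  outside the closed disc and the coefficients are absolutely summable. The Cauchy product with the
  reversed denominator then identifies the sum on the circle.\<close>

lemma rf_stable_expansion:
  assumes f: "rf_stable f"
  shows "summable (\<lambda>k. \<bar>rf_coeff f k\<bar>)"
    and "cmod z = 1 \<Longrightarrow> rf_eval f z = (\<Sum>k. of_real (rf_coeff f k) * inverse z ^ k)"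
proof -
  have fp: "rf_proper f" using f by (simp add: rf_stable_def)
  define n where "n = degree (rf_den f)"
  define P Q where "P = cpoly (poly_rev n (rf_num f))" and "Q = cpoly (poly_rev n (rf_den f))"
  define a where "a = Abs_fps (\<lambda>k. complex_of_real (rf_coeff f k))"
  have nd: "degree (rf_num f) \<le> n" using fp by (simp add: n_def rf_proper_def)
  have Q0: "coeff Q 0 \<noteq> 0" using rf_coeff_rev(2)[OF fp] by (simp add: Q_def n_def)
  have aQ: "a * fps_of_poly Q = fps_of_poly P"
  proof (rule fps_ext)
    fix k
    have "fps_nth (a * fps_of_poly Q) k
       = of_real (fps_nth (Abs_fps (rf_coeff f) * fps_of_poly (poly_rev n (rf_den f))) k)"
      by (simp add: fps_mult_nth a_def Q_def)
    thus "fps_nth (a * fps_of_poly Q) k = fps_nth (fps_of_poly P) k"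
      by (simp add: rf_coeff_rev(1)[OF fp, folded n_def] P_def)
  qed
  have roots: "1 < cmod w" if w: "poly Q w = 0" for w
  proof -
    have w0: "w \<noteq> 0" using w Q0 by (auto simp: poly_0_coeff_0)
    hence "poly (cpoly (rf_den f)) (inverse w) = 0"
      using w by (simp add: Q_def poly_cpoly_rev n_def)
    hence "cmod (inverse w) < 1" using f by (simp add: rf_stable_def rf_pole_def)
    thus ?thesis using w0 by (simp add: norm_inverse inverse_less_1_iff)
  qed
  have "summable (\<lambda>k. cmod (fps_nth a k))"
    by (rule fps_div_poly_summable[OF aQ _ roots]) (use Q0 in auto)
  thus sum: "summable (\<lambda>k. \<bar>rf_coeff f k\<bar>)" by (simp add: a_def)
  show "rf_eval f z = (\<Sum>k. of_real (rf_coeff f k) * inverse z ^ k)" if z: "cmod z = 1"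
  proof -
    define w where "w = inverse z"
    have z0: "z \<noteq> 0" and w0: "w \<noteq> 0" and w1: "cmod w = 1" and wz: "inverse w = z"
      using z by (auto simp: w_def norm_inverse)
    have s1: "summable (\<lambda>k. norm (of_real (rf_coeff f k) * w ^ k))"
      using sum w1 by (simp add: norm_mult norm_power)
    have s2: "summable (\<lambda>k. norm (coeff Q k * w ^ k))"
      by (rule summable_finite[of "{..degree Q}"]) (auto simp: coeff_eq_0)
    have "(\<Sum>k. of_real (rf_coeff f k) * w ^ k) * poly Q w
       = (\<Sum>k. \<Sum>i\<le>k. (of_real (rf_coeff f i) * w ^ i) * (coeff Q (k - i) * w ^ (k - i)))"
      using Cauchy_product[OF s1 s2] by (simp add: sums_unique[OF poly_sums])
    also have "\<dots> = (\<Sum>k. coeff P k * w ^ k)"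
    proof (rule suminf_cong)
      fix k
      have "(\<Sum>i\<le>k. (of_real (rf_coeff f i) * w ^ i) * (coeff Q (k - i) * w ^ (k - i)))
         = (\<Sum>i\<le>k. of_real (rf_coeff f i) * coeff Q (k - i) * w ^ k)"
        by (intro sum.cong refl) (simp add: power_add[symmetric] mult_ac)
      also have "\<dots> = fps_nth (a * fps_of_poly Q) k * w ^ k"
        by (simp add: fps_mult_nth a_def sum_distrib_right atLeast0AtMost)
      finally show "(\<Sum>i\<le>k. (of_real (rf_coeff f i) * w ^ i) * (coeff Q (k - i) * w ^ (k - i))) = coeff P k * w ^ k"
        by (simp add: aQ)
    qed
    also have "\<dots> = poly P w" by (rule sums_unique[OF poly_sums, symmetric])
    finally have e: "(\<Sum>k. of_real (rf_coeff f k) * w ^ k) * poly Q w = poly P w" .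
    have P: "poly P w = w ^ n * poly (cpoly (rf_num f)) z"
      unfolding P_def using poly_cpoly_rev[OF nd w0] by (simp add: wz)
    have Q: "poly Q w = w ^ n * poly (cpoly (rf_den f)) z"
      unfolding Q_def using poly_cpoly_rev[OF _ w0, of "rf_den f" n] by (simp add: wz n_def)
    have "poly (cpoly (rf_den f)) z \<noteq> 0" using f z by (auto simp: rf_stable_def rf_pole_def)
    hence "(\<Sum>k. of_real (rf_coeff f k) * w ^ k) = poly (cpoly (rf_num f)) z / poly (cpoly (rf_den f)) z"
      using e w0 unfolding P Q by (simp add: field_simps)
    thus ?thesis unfolding w_def rf_eval_def by (rule sym)
  qed
qed

lemma rf_coeff_strictly_proper:
  assumes "rf_strictly_proper f"
  shows "rf_coeff f 0 = 0"
proof -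
  have fp: "rf_proper f" using assms by (auto simp: rf_strictly_proper_def rf_proper_def rf_num_def)
  define n where "n = degree (rf_den f)"
  have "coeff (rf_num f) n = 0"
    using assms by (auto simp: rf_strictly_proper_def n_def rf_num_def coeff_eq_0)
  hence "fps_nth (Abs_fps (rf_coeff f) * fps_of_poly (poly_rev n (rf_den f))) 0 = 0"
    unfolding n_def rf_coeff_rev(1)[OF fp] by (simp add: coeff_poly_rev)
  thus ?thesis using rf_coeff_rev(2)[OF fp] by (simp add: n_def)
qed

text \<open>A uniform bound is carried along with the absence of poles, so that it need not be
  recovered from compactness of the circle.\<close>

definition rf_circle :: "ratfun \<Rightarrow> bool" where
  "rf_circle f \<longleftrightarrow> (\<exists>B. \<forall>z. cmod z = 1 \<longrightarrow> rf_value f z (rf_eval f z) \<and> cmod (rf_eval f z) \<le> B)"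

lemma rf_circle_value: "rf_circle f \<Longrightarrow> cmod z = 1 \<Longrightarrow> rf_value f z (rf_eval f z)"
  by (auto simp: rf_circle_def)

lemma rf_circleI:
  assumes "\<And>z. cmod z = 1 \<Longrightarrow> rf_value f z (v z)" "\<And>z. cmod z = 1 \<Longrightarrow> cmod (v z) \<le> B"
  shows "rf_circle f"
  using assms by (auto simp: rf_circle_def rf_value_def)

lemma rf_circle_add:
  assumes "rf_circle f" "rf_circle g" shows "rf_circle (f + g)"
proof -
  obtain B where B: "\<And>z. cmod z = 1 \<Longrightarrow> cmod (rf_eval f z) \<le> B" using assms(1) by (auto simp: rf_circle_def)
  obtain C where C: "\<And>z. cmod z = 1 \<Longrightarrow> cmod (rf_eval g z) \<le> C" using assms(2) by (auto simp: rf_circle_def)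
  show ?thesis
    by (rule rf_circleI[OF rf_value_add[OF rf_circle_value[OF assms(1)] rf_circle_value[OF assms(2)]], where B = "B + C"])
       (auto intro: norm_triangle_mono B C)
qed

lemma rf_circle_mult:
  assumes "rf_circle f" "rf_circle g" shows "rf_circle (f * g)"
proof -
  obtain B where B: "\<And>z. cmod z = 1 \<Longrightarrow> cmod (rf_eval f z) \<le> B" using assms(1) by (auto simp: rf_circle_def)
  obtain C where C: "\<And>z. cmod z = 1 \<Longrightarrow> cmod (rf_eval g z) \<le> C" using assms(2) by (auto simp: rf_circle_def)
  show ?thesis
    by (rule rf_circleI[OF rf_value_mult[OF rf_circle_value[OF assms(1)] rf_circle_value[OF assms(2)]], where B = "B * C"])
       (auto simp: norm_mult intro!: mult_mono' B C)
qed

lemma rf_circle_const [simp]: "rf_circle (rf_const c)"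
  by (rule rf_circleI[OF rf_value_const]) auto

lemma rf_circle_0 [simp]: "rf_circle 0" and rf_circle_1 [simp]: "rf_circle 1"
  using rf_circle_const[of 0] rf_circle_const[of 1] by simp_all

lemma rf_circle_minus: "rf_circle f \<Longrightarrow> rf_circle (- f)"
  unfolding rf_circle_def using rf_value_minus by (metis norm_minus_cancel rf_value_def)

lemma rf_circle_diff: "rf_circle f \<Longrightarrow> rf_circle g \<Longrightarrow> rf_circle (f - g)"
  using rf_circle_add[of f "- g"] rf_circle_minus[of g] by simp

lemma rf_circle_sum: "(\<And>i. i \<in> I \<Longrightarrow> rf_circle (f i)) \<Longrightarrow> rf_circle (\<Sum>i\<in>I. f i)"
  by (induction I rule: infinite_finite_induct) (auto intro: rf_circle_add)

lemma rf_circle_z [simp]: "rf_circle rf_z"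
  by (rule rf_circleI[OF rf_value_z, of 1]) auto

lemma rf_circle_power: "rf_circle f \<Longrightarrow> rf_circle (f ^ n)"
  by (induction n) (auto intro: rf_circle_mult)

lemma rf_circle_recip: "rf_circle f \<Longrightarrow> rf_circle (rf_recip f)"
  unfolding rf_circle_def using rf_value_recip_circle by (metis complex_mod_cnj rf_value_def)

lemma rf_stable_circle: 
  assumes "rf_stable f" shows "rf_circle f"
proof (rule rf_circleI[OF rf_stable_value[OF assms]])
  fix z :: complex assume z: "cmod z = 1"
  have n: "norm (of_real (rf_coeff f k) * inverse z ^ k) = \<bar>rf_coeff f k\<bar>" for k
    using z by (simp add: norm_mult norm_power norm_inverse)
  have "norm (\<Sum>k. of_real (rf_coeff f k) * inverse z ^ k) \<le> (\<Sum>k. norm (of_real (rf_coeff f k) * inverse z ^ k))"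
    by (rule summable_norm) (simp only: n rf_stable_expansion(1)[OF assms])
  thus "cmod (rf_eval f z) \<le> (\<Sum>k. \<bar>rf_coeff f k\<bar>)"
    unfolding n rf_stable_expansion(2)[OF assms z] .
qed auto

text \<open>The fraction may be improper: dividing by z^n, with n the degree of the numerator, makes
  it proper and only adds poles at 0, and multiplication by z^n restores it.\<close>

lemma rf_circle_if_disc_poles:
  assumes f: "f = to_fract a / to_fract b" "b \<noteq> 0" and r: "\<And>z. poly (cpoly b) z = 0 \<Longrightarrow> cmod z < 1"
  shows "rf_circle f"
proof -
  define n where "n = degree a"
  have "rf_stable (to_fract a / to_fract (b * [:0, 1:] ^ n))"
  proof (rule rf_stableI[OF refl])
    show "degree a \<le> degree (b * [:0, 1:] ^ n)"
      using f(2) by (subst degree_mult_eq) (auto simp: n_def degree_power_eq)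
    show "cmod z < 1" if "poly (cpoly (b * [:0, 1:] ^ n)) z = 0" for z
      using that r by (auto simp: cpoly.hom_mult cpoly.hom_power)
  qed (use f in auto)
  hence "rf_circle (to_fract a / to_fract (b * [:0, 1:] ^ n) * rf_z ^ n)"
    by (intro rf_circle_mult rf_stable_circle rf_circle_power rf_circle_z)
  also have "to_fract a / to_fract (b * [:0, 1:] ^ n) * rf_z ^ n = f"
    by (simp add: f(1) to_fract_power rf_z_def)
  finally show ?thesis .
qed

subsection \<open>Transfer matrices\<close>

definition tf_circle :: "tfm \<Rightarrow> bool" where
  "tf_circle G \<longleftrightarrow> (\<forall>i<dim_row G. \<forall>j<dim_col G. rf_circle (G $$ (i, j)))"

lemma tf_circleD: "tf_circle G \<Longrightarrow> G \<in> carrier_mat r c \<Longrightarrow> i < r \<Longrightarrow> j < c \<Longrightarrow> rf_circle (G $$ (i, j))"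
  by (auto simp: tf_circle_def)

lemma tf_eval_carrier [simp]: "G \<in> carrier_mat r c \<Longrightarrow> tf_eval G z \<in> carrier_mat r c"
  by (simp add: tf_eval_def)

lemma tf_value: "tf_circle G \<Longrightarrow> G \<in> carrier_mat r c \<Longrightarrow> i < r \<Longrightarrow> j < c \<Longrightarrow> cmod z = 1 \<Longrightarrow>
    rf_value (G $$ (i, j)) z (tf_eval G z $$ (i, j))"
  using rf_circle_value[OF tf_circleD] by (simp add: tf_eval_def)

lemma tf_circle_evalI:
  assumes G: "G \<in> carrier_mat r c" and M: "\<And>z. cmod z = 1 \<Longrightarrow> M z \<in> carrier_mat r c"
    and v: "\<And>z i j. cmod z = 1 \<Longrightarrow> i < r \<Longrightarrow> j < c \<Longrightarrow> rf_value (G $$ (i, j)) z (M z $$ (i, j))"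
    and z: "cmod z = 1"
  shows "tf_eval G z = M z"
proof (rule eq_matI)
  fix i j assume "i < dim_row (M z)" "j < dim_col (M z)"
  hence ij: "i < r" "j < c" using M[OF z] by auto
  show "tf_eval G z $$ (i, j) = M z $$ (i, j)"
    using v[OF z ij] G ij by (simp add: tf_eval_def rf_value_def)
qed (use G M[OF z] in \<open>auto simp: tf_eval_def\<close>)

lemma index_mult_mat_sum:
  assumes "A \<in> carrier_mat a b" "B \<in> carrier_mat b c" "i < a" "j < c"
  shows "(A * B) $$ (i, j) = (\<Sum>k<b. A $$ (i, k) * B $$ (k, j))"
  using assms by (simp add: scalar_prod_def atLeast0LessThan)

lemma tf_circle_mult:
  assumes "A \<in> carrier_mat a b" "B \<in> carrier_mat b c" "tf_circle A" "tf_circle B"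
  shows "tf_circle (A * B)"
  unfolding tf_circle_def
proof (intro allI impI)
  fix i j assume "i < dim_row (A * B)" "j < dim_col (A * B)"
  hence ij: "i < a" "j < c" using assms by auto
  show "rf_circle ((A * B) $$ (i, j))"
    unfolding index_mult_mat_sum[OF assms(1,2) ij]
    using assms ij by (intro rf_circle_sum rf_circle_mult tf_circleD[of A a b] tf_circleD[of B b c]) auto
qed

lemma tf_eval_mult:
  assumes "A \<in> carrier_mat a b" "B \<in> carrier_mat b c" "tf_circle A" "tf_circle B" "cmod z = 1"
  shows "tf_eval (A * B) z = tf_eval A z * tf_eval B z"
proof (rule tf_circle_evalI[OF mult_carrier_mat[OF assms(1,2)] _ _ assms(5)])
  show "tf_eval A z * tf_eval B z \<in> carrier_mat a c" for z using assms by (intro mult_carrier_mat[of _ a b]) auto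
  fix z i j assume z: "cmod z = 1" and ij: "i < a" "j < c"
  show "rf_value ((A * B) $$ (i, j)) z ((tf_eval A z * tf_eval B z) $$ (i, j))"
    unfolding index_mult_mat_sum[OF assms(1,2) ij]
      index_mult_mat_sum[OF tf_eval_carrier[OF assms(1)] tf_eval_carrier[OF assms(2)] ij]
    using assms ij z by (intro rf_value_sum rf_value_mult tf_value[of A a b] tf_value[of B b c]) auto
qed

lemma tf_circle_add:
  assumes "A \<in> carrier_mat a b" "B \<in> carrier_mat a b" "tf_circle A" "tf_circle B"
  shows "tf_circle (A + B)"
  using assms by (auto simp: tf_circle_def intro: rf_circle_add)

lemma tf_eval_add:
  assumes "A \<in> carrier_mat a b" "B \<in> carrier_mat a b" "tf_circle A" "tf_circle B" "cmod z = 1"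
  shows "tf_eval (A + B) z = tf_eval A z + tf_eval B z"
proof (rule tf_circle_evalI[OF add_carrier_mat[OF assms(2), of A] _ _ assms(5)])
  fix z i j assume z: "cmod z = 1" and ij: "i < a" "j < b"
  show "rf_value ((A + B) $$ (i, j)) z ((tf_eval A z + tf_eval B z) $$ (i, j))"
    using assms ij z rf_value_add[OF tf_value[of A a b i j z] tf_value[of B a b i j z]] by (simp add: tf_eval_def)
qed (use assms in auto)

lemma tf_circle_minus:
  assumes "A \<in> carrier_mat a b" "B \<in> carrier_mat a b" "tf_circle A" "tf_circle B"
  shows "tf_circle (A - B)"
  using assms by (auto simp: tf_circle_def intro: rf_circle_diff)

lemma tf_eval_minus:
  assumes "A \<in> carrier_mat a b" "B \<in> carrier_mat a b" "tf_circle A" "tf_circle B" "cmod z = 1"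
  shows "tf_eval (A - B) z = tf_eval A z - tf_eval B z"
proof (rule tf_circle_evalI[OF minus_carrier_mat[OF assms(2), of A] _ _ assms(5)])
  fix z i j assume z: "cmod z = 1" and ij: "i < a" "j < b"
  show "rf_value ((A - B) $$ (i, j)) z ((tf_eval A z - tf_eval B z) $$ (i, j))"
    using assms ij z rf_value_diff[OF tf_value[of A a b i j z] tf_value[of B a b i j z]] by (simp add: tf_eval_def)
qed (use assms in \<open>auto intro!: minus_carrier_mat\<close>)

lemma tf_circle_smult: "rf_circle f \<Longrightarrow> tf_circle A \<Longrightarrow> tf_circle (f \<cdot>\<^sub>m A)"
  by (auto simp: tf_circle_def intro: rf_circle_mult)

lemma tf_eval_smult:
  assumes "A \<in> carrier_mat a b" "rf_circle f" "tf_circle A" "cmod z = 1"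
  shows "tf_eval (f \<cdot>\<^sub>m A) z = rf_eval f z \<cdot>\<^sub>m tf_eval A z"
proof (rule tf_circle_evalI[OF smult_carrier_mat[OF assms(1)] _ _ assms(4)])
  fix z i j assume z: "cmod z = 1" and ij: "i < a" "j < b"
  show "rf_value ((f \<cdot>\<^sub>m A) $$ (i, j)) z ((rf_eval f z \<cdot>\<^sub>m tf_eval A z) $$ (i, j))"
    using assms ij z rf_value_mult[OF rf_circle_value[of f z] tf_value[of A a b i j z]] by (simp add: tf_eval_def)
qed (use assms in auto)

lemma tf_circle_one [simp]: "tf_circle (1\<^sub>m n)"
  by (auto simp: tf_circle_def)

lemma tf_eval_one: "tf_eval (1\<^sub>m n) z = 1\<^sub>m n"
  using rf_value_1[of z] rf_value_0[of z] by (intro eq_matI) (auto simp: tf_eval_def rf_value_def)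

lemma para_conj_carrier [simp]: "G \<in> carrier_mat r c \<Longrightarrow> G\<^sup>\<sim> \<in> carrier_mat c r"
  by (simp add: para_conj_def)

lemma tf_circle_para_conj: "tf_circle G \<Longrightarrow> tf_circle (G\<^sup>\<sim>)"
  by (auto simp: tf_circle_def para_conj_def intro: rf_circle_recip)

lemma tf_eval_para_conj:
  assumes "G \<in> carrier_mat r c" "tf_circle G" "cmod z = 1"
  shows "tf_eval (G\<^sup>\<sim>) z = mat_adjoint (tf_eval G z)"
proof (rule tf_circle_evalI[OF para_conj_carrier[OF assms(1)] _ _ assms(3)])
  fix z i j assume z: "cmod z = 1" and ij: "i < c" "j < r"
  have "rf_value (rf_recip (G $$ (j, i))) z (cnj (tf_eval G z $$ (j, i)))"
    using assms ij z by (intro rf_value_recip_circle tf_value[of G r c])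
  moreover have "mat_adjoint (tf_eval G z) $$ (i, j) = cnj (tf_eval G z $$ (j, i))"
    using assms ij by (intro mat_adjoint_index) (auto simp: tf_eval_def)
  ultimately show "rf_value (G\<^sup>\<sim> $$ (i, j)) z (mat_adjoint (tf_eval G z) $$ (i, j))"
    using assms ij by (simp add: para_conj_def)
qed (use assms in auto)

lemma tf_const_carrier [simp]: "M \<in> carrier_mat r c \<Longrightarrow> tf_const M \<in> carrier_mat r c"
  by (simp add: tf_const_def)

lemma tf_circle_const [simp]: "tf_circle (tf_const M)"
  by (auto simp: tf_circle_def tf_const_def)

lemma tf_eval_const: "tf_eval (tf_const M) z = map_mat complex_of_real M"
  using rf_value_const[of _ z] by (intro eq_matI) (auto simp: tf_eval_def tf_const_def rf_value_def)

section \<open>Proper stable matrices, units and the supremum norm\<close>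

lemma RHinf_iff: "G \<in> RHinf r c \<longleftrightarrow> G \<in> carrier_mat r c \<and> (\<forall>i<r. \<forall>j<c. rf_stable (G $$ (i, j)))"
  by (auto simp: RHinf_def rf_stable_def)

lemma RHinf_carrier: "G \<in> RHinf r c \<Longrightarrow> G \<in> carrier_mat r c"
  by (simp add: RHinf_iff)

lemma RHinf_circle: "G \<in> RHinf r c \<Longrightarrow> tf_circle G"
  by (auto simp: RHinf_iff tf_circle_def intro: rf_stable_circle)

lemma RHinf_mult:
  assumes "A \<in> RHinf a b" "B \<in> RHinf b c"
  shows "A * B \<in> RHinf a c"
proof -
  have c: "A \<in> carrier_mat a b" "B \<in> carrier_mat b c" using assms by (auto simp: RHinf_iff)
  have "rf_stable ((A * B) $$ (i, j))" if "i < a" "j < c" for i j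
    unfolding index_mult_mat_sum[OF c that]
    using assms that by (intro rf_stable_sum rf_stable_mult) (auto simp: RHinf_iff)
  thus ?thesis using c by (auto simp: RHinf_iff)
qed

lemma RHinf_add: "A \<in> RHinf a b \<Longrightarrow> B \<in> RHinf a b \<Longrightarrow> A + B \<in> RHinf a b"
  by (auto simp: RHinf_iff intro!: rf_stable_add)

lemma RHinf_zero: "0\<^sub>m a b \<in> RHinf a b"
  by (auto simp: RHinf_iff)

lemma fir_set_RHinf:
  assumes "V \<in> fir_set r c N Ys"
  shows "V \<in> RHinf r c"
  using assms by (auto simp: fir_set_def RHinf_iff intro!: rf_stable_sum rf_stable_mult rf_stable_power)

lemma mat_inv_inverse:
  assumes M: "M \<in> carrier_mat n n" and X: "X \<in> carrier_mat n n" "M * X = 1\<^sub>m n"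
  shows "mat_inv M = X"
proof (cases "mat_inverse M")
  case None
  have "X * M = 1\<^sub>m n" using mat_mult_left_right_inverse[OF M X] .
  hence "M \<in> Units (ring_mat TYPE('a) n ())" using M X by (auto simp: Units_def ring_mat_def)
  with mat_inverse(1)[OF M None, of "()"] show ?thesis by simp
next
  case (Some B)
  from mat_inverse(2)[OF M this] have B: "M * B = 1\<^sub>m n" "B * M = 1\<^sub>m n" "B \<in> carrier_mat n n" by auto
  have "B = B * (M * X)" unfolding X(2) by (rule right_mult_one_mat[OF B(3), symmetric])
  also have "\<dots> = (B * M) * X" by (rule assoc_mult_mat[OF B(3) M X(1), symmetric])
  also have "\<dots> = X" unfolding B(2) by (rule left_mult_one_mat[OF X(1)])
  finally show ?thesis using Some by (simp add: mat_inv_def)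
qed

lemma RHinf_unitD:
  assumes "RHinf_unit n U"
  shows "U \<in> RHinf n n" "mat_inv U \<in> RHinf n n" "U * mat_inv U = 1\<^sub>m n" "mat_inv U * U = 1\<^sub>m n"
proof -
  show U: "U \<in> RHinf n n" "mat_inv U \<in> RHinf n n" using assms by (auto simp: RHinf_unit_def)
  have c: "U \<in> carrier_mat n n" using U by (simp add: RHinf_carrier)
  obtain B where B: "U * B = 1\<^sub>m (dim_row U)" "B * U = 1\<^sub>m (dim_row B)"
    using assms by (auto simp: RHinf_unit_def invertible_mat_def inverts_mat_def)
  have "dim_col B = n" using B(1) c by (metis index_mult_mat(3) index_one_mat(3) carrier_matD(1))
  moreover have "dim_row B = n" using B(2) c by (metis index_mult_mat(3) index_one_mat(3) carrier_matD(2))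
  ultimately have Bc: "B \<in> carrier_mat n n" by auto
  have "mat_inv U = B" using B(1) c by (intro mat_inv_inverse[OF c Bc]) simp
  thus "U * mat_inv U = 1\<^sub>m n" "mat_inv U * U = 1\<^sub>m n" using B c Bc by auto
qed

text \<open>The entries are bounded on the circle, so the supremum is over a bounded set and
  dominates every value. A positive number of columns makes \<open>sv_norm\<close> the operator
  norm.\<close>

lemma tf_norm_bound:
  assumes G: "G \<in> carrier_mat r c" "tf_circle G" and c: "0 < c"
  shows "0 \<le> tf_norm G" and "cmod z = 1 \<Longrightarrow> mat_bound (tf_eval G z) (tf_norm G)"
proof -
  have "\<exists>B. \<forall>x\<in>{..<r} \<times> {..<c}. \<forall>z. cmod z = 1 \<longrightarrow> cmod (rf_eval (G $$ x) z) \<le> B"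
  proof -
    have "\<forall>x\<in>{..<r} \<times> {..<c}. \<exists>B. \<forall>z. cmod z = 1 \<longrightarrow> cmod (rf_eval (G $$ x) z) \<le> B"
      using tf_circleD[OF G(2,1)] by (auto simp: rf_circle_def) blast
    then obtain B where B: "\<And>x z. x \<in> {..<r} \<times> {..<c} \<Longrightarrow> cmod z = 1 \<Longrightarrow> cmod (rf_eval (G $$ x) z) \<le> B x"
      by metis
    have "B x \<le> (\<Sum>x\<in>{..<r} \<times> {..<c}. \<bar>B x\<bar>)" if "x \<in> {..<r} \<times> {..<c}" for x
      using member_le_sum[OF that, of "\<lambda>x. \<bar>B x\<bar>"] by auto
    thus ?thesis using B by (meson order_trans)
  qed
  then obtain B where B: "\<And>i j z. i < r \<Longrightarrow> j < c \<Longrightarrow> cmod z = 1 \<Longrightarrow> cmod (rf_eval (G $$ (i, j)) z) \<le> B"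
    by auto
  have mb: "mat_bound (tf_eval G z) (real r * real c * \<bar>B\<bar>)" if z: "cmod z = 1" for z
    unfolding mat_bound_iff_op_bound[OF tf_eval_carrier[OF G(1)]]
    using B[OF _ _ z] G by (intro op_bound_entries) (auto simp: tf_eval_def intro: order_trans[OF _ abs_ge_self])
  have bdd: "bdd_above ((\<lambda>z. sv_norm (tf_eval G z)) ` {z. cmod z = 1})"
    by (rule bdd_aboveI2[of _ _ "real r * real c * \<bar>B\<bar>"])
       (auto intro!: sv_norm_mat_bound(3)[OF tf_eval_carrier[OF G(1)] c] mb)
  have le: "sv_norm (tf_eval G z) \<le> tf_norm G" if "cmod z = 1" for z
    unfolding tf_norm_def using bdd that by (intro cSUP_upper) auto
  show "0 \<le> tf_norm G"
    using le[of 1] sv_norm_mat_bound(1)[OF tf_eval_carrier[OF G(1)] c, of 1] by simp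
  show "mat_bound (tf_eval G z) (tf_norm G)" if "cmod z = 1"
    using sv_norm_mat_bound(2)[OF tf_eval_carrier[OF G(1)] c, of z] le[OF that]
    unfolding mat_bound_iff_op_bound[OF tf_eval_carrier[OF G(1)]] by (rule op_bound_mono)
qed

lemma tf_norm_le:
  assumes G: "G \<in> carrier_mat r c" and c: "0 < c" and b: "0 \<le> b" "\<And>z. cmod z = 1 \<Longrightarrow> mat_bound (tf_eval G z) b"
  shows "tf_norm G \<le> b"
  unfolding tf_norm_def
proof (rule cSUP_least)
  show "{z::complex. cmod z = 1} \<noteq> {}" by (auto intro: exI[of _ 1])
qed (auto intro!: sv_norm_mat_bound(3)[OF tf_eval_carrier[OF G] c] b)

section \<open>Resolvents and powers of a stable matrix\<close>

lemma char_poly_roots_stable: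
  assumes A: "A \<in> carrier_mat n n" "schur_stable A" and z: "poly (cpoly (char_poly A)) z = 0"
  shows "cmod z < 1"
proof -
  have "poly (char_poly (map_mat complex_of_real A)) z = 0"
    using z by (simp add: of_real_hom.char_poly_hom[OF A(1)])
  hence "z \<in> spectrum (map_mat complex_of_real A)"
    using spectrum_root_char_poly[of "map_mat complex_of_real A" n] A by auto
  thus ?thesis using A(2) by (simp add: schur_stable_def)
qed

interpretation to_fract_hom: comm_ring_hom "to_fract :: real poly \<Rightarrow> ratfun"
  by unfold_locales auto

text \<open>Over the polynomials, zI - A times its adjugate is the characteristic polynomial times
  the identity. Mapped to rational functions, this gives the inverse explicitly, with all poles
  among the eigenvalues of \<open>A\<close>.\<close>

lemma resolvent:
  assumes A: "A \<in> carrier_mat n n" "schur_stable A"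
  defines "X \<equiv> mat_inv (rf_z \<cdot>\<^sub>m 1\<^sub>m n - tf_const A)"
  shows "X \<in> carrier_mat n n" "(rf_z \<cdot>\<^sub>m 1\<^sub>m n - tf_const A) * X = 1\<^sub>m n" "tf_circle X"
proof -
  define M where "M = rf_z \<cdot>\<^sub>m 1\<^sub>m n - tf_const A"
  define P where "P = char_poly_matrix A"
  have P: "P \<in> carrier_mat n n" using A by (simp add: P_def)
  have M: "M \<in> carrier_mat n n" unfolding M_def using A by (intro minus_carrier_mat tf_const_carrier)
  have MP: "M = map_mat to_fract P"
  proof (rule eq_matI)
    fix i j assume "i < dim_row (map_mat to_fract P)" "j < dim_col (map_mat to_fract P)"
    hence ij: "i < n" "j < n" using P by auto
    have neg: "[:- a:] = - [:a:]" for a :: real by simp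
    have "M $$ (i, j) = (if i = j then rf_z else 0) - rf_const (A $$ (i, j))"
      using A ij by (simp add: M_def tf_const_def)
    also have "\<dots> = to_fract ((if i = j then [:0, 1:] else 0) + [:- A $$ (i, j):])"
      unfolding neg to_fract_add to_fract_uminus rf_const_def rf_z_def by simp
    also have "(if i = j then [:0, 1:] else 0) + [:- A $$ (i, j):] = P $$ (i, j)"
      using A ij by (simp add: P_def char_poly_matrix_def)
    finally show "M $$ (i, j) = map_mat to_fract P $$ (i, j)" using P ij by simp
  qed (use M P in auto)
  define p where "p = char_poly A"
  have p0: "p \<noteq> 0"
    unfolding p_def using degree_monic_char_poly[OF A(1)] by (metis coeff_0 zero_neq_one)
  define Y where "Y = inverse (to_fract p) \<cdot>\<^sub>m map_mat to_fract (adj_mat P)"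
  have adj: "adj_mat P \<in> carrier_mat n n" "P * adj_mat P = p \<cdot>\<^sub>m 1\<^sub>m n"
    using adj_mat[OF P] by (auto simp: p_def P_def char_poly_def)
  have Y: "Y \<in> carrier_mat n n" using adj by (simp add: Y_def)
  have "M * map_mat to_fract (adj_mat P) = map_mat to_fract (P * adj_mat P)"
    unfolding MP by (rule to_fract_hom.mat_hom_mult[OF P adj(1), symmetric])
  also have "\<dots> = to_fract p \<cdot>\<^sub>m 1\<^sub>m n"
    unfolding adj(2) by (intro eq_matI) auto
  finally have "M * Y = 1\<^sub>m n"
    unfolding Y_def using M adj p0 by (simp add: mult_smult_distrib[OF M, of _ n]) (intro eq_matI, auto)
  from mat_inv_inverse[OF M Y this] have XY: "X = Y" by (simp add: X_def M_def)
  show "X \<in> carrier_mat n n" by (simp add: XY Y)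
  show "(rf_z \<cdot>\<^sub>m 1\<^sub>m n - tf_const A) * X = 1\<^sub>m n" using \<open>M * Y = 1\<^sub>m n\<close> by (simp add: XY M_def)
  show "tf_circle X"
    unfolding tf_circle_def XY
  proof (intro allI impI)
    fix i j assume "i < dim_row Y" "j < dim_col Y"
    hence "Y $$ (i, j) = to_fract (adj_mat P $$ (i, j)) / to_fract p"
      using adj by (simp add: Y_def field_simps)
    thus "rf_circle (Y $$ (i, j))"
      by (rule rf_circle_if_disc_poles[OF _ p0]) (use char_poly_roots_stable[OF A] in \<open>simp add: p_def\<close>)
  qed
qed

lemma state_space_circle:
  assumes A: "A \<in> carrier_mat n n" "schur_stable A"
    and "B \<in> carrier_mat n m" "C \<in> carrier_mat p n" "D \<in> carrier_mat p m"
  shows "state_space n A B C D \<in> carrier_mat p m" "tf_circle (state_space n A B C D)"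
proof -
  let ?X = "mat_inv (rf_z \<cdot>\<^sub>m 1\<^sub>m n - tf_const A)"
  have X: "?X \<in> carrier_mat n n" "tf_circle ?X" using resolvent[OF A] by auto
  have BC: "tf_const B \<in> carrier_mat n m" "tf_const C \<in> carrier_mat p n" "tf_const D \<in> carrier_mat p m"
    using assms by auto
  have c: "tf_const C * ?X \<in> carrier_mat p n" "tf_circle (tf_const C * ?X)"
    using mult_carrier_mat[OF BC(2) X(1)] tf_circle_mult[OF BC(2) X(1) tf_circle_const X(2)] by auto
  have c2: "tf_const C * ?X * tf_const B \<in> carrier_mat p m" "tf_circle (tf_const C * ?X * tf_const B)"
    using mult_carrier_mat[OF c(1) BC(1)] tf_circle_mult[OF c(1) BC(1) c(2) tf_circle_const] by auto
  show "state_space n A B C D \<in> carrier_mat p m" "tf_circle (state_space n A B C D)"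
    unfolding state_space_def using c2 BC(3) by (auto intro: tf_circle_add)
qed

lemma smult_pow_mat_index:
  fixes A :: "'a::comm_semiring_1 mat"
  assumes A: "A \<in> carrier_mat n n"
  shows "i < n \<Longrightarrow> j < n \<Longrightarrow> ((a \<cdot>\<^sub>m A) ^\<^sub>m k) $$ (i, j) = a ^ k * (A ^\<^sub>m k) $$ (i, j)"
proof (induction k arbitrary: i j)
  case 0
  thus ?case using A by simp
next
  case (Suc k)
  have c: "(a \<cdot>\<^sub>m A) ^\<^sub>m k \<in> carrier_mat n n" "a \<cdot>\<^sub>m A \<in> carrier_mat n n" "A ^\<^sub>m k \<in> carrier_mat n n"
    using A by auto
  show ?case
    unfolding pow_mat.simps index_mult_mat_sum[OF c(1,2) Suc.prems] index_mult_mat_sum[OF c(3) A Suc.prems]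
      sum_distrib_left
    using Suc A by (intro sum.cong refl) (simp add: mult_ac)
qed

text \<open>Dividing by a number r between the spectral radius and 1 leaves a matrix of spectral
  radius below 1, whose powers are bounded; the bound is then rescaled by r^k. The empty matrix has
  no eigenvalues and is treated apart.\<close>

lemma schur_stable_power_bound:
  assumes A: "A \<in> carrier_mat n n" "schur_stable A"
  obtains b r :: real where "0 < r" "r < 1" "\<And>k i j. i < n \<Longrightarrow> j < n \<Longrightarrow> \<bar>(A ^\<^sub>m k) $$ (i, j)\<bar> \<le> b * r ^ k"
proof (cases "n = 0")
  case True
  thus ?thesis using that[of "1/2" 0] by simp
next
  case False
  define H where "H = map_mat complex_of_real A"
  have H: "H \<in> carrier_mat n n" using A by (simp add: H_def)
  have n: "0 < n" using False by simp
  obtain k where k: "k \<in> spectrum H" "spectral_radius H = cmod k" using spectral_radius_mem_max(1)[OF H n] by auto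
  have "cmod k < 1" using A(2) k(1) by (simp add: schur_stable_def H_def)
  then obtain r where r: "cmod k < r" "r < 1" using dense by blast
  have r0: "0 < r" using r(1) norm_ge_zero[of k] by linarith
  have Hr: "cmod l < r" if "l \<in> spectrum H" for l
    using spectral_radius_mem_max(2)[OF H n, of "cmod l"] that k(2) r(1) by auto
  define K where "K = of_real (1 / r) \<cdot>\<^sub>m H"
  have K: "K \<in> carrier_mat n n" using H by (simp add: K_def)
  have "spectral_radius K < 1"
  proof -
    obtain l where l: "l \<in> spectrum K" "spectral_radius K = cmod l"
      using spectral_radius_mem_max(1)[OF K n] by auto
    then obtain u where u: "u \<in> carrier_vec n" "u \<noteq> 0\<^sub>v n" "K *\<^sub>v u = l \<cdot>\<^sub>v u"
      using K by (auto simp: spectrum_def eigenvalue_def eigenvector_def)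
    have "H *\<^sub>v u = of_real r \<cdot>\<^sub>v (K *\<^sub>v u)"
      using u(1) H r0 by (intro eq_vecI) (auto simp: K_def)
    hence "H *\<^sub>v u = (of_real r * l) \<cdot>\<^sub>v u" unfolding u(3) by (simp add: smult_smult_assoc)
    hence "of_real r * l \<in> spectrum H"
      using u(1,2) H by (auto simp: spectrum_def eigenvalue_def eigenvector_def)
    from Hr[OF this] have "r * cmod l < r * 1" using r0 by (simp add: norm_mult)
    thus ?thesis using mult_less_cancel_left_pos[OF r0] by (simp only: l(2))
  qed
  then obtain b where b: "\<And>k. norm_bound (K ^\<^sub>m k) b"
    using spectral_radius_jnf_norm_bound_less_1_upper_triangular[OF K] by blast
  show ?thesis
  proof (rule that[OF r0 r(2)])
    fix k i j assume ij: "i < n" "j < n"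
    have "H ^\<^sub>m k = map_mat complex_of_real (A ^\<^sub>m k)"
      unfolding H_def by (rule of_real_hom.mat_hom_pow[OF A(1), symmetric])
    moreover have "map_mat complex_of_real (A ^\<^sub>m k) $$ (i, j) = of_real ((A ^\<^sub>m k) $$ (i, j))"
      using ij pow_carrier_mat[OF A(1), of k] by (intro index_map_mat) auto
    ultimately have "(K ^\<^sub>m k) $$ (i, j) = of_real ((1 / r) ^ k * (A ^\<^sub>m k) $$ (i, j))"
      unfolding K_def smult_pow_mat_index[OF H ij] by (simp only: of_real_mult of_real_power)
    moreover have "cmod ((K ^\<^sub>m k) $$ (i, j)) \<le> b"
      using b[of k] K ij by (simp add: norm_bound_def)
    ultimately have "\<bar>(1 / r) ^ k * (A ^\<^sub>m k) $$ (i, j)\<bar> \<le> b" by (simp only: norm_of_real)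
    thus "\<bar>(A ^\<^sub>m k) $$ (i, j)\<bar> \<le> b * r ^ k"
      using r0 by (simp add: abs_mult power_divide field_simps)
  qed
qed

lemma schur_stable_power_summable:
  assumes A: "A \<in> carrier_mat n n" "schur_stable A" and ij: "i < n" "j < n"
  shows "summable (\<lambda>k. \<bar>(A ^\<^sub>m k) $$ (i, j)\<bar>)"
proof -
  obtain b r :: real where r: "0 < r" "r < 1" and b: "\<And>k i j. i < n \<Longrightarrow> j < n \<Longrightarrow> \<bar>(A ^\<^sub>m k) $$ (i, j)\<bar> \<le> b * r ^ k"
    by (rule schur_stable_power_bound[OF A], rule that)
  have "summable (\<lambda>k. b * r ^ k)" using r by (intro summable_mult summable_geometric) simp
  thus ?thesis by (rule summable_comparison_test'[where N = 0]) (simp only: real_norm_def abs_idempotent b[OF ij])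
qed

subsection \<open>Hankel operators\<close>

definition entry_coeff :: "tfm \<Rightarrow> nat \<Rightarrow> nat \<Rightarrow> nat \<Rightarrow> real" where
  "entry_coeff F k i j = rf_coeff (F $$ (i, j)) k"

lemma entry_coeff_summable:
  "F \<in> RHinf q p \<Longrightarrow> i < q \<Longrightarrow> j < p \<Longrightarrow> summable (\<lambda>k. \<bar>entry_coeff F k i j\<bar>)"
  unfolding entry_coeff_def by (rule rf_stable_expansion(1)) (simp add: RHinf_iff)

lemma tf_eval_expansion:
  "F \<in> RHinf q p \<Longrightarrow> i < q \<Longrightarrow> j < p \<Longrightarrow> cmod z = 1 \<Longrightarrow>
     tf_eval F z $$ (i, j) = (\<Sum>k. of_real (entry_coeff F k i j) * inverse z ^ k)"
  unfolding entry_coeff_def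
  by (subst rf_stable_expansion(2)[symmetric]) (auto simp: RHinf_iff tf_eval_def)

text \<open>Each half of a circle series is supported on an image of the natural numbers, so sums
  over the integers become ordinary series. The last claim records the default value 0 of a
  divergent sum.\<close>

lemma infsum_supported_nat:
  fixes \<phi> :: "int \<Rightarrow> real" and \<iota> :: "nat \<Rightarrow> int"
  assumes "inj \<iota>" "\<And>m. 0 \<le> \<phi> m" "\<forall>m. m \<notin> range \<iota> \<longrightarrow> \<phi> m = 0"
  shows "\<phi> summable_on UNIV \<longleftrightarrow> summable (\<lambda>t. \<phi> (\<iota> t))"
    and "summable (\<lambda>t. \<phi> (\<iota> t)) \<Longrightarrow> (\<Sum>\<^sub>\<infinity>m. \<phi> m) = (\<Sum>t. \<phi> (\<iota> t))"
    and "\<not> summable (\<lambda>t. \<phi> (\<iota> t)) \<Longrightarrow> (\<Sum>\<^sub>\<infinity>m. \<phi> m) = 0"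
proof -
  have 1: "\<phi> summable_on UNIV \<longleftrightarrow> \<phi> summable_on range \<iota>"
    using assms(3) by (intro summable_on_cong_neutral) auto
  also have "\<dots> \<longleftrightarrow> (\<phi> \<circ> \<iota>) summable_on UNIV" by (rule summable_on_reindex[OF assms(1)])
  also have "\<dots> \<longleftrightarrow> summable (\<lambda>t. \<phi> (\<iota> t))"
    unfolding comp_def by (rule summable_on_UNIV_nonneg_real_iff) (rule assms(2))
  finally show S: "\<phi> summable_on UNIV \<longleftrightarrow> summable (\<lambda>t. \<phi> (\<iota> t))" .
  show "(\<Sum>\<^sub>\<infinity>m. \<phi> m) = 0" if "\<not> summable (\<lambda>t. \<phi> (\<iota> t))"
    using S that by (simp add: infsum_not_exists)
  show "(\<Sum>\<^sub>\<infinity>m. \<phi> m) = (\<Sum>t. \<phi> (\<iota> t))" if s: "summable (\<lambda>t. \<phi> (\<iota> t))"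
  proof -
    have "(\<Sum>\<^sub>\<infinity>m. \<phi> m) = infsum \<phi> (range \<iota>)"
      using assms(3) by (intro infsum_cong_neutral) auto
    also have "\<dots> = infsum (\<phi> \<circ> \<iota>) UNIV" by (rule infsum_reindex[OF assms(1)])
    also have "\<dots> = (\<Sum>t. \<phi> (\<iota> t))"
      unfolding comp_def by (intro infsumI sums_nonneg_imp_has_sum summable_sums s assms(2))
    finally show ?thesis .
  qed
qed

lemma vec_norm_sq_nonneg [simp]: "0 \<le> vec_norm_sq v"
  by (simp add: vec_norm_sq_def sum_nonneg)

lemma vec_norm_sq_zero [simp]: "vec_norm_sq (0\<^sub>v n) = 0"
  by (simp add: vec_norm_sq_def)

lemma H2_perp_norm:
  assumes "g \<in> H2_perp p"
  shows "summable (\<lambda>t. vec_norm_sq (g (int t + 1)))" "(L2_norm g)\<^sup>2 = (\<Sum>t. vec_norm_sq (g (int t + 1)))"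
proof -
  have r: "m \<in> range (\<lambda>t. int t + 1)" if "0 < m" for m
    using that by (intro image_eqI[of _ _ "nat (m - 1)"]) auto
  have z: "\<forall>m. m \<notin> range (\<lambda>t. int t + 1) \<longrightarrow> vec_norm_sq (g m) = 0"
  proof (intro allI impI)
    fix m assume "m \<notin> range (\<lambda>t. int t + 1)"
    hence "m \<le> 0" using r[of m] by linarith
    hence "g m = 0\<^sub>v p" using assms unfolding H2_perp_def by blast
    thus "vec_norm_sq (g m) = 0" by simp
  qed
  have i: "inj (\<lambda>t. int t + 1)" by (auto simp: inj_def)
  have S: "(\<lambda>m. vec_norm_sq (g m)) summable_on UNIV" using assms by (simp add: H2_perp_def L2_space_def)
  note I = infsum_supported_nat[of "\<lambda>t. int t + 1" "\<lambda>m. vec_norm_sq (g m)", OF i vec_norm_sq_nonneg z]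
  show s: "summable (\<lambda>t. vec_norm_sq (g (int t + 1)))" using I(1) S by simp
  show "(L2_norm g)\<^sup>2 = (\<Sum>t. vec_norm_sq (g (int t + 1)))"
    unfolding L2_norm_def I(2)[OF s] using s by (simp add: suminf_nonneg)
qed

text \<open>The coefficient of z^(-s) in F g is the sum of F_k g_(k-s). Since g vanishes at indices
  up to 0, the sum starts with k = s + 1, and k = s + t + 1 gives the Hankel form. The unordered sum
  is an ordinary series because the coefficients of \<open>F\<close> are absolutely summable and
  those of g are bounded by its norm.\<close>

lemma hankel_op_coeff:
  assumes F: "F \<in> RHinf q p" and g: "g \<in> H2_perp p" and i: "i < q"
  shows "hankel_op F g (- int s) $ i = (\<Sum>t. \<Sum>j<p. of_real (entry_coeff F (s + t + 1) i j) * g (int t + 1) $ j)"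
    and "summable (\<lambda>t. \<Sum>j<p. of_real (entry_coeff F (s + t + 1) i j) * g (int t + 1) $ j)"
proof -
  have Fc: "F \<in> carrier_mat q p" using F by (rule RHinf_carrier)
  have gc: "g m \<in> carrier_vec p" and g0: "m \<le> 0 \<Longrightarrow> g m = 0\<^sub>v p" for m
    using g by (auto simp: H2_perp_def L2_space_def)
  define a where "a k = (\<Sum>j<p. of_real (entry_coeff F k i j) * g (- int s + int k) $ j)" for k
  define B where "B = (L2_norm g)\<^sup>2"
  have B: "vec_norm_sq (g (int t + 1)) \<le> B" for t
    unfolding B_def H2_perp_norm(2)[OF g]
    using sum_le_suminf[OF H2_perp_norm(1)[OF g], of "{t}"] by simp
  have gb: "cmod (g m $ j) \<le> sqrt B" if "j < p" for m j
  proof (cases "m \<le> 0")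
    case True
    thus ?thesis using g0[OF True] that by (simp add: B_def L2_norm_def infsum_nonneg)
  next
    case False
    then obtain t where t: "m = int t + 1" by (intro that[of "nat (m - 1)"]) simp
    have "(cmod (g m $ j))\<^sup>2 \<le> vec_norm_sq (g m)"
      unfolding vec_norm_sq_def using gc[of m] that
      by (intro member_le_sum) auto
    also have "\<dots> \<le> B" using B[of t] by (simp add: t)
    finally show ?thesis by (rule real_le_rsqrt)
  qed
  have an: "summable (\<lambda>k. norm (a k))"
  proof (rule summable_comparison_test'[of "\<lambda>k. \<Sum>j<p. \<bar>entry_coeff F k i j\<bar> * sqrt B" 0])
    show "summable (\<lambda>k. \<Sum>j<p. \<bar>entry_coeff F k i j\<bar> * sqrt B)"
      by (intro summable_sum summable_mult2 entry_coeff_summable[OF F i]) auto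
    show "norm (norm (a k)) \<le> (\<Sum>j<p. \<bar>entry_coeff F k i j\<bar> * sqrt B)" for k
      unfolding a_def real_norm_def abs_norm_cancel
      by (intro order_trans[OF norm_sum] sum_mono) (auto simp: norm_mult intro!: mult_left_mono gb)
  qed
  have a0: "a k = 0" if "k < Suc s" for k
    using g0[of "- int s + int k"] that by (simp add: a_def)
  have shift: "a (k + Suc s) = (\<Sum>j<p. of_real (entry_coeff F (s + k + 1) i j) * g (int k + 1) $ j)" for k
    by (simp add: a_def add_ac)
  show "summable (\<lambda>t. \<Sum>j<p. of_real (entry_coeff F (s + t + 1) i j) * g (int t + 1) $ j)"
    unfolding shift[symmetric] by (rule summable_ignore_initial_segment[OF summable_norm_cancel[OF an]])
  have dimF: "dim_row (tf_coeff F k) = q" "dim_col (tf_coeff F k) = p" for k using Fc by (auto simp: tf_coeff_def)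
  have "hankel_op F g (- int s) $ i = (\<Sum>\<^sub>\<infinity>k. (map_mat complex_of_real (tf_coeff F k) *\<^sub>v g (- int s + int k)) $ i)"
    using Fc i by (simp add: hankel_op_def H2_proj_def tf_mult_series_def)
  also have "\<dots> = (\<Sum>\<^sub>\<infinity>k. a k)"
  proof (rule infsum_cong)
    fix k
    show "(map_mat complex_of_real (tf_coeff F k) *\<^sub>v g (- int s + int k)) $ i = a k"
      using Fc i gc[of "- int s + int k"]
      by (simp add: a_def scalar_prod_def atLeast0LessThan tf_coeff_def entry_coeff_def)
  qed
  also have "\<dots> = (\<Sum>k. a k)"
    by (intro infsumI norm_summable_imp_has_sum an summable_sums summable_norm_cancel[OF an])
  also have "\<dots> = (\<Sum>k. a (k + Suc s)) + (\<Sum>k<Suc s. a k)"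
    by (rule suminf_split_initial_segment[OF summable_norm_cancel[OF an]])
  also have "(\<Sum>k<Suc s. a k) = 0" using a0 by (intro sum.neutral) auto
  finally show "hankel_op F g (- int s) $ i = (\<Sum>t. \<Sum>j<p. of_real (entry_coeff F (s + t + 1) i j) * g (int t + 1) $ j)"
    unfolding shift by simp
qed

lemma hankel_op_dim: "F \<in> carrier_mat q p \<Longrightarrow> dim_vec (hankel_op F g m) = q"
  by (simp add: hankel_op_def H2_proj_def tf_mult_series_def)

lemma hankel_op_norm:
  assumes F: "F \<in> RHinf q p"
  shows "summable (\<lambda>s. vec_norm_sq (hankel_op F g (- int s))) \<Longrightarrow>
      (L2_norm (hankel_op F g))\<^sup>2 = (\<Sum>s. vec_norm_sq (hankel_op F g (- int s)))"
    and "\<not> summable (\<lambda>s. vec_norm_sq (hankel_op F g (- int s))) \<Longrightarrow> L2_norm (hankel_op F g) = 0"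
proof -
  have r: "m \<in> range (\<lambda>s. - int s)" if "m \<le> 0" for m
    using that by (intro image_eqI[of _ _ "nat (- m)"]) auto
  have z: "\<forall>m. m \<notin> range (\<lambda>s. - int s) \<longrightarrow> vec_norm_sq (hankel_op F g m) = 0"
  proof (intro allI impI)
    fix m assume "m \<notin> range (\<lambda>s. - int s)"
    hence "\<not> m \<le> 0" using r[of m] by blast
    thus "vec_norm_sq (hankel_op F g m) = 0" by (simp add: hankel_op_def H2_proj_def)
  qed
  have i: "inj (\<lambda>s. - int s)" by (auto simp: inj_def)
  note I = infsum_supported_nat[of "\<lambda>s. - int s" "\<lambda>m. vec_norm_sq (hankel_op F g m)", OF i vec_norm_sq_nonneg z]
  show "(L2_norm (hankel_op F g))\<^sup>2 = (\<Sum>s. vec_norm_sq (hankel_op F g (- int s)))"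
    if s: "summable (\<lambda>s. vec_norm_sq (hankel_op F g (- int s)))"
    unfolding L2_norm_def I(2)[OF s] using s by (simp add: suminf_nonneg)
  show "L2_norm (hankel_op F g) = 0" if s: "\<not> summable (\<lambda>s. vec_norm_sq (hankel_op F g (- int s)))"
    unfolding L2_norm_def using I(3)[OF s] by simp
qed

lemma hankel_bounded_complex:
  fixes g :: "nat \<Rightarrow> nat \<Rightarrow> complex"
  assumes "hankel_bounded q p f c"
  shows "(\<Sum>s<I. \<Sum>i<q. (cmod (\<Sum>t<K. \<Sum>j<p. of_real (f (s + t + 1) i j) * g t j))\<^sup>2)
     \<le> c\<^sup>2 * (\<Sum>t<K. \<Sum>j<p. (cmod (g t j))\<^sup>2)"
proof -
  have "(\<Sum>r\<in>{..<I} \<times> {..<q}. (\<Sum>x\<in>{..<K} \<times> {..<p}. f (fst r + fst x + 1) (snd r) (snd x) * u x)\<^sup>2)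
      \<le> c\<^sup>2 * (\<Sum>x\<in>{..<K} \<times> {..<p}. (u x)\<^sup>2)" for u
    using assms[unfolded hankel_bounded_def, rule_format, where I = I and K = K and g = "\<lambda>t j. u (t, j)"]
    by (simp add: sum.cartesian_product case_prod_unfold)
  from real_contraction_complex[OF this, of "\<lambda>x. g (fst x) (snd x)"]
  show ?thesis by (simp add: sum.cartesian_product case_prod_unfold)
qed

text \<open>The finite sections of the Hankel matrix act on the truncated input, and the finitely
  many output components converge as the truncation \<open>K\<close> grows.\<close>

lemma hankel_op_partial_bound:
  assumes F: "F \<in> RHinf q p" and c: "hankel_bounded q p (entry_coeff F) c" and g: "g \<in> H2_perp p"
  shows "(\<Sum>s<I. vec_norm_sq (hankel_op F g (- int s))) \<le> c\<^sup>2 * (L2_norm g)\<^sup>2"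
proof -
  define h where "h K s i = (\<Sum>t<K. \<Sum>j<p. of_real (entry_coeff F (s + t + 1) i j) * g (int t + 1) $ j)" for K s i
  have gc: "g m \<in> carrier_vec p" for m using g by (auto simp: H2_perp_def L2_space_def)
  have lim: "(\<lambda>K. h K s i) \<longlonglongrightarrow> hankel_op F g (- int s) $ i" if "i < q" for s i
    unfolding h_def hankel_op_coeff(1)[OF F g that] by (rule summable_LIMSEQ[OF hankel_op_coeff(2)[OF F g that]])
  have "(\<lambda>K. \<Sum>s<I. \<Sum>i<q. (cmod (h K s i))\<^sup>2) \<longlonglongrightarrow> (\<Sum>s<I. \<Sum>i<q. (cmod (hankel_op F g (- int s) $ i))\<^sup>2)"
    by (intro tendsto_sum tendsto_power tendsto_norm lim) auto
  moreover have "(\<Sum>s<I. \<Sum>i<q. (cmod (h K s i))\<^sup>2) \<le> c\<^sup>2 * (L2_norm g)\<^sup>2" for K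
  proof -
    have "(\<Sum>s<I. \<Sum>i<q. (cmod (h K s i))\<^sup>2) \<le> c\<^sup>2 * (\<Sum>t<K. \<Sum>j<p. (cmod (g (int t + 1) $ j))\<^sup>2)"
      unfolding h_def by (rule hankel_bounded_complex[OF c])
    also have "(\<Sum>t<K. \<Sum>j<p. (cmod (g (int t + 1) $ j))\<^sup>2) = (\<Sum>t<K. vec_norm_sq (g (int t + 1)))"
      by (intro sum.cong refl) (simp add: vec_norm_sq_def carrier_vecD[OF gc])
    also have "\<dots> \<le> (L2_norm g)\<^sup>2"
      unfolding H2_perp_norm(2)[OF g] using H2_perp_norm(1)[OF g] by (intro sum_le_suminf) auto
    finally show ?thesis by (simp add: mult_left_mono)
  qed
  ultimately have "(\<Sum>s<I. \<Sum>i<q. (cmod (hankel_op F g (- int s) $ i))\<^sup>2) \<le> c\<^sup>2 * (L2_norm g)\<^sup>2"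
    by (intro LIMSEQ_le_const2[where X = "\<lambda>K. \<Sum>s<I. \<Sum>i<q. (cmod (h K s i))\<^sup>2"]) blast+
  thus ?thesis using hankel_op_dim[OF RHinf_carrier[OF F]] by (simp add: vec_norm_sq_def)
qed

text \<open>Summability comes first: the norm of a family that is not square summable would be the
  default value 0, and the bound would say nothing.\<close>

lemma hankel_op_bound:
  assumes F: "F \<in> RHinf q p" and c: "hankel_bounded q p (entry_coeff F) c" "0 \<le> c" and g: "g \<in> H2_perp p"
  shows "summable (\<lambda>s. vec_norm_sq (hankel_op F g (- int s)))" "L2_norm (hankel_op F g) \<le> c * L2_norm g"
proof -
  have L0: "0 \<le> L2_norm x" for x by (simp add: L2_norm_def infsum_nonneg)
  show s: "summable (\<lambda>s. vec_norm_sq (hankel_op F g (- int s)))"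
    by (rule bounded_imp_summable[where B = "c\<^sup>2 * (L2_norm g)\<^sup>2"])
       (simp_all only: vec_norm_sq_nonneg hankel_op_partial_bound[OF F c(1) g] flip: lessThan_Suc_atMost)
  have "(L2_norm (hankel_op F g))\<^sup>2 \<le> (c * L2_norm g)\<^sup>2"
    unfolding hankel_op_norm(1)[OF F s] power_mult_distrib
    by (rule suminf_le_const[OF s]) (rule hankel_op_partial_bound[OF F c(1) g])
  thus "L2_norm (hankel_op F g) \<le> c * L2_norm g"
    by (rule power2_le_imp_le) (simp add: c(2) L0)
qed

lemma L2_norm_nonneg: "0 \<le> L2_norm x"
  by (simp add: L2_norm_def infsum_nonneg)

lemma zero_H2_perp: "(\<lambda>_. 0\<^sub>v p) \<in> H2_perp p" "L2_norm (\<lambda>_. 0\<^sub>v p) = 0"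
  by (simp_all add: H2_perp_def L2_space_def L2_norm_def)

lemma hankel_norm_le:
  assumes F: "F \<in> RHinf q p" and c: "hankel_bounded q p (entry_coeff F) c" "0 \<le> c"
  shows "hankel_norm F \<le> c"
proof -
  have Fc: "dim_col F = p" using RHinf_carrier[OF F] by simp
  show ?thesis unfolding hankel_norm_def Fc
  proof (rule cSUP_least)
    show "{g \<in> H2_perp p. L2_norm g \<le> 1} \<noteq> {}" using zero_H2_perp[of p] by force
    fix g assume g: "g \<in> {g \<in> H2_perp p. L2_norm g \<le> 1}"
    have "L2_norm (hankel_op F g) \<le> c * L2_norm g" using g by (intro hankel_op_bound(2)[OF F c]) auto
    also have "\<dots> \<le> c * 1" using g c(2) by (intro mult_left_mono) auto
    finally show "L2_norm (hankel_op F g) \<le> c" by simp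
  qed
qed

lemma finite_series_H2_perp:
  fixes u :: "nat \<Rightarrow> nat \<Rightarrow> real" and K p :: nat
  defines "g \<equiv> (\<lambda>m. if 1 \<le> m \<and> m \<le> int K then vec p (\<lambda>j. complex_of_real (u (nat (m - 1)) j)) else 0\<^sub>v p)"
  shows "g \<in> H2_perp p" "(L2_norm g)\<^sup>2 = (\<Sum>t<K. \<Sum>j<p. (u t j)\<^sup>2)"
proof -
  show g: "g \<in> H2_perp p"
  proof -
    have "(\<lambda>m. vec_norm_sq (g m)) summable_on UNIV \<longleftrightarrow> (\<lambda>m. vec_norm_sq (g m)) summable_on {1..int K}"
      by (intro summable_on_cong_neutral) (auto simp: g_def)
    hence "(\<lambda>m. vec_norm_sq (g m)) summable_on UNIV" by simp
    thus ?thesis by (auto simp: H2_perp_def L2_space_def g_def)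
  qed
  have e: "vec_norm_sq (g (int t + 1)) = (if t < K then \<Sum>j<p. (u t j)\<^sup>2 else 0)" for t
    by (auto simp: g_def vec_norm_sq_def)
  show "(L2_norm g)\<^sup>2 = (\<Sum>t<K. \<Sum>j<p. (u t j)\<^sup>2)"
    unfolding H2_perp_norm(2)[OF g] e by (subst suminf_finite[of "{..<K}"]) auto
qed

text \<open>Some bound \<open>c\<close> has to be known beforehand, as the supremum in
  \<open>hankel_norm\<close> is meaningful only for a bounded set. The sections are then tested by
  finite real inputs, scaled to norm 1.\<close>

lemma hankel_norm_bounded:
  assumes F: "F \<in> RHinf q p" and c: "hankel_bounded q p (entry_coeff F) c" "0 \<le> c"
  shows "0 \<le> hankel_norm F" "hankel_bounded q p (entry_coeff F) (hankel_norm F)"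
proof -
  have Fc: "dim_col F = p" using RHinf_carrier[OF F] by simp
  have bdd: "bdd_above ((\<lambda>g. L2_norm (hankel_op F g)) ` {g \<in> H2_perp p. L2_norm g \<le> 1})"
  proof (rule bdd_aboveI2)
    fix g assume g: "g \<in> {g \<in> H2_perp p. L2_norm g \<le> 1}"
    have "L2_norm (hankel_op F g) \<le> c * L2_norm g" using g by (intro hankel_op_bound(2)[OF F c]) auto
    also have "\<dots> \<le> c * 1" using g c(2) by (intro mult_left_mono) auto
    finally show "L2_norm (hankel_op F g) \<le> c" by simp
  qed
  have up: "L2_norm (hankel_op F g) \<le> hankel_norm F" if "g \<in> H2_perp p" "L2_norm g \<le> 1" for g
    unfolding hankel_norm_def Fc using that by (intro cSUP_upper bdd) auto
  show nn: "0 \<le> hankel_norm F"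
    by (rule order_trans[OF L2_norm_nonneg up[OF zero_H2_perp(1)]]) (simp add: zero_H2_perp(2))
  show "hankel_bounded q p (entry_coeff F) (hankel_norm F)"
    unfolding hankel_bounded_def
  proof (intro allI)
    fix I K and u :: "nat \<Rightarrow> nat \<Rightarrow> real"
    define G where "G = (\<Sum>t<K. \<Sum>j<p. (u t j)\<^sup>2)"
    define X where "X v = (\<Sum>s<I. \<Sum>i<q. (\<Sum>t<K. \<Sum>j<p. entry_coeff F (s + t + 1) i j * v t j)\<^sup>2)" for v
    have G0: "0 \<le> G" by (auto simp: G_def intro!: sum_nonneg)
    have X1: "X v \<le> (hankel_norm F)\<^sup>2" if v: "(\<Sum>t<K. \<Sum>j<p. (v t j)\<^sup>2) \<le> 1" for v
    proof -
      define g where "g = (\<lambda>m. if 1 \<le> m \<and> m \<le> int K then vec p (\<lambda>j. complex_of_real (v (nat (m - 1)) j)) else 0\<^sub>v p)"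
      have g: "g \<in> H2_perp p" "(L2_norm g)\<^sup>2 = (\<Sum>t<K. \<Sum>j<p. (v t j)\<^sup>2)"
        using finite_series_H2_perp[of K p v] by (simp_all add: g_def)
      have "(L2_norm g)\<^sup>2 \<le> 1\<^sup>2" using v g(2) by simp
      hence g1: "L2_norm g \<le> 1" by (rule power2_le_imp_le) simp
      have hs: "hankel_op F g (- int s) $ i = of_real (\<Sum>t<K. \<Sum>j<p. entry_coeff F (s + t + 1) i j * v t j)"
        if "i < q" for s i
      proof -
        have "(\<Sum>t. \<Sum>j<p. of_real (entry_coeff F (s + t + 1) i j) * g (int t + 1) $ j)
            = (\<Sum>t<K. \<Sum>j<p. of_real (entry_coeff F (s + t + 1) i j) * g (int t + 1) $ j)"
          by (rule suminf_finite) (auto simp: g_def)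
        also have "\<dots> = (\<Sum>t<K. \<Sum>j<p. of_real (entry_coeff F (s + t + 1) i j * v t j))"
          by (intro sum.cong refl) (auto simp: g_def)
        finally show ?thesis unfolding hankel_op_coeff(1)[OF F g(1) that] by simp
      qed
      have "X v = (\<Sum>s<I. vec_norm_sq (hankel_op F g (- int s)))"
        unfolding X_def vec_norm_sq_def hankel_op_dim[OF RHinf_carrier[OF F]]
        by (intro sum.cong refl) (simp add: hs del: of_real_sum)
      also have "\<dots> \<le> (L2_norm (hankel_op F g))\<^sup>2"
        unfolding hankel_op_norm(1)[OF F hankel_op_bound(1)[OF F c g(1)]]
        by (intro sum_le_suminf hankel_op_bound(1)[OF F c g(1)]) auto
      also have "\<dots> \<le> (hankel_norm F)\<^sup>2"
        using up[OF g(1) g1] by (intro power_mono L2_norm_nonneg)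
      finally show ?thesis .
    qed
    have scale: "X (\<lambda>t j. a * u t j) = a\<^sup>2 * X u" for a
      by (simp add: X_def power_mult_distrib[symmetric] sum_distrib_left mult_ac)
    have "X u \<le> (hankel_norm F)\<^sup>2 * G"
    proof (cases "G = 0")
      case True
      have "\<forall>t<K. \<forall>j<p. u t j = 0"
        using True unfolding G_def by (simp add: sum_nonneg_eq_0_iff sum_nonneg)
      hence "X u = 0" by (simp add: X_def)
      thus ?thesis using True by simp
    next
      case False
      hence Gp: "0 < G" using G0 by simp
      have "(\<Sum>t<K. \<Sum>j<p. (1 / sqrt G * u t j)\<^sup>2) = G / G"
        unfolding power_mult_distrib sum_distrib_left[symmetric] using Gp
        by (simp add: G_def[symmetric] power_divide)
      hence "X (\<lambda>t j. 1 / sqrt G * u t j) \<le> (hankel_norm F)\<^sup>2" using Gp by (intro X1) simp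
      thus ?thesis unfolding scale using Gp by (simp add: power_divide field_simps)
    qed
    thus "(\<Sum>s<I. \<Sum>i<q. (\<Sum>t<K. \<Sum>j<p. entry_coeff F (s + t + 1) i j * u t j)\<^sup>2)
       \<le> (hankel_norm F)\<^sup>2 * (\<Sum>t<K. \<Sum>j<p. (u t j)\<^sup>2)" by (simp add: X_def G_def)
  qed
qed

subsection \<open>From the matrix inequalities to the Hankel norm\<close>

lemma append_cols_mult_vec:
  fixes X Y :: "'a::comm_ring_1 mat"
  assumes "X \<in> carrier_mat r a" "Y \<in> carrier_mat r b" "u \<in> carrier_vec a" "v \<in> carrier_vec b"
  shows "(X @\<^sub>c Y) *\<^sub>v (u @\<^sub>v v) = X *\<^sub>v u + Y *\<^sub>v v"
proof -
  have "(X @\<^sub>c Y) *\<^sub>v (u @\<^sub>v v) = (X *\<^sub>v u + Y *\<^sub>v v) @\<^sub>v (0\<^sub>m 0 a *\<^sub>v u + 0\<^sub>m 0 b *\<^sub>v v)"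
    unfolding append_cols_def using assms by (subst four_block_mat_mult_vec[of _ r a _ b _ 0]) auto
  also have "\<dots> = X *\<^sub>v u + Y *\<^sub>v v" using assms by (intro eq_vecI) auto
  finally show ?thesis .
qed

lemma append_cols_carrier [simp]:
  "X \<in> carrier_mat r a \<Longrightarrow> Y \<in> carrier_mat r b \<Longrightarrow> X @\<^sub>c Y \<in> carrier_mat r (a + b)"
  unfolding append_cols_def carrier_mat_def by simp

lemma carrier_vec_split:
  assumes "v \<in> carrier_vec (a + b)"
  obtains x y where "x \<in> carrier_vec a" "y \<in> carrier_vec b" "v = x @\<^sub>v y"
  using that[of "vec_first v a" "vec_last v b"] assms by simp

section \<open>Quadratic forms of symmetric matrices\<close>

lemma symmetric_matI:
  fixes M :: "real mat"
  assumes M: "M \<in> carrier_mat n n"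
    and s: "\<And>u v. u \<in> carrier_vec n \<Longrightarrow> v \<in> carrier_vec n \<Longrightarrow> u \<bullet> (M *\<^sub>v v) = v \<bullet> (M *\<^sub>v u)"
  shows "transpose_mat M = M"
proof (rule eq_matI)
  have e: "unit_vec n i \<bullet> (M *\<^sub>v unit_vec n j) = M $$ (i, j)" if "i < n" "j < n" for i j
    using M that by simp
  fix i j assume "i < dim_row M" "j < dim_col M"
  hence ij: "i < n" "j < n" using M by auto
  have "M $$ (j, i) = M $$ (i, j)"
    using s[of "unit_vec n j" "unit_vec n i"] e[OF ij] e[OF ij(2,1)] by simp
  thus "transpose_mat M $$ (i, j) = M $$ (i, j)" using M ij by simp
qed (use M in auto)

lemma symmetric_form:
  fixes M :: "real mat"
  assumes M: "M \<in> carrier_mat n n" "transpose_mat M = M" and v: "u \<in> carrier_vec n" "v \<in> carrier_vec n"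
  shows "u \<bullet> (M *\<^sub>v v) = v \<bullet> (M *\<^sub>v u)"
proof -
  have "u \<bullet> (M *\<^sub>v v) = (transpose_mat M *\<^sub>v u) \<bullet> v"
    by (rule transpose_vec_mult_scalar[OF M(1) v(2,1), symmetric])
  also have "\<dots> = v \<bullet> (M *\<^sub>v u)"
    unfolding M(2) using M v by (intro comm_scalar_prod[of _ n]) auto
  finally show ?thesis .
qed

lemma form_diff:
  fixes M :: "real mat"
  assumes M: "M \<in> carrier_mat n n" "transpose_mat M = M" and v: "u \<in> carrier_vec n" "v \<in> carrier_vec n"
  shows "(a \<cdot>\<^sub>v u - b \<cdot>\<^sub>v v) \<bullet> (M *\<^sub>v (a \<cdot>\<^sub>v u - b \<cdot>\<^sub>v v))
     = a\<^sup>2 * (u \<bullet> (M *\<^sub>v u)) - 2 * a * b * (u \<bullet> (M *\<^sub>v v)) + b\<^sup>2 * (v \<bullet> (M *\<^sub>v v))"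
proof -
  have c: "M *\<^sub>v u \<in> carrier_vec n" "M *\<^sub>v v \<in> carrier_vec n" using M v by auto
  have e: "M *\<^sub>v (a \<cdot>\<^sub>v u - b \<cdot>\<^sub>v v) = a \<cdot>\<^sub>v (M *\<^sub>v u) - b \<cdot>\<^sub>v (M *\<^sub>v v)"
    using M v by (subst mult_minus_distrib_mat_vec[of _ n n]) (auto simp: mult_mat_vec[of _ n n])
  show ?thesis unfolding e
    using c v symmetric_form[OF M v(2,1)]
    by (simp add: minus_scalar_prod_distrib[of _ n] scalar_prod_minus_distrib[of _ n] power2_eq_square algebra_simps)
qed

lemma form_young:
  fixes M :: "real mat"
  assumes M: "M \<in> carrier_mat n n" "transpose_mat M = M"
    and psd: "\<And>x. x \<in> carrier_vec n \<Longrightarrow> 0 \<le> x \<bullet> (M *\<^sub>v x)"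
    and v: "u \<in> carrier_vec n" "v \<in> carrier_vec n"
  shows "2 * (u \<bullet> (M *\<^sub>v v)) \<le> u \<bullet> (M *\<^sub>v u) + v \<bullet> (M *\<^sub>v v)"
  using psd[of "1 \<cdot>\<^sub>v u - 1 \<cdot>\<^sub>v v"] form_diff[OF M v, of 1 1] v by simp

lemma scalar_prod_self_nonneg: "0 \<le> (v :: real vec) \<bullet> v"
  by (simp add: scalar_prod_def sum_nonneg)

lemma scalar_prod_young:
  fixes u v :: "real vec"
  assumes "u \<in> carrier_vec n" "v \<in> carrier_vec n"
  shows "2 * (u \<bullet> v) \<le> u \<bullet> u + v \<bullet> v"
  using form_young[of "1\<^sub>m n" n u v] assms scalar_prod_self_nonneg by auto

text \<open>A weighted Young inequality, read off from the nonnegative value of the form at d u -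
  v.\<close>

lemma form_add_le:
  fixes M :: "real mat"
  assumes M: "M \<in> carrier_mat n n" "transpose_mat M = M"
    and psd: "\<And>x. x \<in> carrier_vec n \<Longrightarrow> 0 \<le> x \<bullet> (M *\<^sub>v x)"
    and v: "u \<in> carrier_vec n" "v \<in> carrier_vec n" and d: "0 < d"
  shows "(u + v) \<bullet> (M *\<^sub>v (u + v)) \<le> (1 + d) * (u \<bullet> (M *\<^sub>v u)) + (1 + 1 / d) * (v \<bullet> (M *\<^sub>v v))"
proof -
  have "u + v = 1 \<cdot>\<^sub>v u - (- 1) \<cdot>\<^sub>v v" using v by (intro eq_vecI) auto
  hence 1: "(u + v) \<bullet> (M *\<^sub>v (u + v)) = u \<bullet> (M *\<^sub>v u) + 2 * (u \<bullet> (M *\<^sub>v v)) + v \<bullet> (M *\<^sub>v v)"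
    using form_diff[OF M v, of 1 "-1"] by simp
  have "0 \<le> (d \<cdot>\<^sub>v u - 1 \<cdot>\<^sub>v v) \<bullet> (M *\<^sub>v (d \<cdot>\<^sub>v u - 1 \<cdot>\<^sub>v v))" using v by (intro psd) auto
  hence "2 * d * (u \<bullet> (M *\<^sub>v v)) \<le> d\<^sup>2 * (u \<bullet> (M *\<^sub>v u)) + v \<bullet> (M *\<^sub>v v)"
    unfolding form_diff[OF M v] by simp
  hence "2 * (u \<bullet> (M *\<^sub>v v)) \<le> d * (u \<bullet> (M *\<^sub>v u)) + (1 / d) * (v \<bullet> (M *\<^sub>v v))"
  proof -
    have "2 * d * (u \<bullet> (M *\<^sub>v v)) / d \<le> (d\<^sup>2 * (u \<bullet> (M *\<^sub>v u)) + v \<bullet> (M *\<^sub>v v)) / d"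
      using \<open>2 * d * (u \<bullet> (M *\<^sub>v v)) \<le> _\<close> d by (intro divide_right_mono) auto
    thus ?thesis using d by (simp add: add_divide_distrib power2_eq_square)
  qed
  thus ?thesis unfolding 1 by (simp add: algebra_simps)
qed

text \<open>Stated as a bilinear form: equal arguments give the sign condition, and exchanging the
  arguments gives the symmetry of the block matrix.\<close>

lemma lmi_observe_form:
  fixes A C Q :: "real mat"
  assumes A: "A \<in> carrier_mat n n" and C: "C \<in> carrier_mat q n" and Q: "Q \<in> carrier_mat n n"
    and v: "x \<in> carrier_vec n" "y \<in> carrier_vec q" "x' \<in> carrier_vec n" "y' \<in> carrier_vec q"
  shows "lmi_observe A C Q l \<in> carrier_mat (n + q) (n + q)"
    and "(x @\<^sub>v y) \<bullet> (lmi_observe A C Q l *\<^sub>v (x' @\<^sub>v y'))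
      = (A *\<^sub>v x) \<bullet> (Q *\<^sub>v (A *\<^sub>v x')) - x \<bullet> (Q *\<^sub>v x') + (C *\<^sub>v x) \<bullet> y' + y \<bullet> (C *\<^sub>v x') - l * (y \<bullet> y')"
proof -
  let ?M = "transpose_mat A * Q * A - Q" and ?L = "- (l \<cdot>\<^sub>m 1\<^sub>m q)"
  have At: "transpose_mat A \<in> carrier_mat n n" "transpose_mat C \<in> carrier_mat n q" using A C by auto
  have M: "?M \<in> carrier_mat n n" using Q by (rule minus_carrier_mat)
  have L: "?L \<in> carrier_mat q q" by simp
  have AQ: "transpose_mat A * Q \<in> carrier_mat n n" using At Q by simp
  have eq: "lmi_observe A C Q l = four_block_mat ?M (transpose_mat C) C ?L"
    using C by (simp add: lmi_observe_def)
  show "lmi_observe A C Q l \<in> carrier_mat (n + q) (n + q)"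
    unfolding eq by (rule four_block_carrier_mat[OF M L])
  have w: "A *\<^sub>v x' \<in> carrier_vec n" "C *\<^sub>v x' \<in> carrier_vec q" "Q *\<^sub>v x' \<in> carrier_vec n"
    "transpose_mat C *\<^sub>v y' \<in> carrier_vec n" "Q *\<^sub>v (A *\<^sub>v x') \<in> carrier_vec n"
    using A C Q v At by auto
  have Mx: "?M *\<^sub>v x' = transpose_mat A *\<^sub>v (Q *\<^sub>v (A *\<^sub>v x')) - Q *\<^sub>v x'"
  proof -
    have "(transpose_mat A * Q * A) *\<^sub>v x' = transpose_mat A *\<^sub>v (Q *\<^sub>v (A *\<^sub>v x'))"
      using At AQ A Q v w by (simp only: assoc_mult_mat_vec)
    thus ?thesis using minus_mult_distrib_mat_vec[of "transpose_mat A * Q * A" n n Q x'] AQ A Q v by simp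
  qed
  have Ly: "?L *\<^sub>v y' = - l \<cdot>\<^sub>v y'" using v by (intro eq_vecI) auto
  have a1: "x \<bullet> (transpose_mat A *\<^sub>v (Q *\<^sub>v (A *\<^sub>v x'))) = (A *\<^sub>v x) \<bullet> (Q *\<^sub>v (A *\<^sub>v x'))"
    using transpose_vec_mult_scalar[OF A v(1) w(5)] comm_scalar_prod[OF v(1) mult_mat_vec_carrier[OF At(1) w(5)]]
      comm_scalar_prod[OF w(5) mult_mat_vec_carrier[OF A v(1)]] by simp
  have a2: "x \<bullet> (transpose_mat C *\<^sub>v y') = (C *\<^sub>v x) \<bullet> y'"
    using transpose_vec_mult_scalar[OF C v(1) v(4)] comm_scalar_prod[OF v(1) mult_mat_vec_carrier[OF At(2) v(4)]]
      comm_scalar_prod[OF v(4) mult_mat_vec_carrier[OF C v(1)]] by simp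
  have tw: "transpose_mat A *\<^sub>v (Q *\<^sub>v (A *\<^sub>v x')) \<in> carrier_vec n" using At w by simp
  have k: "?M *\<^sub>v x' \<in> carrier_vec n" "?L *\<^sub>v y' \<in> carrier_vec q"
    by (rule mult_mat_vec_carrier[OF M v(3)], rule mult_mat_vec_carrier[OF L v(4)])
  have k1: "?M *\<^sub>v x' + transpose_mat C *\<^sub>v y' \<in> carrier_vec n" by (rule add_carrier_vec[OF k(1) w(4)])
  have k2: "C *\<^sub>v x' + ?L *\<^sub>v y' \<in> carrier_vec q" by (rule add_carrier_vec[OF w(2) k(2)])
  have "lmi_observe A C Q l *\<^sub>v (x' @\<^sub>v y') = (?M *\<^sub>v x' + transpose_mat C *\<^sub>v y') @\<^sub>v (C *\<^sub>v x' + ?L *\<^sub>v y')"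
    unfolding eq by (rule four_block_mat_mult_vec[OF M At(2) C L v(3,4)])
  hence "(x @\<^sub>v y) \<bullet> (lmi_observe A C Q l *\<^sub>v (x' @\<^sub>v y'))
     = x \<bullet> (?M *\<^sub>v x' + transpose_mat C *\<^sub>v y') + y \<bullet> (C *\<^sub>v x' + ?L *\<^sub>v y')"
    by (simp only: scalar_prod_append[OF v(1,2) k1 k2])
  also have "\<dots> = x \<bullet> (?M *\<^sub>v x') + x \<bullet> (transpose_mat C *\<^sub>v y') + (y \<bullet> (C *\<^sub>v x') + y \<bullet> (?L *\<^sub>v y'))"
    by (simp only: scalar_prod_add_distrib[OF v(1) k(1) w(4)] scalar_prod_add_distrib[OF v(2) w(2) k(2)])
  also have "x \<bullet> (?M *\<^sub>v x') = (A *\<^sub>v x) \<bullet> (Q *\<^sub>v (A *\<^sub>v x')) - x \<bullet> (Q *\<^sub>v x')"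
    unfolding Mx scalar_prod_minus_distrib[OF v(1) tw w(3)] a1 ..
  also have "y \<bullet> (?L *\<^sub>v y') = - l * (y \<bullet> y')" unfolding Ly using v by (simp add: scalar_prod_smult_distrib[of _ q])
  finally show "(x @\<^sub>v y) \<bullet> (lmi_observe A C Q l *\<^sub>v (x' @\<^sub>v y'))
      = (A *\<^sub>v x) \<bullet> (Q *\<^sub>v (A *\<^sub>v x')) - x \<bullet> (Q *\<^sub>v x') + (C *\<^sub>v x) \<bullet> y' + y \<bullet> (C *\<^sub>v x') - l * (y \<bullet> y')"
    unfolding a2 by simp
qed

text \<open>The three blocks stand for a next state \<open>a\<close>, an input \<open>w\<close> and
  a state \<open>x\<close>. At a = A x + B w the inequality becomes dissipativity: the form of
  \<open>P\<close> grows in one step by at most |w|^2.\<close>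

lemma lmi_control_form:
  fixes A B P :: "real mat"
  assumes A: "A \<in> carrier_mat n n" and B: "B \<in> carrier_mat n p" and P: "P \<in> carrier_mat n n" "transpose_mat P = P"
    and v: "a \<in> carrier_vec n" "w \<in> carrier_vec p" "x \<in> carrier_vec n"
    and v': "a' \<in> carrier_vec n" "w' \<in> carrier_vec p" "x' \<in> carrier_vec n"
  shows "lmi_control A B P \<in> carrier_mat (n + (p + n)) (n + (p + n))"
    and "(a @\<^sub>v (w @\<^sub>v x)) \<bullet> (lmi_control A B P *\<^sub>v (a' @\<^sub>v (w' @\<^sub>v x')))
      = - (a \<bullet> (P *\<^sub>v a')) + a \<bullet> (P *\<^sub>v (B *\<^sub>v w' + A *\<^sub>v x')) + a' \<bullet> (P *\<^sub>v (B *\<^sub>v w + A *\<^sub>v x)) - w \<bullet> w' - x \<bullet> (P *\<^sub>v x')"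
proof -
  let ?wx = "w' @\<^sub>v x'" and ?v = "a' @\<^sub>v (w' @\<^sub>v x')"
  have T: "transpose_mat A \<in> carrier_mat n n" "transpose_mat B \<in> carrier_mat p n" using A B by auto
  have wx: "?wx \<in> carrier_vec (p + n)" and vc: "?v \<in> carrier_vec (n + (p + n))" using v' by auto
  have PB: "P * B \<in> carrier_mat n p" and PA: "P * A \<in> carrier_mat n n"
    and BP: "transpose_mat B * P \<in> carrier_mat p n" and AP: "transpose_mat A * P \<in> carrier_mat n n"
    and mP: "- P \<in> carrier_mat n n" and mI: "- 1\<^sub>m p \<in> carrier_mat p p"
    using P A B T by auto
  let ?R1 = "(- P) @\<^sub>c (P * B) @\<^sub>c (P * A)"
  let ?R2 = "(transpose_mat B * P) @\<^sub>c (- 1\<^sub>m p) @\<^sub>c 0\<^sub>m p n"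
  let ?R3 = "(transpose_mat A * P) @\<^sub>c 0\<^sub>m n p @\<^sub>c (- P)"
  have z: "0\<^sub>m p n \<in> carrier_mat p n" "0\<^sub>m n p \<in> carrier_mat n p" by auto
  have c: "(P * B) @\<^sub>c (P * A) \<in> carrier_mat n (p + n)" "(- 1\<^sub>m p) @\<^sub>c 0\<^sub>m p n \<in> carrier_mat p (p + n)"
    "0\<^sub>m n p @\<^sub>c (- P) \<in> carrier_mat n (p + n)"
    by (rule append_cols_carrier[OF PB PA], rule append_cols_carrier[OF mI z(1)], rule append_cols_carrier[OF z(2) mP])
  have R: "?R1 \<in> carrier_mat n (n + (p + n))" "?R2 \<in> carrier_mat p (n + (p + n))" "?R3 \<in> carrier_mat n (n + (p + n))"
    by (rule append_cols_carrier[OF mP c(1)], rule append_cols_carrier[OF BP c(2)], rule append_cols_carrier[OF AP c(3)])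
  have eq: "lmi_control A B P = ?R1 @\<^sub>r (?R2 @\<^sub>r ?R3)"
    using A B by (simp add: lmi_control_def)
  have R23: "?R2 @\<^sub>r ?R3 \<in> carrier_mat (p + n) (n + (p + n))" by (rule carrier_append_rows[OF R(2,3)])
  show "lmi_control A B P \<in> carrier_mat (n + (p + n)) (n + (p + n))"
    unfolding eq by (rule carrier_append_rows[OF R(1) R23])
  have cv: "P *\<^sub>v a' \<in> carrier_vec n" "B *\<^sub>v w' \<in> carrier_vec n" "A *\<^sub>v x' \<in> carrier_vec n" "P *\<^sub>v x' \<in> carrier_vec n"
    "P *\<^sub>v (B *\<^sub>v w') \<in> carrier_vec n" "P *\<^sub>v (A *\<^sub>v x') \<in> carrier_vec n"
    "transpose_mat B *\<^sub>v (P *\<^sub>v a') \<in> carrier_vec p" "transpose_mat A *\<^sub>v (P *\<^sub>v a') \<in> carrier_vec n"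
    "B *\<^sub>v w \<in> carrier_vec n" "A *\<^sub>v x \<in> carrier_vec n"
    using P A B T v v' by auto
  have r1: "?R1 *\<^sub>v ?v = - (P *\<^sub>v a') + (P *\<^sub>v (B *\<^sub>v w') + P *\<^sub>v (A *\<^sub>v x'))"
    unfolding append_cols_mult_vec[OF mP c(1) v'(1) wx] append_cols_mult_vec[OF PB PA v'(2,3)]
    using P A B v' by (simp add: assoc_mult_mat_vec)
  have r2: "?R2 *\<^sub>v ?v = transpose_mat B *\<^sub>v (P *\<^sub>v a') + - w'"
    unfolding append_cols_mult_vec[OF BP c(2) v'(1) wx] append_cols_mult_vec[OF mI z(1) v'(2,3)]
    using P T v' by (simp add: assoc_mult_mat_vec) (intro eq_vecI, auto)
  have r3: "?R3 *\<^sub>v ?v = transpose_mat A *\<^sub>v (P *\<^sub>v a') + - (P *\<^sub>v x')"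
    unfolding append_cols_mult_vec[OF AP c(3) v'(1) wx] append_cols_mult_vec[OF z(2) mP v'(2,3)]
    using P T v' by (simp add: assoc_mult_mat_vec) (intro eq_vecI, auto)
  have b1: "w \<bullet> (transpose_mat B *\<^sub>v (P *\<^sub>v a')) = a' \<bullet> (P *\<^sub>v (B *\<^sub>v w))"
  proof -
    have "w \<bullet> (transpose_mat B *\<^sub>v (P *\<^sub>v a')) = (transpose_mat B *\<^sub>v (P *\<^sub>v a')) \<bullet> w"
      by (rule comm_scalar_prod[OF v(2) cv(7)])
    also have "\<dots> = (P *\<^sub>v a') \<bullet> (B *\<^sub>v w)" by (rule transpose_vec_mult_scalar[OF B v(2) cv(1)])
    also have "\<dots> = (B *\<^sub>v w) \<bullet> (P *\<^sub>v a')" by (rule comm_scalar_prod[OF cv(1) cv(9)])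
    also have "\<dots> = a' \<bullet> (P *\<^sub>v (B *\<^sub>v w))" by (rule symmetric_form[OF P cv(9) v'(1)])
    finally show ?thesis .
  qed
  have b2: "x \<bullet> (transpose_mat A *\<^sub>v (P *\<^sub>v a')) = a' \<bullet> (P *\<^sub>v (A *\<^sub>v x))"
  proof -
    have "x \<bullet> (transpose_mat A *\<^sub>v (P *\<^sub>v a')) = (transpose_mat A *\<^sub>v (P *\<^sub>v a')) \<bullet> x"
      by (rule comm_scalar_prod[OF v(3) cv(8)])
    also have "\<dots> = (P *\<^sub>v a') \<bullet> (A *\<^sub>v x)" by (rule transpose_vec_mult_scalar[OF A v(3) cv(1)])
    also have "\<dots> = (A *\<^sub>v x) \<bullet> (P *\<^sub>v a')" by (rule comm_scalar_prod[OF cv(1) cv(10)])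
    also have "\<dots> = a' \<bullet> (P *\<^sub>v (A *\<^sub>v x))" by (rule symmetric_form[OF P cv(10) v'(1)])
    finally show ?thesis .
  qed
  have "lmi_control A B P *\<^sub>v ?v = (?R1 *\<^sub>v ?v) @\<^sub>v ((?R2 *\<^sub>v ?v) @\<^sub>v (?R3 *\<^sub>v ?v))"
    unfolding eq mat_mult_append[OF R(1) R23 vc] mat_mult_append[OF R(2,3) vc] ..
  moreover have rc: "?R1 *\<^sub>v ?v \<in> carrier_vec n" "?R2 *\<^sub>v ?v \<in> carrier_vec p" "?R3 *\<^sub>v ?v \<in> carrier_vec n"
    using mult_mat_vec_carrier[OF R(1) vc] mult_mat_vec_carrier[OF R(2) vc] mult_mat_vec_carrier[OF R(3) vc] by auto
  ultimately have "(a @\<^sub>v (w @\<^sub>v x)) \<bullet> (lmi_control A B P *\<^sub>v ?v)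
      = a \<bullet> (?R1 *\<^sub>v ?v) + (w \<bullet> (?R2 *\<^sub>v ?v) + x \<bullet> (?R3 *\<^sub>v ?v))"
    using v by (simp only: scalar_prod_append[of _ n _ "p + n"] scalar_prod_append[of _ p _ n] append_carrier_vec)
  also have "a \<bullet> (?R1 *\<^sub>v ?v) = - (a \<bullet> (P *\<^sub>v a')) + (a \<bullet> (P *\<^sub>v (B *\<^sub>v w')) + a \<bullet> (P *\<^sub>v (A *\<^sub>v x')))"
    unfolding r1 using v cv P(1) by (simp add: scalar_prod_add_distrib[of _ n])
  also have "w \<bullet> (?R2 *\<^sub>v ?v) = a' \<bullet> (P *\<^sub>v (B *\<^sub>v w)) - w \<bullet> w'"
    unfolding r2 using v v' cv by (simp add: scalar_prod_add_distrib[of _ p] b1)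
  also have "x \<bullet> (?R3 *\<^sub>v ?v) = a' \<bullet> (P *\<^sub>v (A *\<^sub>v x)) - x \<bullet> (P *\<^sub>v x')"
    unfolding r3 using v v' cv P(1) by (simp add: scalar_prod_add_distrib[of _ n] b2)
  also have "a \<bullet> (P *\<^sub>v (B *\<^sub>v w')) + a \<bullet> (P *\<^sub>v (A *\<^sub>v x')) = a \<bullet> (P *\<^sub>v (B *\<^sub>v w' + A *\<^sub>v x'))"
    using P v cv by (simp add: mult_add_distrib_mat_vec[of _ n n] scalar_prod_add_distrib[of _ n])
  finally show "(a @\<^sub>v (w @\<^sub>v x)) \<bullet> (lmi_control A B P *\<^sub>v ?v)
      = - (a \<bullet> (P *\<^sub>v a')) + a \<bullet> (P *\<^sub>v (B *\<^sub>v w' + A *\<^sub>v x')) + a' \<bullet> (P *\<^sub>v (B *\<^sub>v w + A *\<^sub>v x)) - w \<bullet> w' - x \<bullet> (P *\<^sub>v x')"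
    using P v' cv by (simp add: mult_add_distrib_mat_vec[of _ n n] scalar_prod_add_distrib[of _ n])
qed

lemma index_mult_mat_vec_sum:
  assumes "M \<in> carrier_mat q p" "v \<in> carrier_vec p" "i < q"
  shows "(M *\<^sub>v v) $ i = (\<Sum>j<p. M $$ (i, j) * v $ j)"
  using assms by (simp add: scalar_prod_def atLeast0LessThan)

lemma sym_nsd_form:
  assumes "sym_nsd M" "M \<in> carrier_mat n n" "x \<in> carrier_vec n"
  shows "x \<bullet> (M *\<^sub>v x) \<le> 0"
proof -
  have "0 \<le> x \<bullet> (- M *\<^sub>v x)" using assms by (simp add: sym_nsd_def sym_psd_def)
  thus ?thesis using assms by simp
qed

lemma sym_nsdI:
  fixes M :: "real mat"
  assumes M: "M \<in> carrier_mat n n"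
    and s: "\<And>u v. u \<in> carrier_vec n \<Longrightarrow> v \<in> carrier_vec n \<Longrightarrow> u \<bullet> (M *\<^sub>v v) = v \<bullet> (M *\<^sub>v u)"
    and n: "\<And>x. x \<in> carrier_vec n \<Longrightarrow> x \<bullet> (M *\<^sub>v x) \<le> 0"
  shows "sym_nsd M"
proof -
  have "transpose_mat (- M) = - M"
    using symmetric_matI[OF M s] M by (metis transpose_uminus)
  moreover have "0 \<le> x \<bullet> (- M *\<^sub>v x)" if "x \<in> carrier_vec n" for x using n[OF that] M that by simp
  ultimately show ?thesis using M by (simp add: sym_nsd_def sym_psd_def)
qed

text \<open>The input is indexed backwards in time: \<open>w 0\<close> is applied last, so that the
  state is the sum of A^t B w_t.\<close>

fun reach :: "real mat \<Rightarrow> real mat \<Rightarrow> nat \<Rightarrow> (nat \<Rightarrow> real vec) \<Rightarrow> real vec" where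
  "reach A B 0 w = 0\<^sub>v (dim_row A)"
| "reach A B (Suc K) w = A *\<^sub>v reach A B K (\<lambda>t. w (Suc t)) + B *\<^sub>v w 0"

lemma reach_carrier:
  assumes "A \<in> carrier_mat n n" "B \<in> carrier_mat n p"
  shows "(\<And>t. w t \<in> carrier_vec p) \<Longrightarrow> reach A B K w \<in> carrier_vec n"
  using assms by (induction K arbitrary: w) auto

text \<open>Continuing for \<open>s\<close> steps without input yields the block row
  \<open>s\<close> of the Hankel matrix applied to \<open>w\<close>.\<close>

lemma reach_output:
  assumes A: "A \<in> carrier_mat n n" and B: "B \<in> carrier_mat n p" and C: "C \<in> carrier_mat q n"
  shows "(\<And>t. w t \<in> carrier_vec p) \<Longrightarrow> i < q \<Longrightarrow>
     ((C * A ^\<^sub>m s) *\<^sub>v reach A B K w) $ i = (\<Sum>t<K. \<Sum>j<p. (C * A ^\<^sub>m (s + t) * B) $$ (i, j) * w t $ j)"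
proof (induction K arbitrary: w s)
  case 0
  thus ?case using A C by simp
next
  case (Suc K)
  let ?r = "reach A B K (\<lambda>t. w (Suc t))"
  have r: "?r \<in> carrier_vec n" by (rule reach_carrier[OF A B]) (rule Suc.prems)
  have As: "A ^\<^sub>m k \<in> carrier_mat n n" for k using A by simp
  have CA: "C * A ^\<^sub>m k \<in> carrier_mat q n" for k using C As by simp
  have Bw: "B *\<^sub>v w 0 \<in> carrier_vec n" using B Suc.prems(1) by simp
  have "(C * A ^\<^sub>m s) *\<^sub>v reach A B (Suc K) w = (C * A ^\<^sub>m s) *\<^sub>v (A *\<^sub>v ?r) + (C * A ^\<^sub>m s) *\<^sub>v (B *\<^sub>v w 0)"
    using CA A r Bw by (simp add: mult_add_distrib_mat_vec[of _ q n])
  also have "(C * A ^\<^sub>m s) *\<^sub>v (A *\<^sub>v ?r) = (C * A ^\<^sub>m Suc s) *\<^sub>v ?r"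
    using CA[of s] A r C As[of s] by (simp add: assoc_mult_mat_vec[symmetric, of _ q n _ n] assoc_mult_mat[of _ q n _ n _ n])
  also have "(C * A ^\<^sub>m s) *\<^sub>v (B *\<^sub>v w 0) = (C * A ^\<^sub>m s * B) *\<^sub>v w 0"
    using CA[of s] B Suc.prems(1) by (simp add: assoc_mult_mat_vec)
  finally have e: "((C * A ^\<^sub>m s) *\<^sub>v reach A B (Suc K) w) $ i
      = ((C * A ^\<^sub>m Suc s) *\<^sub>v ?r) $ i + ((C * A ^\<^sub>m s * B) *\<^sub>v w 0) $ i"
    using Suc.prems(2) C by (simp del: pow_mat.simps)
  have "((C * A ^\<^sub>m Suc s) *\<^sub>v ?r) $ i = (\<Sum>t<K. \<Sum>j<p. (C * A ^\<^sub>m (Suc s + t) * B) $$ (i, j) * w (Suc t) $ j)"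
    by (rule Suc.IH) (rule Suc.prems)+
  moreover have "((C * A ^\<^sub>m s * B) *\<^sub>v w 0) $ i = (\<Sum>j<p. (C * A ^\<^sub>m s * B) $$ (i, j) * w 0 $ j)"
    by (rule index_mult_mat_vec_sum[OF mult_carrier_mat[OF CA B] Suc.prems])
  ultimately show ?case
    unfolding e sum.lessThan_Suc_shift by (simp add: add.commute del: pow_mat.simps)
qed

lemma lmi_hankel_bounded:
  assumes A: "A \<in> carrier_mat n n" and B: "B \<in> carrier_mat n p" and C: "C \<in> carrier_mat q n"
    and f: "\<And>k i j. i < q \<Longrightarrow> j < p \<Longrightarrow> f (Suc k) i j = (C * A ^\<^sub>m k * B) $$ (i, j)"
    and lmi: "lmi_solution A B C P Q l"
  shows "0 \<le> l" "l < 1" "hankel_bounded q p f (sqrt l)"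
proof -
  have P: "P \<in> carrier_mat n n" "transpose_mat P = P" and Q: "Q \<in> carrier_mat n n"
    and psdQ: "\<And>x. x \<in> carrier_vec n \<Longrightarrow> 0 \<le> x \<bullet> (Q *\<^sub>v x)"
    and obs: "sym_nsd (lmi_observe A C Q l)" and ctr: "sym_nsd (lmi_control A B P)"
    using lmi A by (auto simp: lmi_solution_def sym_psd_def)
  show l: "0 \<le> l" "l < 1" using lmi by (auto simp: lmi_solution_def)
  have PQ: "x \<bullet> (Q *\<^sub>v x) \<le> x \<bullet> (P *\<^sub>v x)" if x: "x \<in> carrier_vec n" for x
  proof -
    have "0 \<le> x \<bullet> ((P - Q) *\<^sub>v x)" using lmi A x Q by (auto simp: lmi_solution_def sym_psd_def)
    also have "(P - Q) *\<^sub>v x = P *\<^sub>v x - Q *\<^sub>v x" using P Q x by (intro minus_mult_distrib_mat_vec)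
    finally show ?thesis using P Q x by (simp add: scalar_prod_minus_distrib[of _ n])
  qed
  \<comment> \<open>A Schur complement by hand: the inequality at (x, t C x) is quadratic in t, and
    t = 1 / l is optimal. For l = 0 it is linear in t, and a large t forces C x = 0.\<close>
  have O: "(C *\<^sub>v x) \<bullet> (C *\<^sub>v x) \<le> l * (x \<bullet> (Q *\<^sub>v x) - (A *\<^sub>v x) \<bullet> (Q *\<^sub>v (A *\<^sub>v x)))"
    if x: "x \<in> carrier_vec n" for x
  proof -
    let ?D = "x \<bullet> (Q *\<^sub>v x) - (A *\<^sub>v x) \<bullet> (Q *\<^sub>v (A *\<^sub>v x))" and ?c = "(C *\<^sub>v x) \<bullet> (C *\<^sub>v x)"
    have Cx: "C *\<^sub>v x \<in> carrier_vec q" using C x by simp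
    have t: "2 * t * ?c - l * t\<^sup>2 * ?c \<le> ?D" for t
    proof -
      have y: "t \<cdot>\<^sub>v (C *\<^sub>v x) \<in> carrier_vec q" using Cx by simp
      have "(x @\<^sub>v (t \<cdot>\<^sub>v (C *\<^sub>v x))) \<bullet> (lmi_observe A C Q l *\<^sub>v (x @\<^sub>v (t \<cdot>\<^sub>v (C *\<^sub>v x)))) \<le> 0"
        by (rule sym_nsd_form[OF obs lmi_observe_form(1)[OF A C Q x y x y]]) (use x y in auto)
      thus ?thesis unfolding lmi_observe_form(2)[OF A C Q x y x y]
        using Cx by (simp add: scalar_prod_smult_distrib[of _ q] smult_scalar_prod_distrib[of _ q] power2_eq_square)
    qed
    have c0: "0 \<le> ?c" by (rule scalar_prod_self_nonneg)
    show ?thesis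
    proof (cases "l = 0")
      case True
      have "?c \<le> 0"
      proof (rule ccontr)
        assume "\<not> ?c \<le> 0"
        thus False using t[of "(?D + 1) / (2 * ?c)"] True by simp
      qed
      thus ?thesis using True by simp
    next
      case False
      hence "0 < l" using l by simp
      hence "2 * (1 / l) * ?c - l * (1 / l)\<^sup>2 * ?c = ?c / l" by (simp add: power2_eq_square)
      hence "?c / l \<le> ?D" using t[of "1 / l"] by (simp only:)
      thus ?thesis using \<open>0 < l\<close> by (simp only: pos_divide_le_eq mult.commute)
    qed
  qed
  have Kc: "(A *\<^sub>v x + B *\<^sub>v w) \<bullet> (P *\<^sub>v (A *\<^sub>v x + B *\<^sub>v w)) \<le> w \<bullet> w + x \<bullet> (P *\<^sub>v x)"
    if x: "x \<in> carrier_vec n" and w: "w \<in> carrier_vec p" for x w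
  proof -
    define a where "a = A *\<^sub>v x + B *\<^sub>v w"
    have a: "a \<in> carrier_vec n" using A B x w by (simp add: a_def)
    have ab: "B *\<^sub>v w + A *\<^sub>v x = a" unfolding a_def using A B x w by (intro comm_add_vec[of _ n]) auto
    have "(a @\<^sub>v (w @\<^sub>v x)) \<bullet> (lmi_control A B P *\<^sub>v (a @\<^sub>v (w @\<^sub>v x))) \<le> 0"
      by (rule sym_nsd_form[OF ctr lmi_control_form(1)[OF A B P a w x a w x]]) (use a w x in auto)
    thus ?thesis unfolding lmi_control_form(2)[OF A B P a w x a w x] ab a_def[symmetric] by simp
  qed
  have reachP: "reach A B K w \<bullet> (P *\<^sub>v reach A B K w) \<le> (\<Sum>t<K. w t \<bullet> w t)"
    if "\<And>t. w t \<in> carrier_vec p" for K w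
    using that
  proof (induction K arbitrary: w)
    case 0
    thus ?case using A P by simp
  next
    case (Suc K)
    have r: "reach A B K (\<lambda>t. w (Suc t)) \<in> carrier_vec n" by (rule reach_carrier[OF A B]) (rule Suc.prems)
    show ?case
      unfolding reach.simps sum.lessThan_Suc_shift
      by (rule order_trans[OF Kc[OF r Suc.prems]]) (use Suc.IH[of "\<lambda>t. w (Suc t)"] Suc.prems in simp)
  qed
  \<comment> \<open>The inequality \<open>O\<close> telescopes along the free motion; the form of
    \<open>Q\<close> at the final state is nonnegative and dropped.\<close>
  have obsQ: "(\<Sum>s<I. ((C * A ^\<^sub>m s) *\<^sub>v x) \<bullet> ((C * A ^\<^sub>m s) *\<^sub>v x)) \<le> l * (x \<bullet> (Q *\<^sub>v x))"
    if x: "x \<in> carrier_vec n" for I x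
    using x
  proof (induction I arbitrary: x)
    case 0
    thus ?case using l psdQ by simp
  next
    case (Suc I)
    have Ax: "A *\<^sub>v x \<in> carrier_vec n" using A Suc.prems by simp
    have s: "(C * A ^\<^sub>m Suc s) *\<^sub>v x = (C * A ^\<^sub>m s) *\<^sub>v (A *\<^sub>v x)" for s
    proof -
      have As: "A ^\<^sub>m s \<in> carrier_mat n n" using A by simp
      have "C * A ^\<^sub>m Suc s = C * A ^\<^sub>m s * A" by (simp only: pow_mat.simps assoc_mult_mat[OF C As A])
      thus ?thesis by (simp only: assoc_mult_mat_vec[OF mult_carrier_mat[OF C As] A Suc.prems])
    qed
    have z: "(C * A ^\<^sub>m 0) *\<^sub>v x = C *\<^sub>v x" using A C by simp
    show ?case
      unfolding sum.lessThan_Suc_shift z s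
      using Suc.IH[OF Ax] O[OF Suc.prems] by (simp add: algebra_simps del: pow_mat.simps)
  qed
  show "hankel_bounded q p f (sqrt l)"
    unfolding hankel_bounded_def
  proof (intro allI)
    fix I K and g :: "nat \<Rightarrow> nat \<Rightarrow> real"
    define w where "w t = vec p (g t)" for t
    have w: "w t \<in> carrier_vec p" for t by (simp add: w_def)
    define x where "x = reach A B K w"
    have x: "x \<in> carrier_vec n" unfolding x_def by (rule reach_carrier[OF A B w])
    have "(\<Sum>s<I. \<Sum>i<q. (\<Sum>t<K. \<Sum>j<p. f (s + t + 1) i j * g t j)\<^sup>2)
        = (\<Sum>s<I. ((C * A ^\<^sub>m s) *\<^sub>v x) \<bullet> ((C * A ^\<^sub>m s) *\<^sub>v x))"
    proof (intro sum.cong refl)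
      fix s
      have "(\<Sum>i<q. (\<Sum>t<K. \<Sum>j<p. f (s + t + 1) i j * g t j)\<^sup>2) = (\<Sum>i<q. (((C * A ^\<^sub>m s) *\<^sub>v x) $ i)\<^sup>2)"
        unfolding x_def using f
        by (intro sum.cong refl arg_cong[where f="\<lambda>x. x\<^sup>2"], subst reach_output[OF A B C w]) (auto simp: w_def)
      also have "\<dots> = ((C * A ^\<^sub>m s) *\<^sub>v x) \<bullet> ((C * A ^\<^sub>m s) *\<^sub>v x)"
        using C by (simp add: scalar_prod_def atLeast0LessThan power2_eq_square del: index_mult_mat_vec)
      finally show "(\<Sum>i<q. (\<Sum>t<K. \<Sum>j<p. f (s + t + 1) i j * g t j)\<^sup>2)
          = ((C * A ^\<^sub>m s) *\<^sub>v x) \<bullet> ((C * A ^\<^sub>m s) *\<^sub>v x)" .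
    qed
    also have "\<dots> \<le> l * (x \<bullet> (Q *\<^sub>v x))" by (rule obsQ[OF x])
    also have "\<dots> \<le> l * (x \<bullet> (P *\<^sub>v x))" using PQ[OF x] l by (intro mult_left_mono)
    also have "\<dots> \<le> l * (\<Sum>t<K. w t \<bullet> w t)" unfolding x_def using reachP[of w K] w l by (intro mult_left_mono) auto
    also have "(\<Sum>t<K. w t \<bullet> w t) = (\<Sum>t<K. \<Sum>j<p. (g t j)\<^sup>2)"
      by (simp add: w_def scalar_prod_def atLeast0LessThan power2_eq_square)
    finally show "(\<Sum>s<I. \<Sum>i<q. (\<Sum>t<K. \<Sum>j<p. f (s + t + 1) i j * g t j)\<^sup>2)
        \<le> (sqrt l)\<^sup>2 * (\<Sum>t<K. \<Sum>j<p. (g t j)\<^sup>2)" using l by simp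
  qed
qed

subsection \<open>From the Hankel norm to the matrix inequalities\<close>

text \<open>The series of A^k M M^T (A^T)^k. With M = B it is the controllability Gramian; with the
  transposes of A and C it is the observability Gramian.\<close>

definition gramian :: "real mat \<Rightarrow> real mat \<Rightarrow> real mat" where
  "gramian A M = mat (dim_row A) (dim_row A) (\<lambda>(i, j). \<Sum>k. \<Sum>l<dim_col M.
     (A ^\<^sub>m k * M) $$ (i, l) * (A ^\<^sub>m k * M) $$ (j, l))"

lemma summable_abs_mult:
  fixes x y :: "nat \<Rightarrow> real"
  assumes "summable (\<lambda>k. \<bar>x k\<bar>)" "summable (\<lambda>k. \<bar>y k\<bar>)"
  shows "summable (\<lambda>k. x k * y k)"
proof (rule summable_comparison_test'[where N = 0])
  show "summable (\<lambda>k. \<bar>x k\<bar> * (\<Sum>k. \<bar>y k\<bar>))" using assms(1) by (rule summable_mult2)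
  fix k
  have "\<bar>y k\<bar> \<le> (\<Sum>k. \<bar>y k\<bar>)" using sum_le_suminf[OF assms(2), of "{k}"] by simp
  thus "norm (x k * y k) \<le> \<bar>x k\<bar> * (\<Sum>k. \<bar>y k\<bar>)" by (simp add: abs_mult mult_left_mono)
qed

text \<open>Absolute summability of the powers is all that the Gramians need. It passes to a block
  diagonal matrix with a nilpotent block by computing powers, without a look at eigenvalues.\<close>

locale power_summable =
  fixes n :: nat and A :: "real mat"
  assumes A: "A \<in> carrier_mat n n"
    and pow: "\<And>i j. i < n \<Longrightarrow> j < n \<Longrightarrow> summable (\<lambda>k. \<bar>(A ^\<^sub>m k) $$ (i, j)\<bar>)"
begin

lemma Ak: "A ^\<^sub>m k \<in> carrier_mat n n"
  using A by simp

lemma pow_Suc: "A ^\<^sub>m Suc k = A * A ^\<^sub>m k"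
  using mat_pow_add[OF A, of 1 k] A by simp

lemma mult_summable:
  assumes M: "M \<in> carrier_mat n m" and "i < n" "l < m"
  shows "summable (\<lambda>k. \<bar>(A ^\<^sub>m k * M) $$ (i, l)\<bar>)"
proof (rule summable_comparison_test'[where N = 0])
  show "summable (\<lambda>k. \<Sum>j<n. \<bar>(A ^\<^sub>m k) $$ (i, j)\<bar> * \<bar>M $$ (j, l)\<bar>)"
    using assms by (intro summable_sum summable_mult2 pow) auto
  show "norm \<bar>(A ^\<^sub>m k * M) $$ (i, l)\<bar> \<le> (\<Sum>j<n. \<bar>(A ^\<^sub>m k) $$ (i, j)\<bar> * \<bar>M $$ (j, l)\<bar>)" for k
    unfolding index_mult_mat_sum[OF Ak M assms(2,3)] real_norm_def abs_idempotent
    by (rule order_trans[OF sum_abs]) (simp add: abs_mult)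
qed

lemma gramian_carrier: "gramian A M \<in> carrier_mat n n"
  using A by (simp add: gramian_def)

lemma gramian_symmetric: "transpose_mat (gramian A M) = gramian A M"
  using A by (intro eq_matI) (auto simp: gramian_def mult.commute)

lemma gramian_apply:
  assumes M: "M \<in> carrier_mat n m" and y: "y \<in> carrier_vec n" and i: "i < n"
  shows "(\<lambda>k. ((A ^\<^sub>m k * M) *\<^sub>v (transpose_mat (A ^\<^sub>m k * M) *\<^sub>v y)) $ i) sums (gramian A M *\<^sub>v y) $ i"
proof -
  have AM: "A ^\<^sub>m k * M \<in> carrier_mat n m" for k by (rule mult_carrier_mat[OF Ak M])
  let ?a = "\<lambda>k i l. (A ^\<^sub>m k * M) $$ (i, l)"
  have s: "(\<lambda>k. \<Sum>l<m. ?a k i l * ?a k j l) sums gramian A M $$ (i, j)" if "j < n" for j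
  proof -
    have "summable (\<lambda>k. \<Sum>l<m. ?a k i l * ?a k j l)"
      using that i by (intro summable_sum summable_abs_mult mult_summable[OF M]) auto
    thus ?thesis using A M i that by (simp add: gramian_def summable_sums)
  qed
  have "(\<lambda>k. \<Sum>j<n. (\<Sum>l<m. ?a k i l * ?a k j l) * y $ j) sums (\<Sum>j<n. gramian A M $$ (i, j) * y $ j)"
    by (intro sums_sum sums_mult2 s) auto
  also have "(\<lambda>k. \<Sum>j<n. (\<Sum>l<m. ?a k i l * ?a k j l) * y $ j)
      = (\<lambda>k. ((A ^\<^sub>m k * M) *\<^sub>v (transpose_mat (A ^\<^sub>m k * M) *\<^sub>v y)) $ i)"
  proof
    fix k
    have T: "transpose_mat (A ^\<^sub>m k * M) \<in> carrier_mat m n" by (simp only: transpose_carrier_mat AM)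
    have Ty: "transpose_mat (A ^\<^sub>m k * M) *\<^sub>v y \<in> carrier_vec m" by (rule mult_mat_vec_carrier[OF T y])
    have "((A ^\<^sub>m k * M) *\<^sub>v (transpose_mat (A ^\<^sub>m k * M) *\<^sub>v y)) $ i
       = (\<Sum>l<m. ?a k i l * (transpose_mat (A ^\<^sub>m k * M) *\<^sub>v y) $ l)"
      by (rule index_mult_mat_vec_sum[OF AM Ty i])
    also have "\<dots> = (\<Sum>l<m. ?a k i l * (\<Sum>j<n. ?a k j l * y $ j))"
    proof (intro sum.cong refl)
      fix l assume l: "l \<in> {..<m}"
      have "(transpose_mat (A ^\<^sub>m k * M) *\<^sub>v y) $ l = (\<Sum>j<n. transpose_mat (A ^\<^sub>m k * M) $$ (l, j) * y $ j)"
        using l by (intro index_mult_mat_vec_sum[OF T y]) simp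
      also have "\<dots> = (\<Sum>j<n. ?a k j l * y $ j)"
        using l carrier_matD[OF AM[of k]] by (intro sum.cong refl) (simp add: index_transpose_mat del: index_mult_mat)
      finally show "?a k i l * (transpose_mat (A ^\<^sub>m k * M) *\<^sub>v y) $ l = ?a k i l * (\<Sum>j<n. ?a k j l * y $ j)" by simp
    qed
    also have "\<dots> = (\<Sum>j<n. (\<Sum>l<m. ?a k i l * ?a k j l) * y $ j)"
      unfolding sum_distrib_left sum_distrib_right by (subst sum.swap) (simp only: mult.assoc)
    finally show "(\<Sum>j<n. (\<Sum>l<m. ?a k i l * ?a k j l) * y $ j)
      = ((A ^\<^sub>m k * M) *\<^sub>v (transpose_mat (A ^\<^sub>m k * M) *\<^sub>v y)) $ i" by simp
  qed
  also have "(\<Sum>j<n. gramian A M $$ (i, j) * y $ j) = (gramian A M *\<^sub>v y) $ i"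
    by (rule index_mult_mat_vec_sum[OF gramian_carrier y i, symmetric])
  finally show ?thesis .
qed

lemma gramian_form:
  assumes M: "M \<in> carrier_mat n m" and y: "y \<in> carrier_vec n"
  shows "(\<lambda>k. (transpose_mat (A ^\<^sub>m k * M) *\<^sub>v y) \<bullet> (transpose_mat (A ^\<^sub>m k * M) *\<^sub>v y)) sums (y \<bullet> (gramian A M *\<^sub>v y))"
proof -
  have AM: "A ^\<^sub>m k * M \<in> carrier_mat n m" for k by (rule mult_carrier_mat[OF Ak M])
  have Ty: "transpose_mat (A ^\<^sub>m k * M) *\<^sub>v y \<in> carrier_vec m" for k
    by (intro mult_mat_vec_carrier[OF _ y]) (simp only: transpose_carrier_mat AM)
  have "(\<lambda>k. \<Sum>i<n. y $ i * ((A ^\<^sub>m k * M) *\<^sub>v (transpose_mat (A ^\<^sub>m k * M) *\<^sub>v y)) $ i)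
      sums (\<Sum>i<n. y $ i * (gramian A M *\<^sub>v y) $ i)"
    by (intro sums_sum sums_mult gramian_apply[OF M y]) auto
  also have "(\<lambda>k. \<Sum>i<n. y $ i * ((A ^\<^sub>m k * M) *\<^sub>v (transpose_mat (A ^\<^sub>m k * M) *\<^sub>v y)) $ i)
      = (\<lambda>k. y \<bullet> ((A ^\<^sub>m k * M) *\<^sub>v (transpose_mat (A ^\<^sub>m k * M) *\<^sub>v y)))"
    unfolding scalar_prod_def using A by (simp add: atLeast0LessThan)
  also have "\<dots> = (\<lambda>k. (transpose_mat (A ^\<^sub>m k * M) *\<^sub>v y) \<bullet> (transpose_mat (A ^\<^sub>m k * M) *\<^sub>v y))"
    by (intro ext transpose_vec_mult_scalar[OF AM Ty y, symmetric])
  also have "(\<Sum>i<n. y $ i * (gramian A M *\<^sub>v y) $ i) = y \<bullet> (gramian A M *\<^sub>v y)"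
    unfolding scalar_prod_def using gramian_carrier[of M] by (simp add: atLeast0LessThan)
  finally show ?thesis .
qed

lemma gramian_nonneg:
  assumes "M \<in> carrier_mat n m" "y \<in> carrier_vec n"
  shows "0 \<le> y \<bullet> (gramian A M *\<^sub>v y)"
  by (rule sums_le[OF _ sums_zero gramian_form[OF assms]]) (rule scalar_prod_self_nonneg)

text \<open>The Lyapunov equation X = A X A^T + M M^T as an identity of forms; it comes from
  splitting off the term k = 0 of the series.\<close>

lemma gramian_lyapunov:
  assumes M: "M \<in> carrier_mat n m" and y: "y \<in> carrier_vec n"
  shows "y \<bullet> (gramian A M *\<^sub>v y) = (transpose_mat A *\<^sub>v y) \<bullet> (gramian A M *\<^sub>v (transpose_mat A *\<^sub>v y))
     + (transpose_mat M *\<^sub>v y) \<bullet> (transpose_mat M *\<^sub>v y)"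
proof -
  have At: "transpose_mat A \<in> carrier_mat n n" using A by simp
  have Ay: "transpose_mat A *\<^sub>v y \<in> carrier_vec n" by (rule mult_mat_vec_carrier[OF At y])
  have step: "transpose_mat (A ^\<^sub>m Suc k * M) *\<^sub>v y = transpose_mat (A ^\<^sub>m k * M) *\<^sub>v (transpose_mat A *\<^sub>v y)" for k
  proof -
    have AM: "A ^\<^sub>m k * M \<in> carrier_mat n m" by (rule mult_carrier_mat[OF Ak M])
    have "A ^\<^sub>m Suc k * M = A * (A ^\<^sub>m k * M)" unfolding pow_Suc by (rule assoc_mult_mat[OF A Ak M])
    hence "transpose_mat (A ^\<^sub>m Suc k * M) = transpose_mat (A ^\<^sub>m k * M) * transpose_mat A"
      by (simp only: transpose_mult[OF A AM])
    thus ?thesis using AM by (simp only: assoc_mult_mat_vec[OF _ At y, of "transpose_mat (A ^\<^sub>m k * M)" m] transpose_carrier_mat)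
  qed
  have "transpose_mat (A ^\<^sub>m 0 * M) *\<^sub>v y = transpose_mat M *\<^sub>v y" using A M by simp
  hence "(\<lambda>k. (transpose_mat (A ^\<^sub>m k * M) *\<^sub>v y) \<bullet> (transpose_mat (A ^\<^sub>m k * M) *\<^sub>v y)) sums
     ((transpose_mat A *\<^sub>v y) \<bullet> (gramian A M *\<^sub>v (transpose_mat A *\<^sub>v y)) + (transpose_mat M *\<^sub>v y) \<bullet> (transpose_mat M *\<^sub>v y))"
    using sums_Suc[of "\<lambda>k. (transpose_mat (A ^\<^sub>m k * M) *\<^sub>v y) \<bullet> (transpose_mat (A ^\<^sub>m k * M) *\<^sub>v y)",
        unfolded step, OF gramian_form[OF M Ay]] by (simp only:)
  thus ?thesis using gramian_form[OF M y] sums_unique2 by blast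
qed

lemma transpose_pow: "transpose_mat A ^\<^sub>m k = transpose_mat (A ^\<^sub>m k)"
proof (induction k)
  case 0
  show ?case using A by simp
next
  case (Suc k)
  have "transpose_mat A ^\<^sub>m Suc k = transpose_mat (A ^\<^sub>m k) * transpose_mat A" by (simp add: Suc)
  also have "\<dots> = transpose_mat (A * A ^\<^sub>m k)" by (rule transpose_mult[OF A Ak, symmetric])
  finally show ?case by (simp only: pow_Suc)
qed

lemma transpose_power_summable: "power_summable n (transpose_mat A)"
proof
  show "transpose_mat A \<in> carrier_mat n n" using A by simp
  show "summable (\<lambda>k. \<bar>(transpose_mat A ^\<^sub>m k) $$ (i, j)\<bar>)" if ij: "i < n" "j < n" for i j
    unfolding transpose_pow using pow[OF ij(2,1)] A ij by simp
qed

end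

section \<open>Bounds and inverses of definite forms\<close>

lemma form_bounded:
  fixes M :: "real mat"
  assumes M: "M \<in> carrier_mat n n"
  obtains K where "0 \<le> K" "\<And>y. y \<in> carrier_vec n \<Longrightarrow> y \<bullet> (M *\<^sub>v y) \<le> K * (y \<bullet> y)"
proof (rule that[of "\<Sum>i<n. \<Sum>j<n. \<bar>M $$ (i, j)\<bar>"])
  show "0 \<le> (\<Sum>i<n. \<Sum>j<n. \<bar>M $$ (i, j)\<bar>)" by (intro sum_nonneg) auto
  fix y :: "real vec" assume y: "y \<in> carrier_vec n"
  have yy: "y \<bullet> y = (\<Sum>i<n. (y $ i)\<^sup>2)" using y by (simp add: scalar_prod_def atLeast0LessThan power2_eq_square)
  have le: "\<bar>y $ i\<bar> * \<bar>y $ j\<bar> \<le> y \<bullet> y" if "i < n" "j < n" for i j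
  proof -
    have "(y $ k)\<^sup>2 \<le> y \<bullet> y" if "k < n" for k
      unfolding yy using that by (intro member_le_sum) auto
    hence "\<bar>y $ k\<bar> \<le> sqrt (y \<bullet> y)" if "k < n" for k
      using that by (intro real_le_rsqrt) simp
    hence "\<bar>y $ i\<bar> * \<bar>y $ j\<bar> \<le> sqrt (y \<bullet> y) * sqrt (y \<bullet> y)"
      using that by (intro mult_mono) (auto simp: scalar_prod_self_nonneg)
    thus ?thesis by (simp add: scalar_prod_self_nonneg)
  qed
  have "y \<bullet> (M *\<^sub>v y) = (\<Sum>i<n. y $ i * (M *\<^sub>v y) $ i)"
    unfolding scalar_prod_def using M by (simp add: atLeast0LessThan)
  also have "\<dots> = (\<Sum>i<n. y $ i * (\<Sum>j<n. M $$ (i, j) * y $ j))"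
    by (intro sum.cong refl arg_cong2[where f = times] index_mult_mat_vec_sum[OF M y]) simp
  also have "\<dots> = (\<Sum>i<n. \<Sum>j<n. M $$ (i, j) * (y $ i * y $ j))" by (simp add: sum_distrib_left mult_ac)
  also have "\<dots> \<le> (\<Sum>i<n. \<Sum>j<n. \<bar>M $$ (i, j)\<bar> * (y \<bullet> y))"
  proof (intro sum_mono)
    fix i j assume "i \<in> {..<n}" "j \<in> {..<n}"
    hence "\<bar>M $$ (i, j)\<bar> * (\<bar>y $ i\<bar> * \<bar>y $ j\<bar>) \<le> \<bar>M $$ (i, j)\<bar> * (y \<bullet> y)"
      by (intro mult_left_mono le) auto
    thus "M $$ (i, j) * (y $ i * y $ j) \<le> \<bar>M $$ (i, j)\<bar> * (y \<bullet> y)"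
      using abs_ge_self[of "M $$ (i, j) * (y $ i * y $ j)"] by (simp add: abs_mult)
  qed
  also have "\<dots> = (\<Sum>i<n. \<Sum>j<n. \<bar>M $$ (i, j)\<bar>) * (y \<bullet> y)" by (simp add: sum_distrib_right)
  finally show "y \<bullet> (M *\<^sub>v y) \<le> (\<Sum>i<n. \<Sum>j<n. \<bar>M $$ (i, j)\<bar>) * (y \<bullet> y)" .
qed

lemma scalar_prod_self_zero:
  fixes v :: "real vec"
  assumes "v \<in> carrier_vec n" "v \<bullet> v \<le> 0"
  shows "v = 0\<^sub>v n"
proof -
  have "(\<Sum>i<n. v $ i * v $ i) \<le> 0" using assms by (simp add: scalar_prod_def atLeast0LessThan)
  hence "(\<Sum>i<n. v $ i * v $ i) = 0" by (intro antisym sum_nonneg) auto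
  hence "\<forall>i<n. v $ i = 0" by (subst (asm) sum_nonneg_eq_0_iff) auto
  thus ?thesis using assms(1) by (intro eq_vecI) auto
qed

lemma positive_definite_inverse:
  fixes X :: "real mat"
  assumes X: "X \<in> carrier_mat n n" "transpose_mat X = X" and e: "0 < e"
    and pd: "\<And>y. y \<in> carrier_vec n \<Longrightarrow> e * (y \<bullet> y) \<le> y \<bullet> (X *\<^sub>v y)"
  obtains P where "P \<in> carrier_mat n n" "transpose_mat P = P" "\<And>x. x \<in> carrier_vec n \<Longrightarrow> X *\<^sub>v (P *\<^sub>v x) = x"
proof -
  have "det X \<noteq> 0"
  proof
    assume "det X = 0"
    then obtain v where v: "v \<in> carrier_vec n" "v \<noteq> 0\<^sub>v n" "X *\<^sub>v v = 0\<^sub>v n"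
      using det_0_iff_vec_prod_zero_field[OF X(1)] by auto
    have "e * (v \<bullet> v) \<le> 0" using pd[OF v(1)] v by simp
    hence "v \<bullet> v \<le> 0" using e by (simp add: mult_le_0_iff)
    thus False using scalar_prod_self_zero v by blast
  qed
  from det_non_zero_imp_unit[OF X(1) this] obtain P where P: "P \<in> carrier_mat n n" "X * P = 1\<^sub>m n"
    by (auto simp: Units_def ring_mat_def)
  have XP: "X *\<^sub>v (P *\<^sub>v x) = x" if "x \<in> carrier_vec n" for x
    using assoc_mult_mat_vec[OF X(1) P(1) that] P(2) that by simp
  have "u \<bullet> (P *\<^sub>v v) = v \<bullet> (P *\<^sub>v u)" if uv: "u \<in> carrier_vec n" "v \<in> carrier_vec n" for u v
  proof -
    have c: "P *\<^sub>v u \<in> carrier_vec n" "P *\<^sub>v v \<in> carrier_vec n" using P uv by auto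
    have "u \<bullet> (P *\<^sub>v v) = (P *\<^sub>v v) \<bullet> (X *\<^sub>v (P *\<^sub>v u))"
      unfolding XP[OF uv(1)] by (rule comm_scalar_prod[OF uv(1) c(2)])
    also have "\<dots> = (P *\<^sub>v u) \<bullet> (X *\<^sub>v (P *\<^sub>v v))" by (rule symmetric_form[OF X c(2,1)])
    also have "\<dots> = v \<bullet> (P *\<^sub>v u)" unfolding XP[OF uv(2)] by (rule comm_scalar_prod[OF c(1) uv(2)])
    finally show ?thesis .
  qed
  from symmetric_matI[OF P(1) this] show ?thesis using that[OF P(1) _ XP] by blast
qed

lemma sym_psdI:
  "M \<in> carrier_mat n n \<Longrightarrow> transpose_mat M = M \<Longrightarrow>
    (\<And>x. x \<in> carrier_vec n \<Longrightarrow> 0 \<le> x \<bullet> (M *\<^sub>v x)) \<Longrightarrow> sym_psd M"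
  by (simp add: sym_psd_def)

text \<open>\<open>Q\<close> is the observability Gramian divided by \<open>l\<close>, and \<open>P\<close> is the inverse of the controllability
  Gramian perturbed by \<open>e \<cdot>\<^sub>m W\<close>; without the perturbation there need not be an inverse, since
  \<open>(A, B)\<close> may be uncontrollable. The gap between $c^2$ and \<open>l\<close> absorbs the perturbation.\<close>

lemma hankel_bounded_lmi:
  assumes ps: "power_summable n A" and B: "B \<in> carrier_mat n p" and C: "C \<in> carrier_mat q n"
    and f: "\<And>k i j. i < q \<Longrightarrow> j < p \<Longrightarrow> f (Suc k) i j = (C * A ^\<^sub>m k * B) $$ (i, j)"
    and hb: "hankel_bounded q p f c" and c: "0 \<le> c" "c < 1"
  shows "\<exists>P Q l. lmi_solution A B C P Q l"
proof -
  interpret power_summable n A by (rule ps)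
  interpret T: power_summable n "transpose_mat A" by (rule transpose_power_summable)
  define X0 where "X0 = gramian A B"
  \<comment> \<open>The Gramian with identity input: it dominates the identity and satisfies a
    Lyapunov equation with the same \<open>A\<close>, so adding a multiple of it to
    \<open>X0\<close> yields a definite matrix without losing the Lyapunov inequality.\<close>
  define W where "W = gramian A (1\<^sub>m n)"
  define Q0 where "Q0 = gramian (transpose_mat A) (transpose_mat C)"
  have Ct: "transpose_mat C \<in> carrier_mat n q" and At: "transpose_mat A \<in> carrier_mat n n"
    and Bt: "transpose_mat B \<in> carrier_mat p n" and I: "1\<^sub>m n \<in> carrier_mat n n"
    using A B C by auto
  have X0: "X0 \<in> carrier_mat n n" "transpose_mat X0 = X0" by (simp_all only: X0_def gramian_carrier gramian_symmetric)
  have W: "W \<in> carrier_mat n n" "transpose_mat W = W" by (simp_all only: W_def gramian_carrier gramian_symmetric)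
  have Q0: "Q0 \<in> carrier_mat n n" "transpose_mat Q0 = Q0" by (simp_all only: Q0_def T.gramian_carrier T.gramian_symmetric)
  have CA: "C * A ^\<^sub>m s \<in> carrier_mat q n" for s by (rule mult_carrier_mat[OF C Ak])
  have AB: "A ^\<^sub>m s * B \<in> carrier_mat n p" for s by (rule mult_carrier_mat[OF Ak B])
  have trans_obs: "transpose_mat (transpose_mat A ^\<^sub>m s * transpose_mat C) = C * A ^\<^sub>m s" for s
    unfolding transpose_pow transpose_mult[OF C Ak, symmetric] by simp
  have Q0_psd: "0 \<le> x \<bullet> (Q0 *\<^sub>v x)" if "x \<in> carrier_vec n" for x
    unfolding Q0_def by (rule T.gramian_nonneg[OF Ct that])
  have Q0_lyap: "x \<bullet> (Q0 *\<^sub>v x) = (A *\<^sub>v x) \<bullet> (Q0 *\<^sub>v (A *\<^sub>v x)) + (C *\<^sub>v x) \<bullet> (C *\<^sub>v x)" if "x \<in> carrier_vec n" for x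
    using T.gramian_lyapunov[OF Ct that] by (simp add: Q0_def)
  \<comment> \<open>The input g_t = (A^t B)^T y steers to the state X0 y, and its energy is the form
    of \<open>X0\<close> at y. The output released from there has as its energy the form of
    \<open>Q0\<close> at X0 y, so the Hankel bound compares the two. Both are infinite series, so
    finitely many inputs and outputs are compared before the limits are taken.\<close>
  have hank: "(X0 *\<^sub>v y) \<bullet> (Q0 *\<^sub>v (X0 *\<^sub>v y)) \<le> c\<^sup>2 * (y \<bullet> (X0 *\<^sub>v y))" if y: "y \<in> carrier_vec n" for y
  proof -
    define g where "g t = transpose_mat (A ^\<^sub>m t * B) *\<^sub>v y" for t
    have g: "g t \<in> carrier_vec p" for t unfolding g_def by (intro mult_mat_vec_carrier[OF _ y]) (simp only: transpose_carrier_mat AB)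
    define xi where "xi K = vec n (\<lambda>m. \<Sum>t<K. ((A ^\<^sub>m t * B) *\<^sub>v g t) $ m)" for K
    have xi: "xi K \<in> carrier_vec n" for K by (simp add: xi_def)
    have Xy: "X0 *\<^sub>v y \<in> carrier_vec n" by (rule mult_mat_vec_carrier[OF X0(1) y])
    have lim: "(\<lambda>K. ((C * A ^\<^sub>m s) *\<^sub>v xi K) $ i) \<longlonglongrightarrow> ((C * A ^\<^sub>m s) *\<^sub>v (X0 *\<^sub>v y)) $ i" if i: "i < q" for s i
      unfolding index_mult_mat_vec_sum[OF CA xi i] index_mult_mat_vec_sum[OF CA Xy i]
    proof (intro tendsto_sum tendsto_mult tendsto_const)
      fix m assume "m \<in> {..<n}"
      hence m: "m < n" by simp
      have "(\<lambda>K. \<Sum>t<K. ((A ^\<^sub>m t * B) *\<^sub>v g t) $ m) \<longlonglongrightarrow> (X0 *\<^sub>v y) $ m"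
        using gramian_apply[OF B y m] unfolding sums_def g_def X0_def .
      thus "(\<lambda>K. xi K $ m) \<longlonglongrightarrow> (X0 *\<^sub>v y) $ m" using m by (simp add: xi_def)
    qed
    have out: "((C * A ^\<^sub>m s) *\<^sub>v xi K) $ i = (\<Sum>t<K. \<Sum>j<p. f (s + t + 1) i j * g t $ j)" if i: "i < q" for s i K
    proof -
      have fe: "(\<Sum>m<n. (C * A ^\<^sub>m s) $$ (i, m) * ((A ^\<^sub>m t * B) *\<^sub>v g t) $ m) = (\<Sum>j<p. f (s + t + 1) i j * g t $ j)" for t
      proof -
        have ABg: "(A ^\<^sub>m t * B) *\<^sub>v g t \<in> carrier_vec n" by (rule mult_mat_vec_carrier[OF AB g])
        have m: "(C * A ^\<^sub>m s) * (A ^\<^sub>m t * B) = C * A ^\<^sub>m (s + t) * B"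
        proof -
          have "(C * A ^\<^sub>m s) * (A ^\<^sub>m t * B) = C * (A ^\<^sub>m s * (A ^\<^sub>m t * B))" by (rule assoc_mult_mat[OF C Ak AB])
          also have "A ^\<^sub>m s * (A ^\<^sub>m t * B) = A ^\<^sub>m s * A ^\<^sub>m t * B" by (rule assoc_mult_mat[OF Ak Ak B, symmetric])
          also have "\<dots> = A ^\<^sub>m (s + t) * B" by (simp only: mat_pow_add[OF A])
          also have "C * (A ^\<^sub>m (s + t) * B) = C * A ^\<^sub>m (s + t) * B" by (rule assoc_mult_mat[OF C Ak B, symmetric])
          finally show ?thesis .
        qed
        have "(\<Sum>m<n. (C * A ^\<^sub>m s) $$ (i, m) * ((A ^\<^sub>m t * B) *\<^sub>v g t) $ m) = ((C * A ^\<^sub>m s) *\<^sub>v ((A ^\<^sub>m t * B) *\<^sub>v g t)) $ i"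
          by (rule index_mult_mat_vec_sum[OF CA ABg i, symmetric])
        also have "\<dots> = ((C * A ^\<^sub>m (s + t) * B) *\<^sub>v g t) $ i"
          unfolding m[symmetric] by (simp only: assoc_mult_mat_vec[OF CA AB g])
        also have "\<dots> = (\<Sum>j<p. (C * A ^\<^sub>m (s + t) * B) $$ (i, j) * g t $ j)"
          by (rule index_mult_mat_vec_sum[OF mult_carrier_mat[OF CA B] g i])
        finally show ?thesis using f[OF i] by simp
      qed
      have "((C * A ^\<^sub>m s) *\<^sub>v xi K) $ i = (\<Sum>m<n. (C * A ^\<^sub>m s) $$ (i, m) * (\<Sum>t<K. ((A ^\<^sub>m t * B) *\<^sub>v g t) $ m))"
        unfolding index_mult_mat_vec_sum[OF CA xi i] by (intro sum.cong refl) (simp add: xi_def)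
      also have "\<dots> = (\<Sum>t<K. \<Sum>m<n. (C * A ^\<^sub>m s) $$ (i, m) * ((A ^\<^sub>m t * B) *\<^sub>v g t) $ m)"
        unfolding sum_distrib_left by (rule sum.swap)
      finally show ?thesis unfolding fe .
    qed
    have part: "(\<Sum>s<I. \<Sum>i<q. (((C * A ^\<^sub>m s) *\<^sub>v xi K) $ i)\<^sup>2) \<le> c\<^sup>2 * (y \<bullet> (X0 *\<^sub>v y))" for I K
    proof -
      have "(\<Sum>s<I. \<Sum>i<q. (((C * A ^\<^sub>m s) *\<^sub>v xi K) $ i)\<^sup>2)
         = (\<Sum>s<I. \<Sum>i<q. (\<Sum>t<K. \<Sum>j<p. f (s + t + 1) i j * g t $ j)\<^sup>2)"
        by (intro sum.cong refl) (simp only: out lessThan_iff)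
      also have "\<dots> \<le> c\<^sup>2 * (\<Sum>t<K. \<Sum>j<p. (g t $ j)\<^sup>2)"
        using hb[unfolded hankel_bounded_def, rule_format, where I = I and K = K and g = "\<lambda>t j. g t $ j"] .
      also have "(\<Sum>t<K. \<Sum>j<p. (g t $ j)\<^sup>2) = (\<Sum>t<K. g t \<bullet> g t)"
        unfolding scalar_prod_def carrier_vecD[OF g] by (simp add: atLeast0LessThan power2_eq_square)
      also have "\<dots> \<le> y \<bullet> (X0 *\<^sub>v y)"
      proof -
        have gf: "(\<lambda>k. g k \<bullet> g k) sums (y \<bullet> (X0 *\<^sub>v y))"
          unfolding X0_def g_def by (rule gramian_form[OF B y])
        have "(\<Sum>t<K. g t \<bullet> g t) \<le> (\<Sum>t. g t \<bullet> g t)"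
          by (rule sum_le_suminf[OF sums_summable[OF gf]]) (simp_all add: scalar_prod_self_nonneg)
        thus ?thesis by (simp only: sums_unique[OF gf, symmetric])
      qed
      finally show ?thesis by (simp add: mult_left_mono)
    qed
    have part2: "(\<Sum>s<I. ((C * A ^\<^sub>m s) *\<^sub>v (X0 *\<^sub>v y)) \<bullet> ((C * A ^\<^sub>m s) *\<^sub>v (X0 *\<^sub>v y))) \<le> c\<^sup>2 * (y \<bullet> (X0 *\<^sub>v y))" for I
    proof -
      have "(\<lambda>K. \<Sum>s<I. \<Sum>i<q. (((C * A ^\<^sub>m s) *\<^sub>v xi K) $ i)\<^sup>2) \<longlonglongrightarrow> (\<Sum>s<I. \<Sum>i<q. (((C * A ^\<^sub>m s) *\<^sub>v (X0 *\<^sub>v y)) $ i)\<^sup>2)"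
        by (intro tendsto_sum tendsto_power lim) simp
      hence "(\<Sum>s<I. \<Sum>i<q. (((C * A ^\<^sub>m s) *\<^sub>v (X0 *\<^sub>v y)) $ i)\<^sup>2) \<le> c\<^sup>2 * (y \<bullet> (X0 *\<^sub>v y))"
        by (rule LIMSEQ_le_const2) (use part in blast)
      moreover have "(\<Sum>i<q. (((C * A ^\<^sub>m s) *\<^sub>v (X0 *\<^sub>v y)) $ i)\<^sup>2) = ((C * A ^\<^sub>m s) *\<^sub>v (X0 *\<^sub>v y)) \<bullet> ((C * A ^\<^sub>m s) *\<^sub>v (X0 *\<^sub>v y))" for s
        unfolding scalar_prod_def carrier_vecD[OF mult_mat_vec_carrier[OF CA Xy]]
        by (simp only: atLeast0LessThan power2_eq_square)
      ultimately show ?thesis by (simp only:)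
    qed
    have "(\<lambda>s. ((C * A ^\<^sub>m s) *\<^sub>v (X0 *\<^sub>v y)) \<bullet> ((C * A ^\<^sub>m s) *\<^sub>v (X0 *\<^sub>v y))) sums ((X0 *\<^sub>v y) \<bullet> (Q0 *\<^sub>v (X0 *\<^sub>v y)))"
      using T.gramian_form[OF Ct Xy] unfolding trans_obs Q0_def[symmetric] .
    hence "(\<lambda>I. \<Sum>s<I. ((C * A ^\<^sub>m s) *\<^sub>v (X0 *\<^sub>v y)) \<bullet> ((C * A ^\<^sub>m s) *\<^sub>v (X0 *\<^sub>v y))) \<longlonglongrightarrow> (X0 *\<^sub>v y) \<bullet> (Q0 *\<^sub>v (X0 *\<^sub>v y))"
      unfolding sums_def .
    thus ?thesis by (rule LIMSEQ_le_const2) (use part2 in blast)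
  qed
  \<comment> \<open>Halfway between c^2 and 1. The distance \<open>d\<close> of \<open>l\<close>
    from c^2 then satisfies (1 + d) c^2 <= l because c^2 < 1, and this is the weight with which
    \<open>X\<close> is split below.\<close>
  define l where "l = (1 + c\<^sup>2) / 2"
  have c2: "c\<^sup>2 < 1" "0 \<le> c\<^sup>2" using c by (simp_all add: power_less_one_iff)
  have "c\<^sup>2 < l" "l < 1" using c2(1) by (simp_all add: l_def)
  moreover from this c2(2) have "0 < l" by linarith
  ultimately have l: "c\<^sup>2 < l" "l < 1" "0 < l" by blast+
  define d where "d = l - c\<^sup>2"
  have d: "0 < d" using l(1) by (simp add: d_def)
  have dc: "(1 + d) * c\<^sup>2 \<le> l"
  proof -
    have "d * c\<^sup>2 \<le> d * 1" using d c2(1) by (intro mult_left_mono) auto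
    thus ?thesis by (simp add: d_def distrib_right)
  qed
  obtain K1 where K1: "0 \<le> K1" "\<And>y. y \<in> carrier_vec n \<Longrightarrow> y \<bullet> (Q0 *\<^sub>v y) \<le> K1 * (y \<bullet> y)"
    using form_bounded[OF Q0(1)] by blast
  obtain K2 where K2: "0 \<le> K2" "\<And>y. y \<in> carrier_vec n \<Longrightarrow> y \<bullet> ((W * W) *\<^sub>v y) \<le> K2 * (y \<bullet> y)"
    using form_bounded[OF mult_carrier_mat[OF W(1) W(1)]] by blast
  define K where "K = K1 * K2 + 1"
  have K0: "0 < K" using mult_nonneg_nonneg[OF K1(1) K2(1)] unfolding K_def by linarith
  have KW: "(W *\<^sub>v y) \<bullet> (Q0 *\<^sub>v (W *\<^sub>v y)) \<le> K * (y \<bullet> y)" if y: "y \<in> carrier_vec n" for y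
  proof -
    have Wy: "W *\<^sub>v y \<in> carrier_vec n" by (rule mult_mat_vec_carrier[OF W(1) y])
    have "(W *\<^sub>v y) \<bullet> (W *\<^sub>v y) = y \<bullet> (W *\<^sub>v (W *\<^sub>v y))" by (rule symmetric_form[OF W Wy y])
    also have "\<dots> = y \<bullet> ((W * W) *\<^sub>v y)" by (simp only: assoc_mult_mat_vec[OF W(1) W(1) y])
    also have "\<dots> \<le> K2 * (y \<bullet> y)" by (rule K2(2)[OF y])
    finally have "K1 * ((W *\<^sub>v y) \<bullet> (W *\<^sub>v y)) \<le> K1 * (K2 * (y \<bullet> y))" by (intro mult_left_mono K1(1))
    moreover have "0 \<le> y \<bullet> y" by (rule scalar_prod_self_nonneg)
    ultimately show ?thesis using K1(2)[OF Wy] by (simp add: K_def algebra_simps)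
  qed
  \<comment> \<open>Chosen such that the perturbation costs (1 + 1/d) e^2 K |y|^2 = l e |y|^2. This
    is at most l e times the form of \<open>W\<close>, which is \<open>l\<close> times what
    \<open>X\<close> gains by the perturbation.\<close>
  define e where "e = l / ((1 + 1 / d) * K)"
  have d1: "0 < 1 + 1 / d" using d by (simp add: add_pos_pos)
  have e: "0 < e" unfolding e_def by (rule divide_pos_pos[OF l(3) mult_pos_pos[OF d1 K0]])
  have eK: "(1 + 1 / d) * (e\<^sup>2 * K) = l * e"
  proof -
    have "(1 + 1 / d) * K \<noteq> 0" using mult_pos_pos[OF d1 K0] by linarith
    hence "(1 + 1 / d) * K * e = l" unfolding e_def times_divide_eq_right by (rule nonzero_mult_div_cancel_left)
    hence "(1 + 1 / d) * K * e * e = l * e" by simp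
    thus ?thesis by (simp only: power2_eq_square mult_ac)
  qed
  define X where "X = X0 + e \<cdot>\<^sub>m W"
  have eW: "e \<cdot>\<^sub>m W \<in> carrier_mat n n" using W by simp
  have X: "X \<in> carrier_mat n n" using X0 W by (simp add: X_def)
  have Xv: "X *\<^sub>v y = X0 *\<^sub>v y + e \<cdot>\<^sub>v (W *\<^sub>v y)" if y: "y \<in> carrier_vec n" for y
  proof -
    have "(e \<cdot>\<^sub>m W) *\<^sub>v y = e \<cdot>\<^sub>v (W *\<^sub>v y)" using W(1) y by (intro eq_vecI) auto
    thus ?thesis unfolding X_def by (simp only: add_mult_distrib_mat_vec[OF X0(1) eW y])
  qed
  have Xt: "transpose_mat X = X"
  proof (rule eq_matI)
    fix i j assume "i < dim_row X" "j < dim_col X"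
    hence ij: "i < n" "j < n" using X by auto
    have "X0 $$ (j, i) = X0 $$ (i, j)" "W $$ (j, i) = W $$ (i, j)"
      using arg_cong[OF X0(2), of "\<lambda>M. M $$ (i, j)"] arg_cong[OF W(2), of "\<lambda>M. M $$ (i, j)"] X0(1) W(1) ij by simp_all
    thus "transpose_mat X $$ (i, j) = X $$ (i, j)" using X0 W ij by (simp add: X_def)
  qed (use X in auto)
  have Xf: "y \<bullet> (X *\<^sub>v y) = y \<bullet> (X0 *\<^sub>v y) + e * (y \<bullet> (W *\<^sub>v y))" if y: "y \<in> carrier_vec n" for y
  proof -
    have c: "X0 *\<^sub>v y \<in> carrier_vec n" "W *\<^sub>v y \<in> carrier_vec n" using X0 W y by auto
    thus ?thesis unfolding Xv[OF y] using y by (simp add: scalar_prod_add_distrib[of _ n] scalar_prod_smult_distrib[of _ n])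
  qed
  have X0_psd: "0 \<le> y \<bullet> (X0 *\<^sub>v y)" if "y \<in> carrier_vec n" for y
    unfolding X0_def by (rule gramian_nonneg[OF B that])
  have W_lyap: "y \<bullet> (W *\<^sub>v y) = (transpose_mat A *\<^sub>v y) \<bullet> (W *\<^sub>v (transpose_mat A *\<^sub>v y)) + y \<bullet> y"
    if "y \<in> carrier_vec n" for y
    using gramian_lyapunov[OF I that] that by (simp add: W_def)
  have W_ge: "y \<bullet> y \<le> y \<bullet> (W *\<^sub>v y)" if y: "y \<in> carrier_vec n" for y
  proof -
    have "0 \<le> (transpose_mat A *\<^sub>v y) \<bullet> (W *\<^sub>v (transpose_mat A *\<^sub>v y))"
      unfolding W_def by (rule gramian_nonneg[OF I mult_mat_vec_carrier[OF At y]])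
    thus ?thesis using W_lyap[OF y] by simp
  qed
  have X_pd: "e * (y \<bullet> y) \<le> y \<bullet> (X *\<^sub>v y)" if y: "y \<in> carrier_vec n" for y
    unfolding Xf[OF y] using X0_psd[OF y] mult_left_mono[OF W_ge[OF y] less_imp_le[OF e]] by linarith
  have X_psd: "0 \<le> y \<bullet> (X *\<^sub>v y)" if y: "y \<in> carrier_vec n" for y
    by (rule order_trans[OF mult_nonneg_nonneg[OF less_imp_le[OF e] scalar_prod_self_nonneg] X_pd[OF y]])
  have X_lyap: "(transpose_mat A *\<^sub>v y) \<bullet> (X *\<^sub>v (transpose_mat A *\<^sub>v y)) + (transpose_mat B *\<^sub>v y) \<bullet> (transpose_mat B *\<^sub>v y)
      \<le> y \<bullet> (X *\<^sub>v y)" if y: "y \<in> carrier_vec n" for y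
  proof -
    have Ay: "transpose_mat A *\<^sub>v y \<in> carrier_vec n" by (rule mult_mat_vec_carrier[OF At y])
    have "0 \<le> e * (y \<bullet> y)" by (rule mult_nonneg_nonneg[OF less_imp_le[OF e] scalar_prod_self_nonneg])
    thus ?thesis unfolding Xf[OF y] Xf[OF Ay] W_lyap[OF y] distrib_left
      using gramian_lyapunov[OF B y, folded X0_def] by linarith
  qed
  \<comment> \<open>As forms, X Q0 X <= l X; with x = X y this is Q0 <= l P for the inverse
    \<open>P\<close> of \<open>X\<close>.\<close>
  have XQX: "(X *\<^sub>v y) \<bullet> (Q0 *\<^sub>v (X *\<^sub>v y)) \<le> l * (y \<bullet> (X *\<^sub>v y))" if y: "y \<in> carrier_vec n" for y
  proof -
    have c: "X0 *\<^sub>v y \<in> carrier_vec n" "W *\<^sub>v y \<in> carrier_vec n" using X0 W y by auto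
    have ec: "e \<cdot>\<^sub>v (W *\<^sub>v y) \<in> carrier_vec n" using c by simp
    have eQ: "(e \<cdot>\<^sub>v (W *\<^sub>v y)) \<bullet> (Q0 *\<^sub>v (e \<cdot>\<^sub>v (W *\<^sub>v y))) = e\<^sup>2 * ((W *\<^sub>v y) \<bullet> (Q0 *\<^sub>v (W *\<^sub>v y)))"
      using c Q0 mult_mat_vec_carrier[OF Q0(1) c(2)]
      by (simp add: mult_mat_vec[of _ n n] power2_eq_square scalar_prod_smult_distrib[of _ n] smult_scalar_prod_distrib[of _ n])
    have "(X *\<^sub>v y) \<bullet> (Q0 *\<^sub>v (X *\<^sub>v y)) \<le> (1 + d) * ((X0 *\<^sub>v y) \<bullet> (Q0 *\<^sub>v (X0 *\<^sub>v y)))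
        + (1 + 1 / d) * ((e \<cdot>\<^sub>v (W *\<^sub>v y)) \<bullet> (Q0 *\<^sub>v (e \<cdot>\<^sub>v (W *\<^sub>v y))))"
      unfolding Xv[OF y] by (rule form_add_le[OF Q0 Q0_psd c(1) ec d])
    moreover have "(1 + d) * ((X0 *\<^sub>v y) \<bullet> (Q0 *\<^sub>v (X0 *\<^sub>v y))) \<le> l * (y \<bullet> (X0 *\<^sub>v y))"
    proof -
      have "(1 + d) * ((X0 *\<^sub>v y) \<bullet> (Q0 *\<^sub>v (X0 *\<^sub>v y))) \<le> (1 + d) * (c\<^sup>2 * (y \<bullet> (X0 *\<^sub>v y)))"
        using d by (intro mult_left_mono hank[OF y]) simp
      also have "\<dots> = ((1 + d) * c\<^sup>2) * (y \<bullet> (X0 *\<^sub>v y))" by (simp only: mult.assoc)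
      also have "\<dots> \<le> l * (y \<bullet> (X0 *\<^sub>v y))" by (rule mult_right_mono[OF dc X0_psd[OF y]])
      finally show ?thesis .
    qed
    moreover have "(1 + 1 / d) * ((e \<cdot>\<^sub>v (W *\<^sub>v y)) \<bullet> (Q0 *\<^sub>v (e \<cdot>\<^sub>v (W *\<^sub>v y)))) \<le> l * (e * (y \<bullet> (W *\<^sub>v y)))"
    proof -
      have "(1 + 1 / d) * ((e \<cdot>\<^sub>v (W *\<^sub>v y)) \<bullet> (Q0 *\<^sub>v (e \<cdot>\<^sub>v (W *\<^sub>v y)))) \<le> (1 + 1 / d) * (e\<^sup>2 * (K * (y \<bullet> y)))"
        unfolding eQ using less_imp_le[OF d1] by (intro mult_left_mono KW[OF y]) auto
      also have "\<dots> = (1 + 1 / d) * (e\<^sup>2 * K) * (y \<bullet> y)" by (simp only: mult.assoc)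
      also have "\<dots> = l * e * (y \<bullet> y)" unfolding eK ..
      also have "\<dots> \<le> l * e * (y \<bullet> (W *\<^sub>v y))" using l e by (intro mult_left_mono W_ge[OF y]) auto
      finally show ?thesis by (simp only: mult.assoc)
    qed
    ultimately show ?thesis unfolding Xf[OF y] distrib_left by linarith
  qed
  obtain P where P: "P \<in> carrier_mat n n" "transpose_mat P = P" and XP: "\<And>x. x \<in> carrier_vec n \<Longrightarrow> X *\<^sub>v (P *\<^sub>v x) = x"
    using positive_definite_inverse[OF X Xt e X_pd] by blast
  have Pc: "P *\<^sub>v x \<in> carrier_vec n" if "x \<in> carrier_vec n" for x by (rule mult_mat_vec_carrier[OF P(1) that])
  have Pf: "x \<bullet> (P *\<^sub>v x) = (P *\<^sub>v x) \<bullet> (X *\<^sub>v (P *\<^sub>v x))" if x: "x \<in> carrier_vec n" for x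
    unfolding XP[OF x] by (rule comm_scalar_prod[OF x Pc[OF x]])
  define Q where "Q = (1 / l) \<cdot>\<^sub>m Q0"
  have Q: "Q \<in> carrier_mat n n" using Q0 by (simp add: Q_def)
  have Qv: "Q *\<^sub>v x = (1 / l) \<cdot>\<^sub>v (Q0 *\<^sub>v x)" if "x \<in> carrier_vec n" for x
    unfolding Q_def using Q0(1) that by (intro eq_vecI) auto
  have Qf: "u \<bullet> (Q *\<^sub>v x) = (1 / l) * (u \<bullet> (Q0 *\<^sub>v x))" if "u \<in> carrier_vec n" "x \<in> carrier_vec n" for u x
    unfolding Qv[OF that(2)] by (rule scalar_prod_smult_distrib[OF that(1) mult_mat_vec_carrier[OF Q0(1) that(2)]])
  have Qt: "transpose_mat Q = Q"
    by (rule symmetric_matI[OF Q]) (simp only: Qf symmetric_form[OF Q0])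
  have PQ: "0 \<le> x \<bullet> ((P - Q) *\<^sub>v x)" if x: "x \<in> carrier_vec n" for x
  proof -
    have Qx: "Q *\<^sub>v x \<in> carrier_vec n" by (rule mult_mat_vec_carrier[OF Q x])
    have "x \<bullet> ((P - Q) *\<^sub>v x) = x \<bullet> (P *\<^sub>v x) - x \<bullet> (Q *\<^sub>v x)"
      by (simp only: minus_mult_distrib_mat_vec[OF P(1) Q x] scalar_prod_minus_distrib[OF x Pc[OF x] Qx])
    moreover have "x \<bullet> (Q0 *\<^sub>v x) \<le> l * (x \<bullet> (P *\<^sub>v x))"
      unfolding Pf[OF x] using XQX[OF Pc[OF x]] by (simp only: XP[OF x])
    from mult_left_mono[OF this, of "1 / l"] have "x \<bullet> (Q *\<^sub>v x) \<le> x \<bullet> (P *\<^sub>v x)"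
      unfolding Qf[OF x x] using l(3) by simp
    ultimately show ?thesis by simp
  qed
  have "lmi_solution A B C P Q l"
    unfolding lmi_solution_def
  proof (intro conjI)
    show "P \<in> carrier_mat (dim_row A) (dim_row A)" "Q \<in> carrier_mat (dim_row A) (dim_row A)"
      using A P Q by auto
    show "sym_psd P" by (rule sym_psdI[OF P]) (simp only: Pf X_psd Pc)
    show "sym_psd Q"
    proof (rule sym_psdI[OF Q Qt])
      fix x :: "real vec" assume x: "x \<in> carrier_vec n"
      show "0 \<le> x \<bullet> (Q *\<^sub>v x)"
        unfolding Qf[OF x x] by (rule mult_nonneg_nonneg[OF _ Q0_psd[OF x]]) (use l(3) in simp)
    qed
    show "sym_psd (P - Q)"
    proof -
      have "transpose_mat (P - Q) = P - Q" using transpose_minus[OF P(1) Q] by (simp add: P Qt)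
      thus ?thesis by (rule sym_psdI[OF minus_carrier_mat[OF Q]]) (rule PQ)
    qed
    show "0 \<le> l" "l < 1" using l by auto
    have d0: "0\<^sub>v n \<in> carrier_vec n" "0\<^sub>v q \<in> carrier_vec q" "0\<^sub>v p \<in> carrier_vec p" by auto
    show "sym_nsd (lmi_observe A C Q l)"
    proof (rule sym_nsdI[OF lmi_observe_form(1)[OF A C Q d0(1,2) d0(1,2)]])
      fix u v :: "real vec" assume "u \<in> carrier_vec (n + q)" "v \<in> carrier_vec (n + q)"
      then obtain x y x' y' where u: "x \<in> carrier_vec n" "y \<in> carrier_vec q" "u = x @\<^sub>v y"
        and v: "x' \<in> carrier_vec n" "y' \<in> carrier_vec q" "v = x' @\<^sub>v y'"
        by (metis carrier_vec_split)
      have c: "A *\<^sub>v x \<in> carrier_vec n" "A *\<^sub>v x' \<in> carrier_vec n" "C *\<^sub>v x \<in> carrier_vec q" "C *\<^sub>v x' \<in> carrier_vec q"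
        using A C u v by auto
      show "u \<bullet> (lmi_observe A C Q l *\<^sub>v v) = v \<bullet> (lmi_observe A C Q l *\<^sub>v u)"
        unfolding u(3) v(3) lmi_observe_form(2)[OF A C Q u(1,2) v(1,2)] lmi_observe_form(2)[OF A C Q v(1,2) u(1,2)]
        using symmetric_form[OF Q Qt c(1,2)] symmetric_form[OF Q Qt u(1) v(1)]
          comm_scalar_prod[OF c(3) v(2)] comm_scalar_prod[OF u(2) c(4)] comm_scalar_prod[OF u(2) v(2)] by simp
    next
      fix u :: "real vec" assume "u \<in> carrier_vec (n + q)"
      then obtain x y where u: "x \<in> carrier_vec n" "y \<in> carrier_vec q" "u = x @\<^sub>v y"
        by (metis carrier_vec_split)
      have c: "A *\<^sub>v x \<in> carrier_vec n" "C *\<^sub>v x \<in> carrier_vec q" using A C u by auto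
      define g where "g = C *\<^sub>v x"
      have g: "g \<in> carrier_vec q" using c by (simp add: g_def)
      have "(A *\<^sub>v x) \<bullet> (Q *\<^sub>v (A *\<^sub>v x)) - x \<bullet> (Q *\<^sub>v x) = - ((1 / l) * (g \<bullet> g))"
        unfolding Qf[OF c(1,1)] Qf[OF u(1,1)] Q0_lyap[OF u(1)] g_def by (simp add: algebra_simps)
      \<comment> \<open>Completing the square with weight \<open>l\<close> replaces the Schur
        complement with respect to the block - l I.\<close>
      moreover have "2 * (g \<bullet> y) \<le> (1 / l) * (g \<bullet> g) + l * (y \<bullet> y)"
      proof -
        have s: "g \<in> carrier_vec q" "l \<cdot>\<^sub>v y \<in> carrier_vec q" using g u by auto
        have "2 * (g \<bullet> (l \<cdot>\<^sub>v y)) \<le> g \<bullet> g + (l \<cdot>\<^sub>v y) \<bullet> (l \<cdot>\<^sub>v y)" by (rule scalar_prod_young[OF s])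
        hence "l * (2 * (g \<bullet> y)) \<le> l * ((1 / l) * (g \<bullet> g) + l * (y \<bullet> y))"
          using g u l by (simp add: scalar_prod_smult_distrib[of _ q] smult_scalar_prod_distrib[of _ q] distrib_left)
        thus ?thesis using l(3) by (simp only: mult_le_cancel_left_pos)
      qed
      ultimately show "u \<bullet> (lmi_observe A C Q l *\<^sub>v u) \<le> 0"
        unfolding u(3) lmi_observe_form(2)[OF A C Q u(1,2) u(1,2)] g_def[symmetric]
        using comm_scalar_prod[OF g u(2)] by linarith
    qed
    show "sym_nsd (lmi_control A B P)"
    proof (rule sym_nsdI[OF lmi_control_form(1)[OF A B P d0(1,3,1) d0(1,3,1)]])
      fix u v :: "real vec" assume "u \<in> carrier_vec (n + (p + n))" "v \<in> carrier_vec (n + (p + n))"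
      then obtain a w x a' w' x' where u: "a \<in> carrier_vec n" "w \<in> carrier_vec p" "x \<in> carrier_vec n" "u = a @\<^sub>v (w @\<^sub>v x)"
        and v: "a' \<in> carrier_vec n" "w' \<in> carrier_vec p" "x' \<in> carrier_vec n" "v = a' @\<^sub>v (w' @\<^sub>v x')"
        by (metis carrier_vec_split)
      show "u \<bullet> (lmi_control A B P *\<^sub>v v) = v \<bullet> (lmi_control A B P *\<^sub>v u)"
        unfolding u(4) v(4) lmi_control_form(2)[OF A B P u(1-3) v(1-3)] lmi_control_form(2)[OF A B P v(1-3) u(1-3)]
        using symmetric_form[OF P u(1) v(1)] symmetric_form[OF P u(3) v(3)] comm_scalar_prod[OF u(2) v(2)] by simp
    next
      fix u :: "real vec" assume "u \<in> carrier_vec (n + (p + n))"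
      then obtain a w x where u: "a \<in> carrier_vec n" "w \<in> carrier_vec p" "x \<in> carrier_vec n" "u = a @\<^sub>v (w @\<^sub>v x)"
        by (metis carrier_vec_split)
      \<comment> \<open>In the dual variables b = P a and y = P x the form is expressed by
        \<open>X\<close>. Young's inequality bounds the two cross terms, and what remains is the
        Lyapunov inequality for \<open>X\<close> at b.\<close>
      define b y where "b = P *\<^sub>v a" and "y = P *\<^sub>v x"
      have b: "b \<in> carrier_vec n" and y: "y \<in> carrier_vec n" using Pc u by (auto simp: b_def y_def)
      have c: "B *\<^sub>v w \<in> carrier_vec n" "A *\<^sub>v x \<in> carrier_vec n" "transpose_mat A *\<^sub>v b \<in> carrier_vec n" "transpose_mat B *\<^sub>v b \<in> carrier_vec p"
        using A B At Bt u b by auto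
      have bw: "b \<bullet> (B *\<^sub>v w) = (transpose_mat B *\<^sub>v b) \<bullet> w" by (rule transpose_vec_mult_scalar[OF B u(2) b, symmetric])
      have bx: "b \<bullet> (A *\<^sub>v x) = (transpose_mat A *\<^sub>v b) \<bullet> (X *\<^sub>v y)"
        unfolding y_def XP[OF u(3)] by (rule transpose_vec_mult_scalar[OF A u(3) b, symmetric])
      have m: "a \<bullet> (P *\<^sub>v (B *\<^sub>v w + A *\<^sub>v x)) = b \<bullet> (B *\<^sub>v w) + b \<bullet> (A *\<^sub>v x)"
      proof -
        have s: "B *\<^sub>v w + A *\<^sub>v x \<in> carrier_vec n" by (rule add_carrier_vec[OF c(1,2)])
        have "a \<bullet> (P *\<^sub>v (B *\<^sub>v w + A *\<^sub>v x)) = (B *\<^sub>v w + A *\<^sub>v x) \<bullet> b"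
          unfolding b_def by (rule symmetric_form[OF P u(1) s])
        also have "\<dots> = b \<bullet> (B *\<^sub>v w + A *\<^sub>v x)" by (rule comm_scalar_prod[OF s b])
        also have "\<dots> = b \<bullet> (B *\<^sub>v w) + b \<bullet> (A *\<^sub>v x)" by (rule scalar_prod_add_distrib[OF b c(1,2)])
        finally show ?thesis .
      qed
      have aa: "a \<bullet> (P *\<^sub>v a) = b \<bullet> (X *\<^sub>v b)" unfolding b_def by (rule Pf[OF u(1)])
      have xx: "x \<bullet> (P *\<^sub>v x) = y \<bullet> (X *\<^sub>v y)" unfolding y_def by (rule Pf[OF u(3)])
      show "u \<bullet> (lmi_control A B P *\<^sub>v u) \<le> 0"
        unfolding u(4) lmi_control_form(2)[OF A B P u(1-3) u(1-3)] m aa xx bw bx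
        using X_lyap[OF b] form_young[OF X Xt X_psd c(3) y] scalar_prod_young[OF c(4) u(2)] by linarith
    qed
  qed
  thus ?thesis by blast
qed

subsection \<open>Realizations\<close>

text \<open>The easy half of Nehari's theorem with norm 0: the difference of the two series is the
  zero function, so all Hankel entries vanish. Both series contain a constant term, so the claim
  concerns indices from 1 on.\<close>

lemma laurent_unique:
  fixes f k :: "nat \<Rightarrow> real"
  assumes f: "summable (\<lambda>m. \<bar>f m\<bar>)" and k: "summable (\<lambda>m. \<bar>k m\<bar>)"
    and e: "\<And>z. cmod z = 1 \<Longrightarrow> (\<Sum>m. of_real (f m) * inverse z ^ m) = (\<Sum>m. of_real (k m) * z ^ m)"
  shows "f (Suc n) = 0"
proof -
  have "hankel_bounded 1 1 (\<lambda>m i j. f m) 0"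
  proof (rule hankel_le_sup[where k = "\<lambda>m i j. k m"])
    fix z :: complex assume z: "cmod z = 1"
    show "op_bound 1 1 (\<lambda>i j. (\<Sum>m. of_real (f m) * inverse z ^ m) - (\<Sum>m. of_real (k m) * z ^ m)) 0"
      unfolding e[OF z] by (simp add: op_bound_def L2_set_def)
  qed (use f k in auto)
  \<comment> \<open>A single input equal to 1 picks out the first column, with the entries f 1, ...,
    f (n + 1).\<close>
  from this[unfolded hankel_bounded_def, rule_format, where I = "Suc n" and K = 1 and g = "\<lambda>t j. 1"]
  have "(\<Sum>s<Suc n. (f (Suc s))\<^sup>2) \<le> 0" by simp
  moreover have "(f (Suc n))\<^sup>2 \<le> (\<Sum>s<Suc n. (f (Suc s))\<^sup>2)"
    by (rule member_le_sum) auto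
  ultimately have "(f (Suc n))\<^sup>2 \<le> 0" by (rule order_trans[rotated])
  thus ?thesis by simp
qed

text \<open>With |z| = 1 the Neumann series of the resolvent is not controlled by norms alone.
  Instead, X = w (I + A X) for w = 1/z gives the partial sums X - w^K A^K X, and A^K tends to
  0.\<close>

lemma state_space_expansion:
  assumes A: "A \<in> carrier_mat n n" "schur_stable A"
    and B: "B \<in> carrier_mat n p" and C: "C \<in> carrier_mat q n"
    and z: "cmod z = 1" and ij: "i < q" "j < p"
  shows "(\<lambda>k. of_real ((C * A ^\<^sub>m k * B) $$ (i, j)) * inverse z ^ Suc k) sums
      (tf_eval (state_space n A B C (0\<^sub>m q p)) z $$ (i, j))"
proof -
  define Xf where "Xf = mat_inv (rf_z \<cdot>\<^sub>m 1\<^sub>m n - tf_const A)"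
  have Xf: "Xf \<in> carrier_mat n n" "(rf_z \<cdot>\<^sub>m 1\<^sub>m n - tf_const A) * Xf = 1\<^sub>m n" "tf_circle Xf"
    using resolvent[OF A] by (auto simp: Xf_def)
  define X where "X = tf_eval Xf z"
  define Ac where "Ac = map_mat complex_of_real A"
  define w where "w = inverse z"
  have z0: "z \<noteq> 0" using z by auto
  have X: "X \<in> carrier_mat n n" using Xf by (simp add: X_def)
  have Ac: "Ac \<in> carrier_mat n n" using A by (simp add: Ac_def)
  have zI: "rf_z \<cdot>\<^sub>m 1\<^sub>m n \<in> carrier_mat n n" "tf_const A \<in> carrier_mat n n" using A by auto
  have zIc: "tf_circle (rf_z \<cdot>\<^sub>m 1\<^sub>m n)" by (intro tf_circle_smult) auto
  have ez: "rf_eval rf_z z = z" using rf_value_z[of z] by (simp add: rf_value_def)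
  have res: "(z \<cdot>\<^sub>m 1\<^sub>m n - Ac) * X = 1\<^sub>m n"
  proof -
    have "tf_eval ((rf_z \<cdot>\<^sub>m 1\<^sub>m n - tf_const A) * Xf) z = tf_eval (rf_z \<cdot>\<^sub>m 1\<^sub>m n - tf_const A) z * X"
      unfolding X_def
      by (intro tf_eval_mult[OF minus_carrier_mat[OF zI(2)] Xf(1) _ Xf(3) z] tf_circle_minus[OF zI zIc tf_circle_const])
    also have "tf_eval (rf_z \<cdot>\<^sub>m 1\<^sub>m n - tf_const A) z = z \<cdot>\<^sub>m 1\<^sub>m n - Ac"
      unfolding tf_eval_minus[OF zI zIc tf_circle_const z] Ac_def
      by (subst tf_eval_smult[of _ n n]) (auto simp: z tf_eval_one tf_eval_const ez)
    finally show ?thesis unfolding Xf(2) tf_eval_one by simp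
  qed
  have Xe: "X $$ (a, b) = w * ((1\<^sub>m n :: complex mat) $$ (a, b) + (Ac * X) $$ (a, b))" if "a < n" "b < n" for a b
  proof -
    have "(z \<cdot>\<^sub>m 1\<^sub>m n - Ac) * X = z \<cdot>\<^sub>m X - Ac * X"
      using X Ac by (subst minus_mult_distrib_mat[of _ n n]) (auto simp: mult_smult_assoc_mat[of _ n n _ n])
    hence "(1\<^sub>m n :: complex mat) $$ (a, b) = (z \<cdot>\<^sub>m X - Ac * X) $$ (a, b)" using res by simp
    also have "\<dots> = z * X $$ (a, b) - (Ac * X) $$ (a, b)"
      using X Ac that by (simp del: index_mult_mat(1))
    finally show ?thesis using z0 by (simp add: w_def field_simps del: index_mult_mat(1))
  qed
  have Ak: "A ^\<^sub>m k \<in> carrier_mat n n" for k using A by simp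
  define P where "P k = map_mat complex_of_real (A ^\<^sub>m k)" for k
  have P: "P k \<in> carrier_mat n n" for k using Ak[of k] by (simp add: P_def)
  have PS: "P (Suc k) = P k * Ac" for k
    unfolding P_def Ac_def pow_mat.simps by (rule of_real_hom.mat_hom_mult[OF Ak A(1)])
  have step: "(P k * X) $$ (a, b) = w * P k $$ (a, b) + w * (P (Suc k) * X) $$ (a, b)" if ab: "a < n" "b < n" for k a b
  proof -
    have "(P k * X) $$ (a, b) = (\<Sum>l<n. P k $$ (a, l) * X $$ (l, b))" by (rule index_mult_mat_sum[OF P X ab])
    also have "\<dots> = (\<Sum>l<n. P k $$ (a, l) * (w * ((1\<^sub>m n :: complex mat) $$ (l, b) + (Ac * X) $$ (l, b))))"
      by (intro sum.cong refl arg_cong2[where f = times] Xe) (use ab in auto)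
    also have "\<dots> = w * (\<Sum>l<n. P k $$ (a, l) * (1\<^sub>m n :: complex mat) $$ (l, b)) + w * (\<Sum>l<n. P k $$ (a, l) * (Ac * X) $$ (l, b))"
      by (simp only: sum_distrib_left sum.distrib[symmetric]) (intro sum.cong refl, simp only: distrib_left mult_ac)
    also have "(\<Sum>l<n. P k $$ (a, l) * (1\<^sub>m n :: complex mat) $$ (l, b)) = (P k * 1\<^sub>m n) $$ (a, b)"
      by (rule index_mult_mat_sum[OF P one_carrier_mat ab, symmetric])
    also have "P k * 1\<^sub>m n = P k" by (rule right_mult_one_mat[OF P])
    also have "(\<Sum>l<n. P k $$ (a, l) * (Ac * X) $$ (l, b)) = (P k * (Ac * X)) $$ (a, b)"
      by (rule index_mult_mat_sum[OF P mult_carrier_mat[OF Ac X] ab, symmetric])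
    also have "P k * (Ac * X) = P (Suc k) * X" unfolding PS by (rule assoc_mult_mat[OF P Ac X, symmetric])
    finally show ?thesis .
  qed
  have part: "(\<Sum>k<K. P k $$ (a, b) * w ^ Suc k) = X $$ (a, b) - w ^ K * (P K * X) $$ (a, b)" if ab: "a < n" "b < n" for K a b
  proof (induction K)
    case 0
    have "P 0 = 1\<^sub>m n" using A by (intro eq_matI) (auto simp: P_def)
    thus ?case using X by simp
  next
    case (Suc K)
    show ?case unfolding sum.lessThan_Suc Suc.IH step[OF ab, of K] by (simp add: algebra_simps)
  qed
  have P0: "(\<lambda>K. P K $$ (a, b)) \<longlonglongrightarrow> 0" if ab: "a < n" "b < n" for a b
  proof -
    have "(\<lambda>K. \<bar>(A ^\<^sub>m K) $$ (a, b)\<bar>) \<longlonglongrightarrow> 0"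
      by (rule summable_LIMSEQ_zero[OF schur_stable_power_summable[OF A ab]])
    hence "(\<lambda>K. complex_of_real ((A ^\<^sub>m K) $$ (a, b))) \<longlonglongrightarrow> 0"
      by (simp add: tendsto_rabs_zero_iff tendsto_of_real_iff[where c = 0, simplified])
    moreover have "P K $$ (a, b) = complex_of_real ((A ^\<^sub>m K) $$ (a, b))" for K
      unfolding P_def using carrier_matD[OF Ak[of K]] ab by (intro index_map_mat) auto
    ultimately show ?thesis by simp
  qed
  have w1: "cmod w = 1" using z by (simp add: w_def norm_inverse)
  have Xs: "(\<lambda>k. P k $$ (a, b) * w ^ Suc k) sums X $$ (a, b)" if ab: "a < n" "b < n" for a b
  proof -
    have "(\<lambda>K. \<Sum>l<n. P K $$ (a, l) * X $$ (l, b)) \<longlonglongrightarrow> (\<Sum>l<n. 0 * X $$ (l, b))"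
      by (intro tendsto_sum tendsto_mult tendsto_const P0) (use ab in auto)
    hence "(\<lambda>K. (P K * X) $$ (a, b)) \<longlonglongrightarrow> 0" by (simp only: index_mult_mat_sum[OF P X ab]) simp
    hence "(\<lambda>K. w ^ K * (P K * X) $$ (a, b)) \<longlonglongrightarrow> 0"
      using tendsto_norm_zero_iff[of "\<lambda>K. w ^ K * (P K * X) $$ (a, b)"] tendsto_norm_zero_iff[of "\<lambda>K. (P K * X) $$ (a, b)"]
      by (simp only: norm_mult norm_power w1 power_one mult_1_left)
    hence "(\<lambda>K. X $$ (a, b) - w ^ K * (P K * X) $$ (a, b)) \<longlonglongrightarrow> X $$ (a, b) - 0"
      by (intro tendsto_diff tendsto_const)
    thus ?thesis unfolding sums_def part[OF ab] by simp
  qed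
  have CB: "tf_const C \<in> carrier_mat q n" "tf_const B \<in> carrier_mat n p" using B C by auto
  have CXc: "tf_const C * Xf \<in> carrier_mat q n" "tf_circle (tf_const C * Xf)"
    using mult_carrier_mat[OF CB(1) Xf(1)] tf_circle_mult[OF CB(1) Xf(1) tf_circle_const Xf(3)] by auto
  have CXB: "tf_const C * Xf * tf_const B \<in> carrier_mat q p" "tf_circle (tf_const C * Xf * tf_const B)"
    using mult_carrier_mat[OF CXc(1) CB(2)] tf_circle_mult[OF CXc(1) CB(2) CXc(2) tf_circle_const] by auto
  define Cc Bc where "Cc = map_mat complex_of_real C" and "Bc = map_mat complex_of_real B"
  have Cc: "Cc \<in> carrier_mat q n" and Bc: "Bc \<in> carrier_mat n p" using B C by (auto simp: Cc_def Bc_def)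
  have "tf_eval (state_space n A B C (0\<^sub>m q p)) z = tf_eval (tf_const C * Xf * tf_const B) z + tf_eval (tf_const (0\<^sub>m q p)) z"
    unfolding state_space_def Xf_def[symmetric] by (rule tf_eval_add[OF CXB(1) tf_const_carrier[OF zero_carrier_mat] CXB(2) tf_circle_const z])
  also have "tf_eval (tf_const C * Xf * tf_const B) z = Cc * X * Bc"
    unfolding tf_eval_mult[OF CXc(1) CB(2) CXc(2) tf_circle_const z] tf_eval_mult[OF CB(1) Xf(1) tf_circle_const Xf(3) z]
    by (simp only: tf_eval_const Cc_def Bc_def X_def)
  also have "Cc * X * Bc + tf_eval (tf_const (0\<^sub>m q p)) z = Cc * X * Bc"
    using Cc X Bc by (intro eq_matI) (auto simp: tf_eval_const)
  finally have evz: "tf_eval (state_space n A B C (0\<^sub>m q p)) z = Cc * X * Bc" .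
  have ev: "tf_eval (state_space n A B C (0\<^sub>m q p)) z $$ (i, j) = (\<Sum>b<n. (\<Sum>a<n. Cc $$ (i, a) * X $$ (a, b)) * Bc $$ (b, j))"
    unfolding evz index_mult_mat_sum[OF mult_carrier_mat[OF Cc X] Bc ij]
    by (intro sum.cong refl arg_cong2[where f = times] index_mult_mat_sum[OF Cc X ij(1)]) simp
  have "(\<lambda>k. \<Sum>b<n. (\<Sum>a<n. Cc $$ (i, a) * (P k $$ (a, b) * w ^ Suc k)) * Bc $$ (b, j)) sums
      (\<Sum>b<n. (\<Sum>a<n. Cc $$ (i, a) * X $$ (a, b)) * Bc $$ (b, j))"
    by (intro sums_sum sums_mult2 sums_mult Xs) auto
  moreover have "(\<Sum>b<n. (\<Sum>a<n. Cc $$ (i, a) * (P k $$ (a, b) * w ^ Suc k)) * Bc $$ (b, j))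
      = of_real ((C * A ^\<^sub>m k * B) $$ (i, j)) * w ^ Suc k" for k
  proof -
    have "of_real ((C * A ^\<^sub>m k * B) $$ (i, j)) = (\<Sum>b<n. of_real ((C * A ^\<^sub>m k) $$ (i, b)) * complex_of_real (B $$ (b, j)))"
      unfolding index_mult_mat_sum[OF mult_carrier_mat[OF C Ak] B ij] by simp
    also have "\<dots> = (\<Sum>b<n. (\<Sum>a<n. Cc $$ (i, a) * P k $$ (a, b)) * Bc $$ (b, j))"
    proof (intro sum.cong refl arg_cong2[where f = times])
      fix b assume b: "b \<in> {..<n}"
      show "complex_of_real (B $$ (b, j)) = Bc $$ (b, j)" using B b ij by (simp add: Bc_def)
      have bn: "b < n" using b by simp
      show "complex_of_real ((C * A ^\<^sub>m k) $$ (i, b)) = (\<Sum>a<n. Cc $$ (i, a) * P k $$ (a, b))"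
        unfolding index_mult_mat_sum[OF C Ak ij(1) bn] of_real_sum of_real_mult
        by (intro sum.cong refl arg_cong2[where f = times])
           (use C ij bn carrier_matD[OF Ak[of k]] in \<open>auto simp: Cc_def P_def\<close>)
    qed
    finally show ?thesis by (simp add: sum_distrib_right sum_distrib_left mult_ac)
  qed
  ultimately show ?thesis unfolding ev w_def[symmetric] by simp
qed

text \<open>\<open>rf_coeff\<close> refers to reduced fractions and is not computed from the
  matrices directly. Both expansions represent \<open>F\<close> on the circle, so uniqueness
  identifies its coefficients with the Markov parameters, where C A^k B belongs to z^(-k-1).\<close>

lemma state_space_coeff:
  assumes AA: "A \<in> carrier_mat n n" "schur_stable A"
    and B: "B \<in> carrier_mat n p" and C: "C \<in> carrier_mat q n"
    and F: "F \<in> RHinf q p" "F = state_space n A B C (0\<^sub>m q p)" and ij: "i < q" "j < p"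
  shows "entry_coeff F (Suc k) i j = (C * A ^\<^sub>m k * B) $$ (i, j)"
proof -
  interpret power_summable n A
    by unfold_locales (use AA schur_stable_power_summable[OF AA] in auto)
  define g where "g m = (case m of 0 \<Rightarrow> 0 | Suc k \<Rightarrow> (C * A ^\<^sub>m k * B) $$ (i, j))" for m
  have gs: "summable (\<lambda>m. \<bar>g m\<bar>)"
  proof -
    have CAB: "(C * A ^\<^sub>m k * B) $$ (i, j) = (\<Sum>a<n. C $$ (i, a) * (A ^\<^sub>m k * B) $$ (a, j))" for k
      unfolding assoc_mult_mat[OF C Ak B] by (rule index_mult_mat_sum[OF C mult_carrier_mat[OF Ak B] ij])
    have "summable (\<lambda>k. \<bar>g (Suc k)\<bar>)"
    proof (rule summable_comparison_test'[where N = 0])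
      show "summable (\<lambda>k. \<Sum>a<n. \<bar>C $$ (i, a)\<bar> * \<bar>(A ^\<^sub>m k * B) $$ (a, j)\<bar>)"
        by (intro summable_sum summable_mult mult_summable[OF B]) (use ij in auto)
      show "norm \<bar>g (Suc k)\<bar> \<le> (\<Sum>a<n. \<bar>C $$ (i, a)\<bar> * \<bar>(A ^\<^sub>m k * B) $$ (a, j)\<bar>)" for k
        unfolding g_def nat.case CAB real_norm_def abs_idempotent
        by (rule order_trans[OF sum_abs]) (simp add: abs_mult del: index_mult_mat(1))
    qed
    thus ?thesis by (rule iffD1[OF summable_Suc_iff[of "\<lambda>m. \<bar>g m\<bar>"]])
  qed
  have fs: "summable (\<lambda>m. \<bar>entry_coeff F m i j\<bar>)" by (rule entry_coeff_summable[OF F(1) ij])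
  have "entry_coeff F (Suc k) i j - g (Suc k) = 0"
  proof (rule laurent_unique[where k = "\<lambda>_. 0"])
    show "summable (\<lambda>m. \<bar>entry_coeff F m i j - g m\<bar>)"
      by (rule summable_comparison_test'[OF summable_add[OF fs gs], where N = 0]) (simp add: abs_triangle_ineq4)
    show "summable (\<lambda>m. \<bar>0\<bar> :: real)" by simp
    fix z :: complex assume z: "cmod z = 1"
    have n: "norm (of_real (x m) * inverse z ^ m) = \<bar>x m\<bar>" for x :: "nat \<Rightarrow> real" and m
      using z by (simp add: norm_mult norm_power norm_inverse)
    have s1: "summable (\<lambda>m. of_real (entry_coeff F m i j) * inverse z ^ m)"
      by (rule summable_norm_cancel) (simp only: n[of "\<lambda>m. entry_coeff F m i j"] fs)
    have g1: "(\<lambda>m. of_real (g m) * inverse z ^ m) sums (tf_eval F z $$ (i, j))"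
    proof -
      have "(\<lambda>k. of_real (g (Suc k)) * inverse z ^ Suc k) sums (tf_eval F z $$ (i, j))"
        unfolding F(2) g_def nat.case by (rule state_space_expansion[OF AA B C z ij])
      from sums_Suc[of "\<lambda>m. of_real (g m) * inverse z ^ m", OF this] show ?thesis by (simp add: g_def)
    qed
    have "(\<Sum>m. of_real (entry_coeff F m i j - g m) * inverse z ^ m)
       = (\<Sum>m. of_real (entry_coeff F m i j) * inverse z ^ m) - (\<Sum>m. of_real (g m) * inverse z ^ m)"
      by (subst suminf_diff[OF s1 sums_summable[OF g1]]) (simp add: left_diff_distrib)
    thus "(\<Sum>m. of_real (entry_coeff F m i j - g m) * inverse z ^ m) = (\<Sum>m. of_real 0 * z ^ m)"
      using tf_eval_expansion[OF F(1) ij z] sums_unique[OF g1] by simp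
  qed
  thus ?thesis by (simp add: g_def)
qed

section \<open>The block shift and the parallel connection\<close>

lemma shift_A_carrier: "shift_A N p \<in> carrier_mat (N * p) (N * p)"
  by (simp add: shift_A_def)

lemma shift_A_pow:
  "r < N * p \<Longrightarrow> s < N * p \<Longrightarrow> (shift_A N p ^\<^sub>m k) $$ (r, s) = (if r = s + k * p then 1 else 0)"
proof (induction k arbitrary: r s)
  case 0
  thus ?case using shift_A_carrier[of N p] by auto
next
  case (Suc k)
  have c: "shift_A N p ^\<^sub>m k \<in> carrier_mat (N * p) (N * p)" using shift_A_carrier by simp
  have "(shift_A N p ^\<^sub>m Suc k) $$ (r, s) = (\<Sum>t<N * p. (shift_A N p ^\<^sub>m k) $$ (r, t) * shift_A N p $$ (t, s))"
    unfolding pow_mat.simps by (rule index_mult_mat_sum[OF c shift_A_carrier Suc.prems])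
  also have "\<dots> = (\<Sum>t<N * p. if t = s + p then (if r = t + k * p then 1 else 0) else 0)"
    using Suc by (intro sum.cong refl) (auto simp: shift_A_def)
  also have "\<dots> = (if r = s + Suc k * p then 1 else 0)"
    using Suc.prems by (subst sum.delta) auto
  finally show ?case .
qed

text \<open>After k steps the unit input sits in block k, where \<open>shift_C\<close> holds the
  transpose of G_(N-1-k); after N steps it has left the register.\<close>

lemma shift_output:
  assumes "i < q" "j < p"
  shows "(shift_C N p q G * shift_A N p ^\<^sub>m k * shift_B N p) $$ (i, j)
     = (if k < N then tf_coeff G (N - 1 - k) $$ (j, i) else 0)"
proof -
  have c: "shift_C N p q G \<in> carrier_mat q (N * p)" "shift_A N p ^\<^sub>m k \<in> carrier_mat (N * p) (N * p)"
    "shift_B N p \<in> carrier_mat (N * p) p"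
    using shift_A_carrier by (auto simp: shift_C_def shift_B_def)
  have AB: "(shift_A N p ^\<^sub>m k * shift_B N p) $$ (r, j) = (if r = j + k * p then 1 else 0)" if r: "r < N * p" for r
  proof -
    have "(shift_A N p ^\<^sub>m k * shift_B N p) $$ (r, j) = (\<Sum>s<N * p. (if s = j then (if r = s + k * p then 1 else 0) else 0))"
      unfolding index_mult_mat_sum[OF c(2,3) r assms(2)]
      using r assms by (intro sum.cong refl) (auto simp: shift_A_pow shift_B_def)
    also have "\<dots> = (if j < N * p then (if r = j + k * p then 1 else 0) else 0)" by (subst sum.delta) auto
    finally show ?thesis using r by auto
  qed
  have "(shift_C N p q G * shift_A N p ^\<^sub>m k * shift_B N p) $$ (i, j)
      = (\<Sum>r<N * p. shift_C N p q G $$ (i, r) * (shift_A N p ^\<^sub>m k * shift_B N p) $$ (r, j))"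
    unfolding assoc_mult_mat[OF c] by (rule index_mult_mat_sum[OF c(1) mult_carrier_mat[OF c(2,3)] assms])
  also have "\<dots> = (\<Sum>r<N * p. if r = j + k * p then shift_C N p q G $$ (i, r) else 0)"
    by (intro sum.cong refl) (simp add: AB del: index_mult_mat(1))
  also have "\<dots> = (if j + k * p < N * p then shift_C N p q G $$ (i, j + k * p) else 0)"
    by (subst sum.delta) auto
  also have "j + k * p < N * p \<longleftrightarrow> k < N"
  proof
    assume "j + k * p < N * p"
    hence "k * p < N * p" by linarith
    thus "k < N" by simp
  next
    assume "k < N"
    hence "Suc k * p \<le> N * p" by (intro mult_right_mono) auto
    thus "j + k * p < N * p" using assms by simp
  qed
  finally show ?thesis
    using assms \<open>j + k * p < N * p \<longleftrightarrow> k < N\<close> by (auto simp: shift_C_def)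
qed

lemma block_output:
  fixes Ar Aq Br Bq Cr Cq :: "real mat"
  assumes "Ar \<in> carrier_mat n n" "Br \<in> carrier_mat n p" "Cr \<in> carrier_mat q n"
    "Aq \<in> carrier_mat m m" "Bq \<in> carrier_mat m p" "Cq \<in> carrier_mat q m" and ij: "i < q" "j < p"
  defines "A \<equiv> four_block_mat Ar (0\<^sub>m n m) (0\<^sub>m m n) Aq"
  shows "A ^\<^sub>m k = four_block_mat (Ar ^\<^sub>m k) (0\<^sub>m n m) (0\<^sub>m m n) (Aq ^\<^sub>m k)"
    and "((Cr @\<^sub>c (- Cq)) * A ^\<^sub>m k * (Br @\<^sub>r Bq)) $$ (i, j)
      = (Cr * Ar ^\<^sub>m k * Br) $$ (i, j) - (Cq * Aq ^\<^sub>m k * Bq) $$ (i, j)"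
proof -
  show Apow: "A ^\<^sub>m k = four_block_mat (Ar ^\<^sub>m k) (0\<^sub>m n m) (0\<^sub>m m n) (Aq ^\<^sub>m k)"
    unfolding A_def by (rule pow_four_block_mat[OF assms(1,4)])
  have Ak: "Ar ^\<^sub>m k \<in> carrier_mat n n" "Aq ^\<^sub>m k \<in> carrier_mat m m" using assms by auto
  have Apc: "A ^\<^sub>m k \<in> carrier_mat (n + m) (n + m)" unfolding Apow by (rule four_block_carrier_mat[OF Ak])
  have mC: "- Cq \<in> carrier_mat q m" using assms by simp
  have Cc: "Cr @\<^sub>c (- Cq) \<in> carrier_mat q (n + m)" by (rule append_cols_carrier[OF assms(3) mC])
  have Bc: "Br @\<^sub>r Bq \<in> carrier_mat (n + m) p" by (rule carrier_append_rows[OF assms(2,5)])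
  define e where "e = (unit_vec p j :: real vec)"
  have e: "e \<in> carrier_vec p" by (simp add: e_def)
  have ent: "M $$ (i, j) = (M *\<^sub>v e) $ i" if "M \<in> carrier_mat q p" for M :: "real mat"
    using that ij by (simp add: e_def)
  have v: "Br *\<^sub>v e \<in> carrier_vec n" "Bq *\<^sub>v e \<in> carrier_vec m" using assms e by auto
  have Av: "Ar ^\<^sub>m k *\<^sub>v (Br *\<^sub>v e) \<in> carrier_vec n" "Aq ^\<^sub>m k *\<^sub>v (Bq *\<^sub>v e) \<in> carrier_vec m" using Ak v by auto
  have CA: "Cr * Ar ^\<^sub>m k \<in> carrier_mat q n" "Cq * Aq ^\<^sub>m k \<in> carrier_mat q m" using assms Ak by auto
  have CAB: "Cr * Ar ^\<^sub>m k * Br \<in> carrier_mat q p" "Cq * Aq ^\<^sub>m k * Bq \<in> carrier_mat q p"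
    using mult_carrier_mat[OF CA(1) assms(2)] mult_carrier_mat[OF CA(2) assms(5)] by auto
  have CAc: "(Cr @\<^sub>c (- Cq)) * A ^\<^sub>m k \<in> carrier_mat q (n + m)" by (rule mult_carrier_mat[OF Cc Apc])
  have Bv: "(Br @\<^sub>r Bq) *\<^sub>v e = (Br *\<^sub>v e) @\<^sub>v (Bq *\<^sub>v e)" by (rule mat_mult_append[OF assms(2,5) e])
  have ABv: "A ^\<^sub>m k *\<^sub>v ((Br *\<^sub>v e) @\<^sub>v (Bq *\<^sub>v e)) = (Ar ^\<^sub>m k *\<^sub>v (Br *\<^sub>v e)) @\<^sub>v (Aq ^\<^sub>m k *\<^sub>v (Bq *\<^sub>v e))"
  proof -
    have "A ^\<^sub>m k *\<^sub>v ((Br *\<^sub>v e) @\<^sub>v (Bq *\<^sub>v e))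
        = (Ar ^\<^sub>m k *\<^sub>v (Br *\<^sub>v e) + 0\<^sub>m n m *\<^sub>v (Bq *\<^sub>v e)) @\<^sub>v (0\<^sub>m m n *\<^sub>v (Br *\<^sub>v e) + Aq ^\<^sub>m k *\<^sub>v (Bq *\<^sub>v e))"
      unfolding Apow by (rule four_block_mat_mult_vec[OF Ak(1) _ _ Ak(2) v]) auto
    also have "0\<^sub>m n m *\<^sub>v (Bq *\<^sub>v e) = 0\<^sub>v n" using v by (intro eq_vecI) auto
    also have "0\<^sub>m m n *\<^sub>v (Br *\<^sub>v e) = 0\<^sub>v m" using v by (intro eq_vecI) auto
    finally show ?thesis unfolding right_zero_vec[OF Av(1)] left_zero_vec[OF Av(2)] .
  qed
  have "((Cr @\<^sub>c (- Cq)) * A ^\<^sub>m k * (Br @\<^sub>r Bq)) *\<^sub>v e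
      = (Cr @\<^sub>c (- Cq)) *\<^sub>v ((Ar ^\<^sub>m k *\<^sub>v (Br *\<^sub>v e)) @\<^sub>v (Aq ^\<^sub>m k *\<^sub>v (Bq *\<^sub>v e)))"
    unfolding assoc_mult_mat_vec[OF CAc Bc e] Bv assoc_mult_mat_vec[OF Cc Apc append_carrier_vec[OF v]] ABv ..
  also have "\<dots> = Cr *\<^sub>v (Ar ^\<^sub>m k *\<^sub>v (Br *\<^sub>v e)) + - Cq *\<^sub>v (Aq ^\<^sub>m k *\<^sub>v (Bq *\<^sub>v e))"
    by (rule append_cols_mult_vec[OF assms(3) mC Av])
  finally have 1: "((Cr @\<^sub>c (- Cq)) * A ^\<^sub>m k * (Br @\<^sub>r Bq)) *\<^sub>v e
      = Cr *\<^sub>v (Ar ^\<^sub>m k *\<^sub>v (Br *\<^sub>v e)) + - Cq *\<^sub>v (Aq ^\<^sub>m k *\<^sub>v (Bq *\<^sub>v e))" .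
  have 2: "Cr *\<^sub>v (Ar ^\<^sub>m k *\<^sub>v (Br *\<^sub>v e)) = (Cr * Ar ^\<^sub>m k * Br) *\<^sub>v e"
    by (simp only: assoc_mult_mat_vec[OF CA(1) assms(2) e] assoc_mult_mat_vec[OF assms(3) Ak(1) v(1)])
  have 3: "Cq *\<^sub>v (Aq ^\<^sub>m k *\<^sub>v (Bq *\<^sub>v e)) = (Cq * Aq ^\<^sub>m k * Bq) *\<^sub>v e"
    by (simp only: assoc_mult_mat_vec[OF CA(2) assms(5) e] assoc_mult_mat_vec[OF assms(6) Ak(2) v(2)])
  have 4: "- Cq *\<^sub>v (Aq ^\<^sub>m k *\<^sub>v (Bq *\<^sub>v e)) = - (Cq *\<^sub>v (Aq ^\<^sub>m k *\<^sub>v (Bq *\<^sub>v e)))"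
    using carrier_vecD[OF Av(2)] assms(6) by (intro uminus_mult_mat_vec) simp
  have c5: "(Cr * Ar ^\<^sub>m k * Br) *\<^sub>v e \<in> carrier_vec q" "(Cq * Aq ^\<^sub>m k * Bq) *\<^sub>v e \<in> carrier_vec q"
    by (rule mult_mat_vec_carrier[OF CAB(1) e], rule mult_mat_vec_carrier[OF CAB(2) e])
  have "((Cr @\<^sub>c (- Cq)) * A ^\<^sub>m k * (Br @\<^sub>r Bq)) *\<^sub>v e = (Cr * Ar ^\<^sub>m k * Br) *\<^sub>v e + - ((Cq * Aq ^\<^sub>m k * Bq) *\<^sub>v e)"
    unfolding 1 4 2 3 ..
  hence "(((Cr @\<^sub>c (- Cq)) * A ^\<^sub>m k * (Br @\<^sub>r Bq)) *\<^sub>v e) $ i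
      = ((Cr * Ar ^\<^sub>m k * Br) *\<^sub>v e) $ i - ((Cq * Aq ^\<^sub>m k * Bq) *\<^sub>v e) $ i"
    using carrier_vecD[OF c5(1)] carrier_vecD[OF c5(2)] ij(1) by (simp only: index_add_vec index_uminus_vec)
  thus "((Cr @\<^sub>c (- Cq)) * A ^\<^sub>m k * (Br @\<^sub>r Bq)) $$ (i, j)
      = (Cr * Ar ^\<^sub>m k * Br) $$ (i, j) - (Cq * Aq ^\<^sub>m k * Bq) $$ (i, j)"
    by (simp only: ent[OF CAB(1)] ent[OF CAB(2)] ent[OF mult_carrier_mat[OF CAc Bc]])
qed

section \<open>Anti-stable parts and multiplication by z^N\<close>

lemma summable_unimodular:
  assumes "summable (\<lambda>m. \<bar>x m :: real\<bar>)" "cmod u = 1"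
  shows "summable (\<lambda>m. of_real (x m) * u ^ m)"
  by (rule summable_norm_cancel) (use assms in \<open>simp add: norm_mult norm_power\<close>)

text \<open>With u = 1/z this multiplies a series in 1/z by z^N: the terms with m < N become the
  positive powers z^(N-m), and the rest, beginning with a constant term, forms the second
  series.\<close>

lemma suminf_unimodular_shift:
  assumes g: "summable (\<lambda>m. \<bar>g m :: real\<bar>)" and u: "cmod u = 1"
  shows "inverse u ^ N * (\<Sum>m. of_real (g m) * u ^ m)
     = (\<Sum>m. of_real (if 1 \<le> m \<and> m \<le> N then g (N - m) else 0) * inverse u ^ m) + (\<Sum>m. of_real (g (m + N)) * u ^ m)"
proof -
  let ?e = "\<lambda>m. if 1 \<le> m \<and> m \<le> N then g (N - m) else 0"
  have u0: "u \<noteq> 0" using u by auto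
  have pc: "inverse u ^ N * u ^ (m + N) = u ^ m" for m
    using u0 by (simp add: power_add field_simps)
  have pd: "inverse u ^ N * u ^ m = inverse u ^ (N - m)" if "m \<le> N" for m
    using u0 that by (simp add: power_diff field_simps)
  have "(\<Sum>m. of_real (?e m) * inverse u ^ m) = (\<Sum>m<Suc N. of_real (?e m) * inverse u ^ m)"
    by (rule suminf_finite) auto
  also have "\<dots> = (\<Sum>m<N. of_real (g (N - Suc m)) * inverse u ^ Suc m)"
    unfolding sum.lessThan_Suc_shift by simp
  also have "\<dots> = (\<Sum>m<N. of_real (g (N - Suc m)) * inverse u ^ (N - (N - Suc m)))"
    by (intro sum.cong) auto
  also have "\<dots> = (\<Sum>m<N. of_real (g m) * inverse u ^ (N - m))"
    by (rule sum.nat_diff_reindex[of "\<lambda>m. of_real (g m) * inverse u ^ (N - m)"])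
  finally have e: "(\<Sum>m. of_real (?e m) * inverse u ^ m) = (\<Sum>m<N. of_real (g m) * inverse u ^ (N - m))" .
  have s: "summable (\<lambda>m. of_real (g m) * u ^ m)" by (rule summable_unimodular[OF g u])
  have "summable (\<lambda>m. of_real (g (m + N)) * u ^ (m + N))"
    using summable_ignore_initial_segment[OF s, of N] by simp
  hence "inverse u ^ N * (\<Sum>m. of_real (g (m + N)) * u ^ (m + N)) = (\<Sum>m. inverse u ^ N * (of_real (g (m + N)) * u ^ (m + N)))"
    by (rule suminf_mult[symmetric])
  also have "\<dots> = (\<Sum>m. of_real (g (m + N)) * u ^ m)"
    by (simp only: mult.left_commute[of "inverse u ^ N"] pc)
  finally have t: "inverse u ^ N * (\<Sum>m. of_real (g (m + N)) * u ^ (m + N)) = (\<Sum>m. of_real (g (m + N)) * u ^ m)" .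
  have "inverse u ^ N * (\<Sum>m<N. of_real (g m) * u ^ m) = (\<Sum>m<N. of_real (g m) * inverse u ^ (N - m))"
    unfolding sum_distrib_left by (intro sum.cong refl) (simp add: mult.left_commute[of "inverse u ^ N"] pd)
  thus ?thesis unfolding e suminf_split_initial_segment[OF s, of N] distrib_left t by simp
qed

lemma decomp_eval:
  assumes d: "antistable_stable_decomp p q F F1 F2" and z: "cmod z = 1"
  shows "tf_eval F z = mat_adjoint (tf_eval F1 z) + tf_eval F2 z"
    and "F \<in> carrier_mat p q" "tf_circle F"
proof -
  have F: "F1 \<in> carrier_mat q p" "tf_circle F1" "F2 \<in> carrier_mat p q" "tf_circle F2" "F = F1\<^sup>\<sim> + F2"
    using d by (auto simp: antistable_stable_decomp_def dest: RHinf_carrier RHinf_circle)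
  note c = para_conj_carrier[OF F(1)] F(3) tf_circle_para_conj[OF F(2)] F(4)
  show "tf_eval F z = mat_adjoint (tf_eval F1 z) + tf_eval F2 z"
    unfolding F(5) tf_eval_add[OF c z] tf_eval_para_conj[OF F(1,2) z] ..
  show "F \<in> carrier_mat p q" "tf_circle F" unfolding F(5) using c tf_circle_add[OF c] by auto
qed

lemma rf_eval_z_power: "rf_eval (rf_z ^ N) z = z ^ N"
  using rf_value_power[OF rf_value_z, of N z] by (simp add: rf_value_def)

lemma rf_circle_z_power: "rf_circle (rf_z ^ N)"
  by (intro rf_circle_power rf_circle_z)

lemma tf_eval_cnj_expansion:
  assumes F: "F \<in> RHinf q p" and ij: "i < q" "j < p" and z: "cmod z = 1"
  shows "cnj (tf_eval F z $$ (i, j)) = (\<Sum>m. of_real (entry_coeff F m i j) * z ^ m)"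
proof -
  have "z * cnj z = 1" using complex_norm_square[of z] z by simp
  hence "inverse z = cnj z" by (rule inverse_unique)
  hence t: "cnj (of_real r * inverse z ^ m) = of_real r * z ^ m" for r m
    by (simp only: complex_cnj_mult complex_cnj_power complex_cnj_cnj complex_cnj_complex_of_real)
  have u: "cmod (inverse z) = 1" using z by (simp add: norm_inverse)
  have "cnj (tf_eval F z $$ (i, j)) = (\<Sum>m. cnj (of_real (entry_coeff F m i j) * inverse z ^ m))"
    unfolding tf_eval_expansion[OF F ij z]
    by (rule bounded_linear.suminf[OF bounded_linear_cnj summable_unimodular[OF entry_coeff_summable[OF F ij] u]])
  also have "\<dots> = (\<Sum>m. of_real (entry_coeff F m i j) * z ^ m)" by (simp only: t)
  finally show ?thesis .
qed

lemma decomp_entry_expansion: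
  assumes d: "antistable_stable_decomp p q F F1 F2" and z: "cmod z = 1" and ab: "a < p" "b < q"
  shows "tf_eval F z $$ (a, b)
     = (\<Sum>m. of_real (entry_coeff F1 m b a) * z ^ m) + (\<Sum>m. of_real (entry_coeff F2 m a b) * inverse z ^ m)"
proof -
  have F: "F1 \<in> RHinf q p" "F2 \<in> RHinf p q" using d by (auto simp: antistable_stable_decomp_def)
  have c: "tf_eval F1 z \<in> carrier_mat q p" "tf_eval F2 z \<in> carrier_mat p q" using F by (auto dest: RHinf_carrier)
  have "tf_eval F z $$ (a, b) = cnj (tf_eval F1 z $$ (b, a)) + tf_eval F2 z $$ (a, b)"
    unfolding decomp_eval(1)[OF d z] using c ab by simp
  thus ?thesis unfolding tf_eval_cnj_expansion[OF F(1) ab(2,1) z] tf_eval_expansion[OF F(2) ab z] .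
qed

text \<open>Both decompositions are expanded on the circle. In z^N G the power z^m with m >= 1 has
  the coefficient G_(N-m), and here m = k + 1. The entries of \<open>H1\<close> and
  \<open>F1\<close> are transposed against those of \<open>G\<close> because the anti-stable part
  enters through \<open>para_conj\<close>.\<close>

lemma decomp_shift_coeff:
  assumes F: "antistable_stable_decomp p q F F1 F2"
    and H: "antistable_stable_decomp p q (F - rf_z ^ N \<cdot>\<^sub>m G) H1 H2"
    and G: "G \<in> RHinf p q" and ab: "a < p" "b < q"
  shows "entry_coeff H1 (Suc k) b a = entry_coeff F1 (Suc k) b a - (if k < N then rf_coeff (G $$ (a, b)) (N - 1 - k) else 0)"
proof -
  have S: "F1 \<in> RHinf q p" "F2 \<in> RHinf p q" "H1 \<in> RHinf q p" "H2 \<in> RHinf p q"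
    using F H by (auto simp: antistable_stable_decomp_def)
  define f1 f2 h1 h2 g where "f1 m = entry_coeff F1 m b a" and "f2 m = entry_coeff F2 m a b"
    and "h1 m = entry_coeff H1 m b a" and "h2 m = entry_coeff H2 m a b" and "g m = entry_coeff G m a b" for m
  define e where "e m = (if 1 \<le> m \<and> m \<le> N then g (N - m) else 0)" for m
  have sf1: "summable (\<lambda>m. \<bar>f1 m\<bar>)" and sf2: "summable (\<lambda>m. \<bar>f2 m\<bar>)" and sh1: "summable (\<lambda>m. \<bar>h1 m\<bar>)"
    and sh2: "summable (\<lambda>m. \<bar>h2 m\<bar>)" and sg: "summable (\<lambda>m. \<bar>g m\<bar>)"
    unfolding f1_def f2_def h1_def h2_def g_def using S G ab by (auto intro: entry_coeff_summable)
  have se: "summable (\<lambda>m. \<bar>e m\<bar>)" by (rule summable_finite[of "{..N}"]) (auto simp: e_def)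
  have sgN: "summable (\<lambda>m. \<bar>g (m + N)\<bar>)" by (rule summable_ignore_initial_segment[OF sg])
  have "h1 (Suc k) - f1 (Suc k) + e (Suc k) = 0"
  proof (rule laurent_unique[where f = "\<lambda>m. h1 m - f1 m + e m" and k = "\<lambda>m. f2 m - h2 m - g (m + N)"])
    show "summable (\<lambda>m. \<bar>h1 m - f1 m + e m\<bar>)"
      by (rule summable_comparison_test'[OF summable_add[OF summable_add[OF sh1 sf1] se], where N = 0]) auto
    show "summable (\<lambda>m. \<bar>f2 m - h2 m - g (m + N)\<bar>)"
      by (rule summable_comparison_test'[OF summable_add[OF summable_add[OF sf2 sh2] sgN], where N = 0]) auto
    fix u :: complex assume u: "cmod u = 1"
    \<comment> \<open>\<open>laurent_unique\<close> speaks of powers of the inverse of its variable,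
      whereas the anti-stable part consists of powers of z.\<close>
    define z where "z = inverse u"
    have z: "cmod z = 1" and iz: "inverse z = u" using u by (auto simp: z_def norm_inverse)
    have cG: "G \<in> carrier_mat p q" "tf_circle G" using G by (auto dest: RHinf_carrier RHinf_circle)
    note sm = rf_circle_z_power[of N] cG
    have zG: "rf_z ^ N \<cdot>\<^sub>m G \<in> carrier_mat p q" "tf_circle (rf_z ^ N \<cdot>\<^sub>m G)" using cG tf_circle_smult[OF sm(1) cG(2)] by auto
    have "tf_eval (F - rf_z ^ N \<cdot>\<^sub>m G) z = tf_eval F z - z ^ N \<cdot>\<^sub>m tf_eval G z"
      unfolding tf_eval_minus[OF decomp_eval(2)[OF F z] zG(1) decomp_eval(3)[OF F z] zG(2) z]
        tf_eval_smult[OF cG(1) sm(1) cG(2) z] rf_eval_z_power ..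
    hence "tf_eval (F - rf_z ^ N \<cdot>\<^sub>m G) z $$ (a, b) = tf_eval F z $$ (a, b) - z ^ N * tf_eval G z $$ (a, b)"
      using tf_eval_carrier[OF cG(1), of z] ab by simp
    hence 1: "(\<Sum>m. of_real (h1 m) * z ^ m) + (\<Sum>m. of_real (h2 m) * u ^ m)
       = (\<Sum>m. of_real (f1 m) * z ^ m) + (\<Sum>m. of_real (f2 m) * u ^ m)
         - ((\<Sum>m. of_real (e m) * z ^ m) + (\<Sum>m. of_real (g (m + N)) * u ^ m))"
      unfolding decomp_entry_expansion[OF H z ab] decomp_entry_expansion[OF F z ab] tf_eval_expansion[OF G ab z] iz
      using suminf_unimodular_shift[OF sg u, of N]
      by (simp only: f1_def f2_def h1_def h2_def g_def e_def z_def)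
    have "(\<Sum>m. of_real (h1 m - f1 m + e m) * z ^ m)
        = (\<Sum>m. of_real (h1 m) * z ^ m) - (\<Sum>m. of_real (f1 m) * z ^ m) + (\<Sum>m. of_real (e m) * z ^ m)"
      using summable_unimodular[OF sh1 z] summable_unimodular[OF sf1 z] summable_unimodular[OF se z]
      by (simp add: left_diff_distrib distrib_right suminf_add suminf_diff summable_diff)
    moreover have "(\<Sum>m. of_real (f2 m - h2 m - g (m + N)) * u ^ m)
        = (\<Sum>m. of_real (f2 m) * u ^ m) - (\<Sum>m. of_real (h2 m) * u ^ m) - (\<Sum>m. of_real (g (m + N)) * u ^ m)"
      using summable_unimodular[OF sf2 u] summable_unimodular[OF sh2 u] summable_unimodular[OF sgN u]
      by (simp add: left_diff_distrib suminf_diff[symmetric] summable_diff)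
    ultimately show "(\<Sum>m. of_real (h1 m - f1 m + e m) * inverse u ^ m) = (\<Sum>m. of_real (f2 m - h2 m - g (m + N)) * u ^ m)"
      using 1 by (simp only: z_def[symmetric]) (simp add: algebra_simps)
  qed
  thus ?thesis by (auto simp: h1_def f1_def e_def g_def entry_coeff_def)
qed

text \<open>The powers of the shift vanish from the exponent N on, so its block contributes finite
  sums only.\<close>

lemma power_summable_block_shift:
  assumes A: "A \<in> carrier_mat n n" "schur_stable A" and p: "0 < p"
  shows "power_summable (n + N * p) (four_block_mat A (0\<^sub>m n (N * p)) (0\<^sub>m (N * p) n) (shift_A N p))"
proof
  let ?F = "four_block_mat A (0\<^sub>m n (N * p)) (0\<^sub>m (N * p) n) (shift_A N p)"
  have S: "shift_A N p \<in> carrier_mat (N * p) (N * p)" by (rule shift_A_carrier)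
  show "?F \<in> carrier_mat (n + N * p) (n + N * p)" by (rule four_block_carrier_mat[OF A(1) S])
  fix i j assume ij: "i < n + N * p" "j < n + N * p"
  have Fk: "?F ^\<^sub>m k = four_block_mat (A ^\<^sub>m k) (0\<^sub>m n (N * p)) (0\<^sub>m (N * p) n) (shift_A N p ^\<^sub>m k)" for k
    by (rule pow_four_block_mat[OF A(1) S])
  have ent: "(?F ^\<^sub>m k) $$ (i, j) = (if i < n then if j < n then (A ^\<^sub>m k) $$ (i, j) else 0
      else if j < n then 0 else (shift_A N p ^\<^sub>m k) $$ (i - n, j - n))" for k
    unfolding Fk using ij A S by simp
  show "summable (\<lambda>k. \<bar>(?F ^\<^sub>m k) $$ (i, j)\<bar>)"
  proof (cases "i < n \<and> j < n")
    case True
    thus ?thesis unfolding ent using schur_stable_power_summable[OF A, of i j] by simp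
  next
    case False
    show ?thesis
    proof (rule summable_finite[of "{..<N}"])
      fix k assume "k \<notin> {..<N}"
      hence Nk: "N * p \<le> k * p" by simp
      have "(shift_A N p ^\<^sub>m k) $$ (i - n, j - n) = 0" if "\<not> i < n" "\<not> j < n"
      proof -
        have ij': "i - n < N * p" "j - n < N * p" using ij that by linarith+
        hence "i - n \<noteq> j - n + k * p" using Nk by linarith
        thus ?thesis by (simp only: shift_A_pow[OF ij'] if_False)
      qed
      thus "\<bar>(?F ^\<^sub>m k) $$ (i, j)\<bar> = 0" unfolding ent using False by auto
    qed simp
  qed
qed

text \<open>A stable matrix is its own completion, with second series 0. This supplies the finite
  bound without which the Hankel norm would be a supremum over a possibly unbounded set.\<close>

lemma RHinf_hankel_bounded:
  assumes F: "F \<in> RHinf q p" and p: "0 < p"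
  shows "hankel_bounded q p (entry_coeff F) (tf_norm F)" "0 \<le> tf_norm F"
proof -
  note c = RHinf_carrier[OF F] RHinf_circle[OF F] p
  show 0: "0 \<le> tf_norm F" by (rule tf_norm_bound(1)[OF c])
  show "hankel_bounded q p (entry_coeff F) (tf_norm F)"
  proof (rule hankel_le_sup[OF 0, where k = "\<lambda>_ _ _. 0"])
    fix z :: complex assume z: "cmod z = 1"
    have "op_bound q p (\<lambda>i j. tf_eval F z $$ (i, j)) (tf_norm F)"
      using tf_norm_bound(2)[OF c z] mat_bound_iff_op_bound[OF tf_eval_carrier[OF c(1)]] by blast
    thus "op_bound q p (\<lambda>i j. (\<Sum>m. of_real (entry_coeff F m i j) * inverse z ^ m) - (\<Sum>m. of_real 0 * z ^ m)) (tf_norm F)"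
      by (rule op_bound_cong) (simp add: tf_eval_expansion[OF F _ _ z])
  qed (auto intro: entry_coeff_summable[OF F])
qed

text \<open>Strictness is preserved both ways: a solution with l < 1 bounds the norm by sqrt l, and
  a norm below 1 leaves the room that the construction of \<open>P\<close> and \<open>Q\<close>
  needs.\<close>

lemma lmi_iff_hankel_norm:
  assumes A: "power_summable n A" and B: "B \<in> carrier_mat n p" and C: "C \<in> carrier_mat q n" and p: "0 < p"
    and F: "F \<in> RHinf q p"
    and f: "\<And>k i j. i < q \<Longrightarrow> j < p \<Longrightarrow> entry_coeff F (Suc k) i j = (C * A ^\<^sub>m k * B) $$ (i, j)"
  shows "(\<exists>P Q l. lmi_solution A B C P Q l) \<longleftrightarrow> hankel_norm F < 1"
proof
  assume "\<exists>P Q l. lmi_solution A B C P Q l"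
  then obtain P Q l where l: "lmi_solution A B C P Q l" by blast
  note b = lmi_hankel_bounded[OF power_summable.A[OF A] B C f l]
  have "hankel_norm F \<le> sqrt l" by (rule hankel_norm_le[OF F]) (use b in auto)
  also have "sqrt l < 1" using b by simp
  finally show "hankel_norm F < 1" .
next
  assume h: "hankel_norm F < 1"
  note b = hankel_norm_bounded[OF F RHinf_hankel_bounded[OF F p]]
  show "\<exists>P Q l. lmi_solution A B C P Q l" by (rule hankel_bounded_lmi[OF A B C f b(2,1) h])
qed

subsection \<open>Two-sided reduction\<close>

text \<open>The bound on the error before a reduction that follows from a bound \<open>d\<close>
  after it: the root of a mean of g^2 and y^2 with weights d^2 and 1 - d^2, hence below g if d < 1
  and y < g.\<close>

definition allpass_gain :: "real \<Rightarrow> real \<Rightarrow> real \<Rightarrow> real" where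
  "allpass_gain g d y = sqrt (d\<^sup>2 * g\<^sup>2 + (1 - d\<^sup>2) * y\<^sup>2)"

lemma allpass_gain:
  assumes "0 \<le> d" "d < 1" "0 \<le> y" "y < g"
  shows "0 \<le> allpass_gain g d y" "allpass_gain g d y < g"
proof -
  have d: "d\<^sup>2 < 1" using assms by (simp add: power_less_one_iff abs_square_less_1)
  have y: "y\<^sup>2 < g\<^sup>2" using assms by (intro power_strict_mono) auto
  show "0 \<le> allpass_gain g d y" unfolding allpass_gain_def using d by (intro real_sqrt_ge_zero add_nonneg_nonneg mult_nonneg_nonneg) auto
  have "(1 - d\<^sup>2) * y\<^sup>2 < (1 - d\<^sup>2) * g\<^sup>2" using d y by (intro mult_strict_left_mono) auto
  hence "d\<^sup>2 * g\<^sup>2 + (1 - d\<^sup>2) * y\<^sup>2 < g\<^sup>2" by (simp add: algebra_simps)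
  hence "allpass_gain g d y < sqrt (g\<^sup>2)" unfolding allpass_gain_def by (rule real_sqrt_less_mono)
  thus "allpass_gain g d y < g" using assms by simp
qed

text \<open>The projection annihilates the range of \<open>u\<close>, so the free parameter drops
  out; this is why \<open>Y\<close> and \<open>Z\<close> depend on the data alone.\<close>

lemma projection_absorb:
  fixes u :: "complex mat"
  assumes u: "u \<in> carrier_mat p q" "mat_adjoint u * u = 1\<^sub>m q" and t: "t \<in> carrier_mat p m" and w: "w \<in> carrier_mat q m"
  shows "(1\<^sub>m p - u * mat_adjoint u) * (t - u * w) = (1\<^sub>m p - u * mat_adjoint u) * t"
proof -
  have a: "mat_adjoint u \<in> carrier_mat q p" using u by simp
  have ua: "u * mat_adjoint u \<in> carrier_mat p p" and uw: "u * w \<in> carrier_mat p m" using u w a by auto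
  have P: "1\<^sub>m p - u * mat_adjoint u \<in> carrier_mat p p" by (rule minus_carrier_mat[OF ua])
  have "(1\<^sub>m p - u * mat_adjoint u) * (u * w) = u * w - u * mat_adjoint u * (u * w)"
    using uw ua by (subst minus_mult_distrib_mat[OF _ ua uw]) auto
  also have "u * mat_adjoint u * (u * w) = u * (mat_adjoint u * u * w)"
    by (simp only: assoc_mult_mat[OF u(1) a uw] assoc_mult_mat[OF a u(1) w])
  also have "\<dots> = u * w" using u w by simp
  also have "u * w - u * w = 0\<^sub>m p m" by (rule minus_r_inv_mat[OF uw])
  finally have 0: "(1\<^sub>m p - u * mat_adjoint u) * (u * w) = 0\<^sub>m p m" .
  have z: "X - 0\<^sub>m p m = X" if "X \<in> carrier_mat p m" for X :: "complex mat"
    using that by (intro eq_matI) auto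
  show ?thesis unfolding mult_minus_distrib_mat[OF P t uw] 0 by (rule z[OF mult_carrier_mat[OF P t]])
qed

text \<open>The matrices are values at a point of the circle: \<open>u\<close>, \<open>t\<close> and
  \<open>v\<close> are those of \<open>Ui\<close>, \<open>T1\<close> and \<open>Vci\<close>, while
  \<open>w\<close> and \<open>h\<close> are those of Uo X T3 and Uo X Vco for the parameter X. The
  second reduction acts from the right, so it is applied to adjoints, with the level g replaced by
  1.\<close>

lemma two_sided_reduction:
  fixes u t w y yo yi s h v zz zco zi E :: "complex mat"
  assumes u: "u \<in> carrier_mat p1 p2" "mat_adjoint u * u = 1\<^sub>m p2"
    and t: "t \<in> carrier_mat p1 m" and w: "w \<in> carrier_mat p2 m"
    and y: "y = (1\<^sub>m p1 - u * mat_adjoint u) * t"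
    and yo: "yo \<in> carrier_mat m m" "mat_adjoint yo * yo = of_real (g\<^sup>2) \<cdot>\<^sub>m 1\<^sub>m m - mat_adjoint y * y"
    and yi: "yi \<in> carrier_mat m m" "yo * yi = 1\<^sub>m m" "yi * yo = 1\<^sub>m m"
    and s: "s = mat_adjoint u * t * yi"
    and v: "v \<in> carrier_mat q m" "v * mat_adjoint v = 1\<^sub>m q"
    and h: "h \<in> carrier_mat p2 q" "w * yi = h * v"
    and zz: "zz = s * (1\<^sub>m m - mat_adjoint v * v)"
    and zco: "zco \<in> carrier_mat p2 p2" "zco * mat_adjoint zco = 1\<^sub>m p2 - zz * mat_adjoint zz"
    and zi: "zi \<in> carrier_mat p2 p2" "zi * zco = 1\<^sub>m p2"
    and E: "E \<in> carrier_mat p2 q" "zco * E = s * mat_adjoint v - h"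
    and g: "0 < g"
  shows "mat_bound (t - u * w) c \<Longrightarrow> 0 \<le> c \<Longrightarrow> c < g \<Longrightarrow> mat_bound (mat_adjoint E) (c / g)"
    and "mat_bound (mat_adjoint E) d \<Longrightarrow> 0 \<le> d \<Longrightarrow> d < 1 \<Longrightarrow> mat_bound y b \<Longrightarrow> 0 \<le> b \<Longrightarrow> b < g \<Longrightarrow>
       mat_bound zz b' \<Longrightarrow> 0 \<le> b' \<Longrightarrow> b' < 1 \<Longrightarrow> mat_bound (t - u * w) (allpass_gain g (allpass_gain 1 d b') b)"
proof -
  have ua: "mat_adjoint u \<in> carrier_mat p2 p1" and va: "mat_adjoint v \<in> carrier_mat m q" using u v by auto
  have ut: "mat_adjoint u * t \<in> carrier_mat p2 m" using ua t by auto
  have sc: "s \<in> carrier_mat p2 m" unfolding s by (rule mult_carrier_mat[OF ut yi(1)])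
  have hv: "h * v \<in> carrier_mat p2 m" using h v by auto
  have uw: "u * w \<in> carrier_mat p1 m" using u w by auto
  \<comment> \<open>What the first reduction leaves: its product with \<open>yo\<close> is the
    adjoint of \<open>u\<close> times the model error.\<close>
  define E1 where "E1 = s - h * v"
  have E1: "E1 \<in> carrier_mat p2 m" unfolding E1_def by (rule minus_carrier_mat[OF hv])
  have M: "t - u * w \<in> carrier_mat p1 m" by (rule minus_carrier_mat[OF uw])
  have Y1: "y = (1\<^sub>m p1 - u * mat_adjoint u) * (t - u * w)"
    unfolding y by (rule projection_absorb[OF u t w, symmetric])
  have "E1 * yo = mat_adjoint u * t - w"
  proof -
    have "s * yo = mat_adjoint u * t" unfolding s assoc_mult_mat[OF ut yi(1) yo(1)] yi(3) by (rule right_mult_one_mat[OF ut])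
    moreover have "h * v * yo = w"
      unfolding h(2)[symmetric] assoc_mult_mat[OF w yi(1) yo(1)] yi(3) by (rule right_mult_one_mat[OF w])
    ultimately show ?thesis unfolding E1_def minus_mult_distrib_mat[OF sc hv yo(1)] by simp
  qed
  also have "\<dots> = mat_adjoint u * (t - u * w)"
    unfolding mult_minus_distrib_mat[OF ua t uw] assoc_mult_mat[OF ua u(1) w, symmetric] u(2) left_mult_one_mat[OF w] ..
  finally have E1yo: "E1 * yo = mat_adjoint u * (t - u * w)" .
  note r1 = allpass_reduction[OF u M Y1 yo yi(1,2) E1 E1yo g]
  have vv: "mat_adjoint v * v \<in> carrier_mat m m" using v va by auto
  have Pv: "1\<^sub>m m - mat_adjoint v * v \<in> carrier_mat m m" by (rule minus_carrier_mat[OF vv])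
  have Pa: "mat_adjoint (1\<^sub>m m - mat_adjoint v * v) = 1\<^sub>m m - mat_adjoint v * v"
    unfolding mat_adjoint_minus[OF one_carrier_mat vv] mat_adjoint_mult[OF va v(1)] by simp
  have E1a: "mat_adjoint E1 = mat_adjoint s - mat_adjoint v * mat_adjoint h"
    unfolding E1_def mat_adjoint_minus[OF sc hv] mat_adjoint_mult[OF h(1) v(1)] ..
  have E1ac: "mat_adjoint E1 \<in> carrier_mat m p2" using E1 by simp
  have v2: "mat_adjoint (mat_adjoint v) * mat_adjoint v = 1\<^sub>m q" using v by simp
  \<comment> \<open>Since the projection absorbs the parameter, \<open>zz\<close> is related to the
    adjoint of \<open>E1\<close> as \<open>y\<close> is to the error t - u w.\<close>
  have zza: "mat_adjoint zz = (1\<^sub>m m - mat_adjoint v * mat_adjoint (mat_adjoint v)) * mat_adjoint E1"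
    unfolding zz mat_adjoint_mult[OF sc Pv] Pa E1a
    using projection_absorb[OF va v2, of "mat_adjoint s" p2 "mat_adjoint h"] sc h by simp
  have zzc: "zz \<in> carrier_mat p2 m" unfolding zz by (rule mult_carrier_mat[OF sc Pv])
  have zo: "mat_adjoint (mat_adjoint zco) * mat_adjoint zco = of_real (1\<^sup>2) \<cdot>\<^sub>m 1\<^sub>m p2 - mat_adjoint (mat_adjoint zz) * mat_adjoint zz"
  proof -
    have "1 \<cdot>\<^sub>m 1\<^sub>m p2 = (1\<^sub>m p2 :: complex mat)" by (intro eq_matI) auto
    thus ?thesis using zco by simp
  qed
  have zoi: "mat_adjoint zco * mat_adjoint zi = 1\<^sub>m p2"
    unfolding mat_adjoint_mult[OF zi(1) zco(1), symmetric] zi(2) by simp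
  have "zco * E = E1 * mat_adjoint v"
    unfolding E(2) E1_def minus_mult_distrib_mat[OF sc hv va] assoc_mult_mat[OF h(1) v(1) va] v(2) right_mult_one_mat[OF h(1)] ..
  hence "mat_adjoint (zco * E) = mat_adjoint (E1 * mat_adjoint v)" by simp
  hence Ez: "mat_adjoint E * mat_adjoint zco = mat_adjoint (mat_adjoint v) * mat_adjoint E1"
    unfolding mat_adjoint_mult[OF zco(1) E(1)] mat_adjoint_mult[OF E1 va] .
  have cs: "mat_adjoint zco \<in> carrier_mat p2 p2" "mat_adjoint zi \<in> carrier_mat p2 p2" "mat_adjoint E \<in> carrier_mat q p2"
    using zco zi E by auto
  have pos: "(0 :: real) < 1" by simp
  note r2 = allpass_reduction[OF va v2 E1ac zza cs(1) zo cs(2) zoi cs(3) Ez pos]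
  show "mat_bound (mat_adjoint E) (c / g)" if "mat_bound (t - u * w) c" "0 \<le> c" "c < g"
  proof -
    have "mat_bound E1 (c / g)" by (rule r1(1)[OF that])
    hence "mat_bound (mat_adjoint E1) (c / g)" using that g by (intro mat_bound_adjoint) auto
    from r2(1)[OF this] show ?thesis using that g by simp
  qed
  show "mat_bound (t - u * w) (allpass_gain g (allpass_gain 1 d b') b)"
    if d: "mat_bound (mat_adjoint E) d" "0 \<le> d" "d < 1" and b: "mat_bound y b" "0 \<le> b" "b < g"
      and b': "mat_bound zz b'" "0 \<le> b'" "b' < 1"
  proof -
    note gn = allpass_gain[OF d(2,3) b'(2,3)]
    have "mat_bound (mat_adjoint E1) (allpass_gain 1 d b')"
      unfolding allpass_gain_def by (rule r2(2)[OF d mat_bound_adjoint[OF b'(1,2)] b'(2,3)])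
    from mat_bound_adjoint[OF this gn(1)] have "mat_bound E1 (allpass_gain 1 d b')" by simp
    from r1(2)[OF this gn b] show ?thesis unfolding allpass_gain_def .
  qed
qed

subsection \<open>Model matching\<close>

definition tf_regular :: "nat \<Rightarrow> nat \<Rightarrow> tfm \<Rightarrow> bool" where
  "tf_regular r c G \<longleftrightarrow> G \<in> carrier_mat r c \<and> tf_circle G"

lemma tf_regular_carrier: "tf_regular r c G \<Longrightarrow> G \<in> carrier_mat r c"
  by (simp add: tf_regular_def)

lemma tf_regular_mult: "tf_regular a b A \<Longrightarrow> tf_regular b c B \<Longrightarrow> tf_regular a c (A * B)"
  by (auto simp: tf_regular_def intro: tf_circle_mult)

lemma tf_regular_add: "tf_regular a b A \<Longrightarrow> tf_regular a b B \<Longrightarrow> tf_regular a b (A + B)"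
  by (auto simp: tf_regular_def intro: tf_circle_add)

lemma tf_regular_minus: "tf_regular a b A \<Longrightarrow> tf_regular a b B \<Longrightarrow> tf_regular a b (A - B)"
  by (auto simp: tf_regular_def intro!: tf_circle_minus minus_carrier_mat)

lemma tf_regular_smult: "rf_circle f \<Longrightarrow> tf_regular a b A \<Longrightarrow> tf_regular a b (f \<cdot>\<^sub>m A)"
  by (auto simp: tf_regular_def intro: tf_circle_smult)

lemma tf_regular_one: "tf_regular n n (1\<^sub>m n)"
  by (simp add: tf_regular_def)

lemma tf_regular_para_conj: "tf_regular a b A \<Longrightarrow> tf_regular b a (A\<^sup>\<sim>)"
  by (auto simp: tf_regular_def intro: tf_circle_para_conj)

lemma RHinf_regular: "G \<in> RHinf r c \<Longrightarrow> tf_regular r c G"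
  by (simp add: tf_regular_def RHinf_carrier RHinf_circle)

lemma tf_regular_eval:
  assumes z: "cmod z = 1"
  shows "tf_regular a b A \<Longrightarrow> tf_regular b c B \<Longrightarrow> tf_eval (A * B) z = tf_eval A z * tf_eval B z"
    and "tf_regular a b A \<Longrightarrow> tf_regular a b A' \<Longrightarrow> tf_eval (A + A') z = tf_eval A z + tf_eval A' z"
    and "tf_regular a b A \<Longrightarrow> tf_regular a b A' \<Longrightarrow> tf_eval (A - A') z = tf_eval A z - tf_eval A' z"
    and "rf_circle f \<Longrightarrow> tf_regular a b A \<Longrightarrow> tf_eval (f \<cdot>\<^sub>m A) z = rf_eval f z \<cdot>\<^sub>m tf_eval A z"
    and "tf_regular a b A \<Longrightarrow> tf_eval (A\<^sup>\<sim>) z = mat_adjoint (tf_eval A z)"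
    and "tf_regular a b A \<Longrightarrow> tf_eval A z \<in> carrier_mat a b"
  using z by (auto simp: tf_regular_def intro: tf_eval_mult tf_eval_add tf_eval_minus tf_eval_smult tf_eval_para_conj)

lemma mat_adjoint_smult:
  fixes A :: "complex mat"
  assumes "A \<in> carrier_mat q p"
  shows "mat_adjoint (c \<cdot>\<^sub>m A) = cnj c \<cdot>\<^sub>m mat_adjoint A"
  using assms by (intro eq_matI) auto

lemma mat_bound_smult:
  assumes A: "A \<in> carrier_mat q p" and c: "cmod c = 1"
  shows "mat_bound (c \<cdot>\<^sub>m A) d \<longleftrightarrow> mat_bound A d"
proof -
  have "cnorm ((c \<cdot>\<^sub>m A) *\<^sub>v v) = cnorm (A *\<^sub>v v)" if v: "v \<in> carrier_vec p" for v
  proof -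
    have "(c \<cdot>\<^sub>m A) *\<^sub>v v = c \<cdot>\<^sub>v (A *\<^sub>v v)" using A v by (intro eq_vecI) (auto simp: scalar_prod_def sum_distrib_left mult.assoc)
    thus ?thesis using c by (simp add: cnorm_def norm_mult cong: L2_set_cong_simp)
  qed
  thus ?thesis using A by (auto simp: mat_bound_def)
qed

lemma mult_split_delay:
  fixes L V D W :: "'a::comm_ring_1 mat"
  assumes "L \<in> carrier_mat a b" "V \<in> carrier_mat b c" "D \<in> carrier_mat b c" "W \<in> carrier_mat c d"
  shows "L * (V + t \<cdot>\<^sub>m D) * W = L * V * W + t \<cdot>\<^sub>m (L * D * W)"
proof -
  have tD: "t \<cdot>\<^sub>m D \<in> carrier_mat b c" using assms by simp
  have LV: "L * V \<in> carrier_mat a c" and LD: "L * D \<in> carrier_mat a c" using assms by auto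
  show ?thesis
    unfolding mult_add_distrib_mat[OF assms(1,2) tD] mult_smult_distrib[OF assms(1,3)]
      add_mult_distrib_mat[OF LV smult_carrier_mat[OF LD] assms(4)] mult_smult_assoc_mat[OF LD assms(4)] ..
qed

text \<open>Gathers the factorization identities and the two strict norm bounds; the plant appears
  only through transfer matrices that have no poles on the circle.\<close>

locale model_matching =
  fixes m1 p1 p2 q2 N :: nat and T1 T2 T3 Ui Uo Y Yo Vco Vci Z Zco R :: tfm and \<gamma> :: real
  assumes dims: "0 < m1" "0 < p2" "0 < q2"
    and T1: "tf_regular p1 m1 T1" and T3: "tf_regular q2 m1 T3"
    and T2_fact: "T2 = Ui * Uo" "Ui \<in> RHinf p1 p2" "RHinf_unit p2 Uo" "Ui\<^sup>\<sim> * Ui = 1\<^sub>m p2"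
    and Y: "Y = (1\<^sub>m p1 - Ui * Ui\<^sup>\<sim>) * T1"
    and \<gamma>: "tf_norm Y < \<gamma>"
    and Yo: "RHinf_unit m1 Yo" "Yo\<^sup>\<sim> * Yo = rf_const (\<gamma>\<^sup>2) \<cdot>\<^sub>m 1\<^sub>m m1 - Y\<^sup>\<sim> * Y"
    and T3_fact: "T3 * mat_inv Yo = Vco * Vci" "Vci \<in> RHinf q2 m1" "RHinf_unit q2 Vco"
      "Vci * Vci\<^sup>\<sim> = 1\<^sub>m q2"
    and Z: "Z = Ui\<^sup>\<sim> * T1 * mat_inv Yo * (1\<^sub>m m1 - Vci\<^sup>\<sim> * Vci)"
    and Z_norm: "tf_norm Z < 1"
    and Zco: "RHinf_unit p2 Zco" "Zco * Zco\<^sup>\<sim> = 1\<^sub>m p2 - Z * Z\<^sup>\<sim>"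
    and R: "R = mat_inv Zco * Ui\<^sup>\<sim> * T1 * mat_inv Yo * Vci\<^sup>\<sim>"
begin

abbreviation "Yi \<equiv> mat_inv Yo"
abbreviation "Zi \<equiv> mat_inv Zco"
abbreviation "S \<equiv> Ui\<^sup>\<sim> * T1 * Yi"

lemmas units = RHinf_unitD[OF T2_fact(3)] RHinf_unitD[OF Yo(1)] RHinf_unitD[OF T3_fact(3)] RHinf_unitD[OF Zco(1)]

lemma regular:
  "tf_regular p1 p2 Ui" "tf_regular p2 p1 (Ui\<^sup>\<sim>)" "tf_regular p2 p2 Uo" "tf_regular m1 m1 Yo" "tf_regular m1 m1 Yi"
  "tf_regular q2 q2 Vco" "tf_regular q2 m1 Vci" "tf_regular m1 q2 (Vci\<^sup>\<sim>)" "tf_regular p2 p2 Zco" "tf_regular p2 p2 Zi"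
  "tf_regular p1 p1 (1\<^sub>m p1 - Ui * Ui\<^sup>\<sim>)" "tf_regular m1 m1 (1\<^sub>m m1 - Vci\<^sup>\<sim> * Vci)"
  "tf_regular p2 m1 (Ui\<^sup>\<sim> * T1)" "tf_regular p2 m1 S" "tf_regular p1 m1 Y" "tf_regular p2 m1 Z"
  "tf_regular p1 p2 T2"
proof -
  show u: "tf_regular p1 p2 Ui" "tf_regular p2 p2 Uo" "tf_regular m1 m1 Yo" "tf_regular m1 m1 Yi"
    "tf_regular q2 q2 Vco" "tf_regular q2 m1 Vci" "tf_regular p2 p2 Zco" "tf_regular p2 p2 Zi"
    using units T2_fact(2) T3_fact(2) by (auto intro: RHinf_regular)
  show a: "tf_regular p2 p1 (Ui\<^sup>\<sim>)" "tf_regular m1 q2 (Vci\<^sup>\<sim>)" using u by (auto intro: tf_regular_para_conj)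
  show b: "tf_regular p1 p1 (1\<^sub>m p1 - Ui * Ui\<^sup>\<sim>)" "tf_regular m1 m1 (1\<^sub>m m1 - Vci\<^sup>\<sim> * Vci)"
    by (rule tf_regular_minus[OF tf_regular_one tf_regular_mult[OF u(1) a(1)]],
        rule tf_regular_minus[OF tf_regular_one tf_regular_mult[OF a(2) u(6)]])
  show c: "tf_regular p2 m1 (Ui\<^sup>\<sim> * T1)" by (rule tf_regular_mult[OF a(1) T1])
  show d: "tf_regular p2 m1 S" by (rule tf_regular_mult[OF c u(4)])
  show "tf_regular p1 m1 Y" "tf_regular p2 m1 Z" "tf_regular p1 p2 T2"
    unfolding Y Z T2_fact(1) by (rule tf_regular_mult[OF b(1) T1], rule tf_regular_mult[OF d b(2)], rule tf_regular_mult[OF u(1,2)])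
qed

lemmas carrier = regular[THEN tf_regular_carrier]

lemma Y_norm: "0 \<le> tf_norm Y" and Z_norm_nonneg: "0 \<le> tf_norm Z" and \<gamma>_pos: "0 < \<gamma>"
proof -
  show Y0: "0 \<le> tf_norm Y" and "0 \<le> tf_norm Z"
    using tf_norm_bound(1)[of Y p1 m1] tf_norm_bound(1)[of Z p2 m1] regular(15,16) dims by (auto simp: tf_regular_def)
  show "0 < \<gamma>" using Y0 \<gamma> by linarith
qed

lemma R_regular: "tf_regular p2 q2 R"
  unfolding R by (intro tf_regular_mult[OF tf_regular_mult[OF tf_regular_mult[OF tf_regular_mult[OF regular(10,2)] T1] regular(5)] regular(8)])

text \<open>\<open>X\<close> stands for the whole parameter V + z^(-N) D. The factorizations are
  evaluated at z, which turns \<open>para_conj\<close> into the adjoint. The bound in the second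
  claim does not depend on z, so that strictness survives the supremum.\<close>

lemma error_bounds:
  assumes X: "tf_regular p2 q2 X" and z: "cmod z = 1"
  defines "E \<equiv> tf_eval (R - Zi * Uo * X * Vco) z" and "M \<equiv> tf_eval (T1 - T2 * X * T3) z"
  shows "mat_bound M c \<Longrightarrow> 0 \<le> c \<Longrightarrow> c < \<gamma> \<Longrightarrow> mat_bound (mat_adjoint E) (c / \<gamma>)"
    and "mat_bound (mat_adjoint E) d \<Longrightarrow> 0 \<le> d \<Longrightarrow> d < 1 \<Longrightarrow>
      mat_bound M (allpass_gain \<gamma> (allpass_gain 1 d (tf_norm Z)) (tf_norm Y))"
proof -
  define W H where "W = Uo * X * T3" and "H = Uo * X * Vco"
  have UX: "tf_regular p2 q2 (Uo * X)" by (rule tf_regular_mult[OF regular(3) X])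
  have W: "tf_regular p2 m1 W" and H: "tf_regular p2 q2 H"
    unfolding W_def H_def by (rule tf_regular_mult[OF UX T3], rule tf_regular_mult[OF UX regular(6)])
  note cX = tf_regular_carrier[OF X] and cUX = tf_regular_carrier[OF UX] and cT3 = tf_regular_carrier[OF T3]
    and cT1 = tf_regular_carrier[OF T1] and cH = tf_regular_carrier[OF H] and cW = tf_regular_carrier[OF W]
  have WYi: "W * Yi = H * Vci"
    unfolding W_def H_def assoc_mult_mat[OF cUX cT3 carrier(5)] T3_fact(1) assoc_mult_mat[OF cUX carrier(6,7)] ..
  have M1: "T1 - T2 * X * T3 = T1 - Ui * W"
    unfolding W_def T2_fact(1) assoc_mult_mat[OF carrier(1,3) cX] assoc_mult_mat[OF carrier(1) cUX cT3] ..
  have SV: "tf_regular p2 q2 (S * Vci\<^sup>\<sim>)" by (rule tf_regular_mult[OF regular(14,8)])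
  have ZiU: "Zi * Ui\<^sup>\<sim> \<in> carrier_mat p2 p1" by (rule mult_carrier_mat[OF carrier(10,2)])
  have R1: "R = Zi * (S * Vci\<^sup>\<sim>)"
    unfolding R assoc_mult_mat[OF carrier(10,2) cT1] assoc_mult_mat[OF carrier(10,13,5)] assoc_mult_mat[OF carrier(10,14,8)] ..
  have ZH: "Zi * Uo * X * Vco = Zi * H"
    unfolding H_def assoc_mult_mat[OF carrier(10,3) cX] assoc_mult_mat[OF carrier(10) cUX carrier(6)] ..
  have D: "tf_regular p2 q2 (S * Vci\<^sup>\<sim> - H)" by (rule tf_regular_minus[OF SV H])
  have E1: "R - Zi * Uo * X * Vco = Zi * (S * Vci\<^sup>\<sim> - H)"
    unfolding R1 ZH mult_minus_distrib_mat[OF carrier(10) tf_regular_carrier[OF SV] cH] ..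
  have ER: "tf_regular p2 q2 (R - Zi * Uo * X * Vco)" unfolding E1 by (rule tf_regular_mult[OF regular(10) D])
  have ZE: "Zco * (R - Zi * Uo * X * Vco) = S * Vci\<^sup>\<sim> - H"
    unfolding E1 assoc_mult_mat[OF carrier(9,10) tf_regular_carrier[OF D], symmetric] units(15)
    by (rule left_mult_one_mat[OF tf_regular_carrier[OF D]])
  note ev = tf_regular_eval[OF z]
  let ?e = "\<lambda>G. tf_eval G z"
  have one: "tf_eval (1\<^sub>m n) z = 1\<^sub>m n" for n by (rule tf_eval_one)
  have u: "mat_adjoint (?e Ui) * ?e Ui = 1\<^sub>m p2"
    using arg_cong[OF T2_fact(4), of ?e] unfolding ev(1)[OF regular(2,1)] ev(5)[OF regular(1)] one .
  have y: "?e Y = (1\<^sub>m p1 - ?e Ui * mat_adjoint (?e Ui)) * ?e T1"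
    unfolding Y ev(1)[OF regular(11) T1] ev(3)[OF tf_regular_one tf_regular_mult[OF regular(1,2)]] ev(1)[OF regular(1,2)] ev(5)[OF regular(1)] one ..
  have cg: "rf_circle (rf_const (\<gamma>\<^sup>2))" "rf_eval (rf_const (\<gamma>\<^sup>2)) z = of_real (\<gamma>\<^sup>2)"
    using rf_value_const[of "\<gamma>\<^sup>2" z] by (auto simp: rf_value_def intro: rf_stable_circle)
  have YY: "tf_regular m1 m1 (Y\<^sup>\<sim> * Y)" by (rule tf_regular_mult[OF tf_regular_para_conj[OF regular(15)] regular(15)])
  have yo: "mat_adjoint (?e Yo) * ?e Yo = of_real (\<gamma>\<^sup>2) \<cdot>\<^sub>m 1\<^sub>m m1 - mat_adjoint (?e Y) * ?e Y"
    using arg_cong[OF Yo(2), of ?e]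
    unfolding ev(1)[OF tf_regular_para_conj[OF regular(4)] regular(4)] ev(5)[OF regular(4)]
      ev(3)[OF tf_regular_smult[OF cg(1) tf_regular_one] YY] ev(4)[OF cg(1) tf_regular_one] cg(2)
      ev(1)[OF tf_regular_para_conj[OF regular(15)] regular(15)] ev(5)[OF regular(15)] one .
  have yi: "?e Yo * ?e Yi = 1\<^sub>m m1" "?e Yi * ?e Yo = 1\<^sub>m m1"
    using arg_cong[OF units(7), of ?e] arg_cong[OF units(8), of ?e] unfolding ev(1)[OF regular(4,5)] ev(1)[OF regular(5,4)] one .
  have s: "?e S = mat_adjoint (?e Ui) * ?e T1 * ?e Yi"
    unfolding ev(1)[OF regular(13,5)] ev(1)[OF regular(2) T1] ev(5)[OF regular(1)] ..
  have v: "?e Vci * mat_adjoint (?e Vci) = 1\<^sub>m q2"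
    using arg_cong[OF T3_fact(4), of ?e] unfolding ev(1)[OF regular(7,8)] ev(5)[OF regular(7)] one .
  have h: "?e W * ?e Yi = ?e H * ?e Vci"
    using arg_cong[OF WYi, of ?e] unfolding ev(1)[OF W regular(5)] ev(1)[OF H regular(7)] .
  have zz: "?e Z = ?e S * (1\<^sub>m m1 - mat_adjoint (?e Vci) * ?e Vci)"
    unfolding Z ev(1)[OF regular(14,12)] ev(3)[OF tf_regular_one tf_regular_mult[OF regular(8,7)]] ev(1)[OF regular(8,7)] ev(5)[OF regular(7)] one ..
  have ZZ: "tf_regular p2 p2 (Z * Z\<^sup>\<sim>)" by (rule tf_regular_mult[OF regular(16) tf_regular_para_conj[OF regular(16)]])
  have zco: "?e Zco * mat_adjoint (?e Zco) = 1\<^sub>m p2 - ?e Z * mat_adjoint (?e Z)"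
    using arg_cong[OF Zco(2), of ?e]
    unfolding ev(1)[OF regular(9) tf_regular_para_conj[OF regular(9)]] ev(5)[OF regular(9)]
      ev(3)[OF tf_regular_one ZZ] ev(1)[OF regular(16) tf_regular_para_conj[OF regular(16)]] ev(5)[OF regular(16)] one .
  have zi: "?e Zi * ?e Zco = 1\<^sub>m p2" using arg_cong[OF units(16), of ?e] unfolding ev(1)[OF regular(10,9)] one .
  have ze: "?e Zco * E = ?e S * mat_adjoint (?e Vci) - ?e H"
    using arg_cong[OF ZE, of ?e]
    unfolding E_def ev(1)[OF regular(9) ER] ev(3)[OF SV H] ev(1)[OF regular(14,8)] ev(5)[OF regular(7)] .
  have M: "M = ?e T1 - ?e Ui * ?e W" unfolding M_def M1 ev(3)[OF T1 tf_regular_mult[OF regular(1) W]] ev(1)[OF regular(1) W] ..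
  have Ec: "E \<in> carrier_mat p2 q2" unfolding E_def by (rule ev(6)[OF ER])
  note c = ev(6)[OF regular(1)] ev(6)[OF T1] ev(6)[OF W] ev(6)[OF regular(4)] ev(6)[OF regular(5)] ev(6)[OF regular(7)]
    ev(6)[OF H] ev(6)[OF regular(9)] ev(6)[OF regular(10)]
  note red = two_sided_reduction[OF c(1) u c(2) c(3) y c(4) yo c(5) yi s c(6) v c(7) h zz c(8) zco c(9) zi Ec ze \<gamma>_pos, folded M]
  have nY: "mat_bound (?e Y) (tf_norm Y)" and nZ: "mat_bound (?e Z) (tf_norm Z)"
    using tf_norm_bound(2)[of Y p1 m1 z] tf_norm_bound(2)[of Z p2 m1 z] regular(15,16) dims z by (auto simp: tf_regular_def)
  show "mat_bound M c \<Longrightarrow> 0 \<le> c \<Longrightarrow> c < \<gamma> \<Longrightarrow> mat_bound (mat_adjoint E) (c / \<gamma>)" by (rule red(1))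
  show "mat_bound (mat_adjoint E) d \<Longrightarrow> 0 \<le> d \<Longrightarrow> d < 1 \<Longrightarrow>
      mat_bound M (allpass_gain \<gamma> (allpass_gain 1 d (tf_norm Z)) (tf_norm Y))"
    by (rule red(2)[OF _ _ _ nY Y_norm \<gamma> nZ Z_norm_nonneg Z_norm])
qed

context
  fixes V D H1 H2 :: tfm
  assumes V: "V \<in> RHinf p2 q2" and D: "D \<in> RHinf p2 q2"
    and dec: "antistable_stable_decomp p2 q2 (rf_z ^ N \<cdot>\<^sub>m R - Zi * Uo * (rf_z ^ N \<cdot>\<^sub>m V) * Vco) H1 H2"
begin

abbreviation "model_error \<equiv> T1 - T2 * V * T3 - inverse rf_z ^ N \<cdot>\<^sub>m (T2 * D * T3)"

text \<open>Multiplication by z^N does not change norms on the circle. Taking adjoints turns the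
  anti-stable part into \<open>H1\<close>, a series in 1/z, and everything that \<open>D\<close> can
  influence into a series in z; this is the form in which Hankel bounds apply.\<close>

lemma model_error_regular: "tf_regular p1 m1 model_error"
  and model_error_bounds:
    "cmod z = 1 \<Longrightarrow> mat_bound (tf_eval model_error z) c \<Longrightarrow> 0 \<le> c \<Longrightarrow> c < \<gamma> \<Longrightarrow>
       mat_bound (tf_eval H1 z - mat_adjoint (tf_eval (Zi * Uo * D * Vco) z - tf_eval H2 z)) (c / \<gamma>)"
    "cmod z = 1 \<Longrightarrow> mat_bound (tf_eval H1 z - mat_adjoint (tf_eval (Zi * Uo * D * Vco) z - tf_eval H2 z)) d \<Longrightarrow>
       0 \<le> d \<Longrightarrow> d < 1 \<Longrightarrow> mat_bound (tf_eval model_error z) (allpass_gain \<gamma> (allpass_gain 1 d (tf_norm Z)) (tf_norm Y))"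
proof -
  define X where "X = V + inverse rf_z ^ N \<cdot>\<^sub>m D"
  have iz: "rf_circle (inverse rf_z ^ N)" by (intro rf_circle_power rf_stable_circle rf_stable_inverse_z)
  note rV = RHinf_regular[OF V] and rD = RHinf_regular[OF D]
  note cV = RHinf_carrier[OF V] and cD = RHinf_carrier[OF D]
  have X: "tf_regular p2 q2 X" unfolding X_def by (intro tf_regular_add tf_regular_smult iz rV rD)
  have L: "tf_regular p2 p2 (Zi * Uo)" by (rule tf_regular_mult[OF regular(10,3)])
  note cL = tf_regular_carrier[OF L] and cT1 = tf_regular_carrier[OF T1] and cT3 = tf_regular_carrier[OF T3] and cR = tf_regular_carrier[OF R_regular]
  have TX: "tf_regular p1 m1 (T2 * G * T3)" "tf_regular p2 q2 (Zi * Uo * G * Vco)" if "tf_regular p2 q2 G" for G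
    by (rule tf_regular_mult[OF tf_regular_mult[OF regular(17) that] T3], rule tf_regular_mult[OF tf_regular_mult[OF L that] regular(6)])
  note cT = TX(1)[THEN tf_regular_carrier] and cH = TX(2)[THEN tf_regular_carrier]
  have e: "model_error = T1 - T2 * X * T3"
    unfolding X_def mult_split_delay[OF carrier(17) cV cD cT3]
    using cT[OF rV] cT[OF rD] cT1 by (intro eq_matI) (auto simp del: index_mult_mat(1))
  show "tf_regular p1 m1 model_error" unfolding e by (rule tf_regular_minus[OF T1 TX(1)[OF X]])
  define Rh where "Rh = rf_z ^ N \<cdot>\<^sub>m R - Zi * Uo * (rf_z ^ N \<cdot>\<^sub>m V) * Vco"
  have LV: "Zi * Uo * V \<in> carrier_mat p2 q2" by (rule mult_carrier_mat[OF cL cV])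
  have sm: "t \<cdot>\<^sub>m (A - (P + s \<cdot>\<^sub>m Q)) = t \<cdot>\<^sub>m A - t \<cdot>\<^sub>m P - Q"
    if "A \<in> carrier_mat p2 q2" "P \<in> carrier_mat p2 q2" "Q \<in> carrier_mat p2 q2" "t * s = 1" for A P Q :: tfm and t s
    using that by (intro eq_matI) (auto simp: right_diff_distrib distrib_left mult.assoc[symmetric])
  have Rh: "rf_z ^ N \<cdot>\<^sub>m (R - Zi * Uo * X * Vco) = Rh - Zi * Uo * D * Vco"
    unfolding Rh_def X_def mult_split_delay[OF cL cV cD carrier(6)] mult_smult_distrib[OF cL cV] mult_smult_assoc_mat[OF LV carrier(6)]
  proof (rule sm[OF cR cH[OF rV] cH[OF rD]])
    show "rf_z ^ N * inverse rf_z ^ N = (1 :: ratfun)" by (simp add: power_mult_distrib[symmetric])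
  qed
  have ER: "tf_regular p2 q2 (R - Zi * Uo * X * Vco)" by (rule tf_regular_minus[OF R_regular TX(2)[OF X]])
  have dec': "antistable_stable_decomp p2 q2 Rh H1 H2" unfolding Rh_def by (rule dec)
  have eq: "mat_bound (tf_eval H1 z - mat_adjoint (tf_eval (Zi * Uo * D * Vco) z - tf_eval H2 z)) b
      \<longleftrightarrow> mat_bound (mat_adjoint (tf_eval (R - Zi * Uo * X * Vco) z)) b" if z: "cmod z = 1" for z b
  proof -
    have Rr: "tf_regular p2 q2 Rh" using decomp_eval(2,3)[OF dec' z] by (simp add: tf_regular_def)
    have H: "H1 \<in> RHinf q2 p2" "H2 \<in> RHinf p2 q2" using dec' by (auto simp: antistable_stable_decomp_def)
    note ev = tf_regular_eval[OF z]
    have c: "tf_eval H1 z \<in> carrier_mat q2 p2" "tf_eval H2 z \<in> carrier_mat p2 q2" "tf_eval (Zi * Uo * D * Vco) z \<in> carrier_mat p2 q2"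
      "tf_eval (R - Zi * Uo * X * Vco) z \<in> carrier_mat p2 q2"
      using ev(6)[OF RHinf_regular[OF H(1)]] ev(6)[OF RHinf_regular[OF H(2)]] ev(6)[OF TX(2)[OF rD]] ev(6)[OF ER] .
    have "z ^ N \<cdot>\<^sub>m tf_eval (R - Zi * Uo * X * Vco) z = tf_eval Rh z - tf_eval (Zi * Uo * D * Vco) z"
      using arg_cong[OF Rh, of "\<lambda>G. tf_eval G z"]
      unfolding ev(4)[OF rf_circle_z_power ER] ev(3)[OF Rr TX(2)[OF rD]] rf_eval_z_power .
    hence k: "z ^ N \<cdot>\<^sub>m tf_eval (R - Zi * Uo * X * Vco) z
        = mat_adjoint (tf_eval H1 z) + tf_eval H2 z - tf_eval (Zi * Uo * D * Vco) z"
      unfolding decomp_eval(1)[OF dec' z] .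
    have "tf_eval H1 z - mat_adjoint (tf_eval (Zi * Uo * D * Vco) z - tf_eval H2 z)
        = mat_adjoint (z ^ N \<cdot>\<^sub>m tf_eval (R - Zi * Uo * X * Vco) z)"
      unfolding k using c by (intro eq_matI) auto
    also have "\<dots> = cnj z ^ N \<cdot>\<^sub>m mat_adjoint (tf_eval (R - Zi * Uo * X * Vco) z)"
      using mat_adjoint_smult[OF c(4), of "z ^ N"] by (simp only: complex_cnj_power)
    finally show ?thesis
      using mat_bound_smult[OF mat_adjoint_carrier[OF c(4)], of "cnj z ^ N" b] z by (simp add: norm_power)
  qed
  show "mat_bound (tf_eval H1 z - mat_adjoint (tf_eval (Zi * Uo * D * Vco) z - tf_eval H2 z)) (c / \<gamma>)"
    if "cmod z = 1" "mat_bound (tf_eval model_error z) c" "0 \<le> c" "c < \<gamma>"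
    unfolding eq[OF that(1)] by (rule error_bounds(1)[OF X that(1)]) (use that e in auto)
  show "mat_bound (tf_eval model_error z) (allpass_gain \<gamma> (allpass_gain 1 d (tf_norm Z)) (tf_norm Y))"
    if "cmod z = 1" "mat_bound (tf_eval H1 z - mat_adjoint (tf_eval (Zi * Uo * D * Vco) z - tf_eval H2 z)) d" "0 \<le> d" "d < 1"
    unfolding e by (rule error_bounds(2)[OF X that(1) that(2)[unfolded eq[OF that(1)]] that(3,4)])
qed

text \<open>The adjoint of a stable matrix is a series in z on the circle, so the reduced error is a
  completion of the coefficients of \<open>H1\<close>, whatever \<open>D\<close> is.\<close>

lemma hankel_norm_of_model_error:
  assumes "tf_norm model_error < \<gamma>"
  shows "hankel_norm H1 < 1"
proof -
  define c where "c = tf_norm model_error"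
  have c: "0 \<le> c" "c < \<gamma>" "\<And>z. cmod z = 1 \<Longrightarrow> mat_bound (tf_eval model_error z) c"
    using assms tf_norm_bound[of model_error p1 m1] model_error_regular dims by (auto simp: c_def tf_regular_def)
  have cg: "0 \<le> c / \<gamma>" "c / \<gamma> < 1" using c \<gamma>_pos by auto
  have H: "H1 \<in> RHinf q2 p2" "H2 \<in> RHinf p2 q2" using dec by (auto simp: antistable_stable_decomp_def)
  have F: "Zi * Uo * D * Vco \<in> RHinf p2 q2" by (intro RHinf_mult[OF RHinf_mult[OF RHinf_mult[OF units(14,1)] D] units(9)])
  define k where "k m i j = entry_coeff (Zi * Uo * D * Vco) m j i - entry_coeff H2 m j i" for m i j
  have "hankel_bounded q2 p2 (entry_coeff H1) (c / \<gamma>)"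
  proof (rule hankel_le_sup[OF cg(1), where k = k])
    show "summable (\<lambda>m. \<bar>entry_coeff H1 m i j\<bar>)" if "i < q2" "j < p2" for i j by (rule entry_coeff_summable[OF H(1) that])
    show "summable (\<lambda>m. \<bar>k m i j\<bar>)" if "i < q2" "j < p2" for i j
      unfolding k_def
      by (rule summable_comparison_test'[OF summable_add[OF entry_coeff_summable[OF F that(2,1)] entry_coeff_summable[OF H(2) that(2,1)]], where N = 0]) auto
    fix z :: complex assume z: "cmod z = 1"
    let ?K = "tf_eval (Zi * Uo * D * Vco) z - tf_eval H2 z"
    have cs: "tf_eval H1 z \<in> carrier_mat q2 p2" "tf_eval H2 z \<in> carrier_mat p2 q2" "tf_eval (Zi * Uo * D * Vco) z \<in> carrier_mat p2 q2"
      using H F by (auto dest!: RHinf_carrier intro: tf_eval_carrier)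
    have Kc: "tf_eval H1 z - mat_adjoint ?K \<in> carrier_mat q2 p2" using cs by (intro minus_carrier_mat mat_adjoint_carrier)
    have "op_bound q2 p2 (\<lambda>i j. (tf_eval H1 z - mat_adjoint ?K) $$ (i, j)) (c / \<gamma>)"
      using model_error_bounds(1)[OF z c(3)[OF z] c(1,2)] mat_bound_iff_op_bound[OF Kc] by blast
    thus "op_bound q2 p2 (\<lambda>i j. (\<Sum>m. of_real (entry_coeff H1 m i j) * inverse z ^ m) - (\<Sum>m. of_real (k m i j) * z ^ m)) (c / \<gamma>)"
    proof (rule op_bound_cong)
      fix i j assume ij: "i < q2" "j < p2"
      have "(\<Sum>m. of_real (k m i j) * z ^ m) = cnj (tf_eval (Zi * Uo * D * Vco) z $$ (j, i)) - cnj (tf_eval H2 z $$ (j, i))"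
        unfolding tf_eval_cnj_expansion[OF F ij(2,1) z] tf_eval_cnj_expansion[OF H(2) ij(2,1) z]
          suminf_diff[OF summable_unimodular[OF entry_coeff_summable[OF F ij(2,1)] z] summable_unimodular[OF entry_coeff_summable[OF H(2) ij(2,1)] z]]
        by (simp add: k_def left_diff_distrib)
      thus "(\<Sum>m. of_real (entry_coeff H1 m i j) * inverse z ^ m) - (\<Sum>m. of_real (k m i j) * z ^ m)
          = (tf_eval H1 z - mat_adjoint ?K) $$ (i, j)"
        unfolding tf_eval_expansion[OF H(1) ij z, symmetric] using ij cs by simp
    qed
  qed
  from hankel_norm_le[OF H(1) this cg(1)] cg(2) show ?thesis by linarith
qed

end

text \<open>Nehari's completion determines \<open>D\<close> through Zi Uo D Vco = K + H2, which is
  solvable in \<open>RHinf\<close> because the outer factors are units.\<close>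

lemma model_error_of_hankel_norm:
  assumes V: "V \<in> RHinf p2 q2"
    and dec: "antistable_stable_decomp p2 q2 (rf_z ^ N \<cdot>\<^sub>m R - Zi * Uo * (rf_z ^ N \<cdot>\<^sub>m V) * Vco) H1 H2"
    and h: "hankel_norm H1 < 1"
  shows "\<exists>D\<in>RHinf p2 q2. tf_norm (T1 - T2 * V * T3 - inverse rf_z ^ N \<cdot>\<^sub>m (T2 * D * T3)) < \<gamma>"
proof -
  have H: "H1 \<in> RHinf q2 p2" "H2 \<in> RHinf p2 q2" "strictly_proper H1" using dec by (auto simp: antistable_stable_decomp_def)
  note hb = hankel_norm_bounded[OF H(1) RHinf_hankel_bounded[OF H(1) dims(2)]]
  define d where "d = (1 + hankel_norm H1) / 2"
  have d: "hankel_norm H1 < d" "0 \<le> d" "d < 1" using h hb(1) by (auto simp: d_def)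
  have f0: "entry_coeff H1 0 i j = 0" if "i < q2" "j < p2" for i j
    using H(3) RHinf_carrier[OF H(1)] that by (auto simp: entry_coeff_def strictly_proper_def intro: rf_coeff_strictly_proper)
  obtain M and k :: "nat \<Rightarrow> nat \<Rightarrow> nat \<Rightarrow> real" where k: "\<And>z. cmod z = 1 \<Longrightarrow>
      op_bound q2 p2 (\<lambda>i j. (\<Sum>m. of_real (entry_coeff H1 m i j) * inverse z ^ m) - (\<Sum>m<M. of_real (k m i j) * z ^ m)) d"
    using nehari[OF hb(2,1) d(1) entry_coeff_summable[OF H(1)] f0] by blast
  \<comment> \<open>The adjoint of the finite series in z from Nehari's theorem: the indices are
    exchanged and z becomes 1/z, so the matrix is proper with poles at most at 0.\<close>
  define K :: tfm where "K = mat p2 q2 (\<lambda>(a, b). \<Sum>m<M. inverse rf_z ^ m * rf_const (k m b a))"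
  have K: "K \<in> RHinf p2 q2"
    unfolding RHinf_iff K_def by (auto intro!: rf_stable_sum rf_stable_mult rf_stable_power)
  define KH where "KH = K + H2"
  have KH: "KH \<in> RHinf p2 q2" unfolding KH_def by (rule RHinf_add[OF K H(2)])
  define D where "D = mat_inv Uo * (Zco * (KH * mat_inv Vco))"
  have KV: "KH * mat_inv Vco \<in> RHinf p2 q2" by (rule RHinf_mult[OF KH units(10)])
  have ZKV: "Zco * (KH * mat_inv Vco) \<in> RHinf p2 q2" by (rule RHinf_mult[OF units(13) KV])
  have D: "D \<in> RHinf p2 q2" unfolding D_def by (rule RHinf_mult[OF units(2) ZKV])
  note cs = RHinf_carrier[OF units(1)] RHinf_carrier[OF units(2)] RHinf_carrier[OF units(9)] RHinf_carrier[OF units(10)]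
    RHinf_carrier[OF KH] RHinf_carrier[OF KV] RHinf_carrier[OF ZKV]
  have "Uo * D = Zco * (KH * mat_inv Vco)"
    unfolding D_def assoc_mult_mat[OF cs(1,2,7), symmetric] units(3) by (rule left_mult_one_mat[OF cs(7)])
  hence "Zi * Uo * D = KH * mat_inv Vco"
    unfolding assoc_mult_mat[OF carrier(10,3) RHinf_carrier[OF D]]
    by (simp only: assoc_mult_mat[OF carrier(10,9) cs(6), symmetric] units(16) left_mult_one_mat[OF cs(6)])
  hence ZD: "Zi * Uo * D * Vco = KH"
    by (simp only: assoc_mult_mat[OF cs(5,4,3)] units(12) right_mult_one_mat[OF cs(5)])
  define b where "b = allpass_gain \<gamma> (allpass_gain 1 d (tf_norm Z)) (tf_norm Y)"
  have b: "0 \<le> b" "b < \<gamma>"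
    unfolding b_def using allpass_gain[OF allpass_gain[OF d(2,3) Z_norm_nonneg Z_norm] Y_norm \<gamma>] by auto
  let ?E = "T1 - T2 * V * T3 - inverse rf_z ^ N \<cdot>\<^sub>m (T2 * D * T3)"
  have "tf_norm ?E \<le> b"
  proof (rule tf_norm_le[OF tf_regular_carrier[OF model_error_regular[OF V D dec]] dims(1) b(1)])
    fix z :: complex assume z: "cmod z = 1"
    have z0: "z \<noteq> 0" using z by auto
    have cs: "tf_eval H1 z \<in> carrier_mat q2 p2" "tf_eval H2 z \<in> carrier_mat p2 q2" "tf_eval K z \<in> carrier_mat p2 q2"
      using H K by (auto dest!: RHinf_carrier intro: tf_eval_carrier)
    have KK: "tf_eval KH z - tf_eval H2 z = tf_eval K z"
      unfolding KH_def tf_regular_eval(2)[OF z RHinf_regular[OF K] RHinf_regular[OF H(2)]] using cs by (intro eq_matI) auto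
    have Kij: "cnj (tf_eval K z $$ (j, i)) = (\<Sum>m<M. of_real (k m i j) * z ^ m)" if ij: "i < q2" "j < p2" for i j
    proof -
      have "rf_value (K $$ (j, i)) z (\<Sum>m<M. inverse z ^ m * of_real (k m i j))"
        unfolding K_def using ij by (auto intro!: rf_value_sum rf_value_mult rf_value_power rf_value_inverse_z[OF z0])
      hence e: "tf_eval K z $$ (j, i) = (\<Sum>m<M. inverse z ^ m * of_real (k m i j))"
        using RHinf_carrier[OF K] ij by (simp add: tf_eval_def rf_value_def)
      have "z * cnj z = 1" using complex_norm_square[of z] z by simp
      hence "inverse z = cnj z" by (rule inverse_unique)
      thus ?thesis unfolding e by (simp add: mult.commute)
    qed
    have Kc: "tf_eval H1 z - mat_adjoint (tf_eval K z) \<in> carrier_mat q2 p2" using cs by (intro minus_carrier_mat mat_adjoint_carrier)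
    have "op_bound q2 p2 (\<lambda>i j. (tf_eval H1 z - mat_adjoint (tf_eval K z)) $$ (i, j)) d"
      by (rule op_bound_cong[OF k[OF z]]) (use cs in \<open>simp add: Kij tf_eval_expansion[OF H(1) _ _ z]\<close>)
    hence "mat_bound (tf_eval H1 z - mat_adjoint (tf_eval K z)) d" using mat_bound_iff_op_bound[OF Kc] by blast
    thus "mat_bound (tf_eval ?E z) b"
      unfolding b_def by (intro model_error_bounds(2)[OF V D dec z _ d(2,3)]) (simp only: ZD KK)
  qed
  with b D show ?thesis by (auto intro!: bexI[of _ D])
qed

end

theorem mainTheorem4:
  fixes n m1 p1 p2 q2 N nr :: nat
    and A B1 B2 C1 C2 D12 D21 :: "real mat"
    and Ys :: "nat \<Rightarrow> real mat set"
    and T1 T2 T3 Ui Uo Y Yo Vco Vci Z Zco R R1 R2 :: tfm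
    and \<gamma> \<alpha> :: real
    and Yset :: "tfm set"
    and G Rh Rh1 Rh2 :: "tfm \<Rightarrow> tfm"
    and Ar Br Cr AR BR :: "real mat"
    and CR :: "tfm \<Rightarrow> real mat"
  assumes dims: "0 < m1" "0 < p1" "0 < p2" "0 < q2" "1 \<le> N"
    \<comment> \<open>plant\<close>
    and A: "A \<in> carrier_mat n n" "schur_stable A"
    and B: "B1 \<in> carrier_mat n m1" "B2 \<in> carrier_mat n p2"
    and C: "C1 \<in> carrier_mat p1 n" "C2 \<in> carrier_mat q2 n"
    and D: "D12 \<in> carrier_mat p1 p2" "D21 \<in> carrier_mat q2 m1"
    and D12_pd: "sym_pd (transpose_mat D12 * D12)"
    and D21_pd: "sym_pd (D21 * transpose_mat D21)"
    and CD: "transpose_mat C1 * D12 = 0\<^sub>m n p2"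
    and BD: "B1 * transpose_mat D21 = 0\<^sub>m n q2"
    and T1: "T1 = state_space n A B1 C1 (0\<^sub>m p1 m1)"
    and T2: "T2 = state_space n A B2 C1 D12"
    and T3: "T3 = state_space n A B1 C2 D21"
    \<comment> \<open>structural constraint\<close>
    and Ys: "\<And>i. i < N \<Longrightarrow> matrix_subspace p2 q2 (Ys i)"
    and Yset: "Yset = fir_set p2 q2 N Ys"
    \<comment> \<open>factorizations\<close>
    and T2_fact: "T2 = Ui * Uo" "Ui \<in> RHinf p1 p2" "RHinf_unit p2 Uo" "Ui\<^sup>\<sim> * Ui = 1\<^sub>m p2"
    and Y: "Y = (1\<^sub>m p1 - Ui * Ui\<^sup>\<sim>) * T1"
    and \<gamma>: "tf_norm Y < \<gamma>"
    and Yo: "RHinf_unit m1 Yo" "Yo\<^sup>\<sim> * Yo = rf_const (\<gamma>\<^sup>2) \<cdot>\<^sub>m 1\<^sub>m m1 - Y\<^sup>\<sim> * Y"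
    and T3_fact: "T3 * mat_inv Yo = Vco * Vci" "Vci \<in> RHinf q2 m1" "RHinf_unit q2 Vco"
      "Vci * Vci\<^sup>\<sim> = 1\<^sub>m q2"
    and Z: "Z = Ui\<^sup>\<sim> * T1 * mat_inv Yo * (1\<^sub>m m1 - Vci\<^sup>\<sim> * Vci)"
    and Z_norm: "tf_norm Z < 1"
    and Zco: "RHinf_unit p2 Zco" "Zco * Zco\<^sup>\<sim> = 1\<^sub>m p2 - Z * Z\<^sup>\<sim>"
    and R: "R = mat_inv Zco * Ui\<^sup>\<sim> * T1 * mat_inv Yo * Vci\<^sup>\<sim>"
    and Rh: "\<And>V. Rh V = rf_z ^ N \<cdot>\<^sub>m R - mat_inv Zco * Uo * (rf_z ^ N \<cdot>\<^sub>m V) * Vco"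
    and R_decomp: "antistable_stable_decomp p2 q2 (rf_z ^ N \<cdot>\<^sub>m R) R1 R2"
    and Rh_decomp: "\<And>V. V \<in> Yset \<Longrightarrow> antistable_stable_decomp p2 q2 (Rh V) (Rh1 V) (Rh2 V)"
    \<comment> \<open>state-space data of the matrix inequalities\<close>
    and G: "\<And>V. G V = mat_inv Zco * Uo * V * Vco"
    and R1_real: "minimal_realization nr Ar Br Cr R1" "schur_stable Ar"
    and AR: "AR = four_block_mat Ar (0\<^sub>m nr (N * p2)) (0\<^sub>m (N * p2) nr) (shift_A N p2)"
    and BR: "BR = Br @\<^sub>r shift_B N p2"
    and CR: "\<And>V. CR V = Cr @\<^sub>c (- shift_C N p2 q2 (G V))"
    and \<alpha>: "\<alpha> = Inf {tf_norm (T1 - T2 * V * T3 - inverse rf_z ^ N \<cdot>\<^sub>m (T2 * D * T3)) | D V.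
                        D \<in> RHinf p2 q2 \<and> V \<in> Yset}"
  shows "((\<exists>V\<in>Yset. \<exists>P Q l. lmi_solution AR BR (CR V) P Q l)
            \<longleftrightarrow> (\<exists>V\<in>Yset. hankel_norm (Rh1 V) < 1))
       \<and> ((\<exists>V\<in>Yset. hankel_norm (Rh1 V) < 1) \<longleftrightarrow> \<alpha> < \<gamma>)
       \<and> (\<forall>V\<in>Yset. (\<exists>P Q l. lmi_solution AR BR (CR V) P Q l) \<longrightarrow> hankel_norm (Rh1 V) < 1)"
proof -
  interpret model_matching m1 p1 p2 q2 N T1 T2 T3 Ui Uo Y Yo Vco Vci Z Zco R \<gamma>
  proof
    show "tf_regular p1 m1 T1" "tf_regular q2 m1 T3"
      unfolding tf_regular_def T1 T3
      using state_space_circle[OF A B(1) C(1) zero_carrier_mat] state_space_circle[OF A B(1) C(2) D(2)] by auto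
  qed (fact dims T2_fact Y \<gamma> Yo T3_fact Z Z_norm Zco R)+
  have VR: "V \<in> RHinf p2 q2" if "V \<in> Yset" for V using that unfolding Yset by (rule fir_set_RHinf)
  have dec: "antistable_stable_decomp p2 q2 (rf_z ^ N \<cdot>\<^sub>m R - Zi * Uo * (rf_z ^ N \<cdot>\<^sub>m V) * Vco) (Rh1 V) (Rh2 V)"
    if "V \<in> Yset" for V using Rh_decomp[OF that] unfolding Rh .
  have L: "Zi * Uo \<in> RHinf p2 p2" by (rule RHinf_mult[OF units(14,1)])
  have R1: "R1 \<in> RHinf q2 p2" using R_decomp by (simp add: antistable_stable_decomp_def)
  have real: "Ar \<in> carrier_mat nr nr" "Br \<in> carrier_mat nr p2" "Cr \<in> carrier_mat q2 nr"
    "R1 = state_space nr Ar Br Cr (0\<^sub>m q2 p2)"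
    using R1_real(1) RHinf_carrier[OF R1] by (auto simp: minimal_realization_def is_realization_def)
  have Bq: "shift_B N p2 \<in> carrier_mat (N * p2) p2" by (simp add: shift_B_def)
  \<comment> \<open>The equivalence holds for each \<open>V\<close> separately, which also yields
    the final claim about every \<open>V\<close> in a solution.\<close>
  have lmi: "(\<exists>P Q l. lmi_solution AR BR (CR V) P Q l) \<longleftrightarrow> hankel_norm (Rh1 V) < 1" if V: "V \<in> Yset" for V
  proof -
    have LV: "Zi * Uo * V \<in> RHinf p2 q2" by (rule RHinf_mult[OF L VR[OF V]])
    have GV: "G V \<in> RHinf p2 q2" unfolding G by (rule RHinf_mult[OF LV units(9)])
    have H: "Rh1 V \<in> RHinf q2 p2" using dec[OF V] by (simp add: antistable_stable_decomp_def)
    have "Zi * Uo * (rf_z ^ N \<cdot>\<^sub>m V) * Vco = rf_z ^ N \<cdot>\<^sub>m G V"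
      unfolding G mult_smult_distrib[OF RHinf_carrier[OF L] RHinf_carrier[OF VR[OF V]]]
        mult_smult_assoc_mat[OF RHinf_carrier[OF LV] carrier(6)] ..
    hence dec': "antistable_stable_decomp p2 q2 (rf_z ^ N \<cdot>\<^sub>m R - rf_z ^ N \<cdot>\<^sub>m G V) (Rh1 V) (Rh2 V)"
      using dec[OF V] by simp
    have Cq: "shift_C N p2 q2 (G V) \<in> carrier_mat q2 (N * p2)" by (simp add: shift_C_def)
    show ?thesis
    proof (rule lmi_iff_hankel_norm[OF _ _ _ dims(2) H])
      show "power_summable (nr + N * p2) AR"
        unfolding AR by (rule power_summable_block_shift[OF real(1) R1_real(2) dims(2)])
      show "BR \<in> carrier_mat (nr + N * p2) p2" unfolding BR by (rule carrier_append_rows[OF real(2) Bq])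
      show "CR V \<in> carrier_mat q2 (nr + N * p2)"
        unfolding CR by (rule append_cols_carrier[OF real(3)]) (use Cq in simp)
      fix k i j assume ij: "i < q2" "j < p2"
      have "(CR V * AR ^\<^sub>m k * BR) $$ (i, j) = entry_coeff R1 (Suc k) i j - (if k < N then tf_coeff (G V) (N - 1 - k) $$ (j, i) else 0)"
        unfolding CR AR BR block_output(2)[OF real(1-3) shift_A_carrier Bq Cq ij] shift_output[OF ij]
          state_space_coeff[OF real(1) R1_real(2) real(2,3) R1 real(4) ij] ..
      also have "\<dots> = entry_coeff (Rh1 V) (Suc k) i j"
        unfolding decomp_shift_coeff[OF R_decomp dec' GV ij(2,1)]
        using RHinf_carrier[OF GV] ij by (simp add: tf_coeff_def)
      finally show "entry_coeff (Rh1 V) (Suc k) i j = (CR V * AR ^\<^sub>m k * BR) $$ (i, j)" ..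
    qed
  qed
  define err where "err D V = tf_norm (T1 - T2 * V * T3 - inverse rf_z ^ N \<cdot>\<^sub>m (T2 * D * T3))" for D V
  have \<alpha>': "\<alpha> = Inf {err D V | D V. D \<in> RHinf p2 q2 \<and> V \<in> Yset}" unfolding \<alpha> err_def ..
  have "(\<exists>V\<in>Yset. hankel_norm (Rh1 V) < 1) \<longleftrightarrow> (\<exists>V\<in>Yset. \<exists>D\<in>RHinf p2 q2. err D V < \<gamma>)"
    using model_error_of_hankel_norm[OF VR dec] hankel_norm_of_model_error[OF VR _ dec] unfolding err_def by blast
  also have "\<dots> \<longleftrightarrow> \<alpha> < \<gamma>"
  proof
    assume "\<exists>V\<in>Yset. \<exists>D\<in>RHinf p2 q2. err D V < \<gamma>"
    then obtain V D where VD: "V \<in> Yset" "D \<in> RHinf p2 q2" "err D V < \<gamma>" by blast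
    \<comment> \<open>Norms are nonnegative, so the set is bounded below and its infimum is a
      genuine lower bound.\<close>
    have "0 \<le> err D V" if "D \<in> RHinf p2 q2" "V \<in> Yset" for D V
      using model_error_regular[OF VR[OF that(2)] that(1) dec[OF that(2)]] tf_norm_bound(1)[OF _ _ dims(1)]
      unfolding err_def tf_regular_def by blast
    hence "bdd_below {err D V | D V. D \<in> RHinf p2 q2 \<and> V \<in> Yset}" by (auto intro!: bdd_belowI[of _ 0])
    hence "\<alpha> \<le> err D V" unfolding \<alpha>' by (rule cInf_lower[rotated]) (use VD in auto)
    thus "\<alpha> < \<gamma>" using VD(3) by linarith
  next
    assume a: "\<alpha> < \<gamma>"
    \<comment> \<open>The zero parameter lies in every subspace; nonemptiness is what turns
      \<open>\<alpha> < \<gamma>\<close> into an actual pair \<open>D\<close>,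
      \<open>V\<close>.\<close>
    have "mat p2 q2 (\<lambda>(a, b). \<Sum>i<N. inverse rf_z ^ i * rf_const (0\<^sub>m p2 q2 $$ (a, b))) \<in> Yset"
      unfolding Yset fir_set_def using Ys by (auto simp: matrix_subspace_def intro!: exI[of _ "\<lambda>_. 0\<^sub>m p2 q2"])
    hence "{err D V | D V. D \<in> RHinf p2 q2 \<and> V \<in> Yset} \<noteq> {}" using RHinf_zero[of p2 q2] by blast
    from cInf_lessD[OF this a[unfolded \<alpha>']] show "\<exists>V\<in>Yset. \<exists>D\<in>RHinf p2 q2. err D V < \<gamma>" by blast
  qed
  finally show ?thesis using lmi by blast
qed

end
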